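(* Let $p\ge 2$, $0<s<1$, $0\le t\le s$, $\Lambda\ge 1$, let $\Omega\subset\mathbb{R}^N$ be an open set, and let $K:\mathbb{R}^N\to[0,+\infty)$ be measurable with $\frac1\Lambda |z|^{N+sp}\le K(z)\le \Lambda |z|^{N+sp}$ for all $z\in\mathbb{R}^N$. Let $f\in W^{s,p'}_{loc}(\Omega)$ and let $u\in W^{s,p}_{loc}(\Omega)\cap\mathcal{Y}^{t,p}_s$ be a local weak solution of $(-\Delta_{p,K})^s u=f$ in $\Omega$. For every ball $B_R\Subset\Omega$ (with concentric balls $B_{\rho}$, $\rho<R$) define $$\begin{aligned}\mathcal{A}_R(u,f):=&\Big(R^{sp}[u]^p_{W^{s,p}(B_R)}+\frac{1}{s(1-s)}\|u\|^p_{L^p(B_R)}\Big)+\frac1s\langle u\rangle^p_{\mathcal{X}^p_s(B_{\frac34R};B_R)}+R^{tp}\langle u\rangle^p_{\mathcal{Y}^{t,p}_s(B_{\frac34R};B_{\frac78R})}\\&+R^{s\,p\,p'}\Big(R^{sp'}\big[(1-s)f\big]^{p'}_{W^{s,p'}(B_R)}+\frac{1}{s(1-s)}\big\|(1-s)f\big\|^{p'}_{L^{p'}(B_R)}\Big).\end{aligned}$$ Then: (i) If $t+sp\le p-1$, then $u\in W^{\tau,p}_{loc}(\Omega)$ for every $s\le\tau<\frac{t+sp}{p-1}$, and for every ball $B_R\Subset\Omega$ $$[u]^p_{W^{\tau,p}(B_{R/2})}\le\frac{\mathcal{C}_1}{R^{\tau p}}\,\mathcal{A}_R(u,f),$$ for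 some constant $\mathcal{C}_1>0$ depending only on $N,p,s,\Lambda,t,\tau$. (ii) If $t+sp>p-1$, set $\Gamma:=\frac{1+t+sp}{p}$. Then $u\in W^{1,p}_{loc}(\Omega)$ and $\nabla u\in W^{\tau,p}_{loc}(\Omega)$ for every $0<\tau<\Gamma-1$, and for every ball $B_R\Subset\Omega$ and every such $\tau$ $$\|\nabla u\|^p_{L^p(B_{R/2})}\le\frac{\mathcal{C}_2}{R^p}\,\mathcal{A}_R(u,f)$$ and $$[\nabla u]^p_{W^{\tau,p}(B_{R/4})}\le\frac{(2-\Gamma)^{-p}(\Gamma-1)^{-p}}{(\Gamma-1-\tau)\,\tau}\,\frac{\mathcal{C}_3}{R^{p(1+\tau)}}\,\mathcal{A}_R(u,f),$$ for some constants $\mathcal{C}_2,\mathcal{C}_3>0$ depending only on $N,p,s,\Lambda,t$.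
   Context: Here $p'=p/(p-1)$. $F\Subset E$ means that $F,E$ are open and the closure of $F$ is a compact subset of $E$. For $0<\alpha<1$ and $1\le q<\infty$, $[\psi]_{W^{\alpha,q}(E)}=\left(\int_E\int_E\frac{|\psi(x)-\psi(y)|^q}{|x-y|^{N+\alpha q}}dx\,dy\right)^{1/q}$; $W^{\alpha,q}(E)$ is the set of $\psi\in L^q(E)$ with $[\psi]_{W^{\alpha,q}(E)}<\infty$; $W^{\alpha,q}_{loc}(\Omega)$ is the corresponding local space. Weighted spaces: $\mathcal{X}^p_s=\{\psi\in L^p_{loc}(\mathbb{R}^N):\int_{\mathbb{R}^N}\frac{|\psi(x)|^p}{(1+|x|)^{N+sp}}dx<\infty\}$, and for $0\le t\le1$, $\mathcal{Y}^{t,p}_s$ is the set of $\psi\in\mathcal{X}^p_s$ such that for some $h_0>0$, $\sup_{0<|h|<h_0}\int_{\mathbb{R}^N}\left|\frac{\psi(x+h)-\psi(x)}{|h|^t}\right|^p\frac{dx}{(1+|x|)^{N+sp}}<\infty$ (with $|h|^0=1$). Snail quantities: for $E$ open and bounded and $\psi\in\mathcal{X}^p_s$, $\mathrm{Snail}(\psi;x,E):=\left[|E|^{\frac{sp}{N}}\int_{\mathbb{R}^N\setminus E}\frac{|\psi(y)|^p}{|x-y|^{N+sp}}dy\right]^{1/p}$ for $x\in E$. For $F\Subset E\Subset\mathbb{R}^N$, $$\langle\psi\rangle_{\mathcal{X}^p_s(F;E)}:=\Big(\int_E|\psi|^pdx+\int_F\mathrm{Snail}(\psi;x,E)^pdx\Big)^{1/p},$$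 and for $\psi\in\mathcal{Y}^{t,p}_s$, $$\langle\psi\rangle_{\mathcal{Y}^{t,p}_s(F;E)}:=\sup_{0<|h|<\frac12 d(F,E)}\Big(\int_F\mathrm{Snail}\Big(\frac{\psi(\cdot+h)-\psi}{|h|^t};x,E\Big)^pdx\Big)^{1/p},\quad d(F,E):=\mathrm{dist}(F,\mathbb{R}^N\setminus E).$$ Local weak solution: given $f\in L^{p'}_{loc}(\Omega)$, $u\in W^{s,p}_{loc}(\Omega)\cap\mathcal{X}^p_s$ is a local weak solution of $(-\Delta_{p,K})^su=f$ in $\Omega$ if $$\int_{\mathbb{R}^N}\int_{\mathbb{R}^N}\frac{|u(x)-u(y)|^{p-2}(u(x)-u(y))}{K(x-y)}(\varphi(x)-\varphi(y))\,dx\,dy=\int_{\Omega'}f\varphi\,dx$$ for every $\Omega'\Subset\Omega$ and every $\varphi\in W^{s,p}(\Omega)$ with $\varphi\equiv0$ in $\Omega\setminus\Omega'$ ($\varphi$ is extended by $0$ outside $\Omega$). *)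

theory Defs
  imports "HOL-Analysis.Analysis"
begin

text \<open>
  The Euclidean space is \<open>'a :: euclidean_space\<close>, with \<open>N = DIM('a)\<close>; measurability and integrals
  refer to Lebesgue measure, also on \<open>'a \<times> 'a\<close> for double integrals. Norms, seminorms
  and suprema take values in \<^typ>\<open>ennreal\<close>, so that infinite values are not lost.
\<close>

text \<open>The power \<open>x\<^sup>a\<close> on \<open>[0,\<infinity>]\<close>, meant for \<open>a > 0\<close>.\<close>

definition epowr :: "ennreal \<Rightarrow> real \<Rightarrow> ennreal" where
  "epowr x a = (if x = \<infinity> then \<infinity> else ennreal (enn2real x powr a))"

definition conj_exp :: "real \<Rightarrow> real" where
  "conj_exp p = p / (p - 1)"

definition compactly_inside :: "'a::euclidean_space set \<Rightarrow> 'a set \<Rightarrow> bool" where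
  "compactly_inside F E \<longleftrightarrow> open F \<and> open E \<and> compact (closure F) \<and> closure F \<subseteq> E"


subsection \<open>Lebesgue and fractional Sobolev spaces\<close>

text \<open>
  Elements of the spaces on \<open>E\<close> are total functions, only their values on \<open>E\<close> matter.
  They are vector valued in order to apply to gradients.
\<close>

definition Lnorm :: "real \<Rightarrow> 'a::euclidean_space set \<Rightarrow> ('a \<Rightarrow> 'b::euclidean_space) \<Rightarrow> ennreal" where
  "Lnorm q E \<psi> = epowr (\<integral>\<^sup>+x\<in>E. ennreal (norm (\<psi> x) powr q) \<partial>lebesgue) (1 / q)"

definition Lspace :: "real \<Rightarrow> 'a::euclidean_space set \<Rightarrow> ('a \<Rightarrow> 'b::euclidean_space) set" where
  "Lspace q E = {\<psi>. \<psi> \<in> borel_measurable (lebesgue_on E) \<and> Lnorm q E \<psi> < \<infinity>}"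

definition Lspace_loc :: "real \<Rightarrow> 'a::euclidean_space set \<Rightarrow> ('a \<Rightarrow> 'b::euclidean_space) set" where
  "Lspace_loc q \<Omega> = {\<psi>. \<forall>E. compactly_inside E \<Omega> \<longrightarrow> \<psi> \<in> Lspace q E}"

definition Wseminorm ::
  "real \<Rightarrow> real \<Rightarrow> 'a::euclidean_space set \<Rightarrow> ('a \<Rightarrow> 'b::euclidean_space) \<Rightarrow> ennreal" where
  "Wseminorm \<alpha> q E \<psi> =
     epowr (\<integral>\<^sup>+z\<in>E \<times> E. (case z of (x, y) \<Rightarrow>
        ennreal (norm (\<psi> x - \<psi> y) powr q / norm (x - y) powr (real DIM('a) + \<alpha> * q))) \<partial>lebesgue)
      (1 / q)"

definition Wspace :: "real \<Rightarrow> real \<Rightarrow> 'a::euclidean_space set \<Rightarrow> ('a \<Rightarrow> 'b::euclidean_space) set" where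
  "Wspace \<alpha> q E = {\<psi> \<in> Lspace q E. Wseminorm \<alpha> q E \<psi> < \<infinity>}"

definition Wspace_loc :: "real \<Rightarrow> real \<Rightarrow> 'a::euclidean_space set \<Rightarrow> ('a \<Rightarrow> 'b::euclidean_space) set" where
  "Wspace_loc \<alpha> q \<Omega> = {\<psi>. \<forall>E. compactly_inside E \<Omega> \<longrightarrow> \<psi> \<in> Wspace \<alpha> q E}"


subsection \<open>Weak gradients and first order Sobolev spaces\<close>

primrec Ck :: "nat \<Rightarrow> ('a::euclidean_space \<Rightarrow> real) \<Rightarrow> bool" where
  "Ck 0 \<phi> \<longleftrightarrow> continuous_on UNIV \<phi>"
| "Ck (Suc k) \<phi> \<longleftrightarrow>
     \<phi> differentiable_on UNIV \<and> (\<forall>b\<in>Basis. Ck k (\<lambda>x. frechet_derivative \<phi> (at x) b))"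

definition test_function :: "'a::euclidean_space set \<Rightarrow> ('a \<Rightarrow> real) \<Rightarrow> bool" where
  "test_function E \<phi> \<longleftrightarrow>
     (\<forall>k. Ck k \<phi>) \<and> compact (closure {x. \<phi> x \<noteq> 0}) \<and> closure {x. \<phi> x \<noteq> 0} \<subseteq> E"

definition weak_gradient :: "'a::euclidean_space set \<Rightarrow> ('a \<Rightarrow> real) \<Rightarrow> ('a \<Rightarrow> 'a) \<Rightarrow> bool" where
  "weak_gradient E u g \<longleftrightarrow>
     u \<in> Lspace_loc 1 E \<and> g \<in> Lspace_loc 1 E \<and>
     (\<forall>\<phi>. test_function E \<phi> \<longrightarrow>
        (\<forall>b\<in>Basis. (LINT x:E|lebesgue. u x * frechet_derivative \<phi> (at x) b)
                 = - (LINT x:E|lebesgue. (g x \<bullet> b) * \<phi> x)))"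

definition W1space :: "real \<Rightarrow> 'a::euclidean_space set \<Rightarrow> ('a \<Rightarrow> real) set" where
  "W1space q E = {u \<in> Lspace q E. \<exists>g. weak_gradient E u g \<and> g \<in> Lspace q E}"

definition W1space_loc :: "real \<Rightarrow> 'a::euclidean_space set \<Rightarrow> ('a \<Rightarrow> real) set" where
  "W1space_loc q \<Omega> = {u. \<forall>E. compactly_inside E \<Omega> \<longrightarrow> u \<in> W1space q E}"


subsection \<open>Weighted spaces and snails\<close>

definition Xspace :: "real \<Rightarrow> real \<Rightarrow> ('a::euclidean_space \<Rightarrow> real) set" where
  "Xspace s p = {\<psi> \<in> Lspace_loc p UNIV.
     (\<integral>\<^sup>+x. ennreal (\<bar>\<psi> x\<bar> powr p / (1 + norm x) powr (real DIM('a) + s * p)) \<partial>lebesgue) < \<infinity>}"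

definition diff_quot :: "real \<Rightarrow> 'a::euclidean_space \<Rightarrow> ('a \<Rightarrow> real) \<Rightarrow> 'a \<Rightarrow> real" where
  "diff_quot t h \<psi> x = (\<psi> (x + h) - \<psi> x) / norm h powr t"

definition Yspace :: "real \<Rightarrow> real \<Rightarrow> real \<Rightarrow> ('a::euclidean_space \<Rightarrow> real) set" where
  "Yspace t s p = {\<psi> \<in> Xspace s p. \<exists>h0>0.
     (SUP h\<in>{h. 0 < norm h \<and> norm h < h0}.
        \<integral>\<^sup>+x. ennreal (\<bar>diff_quot t h \<psi> x\<bar> powr p / (1 + norm x) powr (real DIM('a) + s * p))
          \<partial>lebesgue) < \<infinity>}"

definition Snail ::
  "real \<Rightarrow> real \<Rightarrow> ('a::euclidean_space \<Rightarrow> real) \<Rightarrow> 'a \<Rightarrow> 'a set \<Rightarrow> ennreal" where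
  "Snail s p \<psi> x E =
     epowr (ennreal (measure lebesgue E powr (s * p / real DIM('a))) *
        (\<integral>\<^sup>+y\<in>UNIV - E. ennreal (\<bar>\<psi> y\<bar> powr p / norm (x - y) powr (real DIM('a) + s * p))
          \<partial>lebesgue))
      (1 / p)"

definition Xnorm ::
  "real \<Rightarrow> real \<Rightarrow> ('a::euclidean_space \<Rightarrow> real) \<Rightarrow> 'a set \<Rightarrow> 'a set \<Rightarrow> ennreal" where
  "Xnorm s p \<psi> F E =
     epowr ((\<integral>\<^sup>+x\<in>E. ennreal (\<bar>\<psi> x\<bar> powr p) \<partial>lebesgue)
          + (\<integral>\<^sup>+x\<in>F. epowr (Snail s p \<psi> x E) p \<partial>lebesgue))
      (1 / p)"

definition Ynorm ::
  "real \<Rightarrow> real \<Rightarrow> real \<Rightarrow> ('a::euclidean_space \<Rightarrow> real) \<Rightarrow> 'a set \<Rightarrow> 'a set \<Rightarrow> ennreal" where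
  "Ynorm t s p \<psi> F E =
     (SUP h\<in>{h. 0 < norm h \<and> norm h < setdist F (UNIV - E) / 2}.
        epowr (\<integral>\<^sup>+x\<in>F. epowr (Snail s p (diff_quot t h \<psi>) x E) p \<partial>lebesgue) (1 / p))"


subsection \<open>Local weak solutions\<close>

text \<open>
  Under the stated memberships, and for \<open>K\<close> comparable to \<open>norm z powr (N + s * p)\<close>, both integrals
  below converge absolutely. If \<open>p = 2\<close>, the value of \<open>0 powr 0\<close> is irrelevant, because the next
  factor vanishes.
\<close>

definition local_weak_solution ::
  "real \<Rightarrow> real \<Rightarrow> ('a::euclidean_space \<Rightarrow> real) \<Rightarrow> 'a set \<Rightarrow> ('a \<Rightarrow> real) \<Rightarrow> ('a \<Rightarrow> real) \<Rightarrow> bool" where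
  "local_weak_solution s p K \<Omega> f u \<longleftrightarrow>
     f \<in> Lspace_loc (conj_exp p) \<Omega> \<and> u \<in> Wspace_loc s p \<Omega> \<inter> Xspace s p \<and>
     (\<forall>\<Omega>' \<phi>. compactly_inside \<Omega>' \<Omega> \<and> \<phi> \<in> Wspace s p \<Omega> \<and> (\<forall>x\<in>\<Omega> - \<Omega>'. \<phi> x = 0) \<longrightarrow>
        (let \<phi>0 = (\<lambda>x. if x \<in> \<Omega> then \<phi> x else 0) in
          (LINT z|lebesgue. (case z of (x, y) \<Rightarrow>
             \<bar>u x - u y\<bar> powr (p - 2) * (u x - u y) / K (x - y) * (\<phi>0 x - \<phi>0 y)))
          = (LINT x:\<Omega>'|lebesgue. f x * \<phi> x)))"


subsection \<open>The right-hand side of the estimates\<close>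

definition A_term :: "real \<Rightarrow> real \<Rightarrow> real \<Rightarrow>
    ('a::euclidean_space \<Rightarrow> real) \<Rightarrow> ('a \<Rightarrow> real) \<Rightarrow> 'a \<Rightarrow> real \<Rightarrow> ennreal" where
  "A_term t s p u f x0 R =
     (let p' = conj_exp p; g = (\<lambda>x. (1 - s) * f x) in
       (ennreal (R powr (s * p)) * epowr (Wseminorm s p (ball x0 R) u) p
          + ennreal (1 / (s * (1 - s))) * epowr (Lnorm p (ball x0 R) u) p)
     + ennreal (1 / s) * epowr (Xnorm s p u (ball x0 (3/4 * R)) (ball x0 R)) p
     + ennreal (R powr (t * p)) * epowr (Ynorm t s p u (ball x0 (3/4 * R)) (ball x0 (7/8 * R))) p
     + ennreal (R powr (s * p * p')) *
         (ennreal (R powr (s * p')) * epowr (Wseminorm s p' (ball x0 R) g) p'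
          + ennreal (1 / (s * (1 - s))) * epowr (Lnorm p' (ball x0 R) g) p'))"

end

theory Submission
  imports Defs
begin

text \<open>
  The proof is Nirenberg's method of difference quotients. Write \<open>w x = u (x + h) - u x\<close> and let
  \<open>\<eta>\<close> be a cutoff function. The difference of the equations for \<open>u (\<cdot> + h)\<close> and \<open>u\<close> is tested with
  \<open>\<eta>\<^sup>2 w\<close>. With \<open>\<eta>, w\<close> taken at \<open>x\<close> and \<open>\<eta>', w'\<close> at \<open>y\<close>, the identity
  \<open>(w - w') (\<eta>\<^sup>2 w - \<eta>'\<^sup>2 w') = (\<eta> w - \<eta>' w')\<^sup>2 - w w' (\<eta> - \<eta>')\<^sup>2\<close> and the monotonicity of
  \<open>a \<mapsto> \<bar>a\<bar> powr (p - 2) * a\<close> bound the \<open>p\<close>-th power of the \<open>W\<^sup>s\<^sup>,\<^sup>p\<close> seminorm of \<open>\<eta> w\<close> by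
  \<open>\<bar>h\<bar> powr (t + \<tau>)\<close>, provided that the \<open>L\<^sup>p\<close> norm of \<open>w\<close> is at most of order \<open>\<bar>h\<bar> powr \<tau>\<close>: one
  factor \<open>w\<close> in the error terms contributes the exponent \<open>\<tau>\<close>, the tail contributes \<open>t\<close>. Hence second
  differences of \<open>u\<close> have the exponent \<open>(s p + t + \<tau>) / p\<close>.

  Since \<open>\<delta>\<^sub>h = (\<delta>\<^sub>2\<^sub>h - \<delta>\<^sub>h \<delta>\<^sub>h) / 2\<close>, first differences inherit this exponent as long as it is
  below 1, and the exponent 1 if it exceeds 1. Iterating brings the exponent as close as desired to
  the fixed point \<open>(t + s p) / (p - 1)\<close>, respectively up to 1. In the second case one more step gives
  the exponent \<open>\<Gamma> > 1\<close> for second differences, so that difference quotients along dyadic steps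
  converge geometrically in \<open>L\<^sup>p\<close>. The limit is the gradient, its translates have the exponent
  \<open>\<Gamma> - 1\<close>, and summation over dyadic shells yields the fractional seminorm with the factor
  \<open>1 / (\<Gamma> - 1 - \<tau>)\<close>.
\<close>

section \<open>Lebesgue measure on products\<close>

text \<open>Smoothness is carried by \<open>L^p\<close> bounds for translates and not by fractional
  seminorms. A seminorm gives the translate bound with the same exponent, but the way back needs a
  strictly larger exponent; so the way back is taken only once, after the iteration, and this is why
  the final exponents satisfy strict inequalities. The obstacle to better exponents is nonlocal.
  Outside the ball the differences of \<open>u\<close> never gain more than the given exponent
  \<open>t\<close>, so every energy step is bounded by the product of two scales: the improving one
  of \<open>w\<close> inside and the fixed one of its tail. The balls shrink slightly at each step.
  The number of steps depends on the exponents alone, and every constant must be fixed before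
  \<open>u\<close>, \<open>f\<close>, \<open>K\<close> and the ball are known; this dictates the
  form of the statements on uniform bounds. In the same spirit the dependence on \<tau> is kept
  explicit when a geometric series is summed for the gradient. Integrability of each term in the
  weak formulation has to be established before equations are subtracted, and \<open>A\<close> has
  to be a positive real although the right-hand side of the theorem may be zero or infinite.\<close>

lemma measurable_lebesgue_lebesgue:
  fixes T :: "'a::euclidean_space \<Rightarrow> 'b::euclidean_space"
  assumes T: "T \<in> borel \<rightarrow>\<^sub>M borel"
    and null: "\<And>A. A \<in> sets borel \<Longrightarrow> emeasure lborel A = 0 \<Longrightarrow> emeasure lborel (T -` A) = 0"
  shows "T \<in> lebesgue \<rightarrow>\<^sub>M lebesgue"
proof (rule completion.measurable_completion2)
  show T': "T \<in> lebesgue \<rightarrow>\<^sub>M lborel"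
    using T by (auto intro: measurable_completion)
  \<comment> \<open>Measurability into a completion also requires preimages of null sets to be null;
    for a Borel map this is what the second assumption provides.\<close>
  show "null_sets lborel \<subseteq> null_sets (distr lebesgue lborel T)"
  proof
    fix A :: "'b set" assume A: "A \<in> null_sets lborel"
    then have A': "A \<in> sets borel" "emeasure lborel A = 0" by auto
    have "T -` A \<in> sets borel"
      using measurable_sets[OF T A'(1)] by simp
    then have "emeasure lebesgue (T -` A) = 0"
      using null[OF A'] by (simp)
    then show "A \<in> null_sets (distr lebesgue lborel T)"
      using A' T' by (auto simp: null_sets_def emeasure_distr)
  qed
qed

lemma measurable_lebesgue_plus:
  fixes h :: "'a::euclidean_space"
  shows "(\<lambda>x. x + h) \<in> lebesgue \<rightarrow>\<^sub>M lebesgue"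
  using lebesgue_affine_measurable[of "\<lambda>_. 1" h]
  by (simp add: euclidean_representation add.commute)

lemma distr_lebesgue_plus:
  fixes h :: "'a::euclidean_space"
  shows "distr lebesgue lebesgue (\<lambda>x. x + h) = lebesgue"
  using lebesgue_affine_euclidean[of "\<lambda>_. 1" h]
  by (simp add: euclidean_representation add.commute density_1)

lemma nn_integral_lebesgue_shift:
  fixes F :: "'a::euclidean_space \<Rightarrow> ennreal"
  assumes "F \<in> borel_measurable lebesgue"
  shows "(\<integral>\<^sup>+x. F (x + h) \<partial>lebesgue) = (\<integral>\<^sup>+x. F x \<partial>lebesgue)"
proof -
  have "(\<integral>\<^sup>+x. F x \<partial>lebesgue) = (\<integral>\<^sup>+x. F x \<partial>distr lebesgue lebesgue (\<lambda>x. x + h))"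
    by (simp only: distr_lebesgue_plus)
  also have "\<dots> = (\<integral>\<^sup>+x. F (x + h) \<partial>lebesgue)"
    by (rule nn_integral_distr) (use assms measurable_lebesgue_plus in auto)
  finally show ?thesis by simp
qed

lemma integral_lebesgue_shift:
  fixes F :: "'a::euclidean_space \<Rightarrow> real"
  assumes "F \<in> borel_measurable lebesgue"
  shows "(\<integral>x. F (x + h) \<partial>lebesgue) = (\<integral>x. F x \<partial>lebesgue)"
proof -
  have "(\<integral>x. F x \<partial>lebesgue) = (\<integral>x. F x \<partial>distr lebesgue lebesgue (\<lambda>x. x + h))"
    by (simp only: distr_lebesgue_plus)
  also have "\<dots> = (\<integral>x. F (x + h) \<partial>lebesgue)"
    by (rule integral_distr) (use assms measurable_lebesgue_plus in auto)
  finally show ?thesis by simp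
qed

lemma emeasure_lborel_prod_fst:
  fixes A :: "('a::euclidean_space \<times> 'b::euclidean_space) set"
  assumes "A \<in> sets borel"
  shows "emeasure lborel A = (\<integral>\<^sup>+x. emeasure lborel (Pair x -` A) \<partial>lborel)"
proof -
  have "A \<in> sets (lborel \<Otimes>\<^sub>M lborel)"
    using assms by (simp only: lborel_prod sets_lborel)
  then show ?thesis
    using lborel.emeasure_pair_measure_alt[of A lborel] by (simp add: lborel_prod)
qed

lemma emeasure_lborel_prod_snd:
  fixes A :: "('a::euclidean_space \<times> 'b::euclidean_space) set"
  assumes "A \<in> sets borel"
  shows "emeasure lborel A = (\<integral>\<^sup>+y. emeasure lborel ((\<lambda>x. (x, y)) -` A) \<partial>lborel)"
proof -
  have "A \<in> sets (lborel \<Otimes>\<^sub>M lborel)"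
    using assms by (simp only: lborel_prod sets_lborel)
  then show ?thesis
    using lborel_pair.emeasure_pair_measure_alt2[of A] by (simp add: lborel_prod)
qed

section \<open>Projections and differences as maps between completed measures\<close>

lemma fst_lebesgue: "(fst :: 'a::euclidean_space \<times> 'b::euclidean_space \<Rightarrow> 'a) \<in> lebesgue \<rightarrow>\<^sub>M lebesgue"
proof (rule measurable_lebesgue_lebesgue)
  show f: "(fst :: 'a \<times> 'b \<Rightarrow> 'a) \<in> borel \<rightarrow>\<^sub>M borel"
    by (intro borel_measurable_continuous_onI continuous_intros)
  fix A :: "'a set" assume A: "A \<in> sets borel" "emeasure lborel A = 0"
  have B: "(fst :: 'a \<times> 'b \<Rightarrow> 'a) -` A \<in> sets borel"
    using measurable_sets[OF f A(1)] by simp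
  show "emeasure lborel ((fst :: 'a \<times> 'b \<Rightarrow> 'a) -` A) = 0"
    by (subst emeasure_lborel_prod_snd[OF B]) (simp add: vimage_def A(2))
qed

lemma snd_lebesgue: "(snd :: 'a::euclidean_space \<times> 'b::euclidean_space \<Rightarrow> 'b) \<in> lebesgue \<rightarrow>\<^sub>M lebesgue"
proof (rule measurable_lebesgue_lebesgue)
  show f: "(snd :: 'a \<times> 'b \<Rightarrow> 'b) \<in> borel \<rightarrow>\<^sub>M borel"
    by (intro borel_measurable_continuous_onI continuous_intros)
  fix A :: "'b set" assume A: "A \<in> sets borel" "emeasure lborel A = 0"
  have B: "(snd :: 'a \<times> 'b \<Rightarrow> 'b) -` A \<in> sets borel"
    using measurable_sets[OF f A(1)] by simp
  show "emeasure lborel ((snd :: 'a \<times> 'b \<Rightarrow> 'b) -` A) = 0"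
    by (subst emeasure_lborel_prod_fst[OF B]) (simp add: vimage_def A(2))
qed

text \<open>For a fixed second variable the map is a translation, so every slice of the preimage of
  a null set is null.\<close>

lemma diff_lebesgue:
  "(\<lambda>z. fst z - snd z :: 'a::euclidean_space) \<in> lebesgue \<rightarrow>\<^sub>M lebesgue"
proof (rule measurable_lebesgue_lebesgue)
  show f: "(\<lambda>z. fst z - snd z :: 'a) \<in> borel \<rightarrow>\<^sub>M borel"
    by (intro borel_measurable_continuous_onI continuous_intros)
  fix A :: "'a set" assume A: "A \<in> sets borel" "emeasure lborel A = 0"
  have B: "(\<lambda>z. fst z - snd z :: 'a) -` A \<in> sets borel"
    using measurable_sets[OF f A(1)] by simp
  have "emeasure lborel {x. x - y \<in> A} = 0" for y
  proof -
    have "emeasure lborel A = emeasure (distr lborel borel ((+) (-y))) A"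
      by (simp only: lborel_distr_plus)
    also have "\<dots> = emeasure lborel {x. x - y \<in> A}"
      by (subst emeasure_distr) (use A in \<open>auto simp: vimage_def\<close>)
    finally show ?thesis using A by simp
  qed
  then show "emeasure lborel ((\<lambda>z. fst z - snd z :: 'a) -` A) = 0"
    by (subst emeasure_lborel_prod_snd[OF B]) (simp add: vimage_def)
qed

lemma measurable_fst_lebesgue [measurable (raw)]:
  fixes f :: "'c \<Rightarrow> 'a::euclidean_space \<times> 'b::euclidean_space"
  shows "f \<in> M \<rightarrow>\<^sub>M lebesgue \<Longrightarrow> (\<lambda>x. fst (f x)) \<in> M \<rightarrow>\<^sub>M lebesgue"
  by (rule measurable_compose[OF _ fst_lebesgue])

lemma measurable_snd_lebesgue [measurable (raw)]:
  fixes f :: "'c \<Rightarrow> 'a::euclidean_space \<times> 'b::euclidean_space"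
  shows "f \<in> M \<rightarrow>\<^sub>M lebesgue \<Longrightarrow> (\<lambda>x. snd (f x)) \<in> M \<rightarrow>\<^sub>M lebesgue"
  by (rule measurable_compose[OF _ snd_lebesgue])

lemma measurable_shift_lebesgue [measurable (raw)]:
  fixes f :: "'c \<Rightarrow> 'a::euclidean_space"
  shows "f \<in> M \<rightarrow>\<^sub>M lebesgue \<Longrightarrow> (\<lambda>x. f x + h) \<in> M \<rightarrow>\<^sub>M lebesgue"
  by (rule measurable_compose[OF _ measurable_lebesgue_plus])

declare diff_lebesgue [measurable]

lemma measurable_id_lebesgue [measurable]:
  "(\<lambda>x :: 'a::euclidean_space. x) \<in> borel_measurable lebesgue"
  by (rule measurable_completion) simp

lemma measurable_indicator_lebesgue [measurable]:
  "B \<in> sets borel \<Longrightarrow> (indicator B :: 'a::euclidean_space \<Rightarrow> real) \<in> borel_measurable lebesgue"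
  by (rule measurable_completion) simp

section \<open>Tonelli's theorem and exchange of variables for the completed measure\<close>

lemma ex_borel_version:
  fixes F :: "'a::euclidean_space \<Rightarrow> ennreal"
  assumes "F \<in> borel_measurable lebesgue"
  obtains G where "G \<in> borel_measurable borel" "AE x in lborel. F x = G x"
  using completion_ex_borel_measurable[OF assms] by (metis measurable_lborel2)

text \<open>Lebesgue measure on a product is the completion of the product measure, not the product
  of the completions, so Tonelli's theorem does not apply to \<open>F\<close> directly. It is
  applied to a Borel version, which agrees with \<open>F\<close> almost everywhere on almost every
  slice.\<close>

lemma nn_integral_lebesgue_fst:
  fixes F :: "'a::euclidean_space \<times> 'b::euclidean_space \<Rightarrow> ennreal"
  assumes F: "F \<in> borel_measurable lebesgue"
  shows "(\<integral>\<^sup>+z. F z \<partial>lebesgue) = (\<integral>\<^sup>+x. \<integral>\<^sup>+y. F (x, y) \<partial>lebesgue \<partial>lebesgue)"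
proof -
  obtain G where G: "G \<in> borel_measurable borel" "AE x in lborel. F x = G x"
    using ex_borel_version[OF F] by blast
  have "AE z in lborel \<Otimes>\<^sub>M lborel. F z = G z"
    using G(2) by (simp only: lborel_prod)
  then have ae: "AE x in lborel. AE y in lborel. F (x, y) = G (x, y)"
    by (rule lborel_pair.AE_pair)
  have "(\<integral>\<^sup>+z. F z \<partial>lebesgue) = (\<integral>\<^sup>+z. G z \<partial>lborel)"
    unfolding nn_integral_completion by (rule nn_integral_cong_AE) (fact G)
  also have "\<dots> = (\<integral>\<^sup>+z. G z \<partial>(lborel \<Otimes>\<^sub>M lborel))"
    by (simp only: lborel_prod)
  also have "\<dots> = (\<integral>\<^sup>+x. \<integral>\<^sup>+y. G (x, y) \<partial>lborel \<partial>lborel)"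
    by (rule lborel.nn_integral_fst[symmetric]) (use G in \<open>simp only: lborel_prod measurable_lborel2\<close>)
  also have "\<dots> = (\<integral>\<^sup>+x. \<integral>\<^sup>+y. F (x, y) \<partial>lborel \<partial>lborel)"
    by (rule nn_integral_cong_AE)
      (use ae in \<open>auto elim!: eventually_mono intro!: nn_integral_cong_AE simp: eq_commute\<close>)
  finally show ?thesis by (simp add: nn_integral_completion)
qed

lemma nn_integral_lebesgue_swap:
  fixes F :: "'a::euclidean_space \<times> 'b::euclidean_space \<Rightarrow> ennreal"
  assumes F: "F \<in> borel_measurable lebesgue"
  shows "(\<integral>\<^sup>+z. F (snd z, fst z) \<partial>lebesgue) = (\<integral>\<^sup>+z. F z \<partial>lebesgue)"
proof -
  obtain G where G: "G \<in> borel_measurable borel" "AE x in lborel. F x = G x"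
    using ex_borel_version[OF F] by blast
  have d: "distr lborel borel (\<lambda>z :: 'b \<times> 'a. (snd z, fst z)) = lborel"
  proof -
    have "lborel \<Otimes>\<^sub>M lborel = distr (lborel \<Otimes>\<^sub>M lborel) (lborel \<Otimes>\<^sub>M lborel) (\<lambda>(x :: 'b, y :: 'a). (y, x))"
      by (rule lborel_pair.distr_pair_swap)
    then have "lborel = distr lborel lborel (\<lambda>(x :: 'b, y :: 'a). (y, x))"
      by (simp only: lborel_prod)
    also have "\<dots> = distr lborel borel (\<lambda>z :: 'b \<times> 'a. (snd z, fst z))"
      by (rule distr_cong) auto
    finally show ?thesis by simp
  qed
  have m: "(\<lambda>z :: 'b \<times> 'a. (snd z, fst z)) \<in> lborel \<rightarrow>\<^sub>M borel"
    unfolding measurable_lborel2 by (intro borel_measurable_continuous_onI continuous_intros)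
  have "AE z in distr lborel borel (\<lambda>z :: 'b \<times> 'a. (snd z, fst z)). F z = G z"
    using G(2) by (simp only: d)
  then have "AE z in lborel. F (snd z, fst z) = G (snd z, fst z)"
    by (rule AE_distrD[OF m])
  then have "(\<integral>\<^sup>+z. F (snd z, fst z) \<partial>lebesgue) = (\<integral>\<^sup>+z. G (snd z, fst z) \<partial>lborel)"
    unfolding nn_integral_completion by (rule nn_integral_cong_AE)
  also have "\<dots> = (\<integral>\<^sup>+z. G z \<partial>distr lborel borel (\<lambda>z :: 'b \<times> 'a. (snd z, fst z)))"
    by (rule nn_integral_distr[symmetric]) (use G m in simp_all)
  also have "\<dots> = (\<integral>\<^sup>+z. F z \<partial>lebesgue)"
    unfolding d nn_integral_completion by (rule nn_integral_cong_AE) (use G in \<open>auto elim!: eventually_mono\<close>)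
  finally show ?thesis .
qed

lemma nn_integral_lebesgue_snd:
  fixes F :: "'a::euclidean_space \<times> 'b::euclidean_space \<Rightarrow> ennreal"
  assumes F: "F \<in> borel_measurable lebesgue"
    and F': "(\<lambda>z. F (snd z, fst z)) \<in> borel_measurable lebesgue"
  shows "(\<integral>\<^sup>+z. F z \<partial>lebesgue) = (\<integral>\<^sup>+y. \<integral>\<^sup>+x. F (x, y) \<partial>lebesgue \<partial>lebesgue)"
  using nn_integral_lebesgue_fst[OF F'] nn_integral_lebesgue_swap[OF F] by simp

text \<open>Most estimates below have this shape: a pointwise bound by two integrands whose
  integrals are under control. All bounds stay real, which keeps the algebra of constants out of the
  extended reals.\<close>

lemma nn_integral_combine:
  fixes F G H :: "'a \<Rightarrow> real"
  assumes [measurable]: "F \<in> borel_measurable M" "G \<in> borel_measurable M"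
    and le: "\<And>x. x \<in> space M \<Longrightarrow> H x \<le> c * F x + d * G x"
    and nonneg: "\<And>x. 0 \<le> F x" "\<And>x. 0 \<le> G x" "0 \<le> c" "0 \<le> d" "0 \<le> a" "0 \<le> b"
    and F: "(\<integral>\<^sup>+x. ennreal (F x) \<partial>M) \<le> ennreal a"
    and G: "(\<integral>\<^sup>+x. ennreal (G x) \<partial>M) \<le> ennreal b"
  shows "(\<integral>\<^sup>+x. ennreal (H x) \<partial>M) \<le> ennreal (c * a + d * b)"
proof -
  have "(\<integral>\<^sup>+x. ennreal (H x) \<partial>M) \<le> (\<integral>\<^sup>+x. ennreal c * ennreal (F x) + ennreal d * ennreal (G x) \<partial>M)"
    using nonneg by (intro nn_integral_mono) (simp add: le ennreal_leI flip: ennreal_mult ennreal_plus)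
  also have "\<dots> = ennreal c * (\<integral>\<^sup>+x. ennreal (F x) \<partial>M) + ennreal d * (\<integral>\<^sup>+x. ennreal (G x) \<partial>M)"
    by (simp add: nn_integral_add nn_integral_cmult)
  also have "\<dots> \<le> ennreal c * ennreal a + ennreal d * ennreal b"
    by (intro add_mono mult_left_mono F G) auto
  also have "\<dots> = ennreal (c * a + d * b)"
    using nonneg by (simp add: ennreal_mult ennreal_plus)
  finally show ?thesis .
qed

lemma nn_integral_scale:
  fixes F H :: "'a \<Rightarrow> real"
  assumes [measurable]: "F \<in> borel_measurable M"
    and le: "\<And>x. x \<in> space M \<Longrightarrow> H x \<le> c * F x"
    and nonneg: "0 \<le> c"
    and F: "(\<integral>\<^sup>+x. ennreal (F x) \<partial>M) \<le> ennreal a"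
  shows "(\<integral>\<^sup>+x. ennreal (H x) \<partial>M) \<le> ennreal (c * a)"
proof -
  have "(\<integral>\<^sup>+x. ennreal (H x) \<partial>M) \<le> (\<integral>\<^sup>+x. ennreal c * ennreal (F x) \<partial>M)"
    using nonneg by (intro nn_integral_mono) (simp add: le ennreal_leI flip: ennreal_mult')
  also have "\<dots> = ennreal c * (\<integral>\<^sup>+x. ennreal (F x) \<partial>M)"
    by (simp add: nn_integral_cmult)
  also have "\<dots> \<le> ennreal c * ennreal a"
    by (intro mult_left_mono F) auto
  also have "\<dots> = ennreal (c * a)"
    using nonneg by (simp add: ennreal_mult')
  finally show ?thesis .
qed

lemma nn_integral_le_mono:
  fixes F H :: "'a \<Rightarrow> real"
  assumes "\<And>x. x \<in> space M \<Longrightarrow> H x \<le> F x" "(\<integral>\<^sup>+x. ennreal (F x) \<partial>M) \<le> a"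
  shows "(\<integral>\<^sup>+x. ennreal (H x) \<partial>M) \<le> a"
  using assms(2) by (rule order_trans[rotated]) (intro nn_integral_mono ennreal_leI assms(1))

section \<open>Integrals of kernels and elementary inequalities\<close>

lemma powr_sum_le:
  fixes a b q :: real
  assumes "0 \<le> a" "0 \<le> b" "0 \<le> q"
  shows "(a + b) powr q \<le> 2 powr q * (a powr q + b powr q)"
proof -
  have "(a + b) powr q \<le> (2 * max a b) powr q"
    using assms by (intro powr_mono2) auto
  also have "\<dots> = 2 powr q * (max a b) powr q"
    using assms by (simp add: powr_mult)
  also have "\<dots> \<le> 2 powr q * (a powr q + b powr q)"
    by (auto simp: max_def)
  finally show ?thesis .
qed

lemma powr_diff_le:
  fixes a b q :: real
  assumes "0 \<le> q"
  shows "\<bar>a - b\<bar> powr q \<le> 2 powr q * (\<bar>a\<bar> powr q + \<bar>b\<bar> powr q)"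
proof -
  have "\<bar>a - b\<bar> powr q \<le> (\<bar>a\<bar> + \<bar>b\<bar>) powr q"
    using assms by (intro powr_mono2) auto
  also have "\<dots> \<le> 2 powr q * (\<bar>a\<bar> powr q + \<bar>b\<bar> powr q)"
    using assms by (intro powr_sum_le) auto
  finally show ?thesis .
qed

section \<open>Radial kernels integrated over dyadic balls\<close>

lemma nn_integral_ball_const:
  fixes x :: "'a::euclidean_space"
  assumes "0 \<le> r" "0 \<le> c"
  shows "(\<integral>\<^sup>+y. ennreal (c * indicator (ball x r) y) \<partial>lebesgue)
     = ennreal (c * (unit_ball_vol (real DIM('a)) * r ^ DIM('a)))"
proof -
  have "(\<integral>\<^sup>+y. ennreal (c * indicator (ball x r) y) \<partial>lebesgue)
     = (\<integral>\<^sup>+y. ennreal c * indicator (ball x r) y \<partial>lborel)"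
    unfolding nn_integral_completion by (intro nn_integral_cong) (auto simp: indicator_def)
  also have "\<dots> = ennreal c * emeasure lborel (ball x r)"
    by (simp add: nn_integral_cmult_indicator)
  also have "\<dots> = ennreal (c * (unit_ball_vol (real DIM('a)) * r ^ DIM('a)))"
    using assms by (simp add: emeasure_ball ennreal_mult')
  finally show ?thesis .
qed

text \<open>Full balls replace annuli: their volume is explicit and the overlap costs only a
  constant. At a point where \<open>F\<close> is positive a single index \<open>j\<close> already
  dominates it.\<close>

lemma nn_integral_shells:
  fixes x :: "'a::euclidean_space" and F :: "'a \<Rightarrow> real" and c r :: "nat \<Rightarrow> real"
  assumes F: "\<And>y. F y \<le> 0 \<or> (\<exists>j. y \<in> ball x (r j) \<and> F y \<le> c j)"
    and nonneg: "\<And>j. 0 \<le> c j" "\<And>j. 0 \<le> r j"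
    and S: "(\<lambda>j. c j * (unit_ball_vol (real DIM('a)) * r j ^ DIM('a))) sums S"
  shows "(\<integral>\<^sup>+y. ennreal (F y) \<partial>lebesgue) \<le> ennreal S"
proof -
  have "(\<integral>\<^sup>+y. ennreal (F y) \<partial>lebesgue)
      \<le> (\<integral>\<^sup>+y. (\<Sum>j. ennreal (c j * indicator (ball x (r j)) y)) \<partial>lebesgue)"
  proof (rule nn_integral_mono)
    fix y
    show "ennreal (F y) \<le> (\<Sum>j. ennreal (c j * indicator (ball x (r j)) y))"
    proof (cases "F y \<le> 0")
      case True
      then show ?thesis by (simp add: ennreal_neg)
    next
      case False
      then obtain j where j: "y \<in> ball x (r j)" "F y \<le> c j" using F by blast
      then have "ennreal (F y) \<le> ennreal (c j * indicator (ball x (r j)) y)"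
        by (auto intro: ennreal_leI)
      also have "\<dots> = (\<Sum>j\<in>{j}. ennreal (c j * indicator (ball x (r j)) y))" by simp
      also have "\<dots> \<le> (\<Sum>j. ennreal (c j * indicator (ball x (r j)) y))"
        by (intro sum_le_suminf) auto
      finally show ?thesis .
    qed
  qed
  also have "\<dots> = (\<Sum>j. \<integral>\<^sup>+y. ennreal (c j * indicator (ball x (r j)) y) \<partial>lebesgue)"
    by (rule nn_integral_suminf) measurable
  also have "\<dots> = (\<Sum>j. ennreal (c j * (unit_ball_vol (real DIM('a)) * r j ^ DIM('a))))"
    by (intro suminf_cong nn_integral_ball_const nonneg)
  also have "\<dots> = ennreal S"
    using S nonneg by (subst suminf_ennreal2) (auto intro: sums_summable simp: sums_unique[symmetric])
  finally show ?thesis .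
qed

lemma dyadic_between:
  fixes x a :: real
  assumes "0 < x" "x < a"
  obtains j :: nat where "a / 2 ^ Suc j \<le> x" "x < a / 2 ^ j"
proof -
  define P where "P j \<longleftrightarrow> a / 2 ^ Suc j \<le> x" for j :: nat
  have "\<exists>j. P j"
  proof -
    obtain n where n: "a / x < 2 ^ n"
      using real_arch_pow[of 2 "a/x"] by auto
    then have "a < x * 2 ^ n" using assms by (simp add: field_simps)
    then have "a / 2 ^ n \<le> x" by (simp add: field_simps)
    moreover have "a / 2 ^ Suc n \<le> a / 2 ^ n"
      using assms by (simp add: field_simps)
    ultimately show ?thesis unfolding P_def by (intro exI[of _ n]) simp
  qed
  then have 1: "P (LEAST j. P j)" by (rule LeastI_ex)
  moreover have "x < a / 2 ^ (LEAST j. P j)"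
  proof (cases "LEAST j. P j")
    case 0 then show ?thesis using assms by simp
  next
    case (Suc m)
    then have "\<not> P m" using not_less_Least[of m P] by simp
    then show ?thesis using Suc by (simp add: P_def)
  qed
  ultimately show ?thesis using that P_def by blast
qed

lemma dyadic_between_up:
  fixes x a :: real
  assumes "0 < a" "a \<le> x"
  obtains j :: nat where "a * 2 ^ j \<le> x" "x < a * 2 ^ Suc j"
proof -
  define P where "P j \<longleftrightarrow> x < a * 2 ^ Suc j" for j :: nat
  have "\<exists>j. P j"
  proof -
    obtain n where n: "x / a < 2 ^ n"
      using real_arch_pow[of 2 "x/a"] by auto
    then have "x < a * 2 ^ n" using assms by (simp add: field_simps)
    moreover have "a * 2 ^ n \<le> a * 2 ^ Suc n"
      using assms by (simp add: field_simps)
    ultimately show ?thesis unfolding P_def by (intro exI[of _ n]) simp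
  qed
  then have 1: "P (LEAST j. P j)" by (rule LeastI_ex)
  moreover have "a * 2 ^ (LEAST j. P j) \<le> x"
  proof (cases "LEAST j. P j")
    case 0 then show ?thesis using assms by simp
  next
    case (Suc m)
    then have "\<not> P m" using not_less_Least[of m P] by simp
    then show ?thesis using Suc by (simp add: P_def)
  qed
  ultimately show ?thesis using that P_def by blast
qed

lemma two_power_powr: "(2 ^ j) powr \<beta> = (2 powr \<beta>) ^ j" for \<beta> :: real
proof -
  have "(2 ^ j) powr \<beta> = (2 powr real j) powr \<beta>" by (subst powr_realpow) auto
  also have "\<dots> = (2 powr \<beta>) powr real j" by (simp add: powr_powr mult.commute)
  also have "\<dots> = (2 powr \<beta>) ^ j" by (rule powr_realpow) simp
  finally show ?thesis .
qed

text \<open>On a dyadic shell the numerator is taken at the outer and the denominator at the inner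
  radius, which works for either sign of the exponent and costs \<open>2 ^ DIM('a)\<close>.
  Multiplied by the volume this leaves a geometric series of ratio
  \<open>2 powr (- \<beta>)\<close>. Its sum is kept explicit, since its blow-up as \<beta> tends to
  0 is needed for the gradient.\<close>

lemma nn_integral_kernel_near:
  fixes x :: "'a::euclidean_space"
  assumes "0 < \<beta>" "0 < a"
  shows "(\<integral>\<^sup>+y. ennreal (indicator (ball x a) y * norm (x - y) powr (\<beta> - real DIM('a))) \<partial>lebesgue)
    \<le> ennreal (unit_ball_vol (real DIM('a)) * 2 ^ DIM('a) * a powr \<beta> / (1 - 2 powr (- \<beta>)))"
proof (rule nn_integral_shells[where x = x and r = "\<lambda>j. a / 2 ^ j"
      and c = "\<lambda>j. (a / 2 ^ j) powr \<beta> * (2 ^ Suc j / a) ^ DIM('a)"])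
  let ?N = "DIM('a)"
  fix y
  show "indicator (ball x a) y * norm (x - y) powr (\<beta> - real ?N) \<le> 0 \<or>
      (\<exists>j. y \<in> ball x (a / 2 ^ j) \<and>
        indicator (ball x a) y * norm (x - y) powr (\<beta> - real ?N) \<le> (a / 2 ^ j) powr \<beta> * (2 ^ Suc j / a) ^ ?N)"
  proof (cases "y \<in> ball x a \<and> x \<noteq> y")
    case True
    then obtain j where j: "a / 2 ^ Suc j \<le> norm (x - y)" "norm (x - y) < a / 2 ^ j"
      using dyadic_between[of "norm (x - y)" a] by (auto simp: dist_norm)
    have "norm (x - y) powr (\<beta> - real ?N) = norm (x - y) powr \<beta> / norm (x - y) ^ ?N"
      using True by (simp add: powr_diff powr_realpow)
    also have "\<dots> \<le> (a / 2 ^ j) powr \<beta> / (a / 2 ^ Suc j) ^ ?N"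
      using j assms True by (intro frac_le powr_mono2 power_mono) auto
    also have "\<dots> = (a / 2 ^ j) powr \<beta> * (2 ^ Suc j / a) ^ ?N"
      by (simp add: power_divide)
    finally show ?thesis using True j by (intro disjI2 exI[of _ j]) (auto simp: dist_norm)
  qed auto
next
  let ?N = "DIM('a)"
  show "(\<lambda>j. (a / 2 ^ j) powr \<beta> * (2 ^ Suc j / a) ^ ?N * (unit_ball_vol (real ?N) * (a / 2 ^ j) ^ ?N))
    sums (unit_ball_vol (real ?N) * 2 ^ ?N * a powr \<beta> / (1 - 2 powr (- \<beta>)))"
  proof -
    have "(\<lambda>j. (unit_ball_vol (real ?N) * 2 ^ ?N * a powr \<beta>) * (2 powr (- \<beta>)) ^ j) sums
       ((unit_ball_vol (real ?N) * 2 ^ ?N * a powr \<beta>) * (1 / (1 - 2 powr (- \<beta>))))"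
      using assms by (intro sums_mult geometric_sums) (auto simp: powr_less_one)
    moreover have "(a / 2 ^ j) powr \<beta> * (2 ^ Suc j / a) ^ ?N * (unit_ball_vol (real ?N) * (a / 2 ^ j) ^ ?N)
      = (unit_ball_vol (real ?N) * 2 ^ ?N * a powr \<beta>) * (2 powr (- \<beta>)) ^ j" for j
    proof -
      have "(2 ^ Suc j / a) ^ ?N * (a / 2 ^ j) ^ ?N = 2 ^ ?N"
        using assms by (simp flip: power_mult_distrib)
      moreover have "(a / 2 ^ j) powr \<beta> = a powr \<beta> * (2 powr (- \<beta>)) ^ j"
        using assms by (simp add: powr_divide powr_minus_divide power_divide two_power_powr)
      ultimately show ?thesis by (simp add: mult_ac)
    qed
    moreover have "(unit_ball_vol (real ?N) * 2 ^ ?N * a powr \<beta>) * (1 / (1 - 2 powr (- \<beta>)))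
       = unit_ball_vol (real ?N) * 2 ^ ?N * a powr \<beta> / (1 - 2 powr (- \<beta>))" by simp
    ultimately show ?thesis by (simp only:)
  qed
qed (use assms in auto)

lemma nn_integral_kernel_far:
  fixes x :: "'a::euclidean_space"
  assumes "0 < \<beta>" "0 < a"
  shows "(\<integral>\<^sup>+y. ennreal (indicator (- ball x a) y / norm (x - y) powr (real DIM('a) + \<beta>)) \<partial>lebesgue)
    \<le> ennreal (unit_ball_vol (real DIM('a)) * 2 ^ DIM('a) / (1 - 2 powr (- \<beta>)) * a powr (- \<beta>))"
proof (rule nn_integral_shells[where x = x and r = "\<lambda>j. a * 2 ^ Suc j"
      and c = "\<lambda>j. 1 / ((a * 2 ^ j) powr \<beta> * (a * 2 ^ j) ^ DIM('a))"])
  let ?N = "DIM('a)"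
  fix y
  show "indicator (- ball x a) y / norm (x - y) powr (real ?N + \<beta>) \<le> 0 \<or>
      (\<exists>j. y \<in> ball x (a * 2 ^ Suc j) \<and>
        indicator (- ball x a) y / norm (x - y) powr (real ?N + \<beta>) \<le> 1 / ((a * 2 ^ j) powr \<beta> * (a * 2 ^ j) ^ ?N))"
  proof (cases "y \<in> ball x a")
    case False
    then obtain j where j: "a * 2 ^ j \<le> norm (x - y)" "norm (x - y) < a * 2 ^ Suc j"
      using dyadic_between_up[of a "norm (x - y)"] assms by (auto simp: dist_norm)
    have "norm (x - y) > 0" using False assms by (auto simp: dist_norm)
    then have "1 / norm (x - y) powr (real ?N + \<beta>) = 1 / (norm (x - y) powr \<beta> * norm (x - y) ^ ?N)"
      by (simp add: powr_add powr_realpow)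
    also have "\<dots> \<le> 1 / ((a * 2 ^ j) powr \<beta> * (a * 2 ^ j) ^ ?N)"
      using j assms by (intro frac_le mult_mono powr_mono2 power_mono) auto
    finally show ?thesis using False j by (intro disjI2 exI[of _ j]) (auto simp: dist_norm)
  qed auto
next
  let ?N = "DIM('a)"
  show "(\<lambda>j. 1 / ((a * 2 ^ j) powr \<beta> * (a * 2 ^ j) ^ ?N) * (unit_ball_vol (real ?N) * (a * 2 ^ Suc j) ^ ?N))
    sums (unit_ball_vol (real ?N) * 2 ^ ?N / (1 - 2 powr (- \<beta>)) * a powr (- \<beta>))"
  proof -
    have "(\<lambda>j. (unit_ball_vol (real ?N) * 2 ^ ?N * a powr (-\<beta>)) * (2 powr (- \<beta>)) ^ j) sums
       ((unit_ball_vol (real ?N) * 2 ^ ?N * a powr (-\<beta>)) * (1 / (1 - 2 powr (- \<beta>))))"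
      using assms by (intro sums_mult geometric_sums) (auto simp: powr_less_one)
    moreover have "1 / ((a * 2 ^ j) powr \<beta> * (a * 2 ^ j) ^ ?N) * (unit_ball_vol (real ?N) * (a * 2 ^ Suc j) ^ ?N)
      = (unit_ball_vol (real ?N) * 2 ^ ?N * a powr (-\<beta>)) * (2 powr (- \<beta>)) ^ j" for j
    proof -
      have "(a * 2 ^ Suc j) ^ ?N = 2 ^ ?N * (a * 2 ^ j) ^ ?N"
        by (simp add: power_mult_distrib mult_ac)
      moreover have "1 / (a * 2 ^ j) powr \<beta> = a powr (-\<beta>) * (2 powr (- \<beta>)) ^ j"
        using assms by (simp add: powr_mult powr_minus_divide power_divide two_power_powr)
      moreover have "1 / (X * Y) * (V * (W * Y)) = V * W * (1 / X)" if "Y \<noteq> 0" for X Y V W :: real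
        using that by simp
      moreover have "(a * 2 ^ j) ^ ?N \<noteq> 0" using assms by simp
      ultimately show ?thesis by (simp only: mult.assoc not_False_eq_True)
    qed
    moreover have "(unit_ball_vol (real ?N) * 2 ^ ?N * a powr (- \<beta>)) * (1 / (1 - 2 powr (- \<beta>)))
       = unit_ball_vol (real ?N) * 2 ^ ?N / (1 - 2 powr (- \<beta>)) * a powr (- \<beta>)" by simp
    ultimately show ?thesis by (simp only:)
  qed
qed (use assms in auto)


text \<open>Convexity with weights \<open>\<alpha> / (\<alpha> + \<beta>)\<close> and \<open>\<beta> / (\<alpha> + \<beta>)\<close>. Taking \<open>\<alpha>\<close>, \<open>\<beta>\<close> to be the
  norms and integrating gives Minkowski's inequality without Hoelder's.\<close>

lemma powr_add_weighted:
  fixes a b \<alpha> \<beta> p :: real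
  assumes "1 \<le> p" "0 \<le> a" "0 \<le> b" "0 < \<alpha>" "0 < \<beta>"
  shows "(a + b) powr p \<le> ((\<alpha> + \<beta>) / \<alpha>) powr (p - 1) * a powr p + ((\<alpha> + \<beta>) / \<beta>) powr (p - 1) * b powr p"
proof (cases "a = 0 \<or> b = 0")
  case True
  moreover have "1 \<le> ((\<alpha> + \<beta>) / \<alpha>) powr (p - 1)" "1 \<le> ((\<alpha> + \<beta>) / \<beta>) powr (p - 1)"
    using assms by (auto intro!: ge_one_powr_ge_zero)
  ultimately show ?thesis
    using mult_right_mono[of 1 "((\<alpha> + \<beta>) / \<alpha>) powr (p - 1)" "a powr p"]
      mult_right_mono[of 1 "((\<alpha> + \<beta>) / \<beta>) powr (p - 1)" "b powr p"] by auto
next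
  case False
  define m where "m = \<alpha> / (\<alpha> + \<beta>)"
  have m: "0 < m" "m < 1" "1 - m = \<beta> / (\<alpha> + \<beta>)"
    using assms by (auto simp: m_def field_simps)
  have "((1 - m) *\<^sub>R (b / (1 - m)) + m *\<^sub>R (a / m)) powr p
      \<le> (1 - m) * (b / (1 - m)) powr p + m * (a / m) powr p"
    by (rule convex_onD[OF powr_convex[OF \<open>1 \<le> p\<close>]]) (use assms m False in auto)
  also have "(1 - m) *\<^sub>R (b / (1 - m)) + m *\<^sub>R (a / m) = a + b"
    using m(1,2) by simp
  also have "m * (a / m) powr p = (1 / m) powr (p - 1) * a powr p"
  proof -
    have "m * (a / m) powr p = m powr 1 * a powr p / m powr p"
      using m assms by (simp add: powr_divide)
    also have "\<dots> = (1 / m) powr (p - 1) * a powr p"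
      using m by (simp add: powr_divide powr_diff)
    finally show ?thesis .
  qed
  also have "(1 - m) * (b / (1 - m)) powr p = (1 / (1 - m)) powr (p - 1) * b powr p"
  proof -
    have "(1 - m) * (b / (1 - m)) powr p = (1 - m) powr 1 * b powr p / (1 - m) powr p"
      using m(1,2) assms by (simp add: powr_divide)
    also have "\<dots> = (1 / (1 - m)) powr (p - 1) * b powr p"
      using m(1,2) by (simp add: powr_divide powr_diff)
    finally show ?thesis .
  qed
  finally have "(a + b) powr p \<le> (1 / (1 - m)) powr (p - 1) * b powr p + (1 / m) powr (p - 1) * a powr p" .
  moreover have "1 / (1 - m) = (\<alpha> + \<beta>) / \<beta>" "1 / m = (\<alpha> + \<beta>) / \<alpha>" by (simp_all add: m(3)) (simp add: m_def)
  ultimately show ?thesis by simp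
qed

lemma nn_integral_Minkowski:
  fixes F G H :: "'a \<Rightarrow> real"
  assumes p: "1 \<le> p"
    and [measurable]: "F \<in> borel_measurable M" "G \<in> borel_measurable M"
    and le: "\<And>x. x \<in> space M \<Longrightarrow> \<bar>H x\<bar> \<le> \<bar>F x\<bar> + \<bar>G x\<bar>"
    and pos: "0 < \<alpha>" "0 < \<beta>"
    and F: "(\<integral>\<^sup>+x. ennreal (\<bar>F x\<bar> powr p) \<partial>M) \<le> ennreal (\<alpha> powr p)"
    and G: "(\<integral>\<^sup>+x. ennreal (\<bar>G x\<bar> powr p) \<partial>M) \<le> ennreal (\<beta> powr p)"
  shows "(\<integral>\<^sup>+x. ennreal (\<bar>H x\<bar> powr p) \<partial>M) \<le> ennreal ((\<alpha> + \<beta>) powr p)"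
proof -
  let ?c = "((\<alpha> + \<beta>) / \<alpha>) powr (p - 1)" and ?d = "((\<alpha> + \<beta>) / \<beta>) powr (p - 1)"
  have "(\<integral>\<^sup>+x. ennreal (\<bar>H x\<bar> powr p) \<partial>M) \<le> ennreal (?c * \<alpha> powr p + ?d * \<beta> powr p)"
  proof (rule nn_integral_combine[OF _ _ _ _ _ _ _ _ _ F G])
    fix x assume "x \<in> space M"
    then have "\<bar>H x\<bar> powr p \<le> (\<bar>F x\<bar> + \<bar>G x\<bar>) powr p"
      using p le by (intro powr_mono2) auto
    also have "\<dots> \<le> ?c * \<bar>F x\<bar> powr p + ?d * \<bar>G x\<bar> powr p"
      using p pos by (intro powr_add_weighted) auto
    finally show "\<bar>H x\<bar> powr p \<le> ?c * \<bar>F x\<bar> powr p + ?d * \<bar>G x\<bar> powr p" .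
  qed auto
  \<comment> \<open>The weights were chosen as the two norms, so both terms share the factor
    \<open>(\<alpha> + \<beta>) powr (p - 1)\<close> and the sum is exact.\<close>
  also have "?c * \<alpha> powr p + ?d * \<beta> powr p = (\<alpha> + \<beta>) powr p"
  proof -
    have *: "((\<alpha> + \<beta>) / x) powr (p - 1) * x powr p = (\<alpha> + \<beta>) powr (p - 1) * x" if "0 < x" for x
    proof -
      have "x powr p = x powr (p - 1) * x powr 1" by (simp only: flip: powr_add) simp
      then show ?thesis using that pos by (simp add: powr_divide)
    qed
    have "?c * \<alpha> powr p + ?d * \<beta> powr p = (\<alpha> + \<beta>) powr (p - 1) * (\<alpha> + \<beta>) powr 1"
      using pos by (simp add: * distrib_left)
    also have "\<dots> = (\<alpha> + \<beta>) powr p" by (simp only: flip: powr_add) simp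
    finally show ?thesis .
  qed
  finally show ?thesis .
qed

section \<open>Fractional seminorms and translates\<close>

lemma epowr_epowr:
  assumes "0 < p"
  shows "epowr (epowr x (1 / p)) p = x"
  using assms by (cases x) (auto simp: epowr_def powr_powr)

lemma Lnorm_powr:
  "0 < q \<Longrightarrow> epowr (Lnorm q E \<psi>) q = (\<integral>\<^sup>+x. ennreal (indicator E x * norm (\<psi> x) powr q) \<partial>lebesgue)"
  unfolding Lnorm_def by (auto simp: epowr_epowr indicator_def intro!: nn_integral_cong)

text \<open>The \<open>q\<close>-th power of \<open>Wseminorm\<close>, which spares roots in all
  estimates. The form with projections and indicators lets Tonelli's theorem and translations act on
  the integrand as it stands; on the diagonal division by zero gives 0.\<close>

definition gagliardo :: "real \<Rightarrow> real \<Rightarrow> 'a::euclidean_space set \<Rightarrow> ('a \<Rightarrow> 'b::euclidean_space) \<Rightarrow> ennreal" where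
  "gagliardo \<alpha> q E \<psi> = (\<integral>\<^sup>+z. ennreal (indicator E (fst z) * indicator E (snd z) *
     norm (\<psi> (fst z) - \<psi> (snd z)) powr q / norm (fst z - snd z) powr (real DIM('a) + \<alpha> * q)) \<partial>lebesgue)"

lemma Wseminorm_powr:
  "0 < q \<Longrightarrow> epowr (Wseminorm \<alpha> q E \<psi>) q = gagliardo \<alpha> q E \<psi>"
  unfolding Wseminorm_def gagliardo_def
  by (auto simp: epowr_epowr indicator_def intro!: nn_integral_cong)

lemma epowr_less_top_iff: "epowr x a < \<infinity> \<longleftrightarrow> x < \<infinity>"
  by (cases x) (auto simp: epowr_def)

lemma Wspace_iff:
  assumes "0 < q"
  shows "\<psi> \<in> Wspace \<alpha> q E \<longleftrightarrow> \<psi> \<in> borel_measurable (lebesgue_on E) \<and>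
    (\<integral>\<^sup>+x. ennreal (indicator E x * norm (\<psi> x) powr q) \<partial>lebesgue) < \<infinity> \<and> gagliardo \<alpha> q E \<psi> < \<infinity>"
proof -
  have "Lnorm q E \<psi> < \<infinity> \<longleftrightarrow> (\<integral>\<^sup>+x. ennreal (indicator E x * norm (\<psi> x) powr q) \<partial>lebesgue) < \<infinity>"
    "Wseminorm \<alpha> q E \<psi> < \<infinity> \<longleftrightarrow> gagliardo \<alpha> q E \<psi> < \<infinity>"
    using assms by (simp_all only: epowr_less_top_iff flip: Lnorm_powr Wseminorm_powr)
  then show ?thesis unfolding Wspace_def Lspace_def by blast
qed

section \<open>The nonlinearity of the equation and its difference quotient\<close>

definition Jp :: "real \<Rightarrow> real \<Rightarrow> real" where
  "Jp p a = \<bar>a\<bar> powr (p - 2) * a"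

lemma Jp_nonneg: "0 \<le> a \<Longrightarrow> Jp p a = a powr (p - 1)"
proof (cases "a = 0")
  case False
  assume "0 \<le> a"
  then have "\<bar>a\<bar> powr (p - 2) * a = a powr (p - 2) * a powr 1" using False by simp
  also have "\<dots> = a powr (p - 1)" by (simp only: flip: powr_add) (simp add: algebra_simps)
  finally show ?thesis by (simp add: Jp_def)
qed (simp add: Jp_def)

lemma Jp_minus: "Jp p (- a) = - Jp p a"
  by (simp add: Jp_def)

lemma abs_Jp: "\<bar>Jp p a\<bar> = \<bar>a\<bar> powr (p - 1)"
  using Jp_nonneg[of "\<bar>a\<bar>" p] by (simp add: Jp_def abs_mult)

lemma powr_split:
  fixes a e :: real
  assumes "0 \<le> a" 
  shows "a powr (e - 1) * a = a powr e"
proof (cases "a = 0")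
  case False
  then have "a powr (e - 1) * a powr 1 = a powr e" by (simp only: flip: powr_add) simp
  then show ?thesis using assms False by simp
qed simp

lemma powr_superadd:
  fixes a b e :: real
  assumes "1 \<le> e" "0 \<le> a" "0 \<le> b"
  shows "a powr e + b powr e \<le> (a + b) powr e"
proof -
  have "a powr (e - 1) * a \<le> (a + b) powr (e - 1) * a" "b powr (e - 1) * b \<le> (a + b) powr (e - 1) * b"
    using assms by (auto intro!: mult_right_mono powr_mono2)
  then have "a powr e + b powr e \<le> (a + b) powr (e - 1) * (a + b)"
    using assms by (simp add: powr_split distrib_left)
  then show ?thesis using assms by (simp add: powr_split)
qed

lemma powr_diff_upper:
  fixes a b e :: real
  assumes "1 \<le> e" "0 \<le> b" "b \<le> a"
  shows "a powr e - b powr e \<le> e * a powr (e - 1) * (a - b)"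
proof (cases "b < a")
  case True
  show ?thesis
  \<comment> \<open>The derivative of \<open>powr\<close> is available only at positive base, so the
    mean value theorem needs \<open>b > 0\<close>.\<close>
  proof (cases "b = 0")
    case True
    have "a powr e \<le> e * a powr e"
      using mult_right_mono[of 1 e "a powr e"] assms by simp
    then show ?thesis using True assms by (simp add: powr_split mult.assoc)
  next
    case False
    have "\<exists>z. b < z \<and> z < a \<and> a powr e - b powr e = (a - b) * (e * z powr (e - 1))"
      by (rule MVT2[OF True]) (use False assms in \<open>auto intro!: has_real_derivative_powr\<close>)
    then obtain z where z: "b < z" "z < a" "a powr e - b powr e = (a - b) * (e * z powr (e - 1))" by blast
    have "(a - b) * (e * z powr (e - 1)) \<le> (a - b) * (e * a powr (e - 1))"
      using z assms by (intro mult_left_mono powr_mono2) auto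
    then show ?thesis using z by (simp add: mult_ac)
  qed
qed (use assms in auto)

text \<open>Here \<open>a\<close> is the entry of larger absolute value, taken nonnegative. For
  equal signs, superadditivity of the power \<open>p - 1\<close> gives the lower bound and the mean
  value theorem the upper one. For opposite signs \<open>a - b\<close> is at most
  \<open>2 * a\<close>, which is the origin of \<open>2 powr (1 - p)\<close>.\<close>

lemma Jp_ratio_aux:
  fixes a b p :: real
  assumes p: "2 \<le> p" and ab: "b \<le> a" "0 \<le> a" "\<bar>b\<bar> \<le> a"
  shows "2 powr (1 - p) * (a - b) powr (p - 1) \<le> Jp p a - Jp p b"
    and "Jp p a - Jp p b \<le> p * (\<bar>a\<bar> + \<bar>b\<bar>) powr (p - 2) * (a - b)"
proof -
  have c: "2 powr (1 - p) \<le> (1 :: real)" using p powr_mono[of "1-p" 0 2] by simp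
  have "2 powr (1 - p) * (a - b) powr (p - 1) \<le> Jp p a - Jp p b
    \<and> Jp p a - Jp p b \<le> p * (\<bar>a\<bar> + \<bar>b\<bar>) powr (p - 2) * (a - b)"
  proof (cases "0 \<le> b")
    case True
    have "b powr (p - 1) + (a - b) powr (p - 1) \<le> a powr (p - 1)"
      using powr_superadd[of "p - 1" b "a - b"] True ab p by simp
    moreover have "2 powr (1 - p) * (a - b) powr (p - 1) \<le> 1 * (a - b) powr (p - 1)"
      by (intro mult_right_mono c) simp
    moreover have "a powr (p - 1) - b powr (p - 1) \<le> (p - 1) * a powr (p - 2) * (a - b)"
      using powr_diff_upper[of "p - 1" b a] True ab p by simp
    moreover have "(p - 1) * a powr (p - 2) * (a - b) \<le> p * (\<bar>a\<bar> + \<bar>b\<bar>) powr (p - 2) * (a - b)"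
      using True ab p by (intro mult_right_mono mult_mono powr_mono2) auto
    ultimately show ?thesis using True ab by (simp add: Jp_nonneg)
  next
    case False
    then have Jb: "Jp p b = - ((- b) powr (p - 1))"
      using Jp_minus[of p "- b"] Jp_nonneg[of "- b" p] by simp
    have "(a - b) powr (p - 1) \<le> (2 * a) powr (p - 1)"
      using False ab p by (intro powr_mono2) auto
    also have "\<dots> = 2 powr (p - 1) * a powr (p - 1)"
      using ab by (simp add: powr_mult)
    finally have "2 powr (1 - p) * (a - b) powr (p - 1) \<le> 2 powr (1 - p) * (2 powr (p - 1) * a powr (p - 1))"
      by (intro mult_left_mono) auto
    also have "\<dots> = a powr (p - 1)" by (simp flip: mult.assoc powr_add)
    finally have 1: "2 powr (1 - p) * (a - b) powr (p - 1) \<le> a powr (p - 1)" .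
    have "a powr (p - 1) + (- b) powr (p - 1) \<le> (a + - b) powr (p - 1)"
      using powr_superadd[of "p - 1" a "- b"] False ab p by simp
    also have "\<dots> = (\<bar>a\<bar> + \<bar>b\<bar>) powr (p - 2) * (a - b)"
      using powr_split[of "a - b" "p - 1"] False ab by simp
    also have "\<dots> \<le> p * ((\<bar>a\<bar> + \<bar>b\<bar>) powr (p - 2) * (a - b))"
      using mult_right_mono[of 1 p "(\<bar>a\<bar> + \<bar>b\<bar>) powr (p - 2) * (a - b)"] p ab by simp
    finally have 2: "a powr (p - 1) + (- b) powr (p - 1) \<le> p * ((\<bar>a\<bar> + \<bar>b\<bar>) powr (p - 2) * (a - b))" .
    show ?thesis using 1 2 Jb Jp_nonneg[of a p] ab by (simp add: mult.assoc add_increasing2)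
  qed
  then show "2 powr (1 - p) * (a - b) powr (p - 1) \<le> Jp p a - Jp p b"
    and "Jp p a - Jp p b \<le> p * (\<bar>a\<bar> + \<bar>b\<bar>) powr (p - 2) * (a - b)" by auto
qed

text \<open>Writes a difference of \<open>Jp\<close> as a nonnegative weight times
  \<open>a - b\<close>, so that the differenced equation looks linear in \<open>w\<close>. The value
  0 on the diagonal is compatible with the lower bound below even for \<open>p = 2\<close>, because
  \<open>0 powr 0 = 0\<close>.\<close>

definition Jq :: "real \<Rightarrow> real \<Rightarrow> real \<Rightarrow> real" where
  "Jq p a b = (if a = b then 0 else (Jp p a - Jp p b) / (a - b))"

lemma Jq_eq: "Jp p a - Jp p b = Jq p a b * (a - b)"
  by (simp add: Jq_def)

lemma Jq_bounds:
  fixes a b p :: real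
  assumes p: "2 \<le> p"
  shows "2 powr (1 - p) * \<bar>a - b\<bar> powr (p - 2) \<le> Jq p a b"
    and "Jq p a b \<le> p * (\<bar>a\<bar> + \<bar>b\<bar>) powr (p - 2)"
proof -
  let ?P = "\<lambda>a b. 2 powr (1 - p) * \<bar>a - b\<bar> powr (p - 2) \<le> Jq p a b \<and> Jq p a b \<le> p * (\<bar>a\<bar> + \<bar>b\<bar>) powr (p - 2)"
  have 1: "?P a b" if ab: "b < a" "0 \<le> a" "\<bar>b\<bar> \<le> a" for a b
  proof -
    note aux = Jp_ratio_aux[OF p less_imp_le[OF ab(1)] ab(2,3)]
    have "(a - b) powr (p - 1) = \<bar>a - b\<bar> powr (p - 2) * (a - b)"
      using powr_split[of "a - b" "p - 1"] ab by simp
    then have "2 powr (1 - p) * \<bar>a - b\<bar> powr (p - 2) * (a - b) \<le> Jq p a b * (a - b)"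
      "Jq p a b * (a - b) \<le> p * (\<bar>a\<bar> + \<bar>b\<bar>) powr (p - 2) * (a - b)"
      using aux by (simp_all add: mult.assoc flip: Jq_eq)
    then show ?thesis using ab by (simp add: mult_le_cancel_right)
  qed
  have sym: "Jq p b a = Jq p a b" for a b
    by (simp add: Jq_def) (metis minus_diff_eq minus_divide_divide)
  have neg: "Jq p (- a) (- b) = Jq p a b" for a b
    by (simp add: Jq_def Jp_minus) (metis minus_diff_eq minus_divide_divide minus_diff_commute)
  have "?P a b"
  proof (cases "a = b")
    case True
    then show ?thesis using p by (simp add: Jq_def)
  next
    case False
    \<comment> \<open>Exchanging the arguments and changing both signs leave \<open>Jq\<close>
      invariant; this reduces every case to the first.\<close>
    consider "b < a" "0 \<le> a" "\<bar>b\<bar> \<le> a" | "a < b" "0 \<le> b" "\<bar>a\<bar> \<le> b"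
      | "-b < -a" "0 \<le> -a" "\<bar>-b\<bar> \<le> -a" | "-a < -b" "0 \<le> -b" "\<bar>-a\<bar> \<le> -b"
      using False by linarith
    then show ?thesis
    proof cases
      case 1 then show ?thesis using \<open>\<And>b a. \<lbrakk>b < a; 0 \<le> a; \<bar>b\<bar> \<le> a\<rbrakk> \<Longrightarrow> ?P a b\<close> by blast
    next
      case 2 then show ?thesis using 1[of a b] sym[of a b] by (simp add: abs_minus_commute add.commute)
    next
      case 3 then show ?thesis using 1[of "-b" "-a"] neg[of a b] by (simp add: abs_minus_commute add.commute)
    next
      case 4 then show ?thesis using 1[of "-a" "-b"] sym[of "-a" "-b"] neg[of a b]
        by (simp add: abs_minus_commute add.commute)
    qed
  qed
  then show "2 powr (1 - p) * \<bar>a - b\<bar> powr (p - 2) \<le> Jq p a b"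
    and "Jq p a b \<le> p * (\<bar>a\<bar> + \<bar>b\<bar>) powr (p - 2)" by auto
qed

section \<open>Translates against Gagliardo seminorms, in both directions\<close>

lemma add_lebesgue [measurable]:
  "(\<lambda>z. fst z + snd z :: 'a::euclidean_space) \<in> lebesgue \<rightarrow>\<^sub>M lebesgue"
proof (rule measurable_lebesgue_lebesgue)
  show f: "(\<lambda>z. fst z + snd z :: 'a) \<in> borel \<rightarrow>\<^sub>M borel"
    by (intro borel_measurable_continuous_onI continuous_intros)
  fix A :: "'a set" assume A: "A \<in> sets borel" "emeasure lborel A = 0"
  have B: "(\<lambda>z. fst z + snd z :: 'a) -` A \<in> sets borel"
    using measurable_sets[OF f A(1)] by simp
  have "emeasure lborel {x. x + y \<in> A} = 0" for y
  proof -
    have "emeasure lborel A = emeasure (distr lborel borel ((+) y)) A"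
      by (simp only: lborel_distr_plus)
    also have "\<dots> = emeasure lborel {x. x + y \<in> A}"
      by (subst emeasure_distr) (use A in \<open>auto simp: vimage_def add.commute\<close>)
    finally show ?thesis using A by simp
  qed
  then show "emeasure lborel ((\<lambda>z. fst z + snd z :: 'a) -` A) = 0"
    by (subst emeasure_lborel_prod_snd[OF B]) (simp add: vimage_def)
qed

lemma measurable_minus_lebesgue [measurable (raw)]:
  fixes f :: "'c \<Rightarrow> 'a::euclidean_space"
  assumes "f \<in> M \<rightarrow>\<^sub>M lebesgue"
  shows "(\<lambda>x. c - f x) \<in> M \<rightarrow>\<^sub>M lebesgue"
proof -
  have "(\<lambda>x. c - x :: 'a) \<in> lebesgue \<rightarrow>\<^sub>M lebesgue"
    using lebesgue_affine_measurable[of "\<lambda>_. - 1" c]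
    by (simp add: sum_negf euclidean_representation)
  then show ?thesis by (rule measurable_compose[OF assms])
qed

lemma sets_lebesgue_ball [measurable]: "ball x r \<in> sets lebesgue"
  by (simp add: sets_completionI_sets)

lemma ennreal_mult_le_imp:
  assumes "ennreal a * X \<le> ennreal b" "0 < a"
  shows "X \<le> ennreal (b / a)"
proof -
  have "X = ennreal (1 / a) * (ennreal a * X)"
    using assms(2) by (simp add: mult.assoc[symmetric] ennreal_mult'[symmetric])
  also have "\<dots> \<le> ennreal (1 / a) * ennreal b"
    by (intro mult_left_mono assms) auto
  also have "\<dots> = ennreal (b / a)"
    using assms(2) by (simp add: ennreal_mult'[symmetric])
  finally show ?thesis .
qed

lemma unit_ball_vol_DIM_pos [simp]: "0 < unit_ball_vol (real n)"
  by simp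

text \<open>Compare \<open>\<psi> (x + h)\<close> with \<open>\<psi> x\<close> through every
  \<open>y\<close> closer to \<open>x\<close> than \<open>norm h\<close>. Both pairs are at distance
  at most \<open>2 * norm h\<close>, where the kernel is bounded below, and dividing by the volume
  of the ball of such \<open>y\<close> leaves exactly \<open>norm h powr (\<sigma> * q)\<close>. No
  exponent is lost.\<close>

lemma nn_integral_translate_le_gagliardo:
  fixes \<psi> :: "'a::euclidean_space \<Rightarrow> real"
  assumes \<psi> [measurable]: "\<psi> \<in> borel_measurable lebesgue"
    and q: "0 < q" and \<sigma>: "0 \<le> \<sigma>" and h: "h \<noteq> 0" and r: "r + 2 * norm h \<le> R"
    and G: "gagliardo \<sigma> q (ball x0 R) \<psi> \<le> ennreal G" "0 \<le> G"
  shows "(\<integral>\<^sup>+x. ennreal (indicator (ball x0 r) x * \<bar>\<psi> (x + h) - \<psi> x\<bar> powr q) \<partial>lebesgue)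
    \<le> ennreal (2 powr q * 2 * 2 powr (real DIM('a) + \<sigma> * q) / unit_ball_vol (real DIM('a)) * norm h powr (\<sigma> * q) * G)"
proof -
  let ?N = "DIM('a)" and ?B = "ball x0 R"
  let ?e = "real ?N + \<sigma> * q" and ?V = "unit_ball_vol (real ?N)" and ?n = "norm h"
  have n: "0 < ?n" using h by simp
  have e: "0 \<le> ?e" using \<sigma> q by simp
  define \<Phi> :: "'a \<times> 'a \<Rightarrow> real" where
    "\<Phi> z = indicator ?B (fst z) * indicator ?B (snd z) * \<bar>\<psi> (fst z) - \<psi> (snd z)\<bar> powr q / norm (fst z - snd z) powr ?e" for z
  have \<Phi>_m [measurable]: "\<Phi> \<in> borel_measurable lebesgue"
    unfolding \<Phi>_def[abs_def] by measurable
  have \<Phi>_int: "(\<integral>\<^sup>+z. ennreal (\<Phi> z) \<partial>lebesgue) \<le> ennreal G"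
    using G unfolding gagliardo_def \<Phi>_def by simp
  have \<Phi>_int': "(\<integral>\<^sup>+z. ennreal (\<Phi> (z + (h, 0))) \<partial>lebesgue) \<le> ennreal G"
    using \<Phi>_int by (subst nn_integral_lebesgue_shift[of "\<lambda>z. ennreal (\<Phi> z)"]) auto
  define \<Psi> :: "'a \<times> 'a \<Rightarrow> real" where
    "\<Psi> z = indicator (ball x0 r) (fst z) * indicator (ball 0 ?n) (fst z - snd z) * \<bar>\<psi> (fst z + h) - \<psi> (fst z)\<bar> powr q" for z
  have \<Psi>_m [measurable]: "\<Psi> \<in> borel_measurable lebesgue"
    unfolding \<Psi>_def[abs_def] by measurable
  let ?c = "2 powr q * (2 * ?n) powr ?e"
  have near: "\<bar>\<psi> x - \<psi> y\<bar> powr q \<le> (2 * ?n) powr ?e * \<Phi> (x, y)"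
    if "x \<in> ?B" "y \<in> ?B" "norm (x - y) \<le> 2 * ?n" for x y
  proof (cases "x = y")
    case False
    have "norm (x - y) powr ?e \<le> (2 * ?n) powr ?e"
      using that e by (intro powr_mono2) auto
    then have "\<bar>\<psi> x - \<psi> y\<bar> powr q * norm (x - y) powr ?e \<le> \<bar>\<psi> x - \<psi> y\<bar> powr q * (2 * ?n) powr ?e"
      by (intro mult_left_mono) auto
    then show ?thesis using False that by (simp add: \<Phi>_def field_simps)
  qed (use q in \<open>simp add: \<Phi>_def\<close>)
  have "(\<integral>\<^sup>+z. ennreal (\<Psi> z) \<partial>lebesgue) \<le> ennreal (?c * G + ?c * G)"
  proof (rule nn_integral_combine[OF _ _ _ _ _ _ _ _ _ \<Phi>_int' \<Phi>_int])
    fix z :: "'a \<times> 'a"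
    obtain x y where z: "z = (x, y)" by fastforce
    show "\<Psi> z \<le> ?c * \<Phi> (z + (h, 0)) + ?c * \<Phi> z"
    proof (cases "x \<in> ball x0 r \<and> norm (x - y) < ?n")
      case True
      have "norm (x0 - x) < r" using True by (simp add: dist_norm)
      then have xB: "x \<in> ?B" unfolding mem_ball dist_norm using r norm_ge_zero[of h] by linarith
      have xhB: "x + h \<in> ?B"
      proof -
        have "norm (x0 - (x + h)) \<le> norm (x0 - x) + norm h"
          using norm_triangle_ineq4[of "x0 - x" h] by (simp add: algebra_simps)
        then show ?thesis unfolding mem_ball dist_norm using r \<open>norm (x0 - x) < r\<close> norm_ge_zero[of h] by linarith
      qed
      have yB: "y \<in> ?B"
      proof -
        have "norm (x0 - y) \<le> norm (x0 - x) + norm (x - y)"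
          using norm_triangle_ineq[of "x0 - x" "x - y"] by simp
        then show ?thesis unfolding mem_ball dist_norm using r True \<open>norm (x0 - x) < r\<close> norm_ge_zero[of h] by linarith
      qed
      have 1: "norm (x + h - y) \<le> 2 * ?n"
        using True norm_triangle_ineq[of "x - y" h] by (simp add: algebra_simps)
      have 2: "norm (x - y) \<le> 2 * ?n"
        using True norm_ge_zero[of h] by linarith
      have "\<bar>(\<psi> (x + h) - \<psi> y) - (\<psi> x - \<psi> y)\<bar> powr q \<le> 2 powr q * (\<bar>\<psi> (x + h) - \<psi> y\<bar> powr q + \<bar>\<psi> x - \<psi> y\<bar> powr q)"
        using q by (intro powr_diff_le) auto
      also have "\<dots> \<le> 2 powr q * ((2 * ?n) powr ?e * \<Phi> (x + h, y) + (2 * ?n) powr ?e * \<Phi> (x, y))"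
        using True by (intro mult_left_mono add_mono near xB yB xhB 1 2) auto
      finally show ?thesis using True by (simp add: \<Psi>_def z algebra_simps)
    next
      case False
      then have "\<Psi> z = 0" by (auto simp: \<Psi>_def z)
      moreover have "0 \<le> \<Phi> w" for w by (simp add: \<Phi>_def)
      ultimately show ?thesis by simp
    qed
  qed (use G in \<open>auto simp: \<Phi>_def\<close>)
  moreover have "(\<integral>\<^sup>+z. ennreal (\<Psi> z) \<partial>lebesgue)
     = (\<integral>\<^sup>+x. ennreal (?V * ?n ^ ?N) * ennreal (indicator (ball x0 r) x * \<bar>\<psi> (x + h) - \<psi> x\<bar> powr q) \<partial>lebesgue)"
  proof (subst nn_integral_lebesgue_fst, measurable, rule nn_integral_cong)
    fix x
    let ?d = "indicator (ball x0 r) x * \<bar>\<psi> (x + h) - \<psi> x\<bar> powr q"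
    have "(\<integral>\<^sup>+y. ennreal (\<Psi> (x, y)) \<partial>lebesgue) = (\<integral>\<^sup>+y. ennreal (?d * indicator (ball x ?n) y) \<partial>lebesgue)"
      by (intro nn_integral_cong) (auto simp: \<Psi>_def indicator_def dist_norm norm_minus_commute)
    also have "\<dots> = ennreal (?d * (?V * ?n ^ ?N))"
      by (rule nn_integral_ball_const) auto
    also have "\<dots> = ennreal (?V * ?n ^ ?N) * ennreal ?d"
      by (subst ennreal_mult'[symmetric]) (auto simp: mult_ac)
    finally show "(\<integral>\<^sup>+y. ennreal (\<Psi> (x, y)) \<partial>lebesgue) = ennreal (?V * ?n ^ ?N) * ennreal ?d" .
  qed
  ultimately have "ennreal (?V * ?n ^ ?N) * (\<integral>\<^sup>+x. ennreal (indicator (ball x0 r) x * \<bar>\<psi> (x + h) - \<psi> x\<bar> powr q) \<partial>lebesgue) \<le> ennreal (?c * G + ?c * G)"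
    by (simp add: nn_integral_cmult)
  then have "(\<integral>\<^sup>+x. ennreal (indicator (ball x0 r) x * \<bar>\<psi> (x + h) - \<psi> x\<bar> powr q) \<partial>lebesgue) \<le> ennreal ((?c * G + ?c * G) / (?V * ?n ^ ?N))"
    by (rule ennreal_mult_le_imp) (use n in simp)
  also have "(?c * G + ?c * G) / (?V * ?n ^ ?N)
     = 2 powr q * 2 * 2 powr ?e / ?V * ?n powr (\<sigma> * q) * G"
  proof -
    have "(2 * ?n) powr ?e = 2 powr ?e * (?n ^ ?N * ?n powr (\<sigma> * q))"
      using n by (simp add: powr_mult powr_add powr_realpow)
    then show ?thesis using n by (simp add: field_simps)
  qed
  finally show ?thesis .
qed

lemma powr_norm_diff_le:
  fixes a b :: "'b::real_normed_vector"
  assumes "0 \<le> q"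
  shows "norm (a - b) powr q \<le> 2 powr q * (norm a powr q + norm b powr q)"
proof -
  have "norm (a - b) powr q \<le> (norm a + norm b) powr q"
    using assms by (intro powr_mono2 norm_triangle_ineq4) auto
  also have "\<dots> \<le> 2 powr q * (norm a powr q + norm b powr q)"
    using assms by (intro powr_sum_le) auto
  finally show ?thesis .
qed

lemma nn_integral_fst_times_snd:
  fixes F G :: "'a::euclidean_space \<Rightarrow> real"
  assumes [measurable]: "F \<in> borel_measurable lebesgue" "G \<in> borel_measurable lebesgue"
    and nonneg: "\<And>x. 0 \<le> F x" "\<And>x. 0 \<le> G x"
  shows "(\<integral>\<^sup>+z. ennreal (F (fst z) * G (snd z)) \<partial>lebesgue)
    = (\<integral>\<^sup>+x. ennreal (F x) \<partial>lebesgue) * (\<integral>\<^sup>+x. ennreal (G x) \<partial>lebesgue)"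
proof -
  have "(\<integral>\<^sup>+z. ennreal (F (fst z) * G (snd z)) \<partial>lebesgue)
    = (\<integral>\<^sup>+x. \<integral>\<^sup>+y. ennreal (F x) * ennreal (G y) \<partial>lebesgue \<partial>lebesgue)"
    by (subst nn_integral_lebesgue_fst) (simp_all add: ennreal_mult nonneg)
  then show ?thesis by (simp add: nn_integral_cmult nn_integral_multc)
qed

text \<open>Away from the diagonal the kernel is bounded, so the triangle inequality and the finite
  measure of \<open>E\<close> leave only the \<open>L^q\<close> norm. Used for balls and, in the
  covering argument, for general open sets.\<close>

lemma nn_integral_gagliardo_far:
  fixes \<psi> :: "'a::euclidean_space \<Rightarrow> 'b::euclidean_space"
  assumes [measurable]: "(\<lambda>x. indicator E x *\<^sub>R \<psi> x) \<in> borel_measurable lebesgue" "E \<in> sets lebesgue"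
    and q: "0 < q" and \<tau>: "0 \<le> \<tau>" and a: "0 < a"
    and W: "emeasure lebesgue E \<le> ennreal W" "0 \<le> W"
    and P: "(\<integral>\<^sup>+x. ennreal (indicator E x * norm (\<psi> x) powr q) \<partial>lebesgue) \<le> ennreal P" "0 \<le> P"
  shows "(\<integral>\<^sup>+z. ennreal (indicator E (fst z) * indicator E (snd z) * indicator (- ball 0 a) (fst z - snd z) *
       norm (\<psi> (fst z) - \<psi> (snd z)) powr q / norm (fst z - snd z) powr (real DIM('a) + \<tau> * q)) \<partial>lebesgue)
     \<le> ennreal (2 * 2 powr q / a powr (real DIM('a) + \<tau> * q) * W * P)"
proof -
  let ?e = "real DIM('a) + \<tau> * q"
  let ?c = "2 powr q / a powr ?e"
  have e: "0 \<le> ?e" using \<tau> q by simp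
  have [measurable]: "(\<lambda>x. indicator E x * norm (\<psi> x) powr q) \<in> borel_measurable lebesgue"
  proof -
    have "(\<lambda>x. norm (indicator E x *\<^sub>R \<psi> x) powr q) \<in> borel_measurable lebesgue" by measurable
    also have "(\<lambda>x. norm (indicator E x *\<^sub>R \<psi> x) powr q) = (\<lambda>x. indicator E x * norm (\<psi> x) powr q)"
      using q by (auto simp: indicator_def)
    finally show ?thesis .
  qed
  have I: "(\<integral>\<^sup>+x. ennreal (indicator E x) \<partial>lebesgue) \<le> ennreal W"
    using W by (simp add: ennreal_indicator)
  have PW: "(\<integral>\<^sup>+z. ennreal ((indicator E (fst z) * norm (\<psi> (fst z)) powr q) * indicator E (snd z)) \<partial>lebesgue) \<le> ennreal (W * P)"
    using mult_mono[OF P(1) I] W P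
    by (subst nn_integral_fst_times_snd) (auto simp: ennreal_mult mult.commute)
  have WP: "(\<integral>\<^sup>+z. ennreal (indicator E (fst z) * (indicator E (snd z) * norm (\<psi> (snd z)) powr q)) \<partial>lebesgue) \<le> ennreal (W * P)"
    using mult_mono[OF I P(1)] W P
    by (subst nn_integral_fst_times_snd) (auto simp: ennreal_mult mult.commute)
  have "(\<integral>\<^sup>+z. ennreal (indicator E (fst z) * indicator E (snd z) * indicator (- ball 0 a) (fst z - snd z) *
       norm (\<psi> (fst z) - \<psi> (snd z)) powr q / norm (fst z - snd z) powr ?e) \<partial>lebesgue)
     \<le> ennreal (?c * (W * P) + ?c * (W * P))"
  proof (rule nn_integral_combine[OF _ _ _ _ _ _ _ _ _ PW WP])
    fix z :: "'a \<times> 'a"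
    obtain x y where z: "z = (x, y)" by fastforce
    show "indicator E (fst z) * indicator E (snd z) * indicator (- ball 0 a) (fst z - snd z) *
       norm (\<psi> (fst z) - \<psi> (snd z)) powr q / norm (fst z - snd z) powr ?e
       \<le> ?c * ((indicator E (fst z) * norm (\<psi> (fst z)) powr q) * indicator E (snd z))
        + ?c * (indicator E (fst z) * (indicator E (snd z) * norm (\<psi> (snd z)) powr q))"
    proof (cases "x \<in> E \<and> y \<in> E \<and> a \<le> norm (x - y)")
      case True
      have "norm (\<psi> x - \<psi> y) powr q / norm (x - y) powr ?e \<le> 2 powr q * (norm (\<psi> x) powr q + norm (\<psi> y) powr q) / a powr ?e"
        using True a e q by (intro frac_le powr_norm_diff_le powr_mono2) auto
      then show ?thesis using True by (simp add: z add_divide_distrib distrib_left)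
    qed (auto simp: z indicator_def)
  qed (use W P in auto)
  also have "?c * (W * P) + ?c * (W * P) = 2 * 2 powr q / a powr ?e * W * P" by simp
  finally show ?thesis .
qed

text \<open>With \<open>y = x + k\<close> the part near the diagonal becomes an integral over
  \<open>k\<close> of norms of translates, weighted by a power of \<open>norm k\<close>. The margin
  between \<tau> and \<sigma> makes this power integrable at 0; large \<open>k\<close> are left to
  the \<open>L^q\<close> norm.\<close>

lemma gagliardo_le_of_translates:
  fixes \<psi> :: "'a::euclidean_space \<Rightarrow> real"
  assumes [measurable]: "\<psi> \<in> borel_measurable lebesgue"
    and q: "1 \<le> q" and \<tau>: "0 < \<tau>" "\<tau> < \<sigma>" and a: "0 < a" and r: "0 < r" and M: "0 \<le> M"
    and diff: "\<And>k. 0 < norm k \<Longrightarrow> norm k < a \<Longrightarrow>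
      (\<integral>\<^sup>+x. ennreal (indicator (ball x0 r) x * \<bar>\<psi> (x + k) - \<psi> x\<bar> powr q) \<partial>lebesgue) \<le> ennreal (M * norm k powr (\<sigma> * q))"
    and P: "(\<integral>\<^sup>+x. ennreal (indicator (ball x0 r) x * norm (\<psi> x) powr q) \<partial>lebesgue) \<le> ennreal P" "0 \<le> P"
  shows "gagliardo \<tau> q (ball x0 r) \<psi> \<le> ennreal
    (M * (unit_ball_vol (real DIM('a)) * 2 ^ DIM('a) * a powr ((\<sigma> - \<tau>) * q) / (1 - 2 powr (- ((\<sigma> - \<tau>) * q))))
     + 2 * 2 powr q / a powr (real DIM('a) + \<tau> * q) * (unit_ball_vol (real DIM('a)) * r ^ DIM('a)) * P)"
proof -
  let ?N = "DIM('a)" and ?B = "ball x0 r"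
  let ?e = "real ?N + \<tau> * q" and ?\<beta> = "(\<sigma> - \<tau>) * q"
  have \<beta>: "0 < ?\<beta>" using q \<tau> by simp
  define Z where "Z = unit_ball_vol (real ?N) * 2 ^ ?N * a powr ?\<beta> / (1 - 2 powr (- ?\<beta>))"
  have Z: "0 \<le> Z" unfolding Z_def using \<beta> powr_less_one[of 2 "- ?\<beta>"] by (intro divide_nonneg_nonneg mult_nonneg_nonneg) auto
  define F :: "'a \<times> 'a \<Rightarrow> real" where "F z = indicator ?B (fst z) * indicator ?B (snd z) * indicator (ball 0 a) (fst z - snd z) *
       \<bar>\<psi> (fst z) - \<psi> (snd z)\<bar> powr q / norm (fst z - snd z) powr ?e" for z
  define G :: "'a \<times> 'a \<Rightarrow> real" where "G z = indicator ?B (fst z) * indicator ?B (snd z) * indicator (- ball 0 a) (fst z - snd z) *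
       norm (\<psi> (fst z) - \<psi> (snd z)) powr q / norm (fst z - snd z) powr ?e" for z
  define H :: "'a \<times> 'a \<Rightarrow> real" where "H z = indicator ?B (fst z) * indicator (ball 0 a) (snd z) *
       \<bar>\<psi> (fst z + snd z) - \<psi> (fst z)\<bar> powr q / norm (snd z) powr ?e" for z
  have [measurable]: "F \<in> borel_measurable lebesgue" "G \<in> borel_measurable lebesgue" "H \<in> borel_measurable lebesgue"
    unfolding F_def[abs_def] G_def[abs_def] H_def[abs_def] by measurable
  have "(\<integral>\<^sup>+z. ennreal (F z) \<partial>lebesgue) \<le> ennreal (M * Z)"
  proof -
    have "(\<integral>\<^sup>+z. ennreal (F z) \<partial>lebesgue) = (\<integral>\<^sup>+x. \<integral>\<^sup>+y. ennreal (F (x, y)) \<partial>lebesgue \<partial>lebesgue)"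
      by (rule nn_integral_lebesgue_fst) measurable
    also have "\<dots> = (\<integral>\<^sup>+x. \<integral>\<^sup>+k. ennreal (F (x, k + x)) \<partial>lebesgue \<partial>lebesgue)"
    proof (rule nn_integral_cong)
      fix x
      have [measurable]: "(\<lambda>y. F (x, y)) \<in> borel_measurable lebesgue"
        unfolding F_def fst_conv snd_conv by measurable
      show "(\<integral>\<^sup>+y. ennreal (F (x, y)) \<partial>lebesgue) = (\<integral>\<^sup>+k. ennreal (F (x, k + x)) \<partial>lebesgue)"
        by (rule nn_integral_lebesgue_shift[symmetric]) measurable
    qed
    \<comment> \<open>Dropping the condition that \<open>x + k\<close> lies in the ball leaves the
      integrand of the hypothesis on translates.\<close>
    also have "\<dots> \<le> (\<integral>\<^sup>+x. \<integral>\<^sup>+k. ennreal (H (x, k)) \<partial>lebesgue \<partial>lebesgue)"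
      by (intro nn_integral_mono ennreal_leI)
        (auto simp: F_def H_def indicator_def abs_minus_commute add.commute norm_minus_commute)
    also have "\<dots> = (\<integral>\<^sup>+z. ennreal (H z) \<partial>lebesgue)"
      by (rule nn_integral_lebesgue_fst[symmetric]) measurable
    also have "\<dots> = (\<integral>\<^sup>+k. \<integral>\<^sup>+x. ennreal (H (x, k)) \<partial>lebesgue \<partial>lebesgue)"
    proof (rule nn_integral_lebesgue_snd)
      have "(\<lambda>z :: 'a \<times> 'a. snd z + fst z) \<in> lebesgue \<rightarrow>\<^sub>M lebesgue"
        using add_lebesgue by (simp add: add.commute)
      note [measurable] = this
      show "(\<lambda>z. ennreal (H (snd z, fst z))) \<in> borel_measurable lebesgue"
        unfolding H_def fst_conv snd_conv by measurable
    qed measurable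
    also have "\<dots> \<le> (\<integral>\<^sup>+(k::'a). ennreal (M * (indicator (ball 0 a) k * norm (0 - k) powr (?\<beta> - real ?N))) \<partial>lebesgue)"
    proof (rule nn_integral_mono)
      fix k :: 'a
      show "(\<integral>\<^sup>+x. ennreal (H (x, k)) \<partial>lebesgue) \<le> ennreal (M * (indicator (ball 0 a) k * norm (0 - k) powr (?\<beta> - real ?N)))"
      proof (cases "0 < norm k \<and> norm k < a")
        case True
        have "(\<integral>\<^sup>+x. ennreal (H (x, k)) \<partial>lebesgue) \<le> ennreal (1 / norm k powr ?e * (M * norm k powr (\<sigma> * q)))"
          by (rule nn_integral_scale[OF _ _ _ diff]) (use True in \<open>auto simp: H_def indicator_def\<close>)
        also have "1 / norm k powr ?e * (M * norm k powr (\<sigma> * q)) = M * norm k powr (?\<beta> - real ?N)"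
          using True by (simp add: powr_add powr_diff field_simps flip: powr_add)
        finally show ?thesis using True by simp
      next
        case False
        then have "k = 0 \<or> k \<notin> ball 0 a" by auto
        then have "H (x, k) = 0" for x by (auto simp: H_def)
        then show ?thesis by simp
      qed
    qed
    also have "\<dots> \<le> ennreal (M * Z)"
      unfolding Z_def
      by (rule nn_integral_scale[OF _ _ M nn_integral_kernel_near[OF \<beta> a, of 0]]) auto
    finally show ?thesis .
  qed
  moreover have "(\<integral>\<^sup>+z. ennreal (G z) \<partial>lebesgue)
    \<le> ennreal (2 * 2 powr q / a powr ?e * (unit_ball_vol (real ?N) * r ^ ?N) * P)"
    unfolding G_def
    by (rule nn_integral_gagliardo_far) (use assms in \<open>auto simp: emeasure_ball\<close>)
  ultimately have "(\<integral>\<^sup>+z. ennreal (indicator ?B (fst z) * indicator ?B (snd z) *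
     norm (\<psi> (fst z) - \<psi> (snd z)) powr q / norm (fst z - snd z) powr ?e) \<partial>lebesgue) \<le>
    ennreal (1 * (M * Z) + 1 * (2 * 2 powr q / a powr ?e * (unit_ball_vol (real ?N) * r ^ ?N) * P))"
    by (intro nn_integral_combine[of F _ G])
      (use Z M r P in \<open>auto simp: F_def G_def indicator_def\<close>)
  then show ?thesis unfolding gagliardo_def Z_def by simp
qed

text \<open>Young's inequality for three factors, with \<open>Y\<close> and \<open>Z\<close>
  measured in units \<open>l\<close> and \<open>k\<close>: the product of the units comes out in
  front, and this is how small factors are exploited. Bounding all factors by their maximum treats
  \<open>p = 2\<close> without a separate case.\<close>

lemma powr_mult_three_le:
  fixes X Y Z l k p :: real
  assumes p: "2 \<le> p" and nonneg: "0 \<le> X" "0 \<le> Y" "0 \<le> Z" and pos: "0 < l" "0 < k"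
  shows "X powr (p - 2) * Y * Z \<le> l * k * (X powr p + Y powr p / l powr p + Z powr p / k powr p)"
proof -
  define m where "m = max X (max (Y / l) (Z / k))"
  have m: "0 \<le> m" "X \<le> m" "Y / l \<le> m" "Z / k \<le> m" using nonneg by (auto simp: m_def)
  have "X powr (p - 2) * (Y / l) * (Z / k) \<le> m powr (p - 2) * m * m"
    using m nonneg pos p by (intro mult_mono powr_mono2) auto
  also have "\<dots> = m powr p"
    using powr_split[of m "p - 1"] powr_split[of m p] m p by simp
  also have "\<dots> \<le> X powr p + (Y / l) powr p + (Z / k) powr p"
    unfolding m_def max_def by auto
  finally have "l * k * (X powr (p - 2) * (Y / l) * (Z / k)) \<le> l * k * (X powr p + (Y / l) powr p + (Z / k) powr p)"
    using pos by (intro mult_left_mono) auto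
  then show ?thesis using pos nonneg by (simp add: powr_divide)
qed

lemma powr_mult_two_le:
  fixes X Y p :: real
  assumes p: "1 \<le> p" and nonneg: "0 \<le> X" "0 \<le> Y"
  shows "X powr (p - 1) * Y \<le> X powr p + Y powr p"
proof -
  define m where "m = max X Y"
  have m: "0 \<le> m" "X \<le> m" "Y \<le> m" using nonneg by (auto simp: m_def)
  have "X powr (p - 1) * Y \<le> m powr (p - 1) * m"
    using m nonneg p by (intro mult_mono powr_mono2) auto
  also have "\<dots> = m powr p" using powr_split[of m p] m by simp
  also have "\<dots> \<le> X powr p + Y powr p" unfolding m_def max_def by auto
  finally show ?thesis .
qed

text \<open>Whichever of \<open>x\<close> and \<open>y powr (p - 1)\<close> is larger bounds the
  product by its own power; the sharp constants of Young's inequality are given up.\<close>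

lemma Young_conj_exp:
  fixes x y p :: real
  assumes p: "1 < p" and nonneg: "0 \<le> x" "0 \<le> y"
  shows "x * y \<le> x powr (conj_exp p) + y powr p"
proof (cases "x \<le> y powr (p - 1)")
  case True
  then have "x * y \<le> y powr (p - 1) * y" using nonneg by (intro mult_right_mono)
  also have "\<dots> = y powr p" using nonneg by (simp add: powr_split)
  finally show ?thesis by (simp add: add_increasing)
next
  case False
  then have "(y powr (p - 1)) powr (1 / (p - 1)) \<le> x powr (1 / (p - 1))"
    using p by (intro powr_mono2) auto
  moreover have "(y powr (p - 1)) powr (1 / (p - 1)) = y"
    using p nonneg by (simp add: powr_powr)
  ultimately have "x * y \<le> x * x powr (1 / (p - 1))"
    using nonneg by (intro mult_left_mono) auto
  also have "\<dots> = x powr (conj_exp p)"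
  proof -
    have "conj_exp p - 1 = 1 / (p - 1)" using p by (simp add: conj_exp_def field_simps)
    then show ?thesis using powr_split[of x "conj_exp p"] nonneg by (simp add: mult.commute)
  qed
  finally show ?thesis by (simp add: add_increasing2)
qed

lemma integrable_of_abs_le:
  fixes F :: "'a \<Rightarrow> real"
  assumes [measurable]: "F \<in> borel_measurable M"
    and "\<And>x. \<bar>F x\<bar> \<le> G x" "(\<integral>\<^sup>+x. ennreal (G x) \<partial>M) < \<infinity>"
  shows "integrable M F"
proof (rule integrableI_bounded)
  have "(\<integral>\<^sup>+x. ennreal (norm (F x)) \<partial>M) \<le> (\<integral>\<^sup>+x. ennreal (G x) \<partial>M)"
    using assms(2) by (intro nn_integral_mono ennreal_leI) auto
  then show "(\<integral>\<^sup>+x. ennreal (norm (F x)) \<partial>M) < \<infinity>" using assms(3) by simp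
qed measurable

text \<open>At coinciding points the value is 0 by division by zero. This matches
  \<open>1 / K\<close>, because the bounds on \<open>K\<close> force \<open>K 0 = 0\<close>.\<close>

definition mu :: "real \<Rightarrow> real \<Rightarrow> 'a::euclidean_space \<times> 'a \<Rightarrow> real" where
  "mu s p z = 1 / norm (fst z - snd z) powr (real DIM('a) + s * p)"

lemma mu_nonneg [simp]: "0 \<le> mu s p z"
  by (simp add: mu_def)

lemma mu_swap: "mu s p (snd z, fst z) = mu s p z"
  by (simp add: mu_def norm_minus_commute)

lemma measurable_mu [measurable]: "mu s p \<in> borel_measurable lebesgue"
  unfolding mu_def[abs_def] by measurable

section \<open>The energy estimate\<close>

text \<open>The hypotheses collect what the theorem provides on one ball: \<open>A\<close> is a multiple of the
  right-hand side of the estimates, and \<open>kf\<close>, \<open>kn\<close> bound the integrals of the kernel away from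
  the diagonal and, with the weight \<open>\<bar>x - y\<bar>\<^sup>p\<close>, near it.\<close>

locale controlled =
  fixes p s t \<Lambda> kf kn :: real and K f u :: "'a::euclidean_space \<Rightarrow> real" and x0 :: 'a and R A :: real
  assumes p: "2 \<le> p" and s: "0 < s" "s < 1" and t: "0 \<le> t" "t \<le> s" and \<Lambda>: "1 \<le> \<Lambda>"
    and kf: "0 \<le> kf" "\<And>(x :: 'a) a. 0 < a \<Longrightarrow>
      (\<integral>\<^sup>+y. ennreal (indicator (- ball x a) y / norm (x - y) powr (real DIM('a) + s * p)) \<partial>lebesgue) \<le> ennreal (kf * a powr (- (s * p)))"
    and kn: "0 \<le> kn" "\<And>(x :: 'a) a. 0 < a \<Longrightarrow>
      (\<integral>\<^sup>+y. ennreal (indicator (ball x a) y * norm (x - y) powr (p - s * p - real DIM('a))) \<partial>lebesgue) \<le> ennreal (kn * a powr (p - s * p))"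
    and measurable_K [measurable]: "K \<in> borel_measurable lebesgue"
    and measurable_f [measurable]: "f \<in> borel_measurable lebesgue"
    and measurable_u [measurable]: "u \<in> borel_measurable lebesgue"
    and K: "\<And>z. 1 / \<Lambda> * norm z powr (real DIM('a) + s * p) \<le> K z"
      "\<And>z. K z \<le> \<Lambda> * norm z powr (real DIM('a) + s * p)"
    and R: "0 < R" and A: "0 < A"
    and u_gagliardo: "gagliardo s p (ball x0 R) u \<le> ennreal (R powr (- (s * p)) * A)"
    and u_Lp: "(\<integral>\<^sup>+x. ennreal (indicator (ball x0 R) x * \<bar>u x\<bar> powr p) \<partial>lebesgue) \<le> ennreal A"
    and u_tail: "(\<integral>\<^sup>+z. ennreal (indicator (ball x0 (3/4 * R)) (fst z) * indicator (- ball x0 R) (snd z) *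
        \<bar>u (snd z)\<bar> powr p * mu s p z) \<partial>lebesgue) \<le> ennreal (R powr (- (s * p)) * A)"
    and u_diff_tail: "\<And>h. 0 < norm h \<Longrightarrow> norm h < R / 16 \<Longrightarrow>
        (\<integral>\<^sup>+z. ennreal (indicator (ball x0 (3/4 * R)) (fst z) * indicator (- ball x0 (7/8 * R)) (snd z) *
        \<bar>u (snd z + h) - u (snd z)\<bar> powr p * mu s p z) \<partial>lebesgue) \<le> ennreal (R powr (- (s * p)) * (norm h / R) powr (t * p) * A)"
    and f_gagliardo: "gagliardo s (conj_exp p) (ball x0 R) f
        \<le> ennreal (R powr (- (s * p * conj_exp p)) * R powr (- (s * conj_exp p)) * A)"
    and f_Lp: "(\<integral>\<^sup>+x. ennreal (indicator (ball x0 R) x * \<bar>f x\<bar> powr (conj_exp p)) \<partial>lebesgue) < \<infinity>"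
    and weak: "\<And>\<phi>. \<phi> \<in> borel_measurable lebesgue \<Longrightarrow> (\<And>x. x \<notin> ball x0 (3/4 * R) \<Longrightarrow> \<phi> x = 0) \<Longrightarrow>
        (\<integral>\<^sup>+x. ennreal (\<bar>\<phi> x\<bar> powr p) \<partial>lebesgue) < \<infinity> \<Longrightarrow>
        (\<integral>\<^sup>+z. ennreal (\<bar>\<phi> (fst z) - \<phi> (snd z)\<bar> powr p * mu s p z) \<partial>lebesgue) < \<infinity> \<Longrightarrow>
        (\<integral>z. Jp p (u (fst z) - u (snd z)) / K (fst z - snd z) * (\<phi> (fst z) - \<phi> (snd z)) \<partial>lebesgue)
          = (\<integral>x. f x * \<phi> x \<partial>lebesgue)"
begin

lemma K_mu: "1 / K (fst z - snd z) \<le> \<Lambda> * mu s p z" "mu s p z \<le> \<Lambda> * (1 / K (fst z - snd z))" "0 \<le> K (fst z - snd z)"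
proof -
  let ?n = "norm (fst z - snd z) powr (real DIM('a) + s * p)"
  note K' = K[of "fst z - snd z"]
  have n: "0 \<le> ?n" by simp
  show "0 \<le> K (fst z - snd z)"
    using K'(1) \<Lambda> by (auto intro: order_trans[rotated])
  show "1 / K (fst z - snd z) \<le> \<Lambda> * mu s p z"
  proof (cases "fst z = snd z")
    case True
    then have "K (fst z - snd z) = 0" using K'(1,2) by simp
    then show ?thesis using True by (simp add: mu_def)
  next
    case False
    then have "0 < 1 / \<Lambda> * ?n" using \<Lambda> by simp
    then have "1 / K (fst z - snd z) \<le> 1 / (1 / \<Lambda> * ?n)"
      using K'(1) by (intro divide_left_mono mult_pos_pos) (use \<Lambda> in \<open>auto intro: less_le_trans\<close>)
    then show ?thesis by (simp add: mu_def)
  qed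
  show "mu s p z \<le> \<Lambda> * (1 / K (fst z - snd z))"
  proof (cases "fst z = snd z")
    case True
    then have "K (fst z - snd z) = 0" using K'(1,2) by simp
    then show ?thesis using True by (simp add: mu_def)
  next
    case False
    then have "0 < 1 / \<Lambda> * ?n" using \<Lambda> by simp
    then have "0 < K (fst z - snd z)" using K'(1) by (rule less_le_trans)
    then have "1 / (\<Lambda> * ?n) \<le> 1 / K (fst z - snd z)"
      using K'(2) by (intro divide_left_mono) auto
    then have "\<Lambda> * (1 / (\<Lambda> * ?n)) \<le> \<Lambda> * (1 / K (fst z - snd z))"
      using \<Lambda> by (intro mult_left_mono) auto
    then show ?thesis using \<Lambda> by (simp add: mu_def)
  qed
qed

lemma sp: "0 < s * p" "s * p < p" "0 < p" "1 < p"
  using s p by auto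

lemma kernel_far_fst:
  fixes g :: "'a \<Rightarrow> real"
  assumes [measurable]: "g \<in> borel_measurable lebesgue" and g: "\<And>x. 0 \<le> g x" and a: "0 < a"
    and P: "(\<integral>\<^sup>+x. ennreal (g x) \<partial>lebesgue) \<le> ennreal P"
  shows "(\<integral>\<^sup>+z. ennreal (g (fst z) * indicator (- ball 0 a) (fst z - snd z) * mu s p z) \<partial>lebesgue)
    \<le> ennreal (kf * a powr (- (s * p)) * P)"
proof -
  let ?k = "kf * a powr (- (s * p))"
  have k: "0 \<le> ?k" using kf by simp
  have "(\<integral>\<^sup>+z. ennreal (g (fst z) * indicator (- ball 0 a) (fst z - snd z) * mu s p z) \<partial>lebesgue)
     = (\<integral>\<^sup>+x. \<integral>\<^sup>+y. ennreal (g x * indicator (- ball 0 a) (x - y) * mu s p (x, y)) \<partial>lebesgue \<partial>lebesgue)"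
    by (subst nn_integral_lebesgue_fst) simp_all
  also have "\<dots> \<le> (\<integral>\<^sup>+x. ennreal (?k * g x) \<partial>lebesgue)"
  proof (rule nn_integral_mono)
    fix x
    have "(\<integral>\<^sup>+y. ennreal (g x * indicator (- ball 0 a) (x - y) * mu s p (x, y)) \<partial>lebesgue) \<le> ennreal (g x * ?k)"
      by (rule nn_integral_scale[OF _ _ g kf(2)[OF a, of x]]) (use g in \<open>auto simp: mu_def indicator_def dist_norm norm_minus_commute\<close>)
    then show "(\<integral>\<^sup>+y. ennreal (g x * indicator (- ball 0 a) (x - y) * mu s p (x, y)) \<partial>lebesgue) \<le> ennreal (?k * g x)"
      by (simp add: mult.commute)
  qed
  also have "\<dots> \<le> ennreal (?k * P)"
    by (rule nn_integral_scale[OF _ _ k P]) auto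
  finally show ?thesis .
qed

text \<open>The additional weight will come from the Lipschitz bound of the cutoff; it makes the
  kernel integrable at the diagonal because \<open>s < 1\<close>.\<close>

lemma kernel_near_fst:
  fixes g :: "'a \<Rightarrow> real"
  assumes [measurable]: "g \<in> borel_measurable lebesgue" and g: "\<And>x. 0 \<le> g x" and a: "0 < a"
    and P: "(\<integral>\<^sup>+x. ennreal (g x) \<partial>lebesgue) \<le> ennreal P"
  shows "(\<integral>\<^sup>+z. ennreal (g (fst z) * indicator (ball 0 a) (fst z - snd z) * (norm (fst z - snd z) powr p * mu s p z)) \<partial>lebesgue)
    \<le> ennreal (kn * a powr (p - s * p) * P)"
proof -
  let ?k = "kn * a powr (p - s * p)"
  have k: "0 \<le> ?k" using kn by simp
  have "(\<integral>\<^sup>+z. ennreal (g (fst z) * indicator (ball 0 a) (fst z - snd z) * (norm (fst z - snd z) powr p * mu s p z)) \<partial>lebesgue)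
     = (\<integral>\<^sup>+x. \<integral>\<^sup>+y. ennreal (g x * indicator (ball 0 a) (x - y) * (norm (x - y) powr p * mu s p (x, y))) \<partial>lebesgue \<partial>lebesgue)"
    by (subst nn_integral_lebesgue_fst) simp_all
  also have "\<dots> \<le> (\<integral>\<^sup>+x. ennreal (?k * g x) \<partial>lebesgue)"
  proof (rule nn_integral_mono)
    fix x
    have "(\<integral>\<^sup>+y. ennreal (g x * indicator (ball 0 a) (x - y) * (norm (x - y) powr p * mu s p (x, y))) \<partial>lebesgue) \<le> ennreal (g x * ?k)"
    proof (rule nn_integral_scale[OF _ _ g kn(2)[OF a, of x]])
      fix y
      show "g x * indicator (ball 0 a) (x - y) * (norm (x - y) powr p * mu s p (x, y))
        \<le> g x * (indicator (ball x a) y * norm (x - y) powr (p - s * p - real DIM('a)))"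
        by (auto simp: mu_def indicator_def dist_norm powr_diff powr_add mult_ac norm_minus_commute)
    qed auto
    then show "(\<integral>\<^sup>+y. ennreal (g x * indicator (ball 0 a) (x - y) * (norm (x - y) powr p * mu s p (x, y))) \<partial>lebesgue) \<le> ennreal (?k * g x)"
      by (simp add: mult.commute)
  qed
  also have "\<dots> \<le> ennreal (?k * P)"
    by (rule nn_integral_scale[OF _ _ k P]) auto
  finally show ?thesis .
qed

lemma kernel_far_snd:
  fixes g :: "'a \<Rightarrow> real"
  assumes [measurable]: "g \<in> borel_measurable lebesgue" and g: "\<And>x. 0 \<le> g x" and a: "0 < a"
    and P: "(\<integral>\<^sup>+x. ennreal (g x) \<partial>lebesgue) \<le> ennreal P"
  shows "(\<integral>\<^sup>+z. ennreal (g (snd z) * indicator (- ball 0 a) (fst z - snd z) * mu s p z) \<partial>lebesgue)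
    \<le> ennreal (kf * a powr (- (s * p)) * P)"
proof -
  have "(\<integral>\<^sup>+z. ennreal (g (snd z) * indicator (- ball 0 a) (fst z - snd z) * mu s p z) \<partial>lebesgue)
    = (\<integral>\<^sup>+z. ennreal (g (fst z) * indicator (- ball 0 a) (fst z - snd z) * mu s p z) \<partial>lebesgue)"
    by (subst nn_integral_lebesgue_swap[symmetric])
      (auto simp: mu_swap indicator_def norm_minus_commute intro!: nn_integral_cong)
  then show ?thesis using kernel_far_fst[OF assms] by simp
qed

text \<open>Selects the pairs with at least one point in the ball that carries all test functions;
  no other pair enters the weak formulation.\<close>

definition nearB :: "'a \<times> 'a \<Rightarrow> real" where
  "nearB z = (if fst z \<in> ball x0 (3/4 * R) \<or> snd z \<in> ball x0 (3/4 * R) then 1 else 0)"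

lemma nearB_nonneg [simp]: "0 \<le> nearB z" by (simp add: nearB_def)

lemma measurable_nearB [measurable]: "nearB \<in> borel_measurable lebesgue"
proof -
  have "nearB = (\<lambda>z. max (indicator (ball x0 (3/4 * R)) (fst z)) (indicator (ball x0 (3/4 * R)) (snd z)))"
    by (auto simp: nearB_def fun_eq_iff)
  also have "\<dots> \<in> borel_measurable lebesgue" by measurable
  finally show ?thesis .
qed

text \<open>The summand 1 belongs to pairs inside the large ball, the factor 2 to the two orders of
  a pair with one point outside, \<open>2 powr p\<close> to the triangle inequality, and
  \<open>4 powr (s * p)\<close> to the distance \<open>R / 4\<close> between the balls.\<close>

definition cX :: real where
  "cX = 1 + 2 * (2 powr p * (kf * 4 powr (s * p) + 1))"

lemma cX_nonneg: "0 \<le> cX" using kf by (simp add: cX_def)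

text \<open>Pairs inside the ball of radius \<open>R\<close> are covered by the seminorm. If one
  point is outside, the inner value is controlled by the \<open>L^p\<close> norm, since the points
  are \<open>R / 4\<close> apart, and the outer value by the tail.\<close>

lemma u_energy_near:
  "(\<integral>\<^sup>+z. ennreal (nearB z * \<bar>u (fst z) - u (snd z)\<bar> powr p * mu s p z) \<partial>lebesgue) \<le> ennreal (cX * (R powr (- (s * p)) * A))"
proof -
  let ?E = "R powr (- (s * p)) * A"
  let ?B = "ball x0 R" and ?b = "ball x0 (3/4 * R)"
  have E: "0 \<le> ?E" using A by simp
  define \<Phi> where "\<Phi> z = indicator ?B (fst z) * indicator ?B (snd z) * \<bar>u (fst z) - u (snd z)\<bar> powr p * mu s p z" for z
  define T where "T z = indicator ?b (fst z) * indicator (- ?B) (snd z) * \<bar>u (fst z) - u (snd z)\<bar> powr p * mu s p z" for z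
  define T1 where "T1 z = (indicator ?b (fst z) * \<bar>u (fst z)\<bar> powr p) * indicator (- ball 0 (R / 4)) (fst z - snd z) * mu s p z" for z
  define T2 where "T2 z = indicator ?b (fst z) * indicator (- ?B) (snd z) * \<bar>u (snd z)\<bar> powr p * mu s p z" for z
  have [measurable]: "\<Phi> \<in> borel_measurable lebesgue" "T \<in> borel_measurable lebesgue" "T1 \<in> borel_measurable lebesgue" "T2 \<in> borel_measurable lebesgue"
    unfolding \<Phi>_def[abs_def] T_def[abs_def] T1_def[abs_def] T2_def[abs_def] by measurable
  have T'm [measurable]: "(\<lambda>z. T (snd z, fst z)) \<in> borel_measurable lebesgue"
    unfolding T_def mu_swap fst_conv snd_conv by measurable
  have \<Phi>: "(\<integral>\<^sup>+z. ennreal (\<Phi> z) \<partial>lebesgue) \<le> ennreal ?E"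
    using u_gagliardo by (simp add: \<Phi>_def gagliardo_def mu_def)
  have T1: "(\<integral>\<^sup>+z. ennreal (T1 z) \<partial>lebesgue) \<le> ennreal (kf * (R / 4) powr (- (s * p)) * A)"
    unfolding T1_def
    by (rule kernel_far_fst) (use R in \<open>auto simp: indicator_def intro!: nn_integral_le_mono[OF _ u_Lp]\<close>)
  have T2: "(\<integral>\<^sup>+z. ennreal (T2 z) \<partial>lebesgue) \<le> ennreal ?E"
    using u_tail by (simp add: T2_def)
  have T: "(\<integral>\<^sup>+z. ennreal (T z) \<partial>lebesgue) \<le> ennreal (2 powr p * (kf * (R / 4) powr (- (s * p)) * A) + 2 powr p * ?E)"
  proof (rule nn_integral_combine[OF _ _ _ _ _ _ _ _ _ T1 T2])
    fix z :: "'a \<times> 'a"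
    obtain x y where z: "z = (x, y)" by fastforce
    show "T z \<le> 2 powr p * T1 z + 2 powr p * T2 z"
    proof (cases "x \<in> ?b \<and> y \<notin> ?B")
      case True
      then have "R / 4 \<le> norm (x - y)"
        using norm_triangle_ineq[of "x0 - x" "x - y"] by (auto simp: dist_norm)
      then have "T z = \<bar>u x - u y\<bar> powr p * mu s p z" "T1 z = \<bar>u x\<bar> powr p * mu s p z" "T2 z = \<bar>u y\<bar> powr p * mu s p z"
        using True by (auto simp: T_def T1_def T2_def z)
      moreover have "\<bar>u x - u y\<bar> powr p * mu s p z \<le> 2 powr p * (\<bar>u x\<bar> powr p + \<bar>u y\<bar> powr p) * mu s p z"
        using sp by (intro mult_right_mono powr_diff_le) auto
      ultimately show ?thesis by (simp add: algebra_simps)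
    next
      case False
      then have "T z = 0" by (auto simp: T_def z)
      then show ?thesis by (simp add: T1_def T2_def)
    qed
  qed (use A kf in \<open>auto simp: T1_def T2_def\<close>)
  have eq: "2 powr p * (kf * (R / 4) powr (- (s * p)) * A) + 2 powr p * ?E = 2 powr p * (kf * 4 powr (s * p) + 1) * ?E"
    using R by (simp add: powr_divide powr_minus_divide field_simps)
  have T': "(\<integral>\<^sup>+z. ennreal (T (snd z, fst z)) \<partial>lebesgue) \<le> ennreal (2 powr p * (kf * 4 powr (s * p) + 1) * ?E)"
    using T unfolding eq by (subst nn_integral_lebesgue_swap[of "\<lambda>z. ennreal (T z)"]) auto
  have TT: "(\<integral>\<^sup>+z. ennreal (T z + T (snd z, fst z)) \<partial>lebesgue) \<le> ennreal (1 * (2 powr p * (kf * 4 powr (s * p) + 1) * ?E) + 1 * (2 powr p * (kf * 4 powr (s * p) + 1) * ?E))"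
    by (rule nn_integral_combine[OF _ _ _ _ _ _ _ _ _ T[unfolded eq] T']) (use A kf in \<open>auto simp: T_def mu_swap\<close>)
  have "(\<integral>\<^sup>+z. ennreal (nearB z * \<bar>u (fst z) - u (snd z)\<bar> powr p * mu s p z) \<partial>lebesgue)
    \<le> ennreal (1 * ?E + 1 * (1 * (2 powr p * (kf * 4 powr (s * p) + 1) * ?E) + 1 * (2 powr p * (kf * 4 powr (s * p) + 1) * ?E)))"
  proof (rule nn_integral_combine[OF _ _ _ _ _ _ _ _ _ \<Phi> TT])
    fix z :: "'a \<times> 'a"
    obtain x y where z: "z = (x, y)" by fastforce
    have sub: "x \<in> ?B" if "x \<in> ?b" for x using that R by auto
    have "nearB z * (\<bar>u (fst z) - u (snd z)\<bar> powr p * mu s p z) \<le>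
      (indicator ?B x * indicator ?B y + indicator ?b x * indicator (- ?B) y + indicator ?b y * indicator (- ?B) x) * (\<bar>u (fst z) - u (snd z)\<bar> powr p * mu s p z)"
      by (intro mult_right_mono) (use sub[of x] sub[of y] in \<open>auto simp: nearB_def indicator_def z\<close>)
    then show "nearB z * \<bar>u (fst z) - u (snd z)\<bar> powr p * mu s p z \<le> 1 * \<Phi> z + 1 * (T z + T (snd z, fst z))"
      by (simp add: \<Phi>_def T_def z mu_swap[of s p "(x, y)", simplified] abs_minus_commute algebra_simps)
  qed (use A kf in \<open>auto simp: \<Phi>_def T_def mu_swap\<close>)
  also have "1 * ?E + 1 * (1 * (2 powr p * (kf * 4 powr (s * p) + 1) * ?E) + 1 * (2 powr p * (kf * 4 powr (s * p) + 1) * ?E)) = cX * ?E"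
    by (simp add: cX_def algebra_simps)
  finally show ?thesis .
qed

text \<open>The starting exponent of the iteration, on the whole ball up to radius
  \<open>7/8 * R\<close> where the tail hypothesis on differences takes over. The restriction to
  \<open>R / 16\<close> is the room left there, since \<open>7/8 + 2/16 = 1\<close>.\<close>

lemma translates_base:
  assumes h: "h \<noteq> 0" "norm h \<le> R / 16"
  shows "(\<integral>\<^sup>+x. ennreal (indicator (ball x0 (7/8 * R)) x * \<bar>u (x + h) - u x\<bar> powr p) \<partial>lebesgue)
    \<le> ennreal (2 powr p * 2 * 2 powr (real DIM('a) + s * p) / unit_ball_vol (real DIM('a)) * (norm h / R) powr (s * p) * A)"
proof -
  have "(\<integral>\<^sup>+x. ennreal (indicator (ball x0 (7/8 * R)) x * \<bar>u (x + h) - u x\<bar> powr p) \<partial>lebesgue)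
    \<le> ennreal (2 powr p * 2 * 2 powr (real DIM('a) + s * p) / unit_ball_vol (real DIM('a)) * norm h powr (s * p) * (R powr (- (s * p)) * A))"
    by (rule nn_integral_translate_le_gagliardo[OF _ _ _ _ _ u_gagliardo]) (use h s sp R A in auto)
  moreover have "norm h powr (s * p) * (R powr (- (s * p)) * A) = (norm h / R) powr (s * p) * A"
    using R by (simp add: powr_divide powr_minus_divide)
  ultimately show ?thesis by (simp only: mult.assoc)
qed

text \<open>The bound is arranged as a power of
  \<open>(norm h / R) powr s * R powr (- (s * p))\<close>, because this is the unit in which
  differences of \<open>f\<close> will enter Young's inequality.\<close>

lemma f_translates:
  assumes h: "h \<noteq> 0" "norm h \<le> R / 16"
  shows "(\<integral>\<^sup>+x. ennreal (indicator (ball x0 (7/8 * R)) x * \<bar>f (x + h) - f x\<bar> powr (conj_exp p)) \<partial>lebesgue)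
    \<le> ennreal (2 powr conj_exp p * 2 * 2 powr (real DIM('a) + s * conj_exp p) / unit_ball_vol (real DIM('a))
        * ((norm h / R) powr s * R powr (- (s * p))) powr (conj_exp p) * A)"
proof -
  let ?q = "conj_exp p"
  have q: "0 < ?q" using p by (simp add: conj_exp_def)
  have "(\<integral>\<^sup>+x. ennreal (indicator (ball x0 (7/8 * R)) x * \<bar>f (x + h) - f x\<bar> powr ?q) \<partial>lebesgue)
    \<le> ennreal (2 powr ?q * 2 * 2 powr (real DIM('a) + s * ?q) / unit_ball_vol (real DIM('a)) * norm h powr (s * ?q) *
       (R powr (- (s * p * ?q)) * R powr (- (s * ?q)) * A))"
    by (rule nn_integral_translate_le_gagliardo[OF _ _ _ _ _ f_gagliardo]) (use h s q R A in auto)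
  moreover have "norm h powr (s * ?q) * (R powr (- (s * p * ?q)) * R powr (- (s * ?q)) * A) = ((norm h / R) powr s * R powr (- (s * p))) powr ?q * A"
    using R by (simp add: powr_divide powr_minus_divide powr_mult powr_powr)
  ultimately show ?thesis by (simp only: mult.assoc)
qed

end

text \<open>One energy step for a fixed increment \<open>h\<close>, with radii in units of
  \<open>R\<close>. Of the gap \<open>4 * d\<close>, the first half keeps translates of the inner
  ball where the cutoff is 1, the third quarter is its descent, and the last quarter separates its
  support from the outside and absorbs the shift by \<open>h\<close>. The bounds 1/32 and 5/8 keep
  shifted supports within \<open>3/4 * R\<close>.\<close>

locale energy = controlled p s t \<Lambda> kf kn K f u x0 R A
  for p s t \<Lambda> kf kn :: real and K f u :: "'a::euclidean_space \<Rightarrow> real" and x0 :: 'a and R A :: real +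
  fixes h :: 'a and \<rho> \<rho>' d \<tau> C :: real
  assumes d: "0 < d" "d \<le> 1 / 32" and \<rho>': "0 \<le> \<rho>'" and gap: "\<rho>' + 4 * d \<le> \<rho>" and \<rho>: "\<rho> \<le> 5 / 8"
    and h: "h \<noteq> 0" "norm h \<le> d * R" and \<tau>: "t \<le> \<tau>" and C: "0 \<le> C"
    and D: "(\<integral>\<^sup>+x. ennreal (indicator (ball x0 (\<rho> * R)) x * \<bar>u (x + h) - u x\<bar> powr p) \<partial>lebesgue)
      \<le> ennreal (C * (norm h / R) powr (\<tau> * p) * A)"
begin

definition w :: "'a \<Rightarrow> real" where "w x = u (x + h) - u x"

definition eta :: "'a \<Rightarrow> real" where
  "eta x = max 0 (min 1 (((\<rho>' + 3 * d) * R - norm (x - x0)) / (d * R)))"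

text \<open>\<open>e\<close> is the dimensionless step; \<open>la\<close> and \<open>ka\<close> are
  the scales of \<open>w\<close> inside the ball and in the tail, and \<open>En\<close> is the unit
  of energy.\<close>

definition e :: real where "e = norm h / R"
definition la :: real where "la = e powr \<tau>"
definition ka :: real where "ka = e powr t"
definition En :: real where "En = R powr (- (s * p)) * A"

lemma e: "0 < e" "e \<le> 1" "norm h = e * R"
proof -
  have "d * R \<le> 1 / 32 * R" using d R by (intro mult_right_mono) auto
  then have "norm h \<le> 1 / 32 * R" using h by linarith
  then show "e \<le> 1" using R by (simp add: e_def)
qed (use h R in \<open>auto simp: e_def\<close>)

lemma h16: "norm h < R / 16"
proof -
  have "d * R \<le> 1 / 32 * R" using d R by (intro mult_right_mono) auto
  then have "norm h \<le> 1 / 32 * R" using h by linarith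
  also have "\<dots> < R / 16" using R by simp
  finally show ?thesis .
qed

lemma la_ka: "0 < la" "0 < ka" "la \<le> ka" "ka \<le> 1"
  using e \<tau> t by (auto simp: la_def ka_def intro!: powr_mono' powr_le1)

lemma En: "0 < En"
  using R A by (simp add: En_def)

lemma dR: "0 < d * R" using d R by simp

lemma measurable_w [measurable]: "w \<in> borel_measurable lebesgue"
  unfolding w_def[abs_def] by measurable

lemma measurable_eta [measurable]: "eta \<in> borel_measurable lebesgue"
  unfolding eta_def[abs_def] by measurable

lemma eta_bounds: "0 \<le> eta x" "eta x \<le> 1"
  by (auto simp: eta_def)

lemma eta_one: "norm (x - x0) \<le> (\<rho>' + 2 * d) * R \<Longrightarrow> eta x = 1"
  using dR by (simp add: eta_def field_simps)

lemma eta_zero: "x \<notin> ball x0 ((\<rho>' + 3 * d) * R) \<Longrightarrow> eta x = 0"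
  using dR by (simp add: eta_def dist_norm norm_minus_commute divide_nonpos_pos)

lemma eta_lip: "\<bar>eta x - eta y\<bar> \<le> norm (x - y) / (d * R)"
proof -
  have clamp: "\<bar>max 0 (min 1 a) - max 0 (min 1 b)\<bar> \<le> \<bar>a - b\<bar>" for a b :: real by auto
  have "\<bar>eta x - eta y\<bar> \<le> \<bar>((\<rho>' + 3 * d) * R - norm (x - x0)) / (d * R) - ((\<rho>' + 3 * d) * R - norm (y - x0)) / (d * R)\<bar>"
    unfolding eta_def by (rule clamp)
  also have "\<dots> = \<bar>norm (y - x0) - norm (x - x0)\<bar> / (d * R)"
    using dR by (simp add: diff_divide_distrib[symmetric] abs_divide)
  also have "\<dots> \<le> norm (x - y) / (d * R)"
    using norm_triangle_ineq3[of "y - x0" "x - x0"] dR by (intro divide_right_mono) (auto simp: norm_minus_commute)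
  finally show ?thesis .
qed

lemma eta_diff_le_one: "\<bar>eta x - eta y\<bar> \<le> 1"
  using eta_bounds[of x] eta_bounds[of y] by auto

abbreviation B\<rho> :: "'a set" where "B\<rho> \<equiv> ball x0 (\<rho> * R)"
abbreviation Br :: "'a set" where "Br \<equiv> ball x0 ((\<rho>' + 3 * d) * R)"

lemma radii: "(\<rho>' + 3 * d) * R + d * R \<le> \<rho> * R" "\<rho> * R \<le> 5/8 * R"
proof -
  have "(\<rho>' + 4 * d) * R \<le> \<rho> * R" using gap R by (intro mult_right_mono) auto
  then show "(\<rho>' + 3 * d) * R + d * R \<le> \<rho> * R" by (simp add: algebra_simps)
  show "\<rho> * R \<le> 5/8 * R" using \<rho> R by (intro mult_right_mono) auto
qed

lemma Br_subset: "x \<in> Br \<Longrightarrow> x \<in> B\<rho>" "x \<in> Br \<Longrightarrow> x \<in> ball x0 (3/4 * R)" "x \<in> Br \<Longrightarrow> x + h \<in> ball x0 (3/4 * R)"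
  "x - h \<in> Br \<Longrightarrow> x \<in> ball x0 (3/4 * R)"
proof -
  show "x \<in> Br \<Longrightarrow> x \<in> B\<rho>" "x \<in> Br \<Longrightarrow> x \<in> ball x0 (3/4 * R)"
    unfolding mem_ball using radii dR R by linarith+
  have *: "y + h \<in> ball x0 (3/4 * R)" if "y \<in> Br" for y
  proof -
    have "dist x0 (y + h) \<le> dist x0 y + norm h"
      using norm_triangle_ineq4[of "x0 - y" h] by (simp add: dist_norm algebra_simps)
    also have "\<dots> < (\<rho>' + 3 * d) * R + d * R" using that h by auto
    also have "\<dots> \<le> 3/4 * R" using radii R by linarith
    finally show ?thesis by simp
  qed
  show "x \<in> Br \<Longrightarrow> x + h \<in> ball x0 (3/4 * R)" by (rule *)
  show "x - h \<in> Br \<Longrightarrow> x \<in> ball x0 (3/4 * R)" using *[of "x - h"] by simp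
qed

lemma B\<rho>_subset: "x \<in> B\<rho> \<Longrightarrow> x \<in> ball x0 (7/8 * R)"
  unfolding mem_ball using radii R by linarith

lemma D': "(\<integral>\<^sup>+x. ennreal (indicator B\<rho> x * \<bar>w x\<bar> powr p) \<partial>lebesgue) \<le> ennreal (C * la powr p * A)"
  using D by (simp add: w_def la_def e_def powr_powr)

definition cY :: real where "cY = kn / d powr p + kf"

lemma cY: "0 \<le> cY" using kn kf by (simp add: cY_def)

text \<open>The two cutoff errors, with \<open>w\<close> at the first and at the second point. If
  the first point is in \<open>B\<rho>\<close>, then \<open>Yp\<close> sees \<open>w\<close> only
  inside, whereas \<open>Zp\<close> also sees the tail; this asymmetry produces the two different
  scales.\<close>

definition Yp :: "'a \<times> 'a \<Rightarrow> real" where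
  "Yp z = \<bar>eta (fst z) - eta (snd z)\<bar> powr p * \<bar>w (fst z)\<bar> powr p * mu s p z"
definition Zp :: "'a \<times> 'a \<Rightarrow> real" where
  "Zp z = \<bar>eta (fst z) - eta (snd z)\<bar> powr p * \<bar>w (snd z)\<bar> powr p * mu s p z"

lemma measurable_Yp [measurable]: "Yp \<in> borel_measurable lebesgue"
  unfolding Yp_def[abs_def] by measurable

lemma measurable_Zp [measurable]: "Zp \<in> borel_measurable lebesgue"
  unfolding Zp_def[abs_def] by measurable

lemma Yp_Zp_nonneg [simp]: "0 \<le> Yp z" "0 \<le> Zp z" by (auto simp: Yp_def Zp_def)

lemma Yp_swap: "Yp (snd z, fst z) = Zp z"
  by (simp add: Yp_def Zp_def mu_swap abs_minus_commute)

text \<open>For points closer than \<open>R\<close> the Lipschitz bound of \<open>eta\<close>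
  supplies the \<open>p\<close>-th power of the distance that tames the kernel; for the others
  \<open>eta\<close> varies by at most 1 and the kernel is integrable.\<close>

lemma Y_bound: "(\<integral>\<^sup>+z. ennreal (indicator B\<rho> (fst z) * Yp z) \<partial>lebesgue) \<le> ennreal (cY * C * la powr p * En)"
proof -
  let ?g = "\<lambda>x. indicator B\<rho> x * \<bar>w x\<bar> powr p"
  define N where "N z = ?g (fst z) * indicator (ball 0 R) (fst z - snd z) * (norm (fst z - snd z) powr p * mu s p z)" for z
  define F where "F z = ?g (fst z) * indicator (- ball 0 R) (fst z - snd z) * mu s p z" for z
  have [measurable]: "N \<in> borel_measurable lebesgue" "F \<in> borel_measurable lebesgue"
    unfolding N_def[abs_def] F_def[abs_def] by measurable
  have N: "(\<integral>\<^sup>+z. ennreal (N z) \<partial>lebesgue) \<le> ennreal (kn * R powr (p - s * p) * (C * la powr p * A))"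
    unfolding N_def by (rule kernel_near_fst[OF _ _ R D']) auto
  have F: "(\<integral>\<^sup>+z. ennreal (F z) \<partial>lebesgue) \<le> ennreal (kf * R powr (- (s * p)) * (C * la powr p * A))"
    unfolding F_def by (rule kernel_far_fst[OF _ _ R D']) auto
  have "(\<integral>\<^sup>+z. ennreal (indicator B\<rho> (fst z) * Yp z) \<partial>lebesgue) \<le>
     ennreal (1 / (d * R) powr p * (kn * R powr (p - s * p) * (C * la powr p * A)) + 1 * (kf * R powr (- (s * p)) * (C * la powr p * A)))"
  proof (rule nn_integral_combine[OF _ _ _ _ _ _ _ _ _ N F])
    fix z :: "'a \<times> 'a"
    obtain x y where z: "z = (x, y)" by fastforce
    show "indicator B\<rho> (fst z) * Yp z \<le> 1 / (d * R) powr p * N z + 1 * F z"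
    proof (cases "norm (x - y) < R")
      case True
      have "\<bar>eta x - eta y\<bar> powr p \<le> (norm (x - y) / (d * R)) powr p"
        using eta_lip sp by (intro powr_mono2) auto
      also have "\<dots> = 1 / (d * R) powr p * norm (x - y) powr p"
        using dR by (simp add: powr_divide)
      finally have "\<bar>eta x - eta y\<bar> powr p * (indicator B\<rho> x * \<bar>w x\<bar> powr p * mu s p z)
         \<le> 1 / (d * R) powr p * norm (x - y) powr p * (indicator B\<rho> x * \<bar>w x\<bar> powr p * mu s p z)"
        by (rule mult_right_mono) simp
      then show ?thesis using True by (simp add: Yp_def N_def F_def z mult_ac)
    next
      case False
      have "\<bar>eta x - eta y\<bar> powr p \<le> 1"
        using eta_diff_le_one sp by (intro powr_le1) auto
      then have "\<bar>eta x - eta y\<bar> powr p * (indicator B\<rho> x * \<bar>w x\<bar> powr p * mu s p z) \<le> 1 * (indicator B\<rho> x * \<bar>w x\<bar> powr p * mu s p z)"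
        by (rule mult_right_mono) simp
      then show ?thesis using False by (simp add: Yp_def N_def F_def z mult_ac)
    qed
  qed (use kn kf C A in \<open>auto simp: N_def F_def\<close>)
  also have "1 / (d * R) powr p * (kn * R powr (p - s * p) * (C * la powr p * A)) + 1 * (kf * R powr (- (s * p)) * (C * la powr p * A))
     = cY * C * la powr p * En"
    using d R by (simp add: cY_def En_def powr_mult powr_diff powr_minus field_simps)
  finally show ?thesis .
qed

lemma Y_bound_swap: "(\<integral>\<^sup>+z. ennreal (indicator B\<rho> (snd z) * Zp z) \<partial>lebesgue) \<le> ennreal (cY * C * la powr p * En)"
  using Y_bound
  by (subst (asm) nn_integral_lebesgue_swap[symmetric]) (auto simp: Yp_swap)

definition cb :: real where "cb = 2 powr p * 2 * 2 powr (real DIM('a) + s * p) / unit_ball_vol (real DIM('a))"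
definition cZ :: real where "cZ = 1 + kf / d powr (s * p) * cb"

lemma cb: "0 \<le> cb" by (simp add: cb_def)
lemma cZ: "0 \<le> cZ" using kf cb by (simp add: cZ_def)

definition Zfar :: "'a \<times> 'a \<Rightarrow> real" where
  "Zfar z = indicator Br (fst z) * indicator (- B\<rho>) (snd z) * \<bar>w (snd z)\<bar> powr p * mu s p z"

lemma measurable_Zfar [measurable]: "Zfar \<in> borel_measurable lebesgue"
  unfolding Zfar_def[abs_def] by measurable

text \<open>Up to radius \<open>7/8 * R\<close> the starting regularity of \<open>u\<close> applies,
  beyond it the snail of the difference quotient. Neither depends on the exponent \<tau> reached so
  far, so this contribution stays at the scale \<open>ka\<close> in every step.\<close>

lemma Zfar_bound: "(\<integral>\<^sup>+z. ennreal (Zfar z) \<partial>lebesgue) \<le> ennreal (cZ * ka powr p * En)"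
proof -
  let ?g = "\<lambda>x. indicator (ball x0 (7/8 * R)) x * \<bar>w x\<bar> powr p"
  define F where "F z = ?g (snd z) * indicator (- ball 0 (d * R)) (fst z - snd z) * mu s p z" for z
  define G where "G z = indicator (ball x0 (3/4 * R)) (fst z) * indicator (- ball x0 (7/8 * R)) (snd z) * \<bar>w (snd z)\<bar> powr p * mu s p z" for z
  have [measurable]: "F \<in> borel_measurable lebesgue" "G \<in> borel_measurable lebesgue"
    unfolding F_def[abs_def] G_def[abs_def] by measurable
  \<comment> \<open>Since \<open>t \<le> s\<close> and \<open>e \<le> 1\<close>, the starting
    regularity is at least as good as the tail.\<close>
  have "e powr (s * p) \<le> e powr (t * p)"
    using e t sp by (intro powr_mono') auto
  then have le: "cb * e powr (s * p) * A \<le> cb * ka powr p * A"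
    using cb A by (auto simp: ka_def powr_powr intro!: mult_left_mono mult_right_mono)
  have "(\<integral>\<^sup>+x. ennreal (?g x) \<partial>lebesgue) \<le> ennreal (cb * e powr (s * p) * A)"
    using translates_base[OF h(1)] h16 by (simp add: w_def cb_def e_def)
  also have "\<dots> \<le> ennreal (cb * ka powr p * A)" by (rule ennreal_leI[OF le])
  finally have "(\<integral>\<^sup>+z. ennreal (F z) \<partial>lebesgue) \<le> ennreal (kf * (d * R) powr (- (s * p)) * (cb * ka powr p * A))"
    unfolding F_def by (intro kernel_far_snd dR) auto
  moreover have "(\<integral>\<^sup>+z. ennreal (G z) \<partial>lebesgue) \<le> ennreal (ka powr p * En)"
    using u_diff_tail[of h] h h16 by (simp add: G_def w_def ka_def e_def powr_powr En_def mult_ac)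
  ultimately have "(\<integral>\<^sup>+z. ennreal (Zfar z) \<partial>lebesgue) \<le> ennreal (1 * (kf * (d * R) powr (- (s * p)) * (cb * ka powr p * A)) + 1 * (ka powr p * En))"
  proof (rule nn_integral_combine[rotated -2])
    fix z :: "'a \<times> 'a"
    obtain x y where z: "z = (x, y)" by fastforce
    show "Zfar z \<le> 1 * F z + 1 * G z"
    proof (cases "x \<in> Br \<and> y \<notin> B\<rho>")
      case True
      have "norm (x0 - y) \<le> norm (x0 - x) + norm (x - y)"
        using norm_triangle_ineq[of "x0 - x" "x - y"] by simp
      moreover have "norm (x0 - x) < (\<rho>' + 3 * d) * R" "\<rho> * R \<le> norm (x0 - y)" using True by (auto simp: dist_norm)
      ultimately have "d * R \<le> norm (x - y)" using radii(1) by linarith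
      then show ?thesis using True Br_subset(2)[of x]
        by (auto simp: Zfar_def F_def G_def z indicator_def)
    next
      case False
      then have "Zfar z = 0" by (auto simp: Zfar_def z)
      then show ?thesis by (simp add: F_def G_def)
    qed
  qed (use kf cb A En in \<open>auto simp: F_def G_def\<close>)
  also have "1 * (kf * (d * R) powr (- (s * p)) * (cb * ka powr p * A)) + 1 * (ka powr p * En) = cZ * ka powr p * En"
    using d R by (simp add: cZ_def En_def powr_mult powr_minus field_simps)
  finally show ?thesis .
qed

lemma Z_bound: "(\<integral>\<^sup>+z. ennreal (indicator B\<rho> (fst z) * Zp z) \<partial>lebesgue) \<le> ennreal (cY * C * la powr p * En + cZ * ka powr p * En)"
proof -
  have "(\<integral>\<^sup>+z. ennreal (indicator B\<rho> (fst z) * Zp z) \<partial>lebesgue) \<le> ennreal (1 * (cY * C * la powr p * En) + 1 * (cZ * ka powr p * En))"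
  proof (rule nn_integral_combine[OF _ _ _ _ _ _ _ _ _ Y_bound_swap Zfar_bound])
    fix z :: "'a \<times> 'a"
    obtain x y where z: "z = (x, y)" by fastforce
    show "indicator B\<rho> (fst z) * Zp z \<le> 1 * (indicator B\<rho> (snd z) * Zp z) + 1 * Zfar z"
    proof (cases "y \<in> B\<rho>")
      case True
      then show ?thesis by (auto simp: z Zfar_def indicator_def)
    next
      case False
      then have y: "eta y = 0" using eta_zero[of y] Br_subset(1)[of y] by blast
      show ?thesis
      proof (cases "x \<in> Br")
        case True
        have "\<bar>eta x\<bar> powr p \<le> 1" using eta_bounds[of x] sp by (intro powr_le1) auto
        then have "\<bar>eta x\<bar> powr p * (\<bar>w y\<bar> powr p * mu s p z) \<le> 1 * (\<bar>w y\<bar> powr p * mu s p z)"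
          by (rule mult_right_mono) simp
        then show ?thesis using True False Br_subset(1)[OF True] by (simp add: z Zp_def Zfar_def y mult_ac)
      next
        case F: False
        then show ?thesis using eta_zero[of x] y False sp by (simp add: z Zp_def Zfar_def)
      qed
    qed
  qed (use cY cZ C En in \<open>auto simp: Zfar_def\<close>)
  then show ?thesis by simp
qed

section \<open>The nonlinear error term and the right-hand side\<close>

definition da :: "'a \<times> 'a \<Rightarrow> real" where "da z = u (fst z + h) - u (snd z + h)"
definition db :: "'a \<times> 'a \<Rightarrow> real" where "db z = u (fst z) - u (snd z)"

lemma measurable_da_db [measurable]: "da \<in> borel_measurable lebesgue" "db \<in> borel_measurable lebesgue"
  unfolding da_def[abs_def] db_def[abs_def] by measurable

lemma da_db: "da z - db z = w (fst z) - w (snd z)"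
  by (simp add: da_def db_def w_def)

definition touch :: "'a \<times> 'a \<Rightarrow> real" where
  "touch z = (if fst z \<in> Br \<or> snd z \<in> Br then 1 else 0)"

lemma measurable_touch [measurable]: "touch \<in> borel_measurable lebesgue"
proof -
  have "touch = (\<lambda>z. max (indicator Br (fst z)) (indicator Br (snd z)))"
    by (auto simp: touch_def fun_eq_iff)
  also have "\<dots> \<in> borel_measurable lebesgue" by measurable
  finally show ?thesis .
qed

lemma touch_nonneg [simp]: "0 \<le> touch z" by (simp add: touch_def)

lemma touch_zero: "touch z = 0 \<Longrightarrow> eta (fst z) = 0 \<and> eta (snd z) = 0"
  using eta_zero by (auto simp: touch_def split: if_splits)

lemma db_bound: "(\<integral>\<^sup>+z. ennreal (touch z * \<bar>db z\<bar> powr p * mu s p z) \<partial>lebesgue) \<le> ennreal (cX * En)"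
  unfolding En_def
  by (rule nn_integral_le_mono[OF _ u_energy_near])
    (use Br_subset(2) in \<open>auto simp: db_def touch_def nearB_def intro!: mult_right_mono\<close>)

text \<open>Translating both points by \<open>h\<close> preserves the measure and \<open>mu\<close>
  and turns \<open>db\<close> into \<open>da\<close>; the translated pairs still touch the ball of
  radius \<open>3/4 * R\<close>.\<close>

lemma da_bound: "(\<integral>\<^sup>+z. ennreal (touch z * \<bar>da z\<bar> powr p * mu s p z) \<partial>lebesgue) \<le> ennreal (cX * En)"
proof -
  define G where "G z = nearB z * \<bar>u (fst z) - u (snd z)\<bar> powr p * mu s p z" for z
  have [measurable]: "G \<in> borel_measurable lebesgue" unfolding G_def[abs_def] by measurable
  have "(\<integral>\<^sup>+z. ennreal (G (z + (h, h))) \<partial>lebesgue) \<le> ennreal (cX * En)"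
    using u_energy_near by (subst nn_integral_lebesgue_shift[of "\<lambda>z. ennreal (G z)"]) (auto simp: G_def En_def)
  then show ?thesis
  proof (rule nn_integral_le_mono[rotated])
    fix z :: "'a \<times> 'a"
    have "touch z \<le> nearB (z + (h, h))"
      using Br_subset(3) by (auto simp: touch_def nearB_def)
    then have "touch z * (\<bar>da z\<bar> powr p * mu s p z) \<le> nearB (z + (h, h)) * (\<bar>da z\<bar> powr p * mu s p z)"
      by (rule mult_right_mono) simp
    then show "touch z * \<bar>da z\<bar> powr p * mu s p z \<le> G (z + (h, h))"
      by (simp add: G_def da_def mu_def)
  qed
qed

lemma dab_bound: "(\<integral>\<^sup>+z. ennreal (touch z * (\<bar>da z\<bar> + \<bar>db z\<bar>) powr p * mu s p z) \<partial>lebesgue) \<le> ennreal (2 powr p * (2 * cX) * En)"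
proof -
  have "(\<integral>\<^sup>+z. ennreal (touch z * (\<bar>da z\<bar> + \<bar>db z\<bar>) powr p * mu s p z) \<partial>lebesgue) \<le> ennreal (2 powr p * (cX * En) + 2 powr p * (cX * En))"
  proof (rule nn_integral_combine[OF _ _ _ _ _ _ _ _ _ da_bound db_bound])
    fix z
    have "(\<bar>da z\<bar> + \<bar>db z\<bar>) powr p * (touch z * mu s p z) \<le> 2 powr p * (\<bar>da z\<bar> powr p + \<bar>db z\<bar> powr p) * (touch z * mu s p z)"
      using sp by (intro mult_right_mono powr_sum_le) auto
    then show "touch z * (\<bar>da z\<bar> + \<bar>db z\<bar>) powr p * mu s p z \<le> 2 powr p * (touch z * \<bar>da z\<bar> powr p * mu s p z) + 2 powr p * (touch z * \<bar>db z\<bar> powr p * mu s p z)"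
      by (simp add: algebra_simps)
  qed (use cX_nonneg En in auto)
  then show ?thesis by (simp add: algebra_simps)
qed

text \<open>The error of the algebraic identity, weighted by the upper bound of \<open>Jq\<close>
  without its factor \<open>p\<close>.\<close>

definition T :: "'a \<times> 'a \<Rightarrow> real" where
  "T z = (\<bar>da z\<bar> + \<bar>db z\<bar>) powr (p - 2) * (\<bar>eta (fst z) - eta (snd z)\<bar> * \<bar>w (fst z)\<bar>) * (\<bar>eta (fst z) - eta (snd z)\<bar> * \<bar>w (snd z)\<bar>) * mu s p z"

lemma measurable_T [measurable]: "T \<in> borel_measurable lebesgue"
  unfolding T_def[abs_def] by measurable

lemma T_nonneg [simp]: "0 \<le> T z" by (simp add: T_def)

lemma T_swap: "T (snd z, fst z) = T z"
  by (simp add: T_def da_def db_def mu_swap abs_minus_commute mult_ac)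

definition cT :: real where "cT = 2 powr p * (2 * cX) + 2 * cY * C + cZ"

lemma cT: "0 \<le> cT" using cX_nonneg cY cZ C by (simp add: cT_def)

text \<open>The decisive estimate. Young's inequality takes the three factors in the units 1,
  \<open>la\<close> and \<open>ka\<close>: the energies of \<open>u\<close> are bounded but not
  small, \<open>w\<close> at the inner point has the current scale \<open>la\<close>, and
  \<open>w\<close> at the other point may lie in the tail and has only the scale \<open>ka\<close>.
  The gain is the product of the units.\<close>

lemma T_half_bound: "(\<integral>\<^sup>+z. ennreal (indicator B\<rho> (fst z) * T z) \<partial>lebesgue) \<le> ennreal (la * ka * cT * En)"
proof -
  let ?X = "\<lambda>z. touch z * (\<bar>da z\<bar> + \<bar>db z\<bar>) powr p * mu s p z"
  let ?Y = "\<lambda>z. indicator B\<rho> (fst z) * Yp z" and ?Z = "\<lambda>z. indicator B\<rho> (fst z) * Zp z"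
  have lkp: "la powr p \<le> ka powr p" using la_ka sp by (intro powr_mono2) auto
  have "(\<integral>\<^sup>+z. ennreal (1 / la powr p * ?Y z + 1 / ka powr p * ?Z z) \<partial>lebesgue)
     \<le> ennreal (1 / la powr p * (cY * C * la powr p * En) + 1 / ka powr p * (cY * C * la powr p * En + cZ * ka powr p * En))"
    by (rule nn_integral_combine[OF _ _ _ _ _ _ _ _ _ Y_bound Z_bound]) (use cY cZ C En in auto)
  also have "\<dots> \<le> ennreal ((2 * cY * C + cZ) * En)"
  proof (rule ennreal_leI)
    have "1 / ka powr p * (cY * C * la powr p * En) \<le> 1 / ka powr p * (cY * C * ka powr p * En)"
      using lkp cY C En by (intro mult_left_mono mult_right_mono) auto
    then show "1 / la powr p * (cY * C * la powr p * En) + 1 / ka powr p * (cY * C * la powr p * En + cZ * ka powr p * En) \<le> (2 * cY * C + cZ) * En"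
      using la_ka by (simp add: algebra_simps)
  qed
  finally have YZ: "(\<integral>\<^sup>+z. ennreal (1 / la powr p * ?Y z + 1 / ka powr p * ?Z z) \<partial>lebesgue) \<le> ennreal ((2 * cY * C + cZ) * En)" .
  have "(\<integral>\<^sup>+z. ennreal (indicator B\<rho> (fst z) * T z) \<partial>lebesgue) \<le> ennreal (la * ka * (2 powr p * (2 * cX) * En) + la * ka * ((2 * cY * C + cZ) * En))"
  proof (rule nn_integral_combine[OF _ _ _ _ _ _ _ _ _ dab_bound YZ])
    fix z :: "'a \<times> 'a"
    show "indicator B\<rho> (fst z) * T z \<le> la * ka * ?X z + la * ka * (1 / la powr p * ?Y z + 1 / ka powr p * ?Z z)"
    proof (cases "fst z \<in> B\<rho> \<and> touch z \<noteq> 0")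
      case True
      then have "touch z = 1" by (metis touch_def)
      let ?e = "\<bar>eta (fst z) - eta (snd z)\<bar>"
      have "(\<bar>da z\<bar> + \<bar>db z\<bar>) powr (p - 2) * (?e * \<bar>w (fst z)\<bar>) * (?e * \<bar>w (snd z)\<bar>) \<le>
        la * ka * ((\<bar>da z\<bar> + \<bar>db z\<bar>) powr p + (?e * \<bar>w (fst z)\<bar>) powr p / la powr p + (?e * \<bar>w (snd z)\<bar>) powr p / ka powr p)"
        using la_ka p by (intro powr_mult_three_le) auto
      then have "T z \<le> la * ka * ((\<bar>da z\<bar> + \<bar>db z\<bar>) powr p + (?e * \<bar>w (fst z)\<bar>) powr p / la powr p + (?e * \<bar>w (snd z)\<bar>) powr p / ka powr p) * mu s p z"
        unfolding T_def by (rule mult_right_mono) simp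
      also have "\<dots> = la * ka * (1 * (\<bar>da z\<bar> + \<bar>db z\<bar>) powr p * mu s p z) + la * ka * (1 / la powr p * Yp z + 1 / ka powr p * Zp z)"
        by (simp add: Yp_def Zp_def powr_mult algebra_simps)
      finally show ?thesis using True \<open>touch z = 1\<close> by simp
    next
      case False
      have "indicator B\<rho> (fst z) * T z = 0"
      proof (cases "fst z \<in> B\<rho>")
        case True
        then show ?thesis using False touch_zero[of z] by (simp add: T_def)
      qed simp
      moreover have "0 \<le> la * ka * ?X z + la * ka * (1 / la powr p * ?Y z + 1 / ka powr p * ?Z z)"
        using la_ka by simp
      ultimately show ?thesis by linarith
    qed
  qed (use la_ka cX_nonneg cY cZ C En in auto)
  then show ?thesis by (simp add: cT_def algebra_simps)
qed

lemma T_bound: "(\<integral>\<^sup>+z. ennreal (T z) \<partial>lebesgue) \<le> ennreal (2 * la * ka * cT * En)"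
proof -
  have T': "(\<integral>\<^sup>+z. ennreal (indicator B\<rho> (snd z) * T z) \<partial>lebesgue) \<le> ennreal (la * ka * cT * En)"
    using T_half_bound
    by (subst (asm) nn_integral_lebesgue_swap[symmetric]) (auto simp: T_swap)
  have "(\<integral>\<^sup>+z. ennreal (T z) \<partial>lebesgue) \<le> ennreal (1 * (la * ka * cT * En) + 1 * (la * ka * cT * En))"
  proof (rule nn_integral_combine[OF _ _ _ _ _ _ _ _ _ T_half_bound T'])
    fix z :: "'a \<times> 'a"
    show "T z \<le> 1 * (indicator B\<rho> (fst z) * T z) + 1 * (indicator B\<rho> (snd z) * T z)"
    proof (cases "fst z \<in> B\<rho> \<or> snd z \<in> B\<rho>")
      case False
      then have "touch z = 0" using Br_subset(1) by (auto simp: touch_def)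
      then show ?thesis using touch_zero[of z] by (simp add: T_def)
    qed (auto simp: indicator_def)
  qed (use la_ka cT En in auto)
  then show ?thesis by (simp add: mult_ac)
qed

definition cf :: real where
  "cf = 2 powr conj_exp p * 2 * 2 powr (real DIM('a) + s * conj_exp p) / unit_ball_vol (real DIM('a))"

lemma cf: "0 \<le> cf" by (simp add: cf_def)

text \<open>Differences of \<open>f\<close> are measured in the unit \<open>lf\<close> and
  \<open>w\<close> in the unit \<open>la\<close>. Their product contains \<open>e powr s\<close>,
  which is at most \<open>ka\<close>, so the right-hand side of the equation is of the same order as
  the error terms.\<close>

lemma f_bound: "(\<integral>\<^sup>+x. ennreal (\<bar>(f (x + h) - f x) * ((eta x)^2 * w x)\<bar>) \<partial>lebesgue) \<le> ennreal (e powr s * la * (cf + C) * En)"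
proof -
  define lf where "lf = e powr s * R powr (- (s * p))"
  have lf: "0 < lf" using e R by (simp add: lf_def)
  let ?q = "conj_exp p"
  let ?F = "\<lambda>x. indicator (ball x0 (7/8 * R)) x * \<bar>f (x + h) - f x\<bar> powr ?q"
  have F: "(\<integral>\<^sup>+x. ennreal (?F x) \<partial>lebesgue) \<le> ennreal (cf * lf powr ?q * A)"
    using f_translates[OF h(1)] h16 by (simp add: cf_def lf_def e_def)
  have "(\<integral>\<^sup>+x. ennreal (\<bar>(f (x + h) - f x) * ((eta x)^2 * w x)\<bar>) \<partial>lebesgue)
    \<le> ennreal (lf * la / lf powr ?q * (cf * lf powr ?q * A) + lf * la / la powr p * (C * la powr p * A))"
  proof (rule nn_integral_combine[OF _ _ _ _ _ _ _ _ _ F D'])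
    fix x
    show "\<bar>(f (x + h) - f x) * ((eta x)^2 * w x)\<bar> \<le> lf * la / lf powr ?q * ?F x + lf * la / la powr p * (indicator B\<rho> x * \<bar>w x\<bar> powr p)"
    proof (cases "x \<in> Br")
      case True
      have "(eta x)^2 \<le> 1" using eta_bounds[of x] by (simp add: power_le_one)
      then have "(\<bar>f (x + h) - f x\<bar> * \<bar>w x\<bar>) * (eta x)^2 \<le> (\<bar>f (x + h) - f x\<bar> * \<bar>w x\<bar>) * 1"
        by (intro mult_left_mono) auto
      then have "\<bar>(f (x + h) - f x) * ((eta x)^2 * w x)\<bar> \<le> lf * la * ((\<bar>f (x + h) - f x\<bar> / lf) * (\<bar>w x\<bar> / la))"
        using lf la_ka by (simp add: abs_mult mult_ac)
      also have "\<dots> \<le> lf * la * ((\<bar>f (x + h) - f x\<bar> / lf) powr ?q + (\<bar>w x\<bar> / la) powr p)"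
        using lf la_ka sp by (intro mult_left_mono Young_conj_exp) auto
      also have "\<dots> = lf * la / lf powr ?q * ?F x + lf * la / la powr p * (indicator B\<rho> x * \<bar>w x\<bar> powr p)"
        using True Br_subset(1)[OF True] B\<rho>_subset[OF Br_subset(1)[OF True]] lf la_ka
        by (simp add: powr_divide algebra_simps)
      finally show ?thesis .
    next
      case False
      then show ?thesis using eta_zero[of x] lf la_ka by simp
    qed
  qed (use lf la_ka cf C A in auto)
  also have "lf * la / lf powr ?q * (cf * lf powr ?q * A) + lf * la / la powr p * (C * la powr p * A) = e powr s * la * (cf + C) * En"
  proof -
    have "lf powr ?q \<noteq> 0" "la powr p \<noteq> 0" using lf la_ka by auto
    then show ?thesis by (simp add: lf_def En_def algebra_simps)
  qed
  finally show ?thesis .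
qed

end

lemma powr_eq_powr_times_square:
  fixes x p :: real
  shows "\<bar>x\<bar> powr p = \<bar>x\<bar> powr (p - 2) * x\<^sup>2"
proof -
  have "\<bar>x\<bar> powr (p - 2) * \<bar>x\<bar> = \<bar>x\<bar> powr (p - 1)"
    using powr_split[of "\<bar>x\<bar>" "p - 1"] by simp
  then have "\<bar>x\<bar> powr (p - 2) * \<bar>x\<bar> * \<bar>x\<bar> = \<bar>x\<bar> powr p"
    using powr_split[of "\<bar>x\<bar>" p] by simp
  then show ?thesis by (simp add: power2_eq_square mult.assoc)
qed

text \<open>Monotonicity controls only the quadratic expression with weight
  \<open>\<bar>v - w\<bar> powr (p - 2)\<close>. It suffices when \<open>a * v - b * w\<close> is at
  most twice \<open>v - w\<close> in size; otherwise the difference is due to \<open>a - b\<close>,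
  and the cutoff term takes over.\<close>

lemma cutoff_diff_powr_le:
  fixes a b v w p :: real
  assumes p: "2 \<le> p" and ab: "0 \<le> a" "a \<le> 1" "0 \<le> b" "b \<le> 1"
  shows "\<bar>a * v - b * w\<bar> powr p \<le>
    2 powr (p - 2) * (\<bar>v - w\<bar> powr (p - 2) * (a * v - b * w)\<^sup>2) + \<bar>a - b\<bar> powr p * (\<bar>v\<bar> + \<bar>w\<bar>) powr p"
proof (cases "\<bar>a * v - b * w\<bar> \<le> 2 * \<bar>v - w\<bar>")
  case True
  have "\<bar>a * v - b * w\<bar> powr p = \<bar>a * v - b * w\<bar> powr (p - 2) * (a * v - b * w)\<^sup>2"
    by (rule powr_eq_powr_times_square)
  also have "\<dots> \<le> (2 * \<bar>v - w\<bar>) powr (p - 2) * (a * v - b * w)\<^sup>2"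
    using True p by (intro mult_right_mono powr_mono2) auto
  finally show ?thesis by (simp add: powr_mult add_increasing2)
next
  case False
  have "2 * (a * v - b * w) = (a + b) * (v - w) + (a - b) * (v + w)"
    by (simp add: algebra_simps)
  then have "2 * \<bar>a * v - b * w\<bar> \<le> \<bar>(a + b) * (v - w)\<bar> + \<bar>(a - b) * (v + w)\<bar>" by linarith
  moreover have "\<bar>(a + b) * (v - w)\<bar> \<le> 2 * \<bar>v - w\<bar>"
    using ab by (simp add: abs_mult mult_right_mono)
  moreover have "\<bar>(a - b) * (v + w)\<bar> \<le> \<bar>a - b\<bar> * (\<bar>v\<bar> + \<bar>w\<bar>)"
    by (simp add: abs_mult mult_left_mono)
  ultimately have "\<bar>a * v - b * w\<bar> \<le> \<bar>a - b\<bar> * (\<bar>v\<bar> + \<bar>w\<bar>)" using False by linarith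
  then have "\<bar>a * v - b * w\<bar> powr p \<le> (\<bar>a - b\<bar> * (\<bar>v\<bar> + \<bar>w\<bar>)) powr p"
    using p by (intro powr_mono2) auto
  then show ?thesis by (simp add: powr_mult add_increasing)
qed

section \<open>Testing the difference of the two equations\<close>

context energy
begin

definition phi :: "'a \<Rightarrow> real" where "phi x = (eta x)\<^sup>2 * w x"

lemma measurable_phi [measurable]: "phi \<in> borel_measurable lebesgue"
  unfolding phi_def[abs_def] by measurable

lemma phi_zero: "x \<notin> Br \<Longrightarrow> phi x = 0"
  using eta_zero by (simp add: phi_def)

lemma phi_Lp: "(\<integral>\<^sup>+x. ennreal (\<bar>phi x\<bar> powr p) \<partial>lebesgue) < \<infinity>"
proof -
  have "(\<integral>\<^sup>+x. ennreal (\<bar>phi x\<bar> powr p) \<partial>lebesgue) \<le> ennreal (C * la powr p * A)"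
  proof (rule nn_integral_le_mono[OF _ D'])
    fix x
    show "\<bar>phi x\<bar> powr p \<le> indicator B\<rho> x * \<bar>w x\<bar> powr p"
    proof (cases "x \<in> Br")
      case True
      have "(eta x)\<^sup>2 \<le> 1" using eta_bounds[of x] by (simp add: power_le_one)
      then have "\<bar>phi x\<bar> \<le> \<bar>w x\<bar>"
        using mult_right_mono[of "(eta x)\<^sup>2" 1 "\<bar>w x\<bar>"] by (simp add: phi_def abs_mult)
      then show ?thesis using Br_subset(1)[OF True] sp by (simp add: powr_mono2)
    next
      case False
      then show ?thesis by (simp add: phi_zero)
    qed
  qed
  then show ?thesis by (rule le_less_trans) simp
qed

text \<open>Only finiteness matters: together with the \<open>L^p\<close> bound and the support it
  makes \<open>phi\<close> an admissible test function and the integrals below absolutely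
  convergent.\<close>

lemma phi_energy: "(\<integral>\<^sup>+z. ennreal (\<bar>phi (fst z) - phi (snd z)\<bar> powr p * mu s p z) \<partial>lebesgue) < \<infinity>"
proof -
  let ?c = "cY * C * la powr p * En"
  have c: "0 \<le> ?c" "0 \<le> cZ * ka powr p * En" using cY C En cZ by auto
  have c3: "0 \<le> 1 * (?c + cZ * ka powr p * En) + 1 * ?c" using c by (simp only: mult_1 add_nonneg_nonneg)
  have "(\<integral>\<^sup>+z. ennreal (1 * (indicator B\<rho> (fst z) * Zp z) + 1 * (indicator B\<rho> (snd z) * Zp z)) \<partial>lebesgue) \<le>
      ennreal (1 * (?c + cZ * ka powr p * En) + 1 * ?c)"
    by (rule nn_integral_combine[OF _ _ _ _ _ _ _ _ _ Z_bound Y_bound_swap]) (use c in auto)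
  then have Z: "(\<integral>\<^sup>+z. ennreal (Zp z) \<partial>lebesgue) \<le> ennreal (1 * (?c + cZ * ka powr p * En) + 1 * ?c)"
  proof (rule nn_integral_le_mono[rotated])
    fix z :: "'a \<times> 'a"
    show "Zp z \<le> 1 * (indicator B\<rho> (fst z) * Zp z) + 1 * (indicator B\<rho> (snd z) * Zp z)"
    proof (cases "fst z \<in> B\<rho> \<or> snd z \<in> B\<rho>")
      case False
      then have "touch z = 0" using Br_subset(1) by (auto simp: touch_def)
      then show ?thesis using touch_zero[of z] sp by (simp add: Zp_def)
    qed (auto simp: indicator_def)
  qed
  have "(\<integral>\<^sup>+z. ennreal (\<bar>phi (fst z) - phi (snd z)\<bar> powr p * mu s p z) \<partial>lebesgue)
    \<le> ennreal (2 powr p * (2 powr p * (2 * cX) * En) + 2 powr p * 2 powr p * (1 * (?c + cZ * ka powr p * En) + 1 * ?c))"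
  proof (rule nn_integral_combine[OF _ _ _ _ _ _ _ _ _ dab_bound Z])
    fix z :: "'a \<times> 'a"
    obtain x y where z: "z = (x, y)" by fastforce
    show "\<bar>phi (fst z) - phi (snd z)\<bar> powr p * mu s p z \<le>
      2 powr p * (touch z * (\<bar>da z\<bar> + \<bar>db z\<bar>) powr p * mu s p z) + 2 powr p * 2 powr p * Zp z"
    proof (cases "touch z = 0")
      case True
      then show ?thesis using touch_zero[OF True] sp by (simp add: phi_def)
    next
      case False
      then have t1: "touch z = 1" by (metis touch_def)
      have "phi x - phi y = (eta x)\<^sup>2 * (w x - w y) + ((eta x + eta y) * (eta x - eta y)) * w y"
        by (simp add: phi_def power2_eq_square algebra_simps)
      then have "\<bar>phi x - phi y\<bar> \<le> \<bar>(eta x)\<^sup>2 * (w x - w y)\<bar> + \<bar>((eta x + eta y) * (eta x - eta y)) * w y\<bar>"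
        by linarith
      also have "\<bar>(eta x)\<^sup>2 * (w x - w y)\<bar> \<le> 1 * \<bar>w x - w y\<bar>"
        unfolding abs_mult using eta_bounds[of x] by (intro mult_right_mono) (auto simp: power_le_one)
      also have "\<bar>w x - w y\<bar> \<le> \<bar>da z\<bar> + \<bar>db z\<bar>" using da_db[of z] by (simp add: z)
      also have "\<bar>((eta x + eta y) * (eta x - eta y)) * w y\<bar> \<le> (2 * \<bar>eta x - eta y\<bar>) * \<bar>w y\<bar>"
        unfolding abs_mult using eta_bounds[of x] eta_bounds[of y] by (intro mult_right_mono) auto
      finally have "\<bar>phi x - phi y\<bar> powr p \<le> ((\<bar>da z\<bar> + \<bar>db z\<bar>) + 2 * \<bar>eta x - eta y\<bar> * \<bar>w y\<bar>) powr p"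
        using sp by (intro powr_mono2) auto
      also have "\<dots> \<le> 2 powr p * ((\<bar>da z\<bar> + \<bar>db z\<bar>) powr p + (2 * \<bar>eta x - eta y\<bar> * \<bar>w y\<bar>) powr p)"
        using sp by (intro powr_sum_le) auto
      also have "\<dots> = 2 powr p * (\<bar>da z\<bar> + \<bar>db z\<bar>) powr p + 2 powr p * 2 powr p * (\<bar>eta x - eta y\<bar> powr p * \<bar>w y\<bar> powr p)"
        by (simp add: powr_mult algebra_simps)
      finally have "\<bar>phi x - phi y\<bar> powr p * mu s p z \<le> (2 powr p * (\<bar>da z\<bar> + \<bar>db z\<bar>) powr p + 2 powr p * 2 powr p * (\<bar>eta x - eta y\<bar> powr p * \<bar>w y\<bar> powr p)) * mu s p z"
        by (rule mult_right_mono) simp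
      then show ?thesis by (simp add: z[symmetric] t1 Zp_def) (simp add: z algebra_simps)
    qed
  qed (use cX_nonneg En c3 in auto)
  then show ?thesis by (rule le_less_trans) simp
qed

lemma kernel_product_le:
  assumes "\<bar>c\<bar> = \<bar>a\<bar> powr (p - 1)"
  shows "\<bar>c / K (fst z - snd z) * b\<bar> \<le> \<Lambda> * (\<bar>a\<bar> powr p * mu s p z) + \<Lambda> * (\<bar>b\<bar> powr p * mu s p z)"
proof -
  have "\<bar>c / K (fst z - snd z) * b\<bar> = (\<bar>a\<bar> powr (p - 1) * \<bar>b\<bar>) * (1 / K (fst z - snd z))"
    using K_mu(3)[of z] assms by (simp add: abs_mult)
  also have "\<dots> \<le> (\<bar>a\<bar> powr p + \<bar>b\<bar> powr p) * (\<Lambda> * mu s p z)"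
    using sp K_mu[of z] by (intro mult_mono powr_mult_two_le) auto
  finally show ?thesis by (simp add: algebra_simps)
qed

definition L1 :: "'a \<times> 'a \<Rightarrow> real" where
  "L1 z = Jp p (db z) / K (fst z - snd z) * (phi (fst z) - phi (snd z))"
definition L2 :: "'a \<times> 'a \<Rightarrow> real" where
  "L2 z = Jp p (da z) / K (fst z - snd z) * (phi (fst z) - phi (snd z))"

lemma measurable_L [measurable]: "L1 \<in> borel_measurable lebesgue" "L2 \<in> borel_measurable lebesgue"
  unfolding L1_def[abs_def] L2_def[abs_def] Jp_def by measurable

text \<open>Needed before the equations are subtracted: the Bochner integral of a non-integrable
  function is 0 and is not additive.\<close>

lemma L_integrable: "integrable lebesgue L1" "integrable lebesgue L2"
proof -
  have phi: "(\<integral>\<^sup>+z. ennreal (\<bar>phi (fst z) - phi (snd z)\<bar> powr p * mu s p z) \<partial>lebesgue)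
    \<le> ennreal (enn2real (\<integral>\<^sup>+z. ennreal (\<bar>phi (fst z) - phi (snd z)\<bar> powr p * mu s p z) \<partial>lebesgue))"
    using phi_energy by simp
  have *: "integrable lebesgue (\<lambda>z. Jp p (g z) / K (fst z - snd z) * (phi (fst z) - phi (snd z)))"
    if [measurable]: "g \<in> borel_measurable lebesgue"
      and g: "(\<integral>\<^sup>+z. ennreal (touch z * \<bar>g z\<bar> powr p * mu s p z) \<partial>lebesgue) \<le> ennreal (cX * En)" for g
  proof (rule integrable_of_abs_le)
    show "(\<lambda>z. Jp p (g z) / K (fst z - snd z) * (phi (fst z) - phi (snd z))) \<in> borel_measurable lebesgue"
      unfolding Jp_def by measurable
    have "(\<integral>\<^sup>+z. ennreal (\<Lambda> * (touch z * \<bar>g z\<bar> powr p * mu s p z) + \<Lambda> * (\<bar>phi (fst z) - phi (snd z)\<bar> powr p * mu s p z)) \<partial>lebesgue)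
      \<le> ennreal (\<Lambda> * (cX * En) + \<Lambda> * enn2real (\<integral>\<^sup>+z. ennreal (\<bar>phi (fst z) - phi (snd z)\<bar> powr p * mu s p z) \<partial>lebesgue))"
      by (rule nn_integral_combine[OF _ _ _ _ _ _ _ _ _ g phi]) (use \<Lambda> cX_nonneg En in auto)
    then show "(\<integral>\<^sup>+z. ennreal (\<Lambda> * (touch z * \<bar>g z\<bar> powr p * mu s p z) + \<Lambda> * (\<bar>phi (fst z) - phi (snd z)\<bar> powr p * mu s p z)) \<partial>lebesgue) < \<infinity>"
      by (rule le_less_trans) simp
    fix z :: "'a \<times> 'a"
    show "\<bar>Jp p (g z) / K (fst z - snd z) * (phi (fst z) - phi (snd z))\<bar>
      \<le> \<Lambda> * (touch z * \<bar>g z\<bar> powr p * mu s p z) + \<Lambda> * (\<bar>phi (fst z) - phi (snd z)\<bar> powr p * mu s p z)"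
    proof (cases "touch z = 0")
      case True
      then show ?thesis using touch_zero[OF True] sp by (simp add: phi_def)
    next
      case False
      then have "touch z = 1" by (metis touch_def)
      then show ?thesis using kernel_product_le[OF abs_Jp[of p "g z"], of z "phi (fst z) - phi (snd z)"] by simp
    qed
  qed
  show "integrable lebesgue L1" "integrable lebesgue L2"
    unfolding L1_def[abs_def] L2_def[abs_def] by (rule *[OF _ db_bound] *[OF _ da_bound], measurable)+
qed

lemma f_phi_integrable: "integrable lebesgue (\<lambda>x. f x * phi x)" "integrable lebesgue (\<lambda>x. f (x + h) * phi x)"
proof -
  let ?q = "conj_exp p"
  let ?F = "\<lambda>x. indicator (ball x0 R) x * \<bar>f x\<bar> powr ?q"
  have sub: "x \<in> ball x0 R" if "x \<in> ball x0 (3/4 * R)" for x using that R by auto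
  have f1: "(\<integral>\<^sup>+x. ennreal (?F x) \<partial>lebesgue) < \<infinity>" by (rule f_Lp)
  moreover have f2: "(\<integral>\<^sup>+x. ennreal (?F (x + h)) \<partial>lebesgue) < \<infinity>"
    using f_Lp by (subst nn_integral_lebesgue_shift[of "\<lambda>x. ennreal (?F x)"]) auto
  have fin: "(\<integral>\<^sup>+x. ennreal (G x + \<bar>phi x\<bar> powr p) \<partial>lebesgue) < \<infinity>"
    if "(\<integral>\<^sup>+x. ennreal (G x) \<partial>lebesgue) < \<infinity>" and [measurable]: "G \<in> borel_measurable lebesgue" and "\<And>x. 0 \<le> G x" for G
    using that phi_Lp by (simp add: nn_integral_add)
  show "integrable lebesgue (\<lambda>x. f x * phi x)"
  proof (rule integrable_of_abs_le)
    show "(\<integral>\<^sup>+x. ennreal (?F x + \<bar>phi x\<bar> powr p) \<partial>lebesgue) < \<infinity>" by (rule fin[OF f1]) auto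
    show "\<bar>f x * phi x\<bar> \<le> ?F x + \<bar>phi x\<bar> powr p" for x
      using Young_conj_exp[of p "\<bar>f x\<bar>" "\<bar>phi x\<bar>"] sp phi_zero[of x] sub[OF Br_subset(2)[of x]]
      by (cases "x \<in> Br") (auto simp: abs_mult)
  qed measurable
  show "integrable lebesgue (\<lambda>x. f (x + h) * phi x)"
  proof (rule integrable_of_abs_le)
    show "(\<integral>\<^sup>+x. ennreal (?F (x + h) + \<bar>phi x\<bar> powr p) \<partial>lebesgue) < \<infinity>" by (rule fin[OF f2]) auto
    show "\<bar>f (x + h) * phi x\<bar> \<le> ?F (x + h) + \<bar>phi x\<bar> powr p" for x
      using Young_conj_exp[of p "\<bar>f (x + h)\<bar>" "\<bar>phi x\<bar>"] sp phi_zero[of x] sub[OF Br_subset(3)[of x]]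
      by (cases "x \<in> Br") (auto simp: abs_mult)
  qed measurable
qed

lemma weak_L1: "(\<integral>z. L1 z \<partial>lebesgue) = (\<integral>x. f x * phi x \<partial>lebesgue)"
  unfolding L1_def db_def
  by (rule weak) (use phi_zero Br_subset(2) phi_Lp phi_energy in auto)

text \<open>The equation for the translate comes from the original one, tested with
  \<open>phi\<close> translated by \<open>- h\<close>: translating both variables leaves
  \<open>K (x - y)\<close> unchanged and moves the shift onto \<open>u\<close> and
  \<open>f\<close>.\<close>

lemma weak_L2: "(\<integral>z. L2 z \<partial>lebesgue) = (\<integral>x. f (x + h) * phi x \<partial>lebesgue)"
proof -
  define psi where "psi x = phi (x + - h)" for x
  have [measurable]: "psi \<in> borel_measurable lebesgue" unfolding psi_def[abs_def] by measurable
  define F where "F z = Jp p (u (fst z) - u (snd z)) / K (fst z - snd z) * (psi (fst z) - psi (snd z))" for z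
  have [measurable]: "F \<in> borel_measurable lebesgue" unfolding F_def[abs_def] Jp_def by measurable
  have "(\<integral>z. F z \<partial>lebesgue) = (\<integral>x. f x * psi x \<partial>lebesgue)"
    unfolding F_def
  proof (rule weak)
    show "psi x = 0" if "x \<notin> ball x0 (3/4 * R)" for x
      using that Br_subset(4)[of x] phi_zero[of "x - h"] by (auto simp: psi_def)
    show "(\<integral>\<^sup>+x. ennreal (\<bar>psi x\<bar> powr p) \<partial>lebesgue) < \<infinity>"
      unfolding psi_def
      by (subst nn_integral_lebesgue_shift[of "\<lambda>x. ennreal (\<bar>phi x\<bar> powr p)"]) (use phi_Lp in auto)
    define G where "G z = \<bar>phi (fst z) - phi (snd z)\<bar> powr p * mu s p z" for z
    have [measurable]: "G \<in> borel_measurable lebesgue" unfolding G_def[abs_def] by measurable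
    have "(\<integral>\<^sup>+z. ennreal (\<bar>psi (fst z) - psi (snd z)\<bar> powr p * mu s p z) \<partial>lebesgue) = (\<integral>\<^sup>+z. ennreal (G (z + (- h, - h))) \<partial>lebesgue)"
      by (simp add: G_def psi_def mu_def)
    also have "\<dots> < \<infinity>"
      by (subst nn_integral_lebesgue_shift[of "\<lambda>z. ennreal (G z)"]) (use phi_energy in \<open>auto simp: G_def\<close>)
    finally show "(\<integral>\<^sup>+z. ennreal (\<bar>psi (fst z) - psi (snd z)\<bar> powr p * mu s p z) \<partial>lebesgue) < \<infinity>" .
  qed measurable
  moreover have "(\<integral>z. L2 z \<partial>lebesgue) = (\<integral>z. F (z + (h, h)) \<partial>lebesgue)"
    by (simp add: L2_def F_def da_def psi_def)
  moreover have "(\<integral>z. F (z + (h, h)) \<partial>lebesgue) = (\<integral>z. F z \<partial>lebesgue)"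
    by (rule integral_lebesgue_shift) measurable
  moreover have "(\<integral>x. f (x + h) * psi (x + h) \<partial>lebesgue) = (\<integral>x. f x * psi x \<partial>lebesgue)"
    by (rule integral_lebesgue_shift[of "\<lambda>x. f x * psi x"]) measurable
  ultimately show ?thesis by (simp add: psi_def)
qed

text \<open>The square and the remainder of the algebraic identity for
  \<open>(w - w') * (phi - phi')\<close>, both with the weight \<open>Jq / K\<close>; the square is
  nonnegative and is the quantity to be bounded.\<close>

definition Pg :: "'a \<times> 'a \<Rightarrow> real" where
  "Pg z = Jq p (da z) (db z) * (eta (fst z) * w (fst z) - eta (snd z) * w (snd z))\<^sup>2 / K (fst z - snd z)"
definition Qg :: "'a \<times> 'a \<Rightarrow> real" where
  "Qg z = Jq p (da z) (db z) * (w (fst z) * w (snd z) * (eta (fst z) - eta (snd z))\<^sup>2) / K (fst z - snd z)"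

lemma measurable_PQ [measurable]: "Pg \<in> borel_measurable lebesgue" "Qg \<in> borel_measurable lebesgue"
  unfolding Pg_def[abs_def] Qg_def[abs_def] Jq_def Jp_def by measurable

lemma Jq_nonneg: "0 \<le> Jq p a b"
  by (rule order_trans[OF _ Jq_bounds(1)[OF p]]) simp

lemma Pg_nonneg: "0 \<le> Pg z"
  using Jq_nonneg K_mu(3)[of z] by (simp add: Pg_def)

lemma L_eq: "L2 z - L1 z = Pg z - Qg z"
proof -
  obtain x y where z: "z = (x, y)" by fastforce
  have "L2 z - L1 z = (Jp p (da z) - Jp p (db z)) * (phi x - phi y) / K (x - y)"
    by (simp add: L1_def L2_def z left_diff_distrib diff_divide_distrib)
  also have "\<dots> = Jq p (da z) (db z) * ((w x - w y) * (phi x - phi y)) / K (x - y)"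
    using da_db[of z] by (simp add: Jq_eq z)
  also have "(w x - w y) * (phi x - phi y) = (eta x * w x - eta y * w y)\<^sup>2 - w x * w y * (eta x - eta y)\<^sup>2"
    by (simp add: phi_def power2_eq_square algebra_simps)
  finally show ?thesis by (simp add: Pg_def Qg_def z right_diff_distrib diff_divide_distrib)
qed

lemma Qg_bound: "\<bar>Qg z\<bar> \<le> p * \<Lambda> * T z"
proof -
  obtain x y where z: "z = (x, y)" by fastforce
  let ?W = "\<bar>w x\<bar> * \<bar>w y\<bar> * (eta x - eta y)\<^sup>2"
  have "\<bar>Qg z\<bar> = Jq p (da z) (db z) * ?W * (1 / K (x - y))"
    using Jq_nonneg[of "da z" "db z"] K_mu(3)[of z] by (simp add: Qg_def z abs_mult)
  also have "\<dots> \<le> p * (\<bar>da z\<bar> + \<bar>db z\<bar>) powr (p - 2) * ?W * (\<Lambda> * mu s p z)"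
    using K_mu[of z] p Jq_bounds(2)[OF p] by (intro mult_mono) (auto simp: z)
  also have "\<dots> = p * \<Lambda> * T z"
  proof -
    have "(eta x - eta y)\<^sup>2 = \<bar>eta x - eta y\<bar> * \<bar>eta x - eta y\<bar>"
      by (simp add: power2_eq_square abs_mult_self_eq)
    then show ?thesis by (simp add: T_def z mult_ac)
  qed
  finally show ?thesis .
qed

definition cP :: real where "cP = (cf + C) + p * \<Lambda> * (2 * cT)"

lemma cP: "0 \<le> cP" using cf C cT p \<Lambda> by (simp add: cP_def)

lemma e_s_le: "e powr s \<le> ka"
  using e t by (auto simp: ka_def intro: powr_mono')

lemma Pg_bound: "(\<integral>\<^sup>+z. ennreal (Pg z) \<partial>lebesgue) \<le> ennreal (cP * (la * ka * En))"
proof -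
  have Tfin: "(\<integral>\<^sup>+z. ennreal (p * \<Lambda> * T z) \<partial>lebesgue) \<le> ennreal (p * \<Lambda> * (2 * la * ka * cT * En))"
    by (rule nn_integral_scale[OF _ _ _ T_bound]) (use p \<Lambda> in auto)
  have Q: "integrable lebesgue Qg"
    by (rule integrable_of_abs_le[OF _ Qg_bound]) (auto intro: le_less_trans[OF Tfin])
  \<comment> \<open>Read this way, the identity yields the integrability of \<open>Pg\<close>, which
    is not known beforehand, from that of the other three terms.\<close>
  have "Pg = (\<lambda>z. (L2 z - L1 z) + Qg z)"
    using L_eq by (simp add: fun_eq_iff)
  then have P: "integrable lebesgue Pg" and "(\<integral>z. Pg z \<partial>lebesgue) = (\<integral>z. L2 z \<partial>lebesgue) - (\<integral>z. L1 z \<partial>lebesgue) + (\<integral>z. Qg z \<partial>lebesgue)"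
    using Q L_integrable by (auto simp: Bochner_Integration.integral_add Bochner_Integration.integral_diff)
  then have eq: "(\<integral>z. Pg z \<partial>lebesgue) = (\<integral>x. (f (x + h) - f x) * phi x \<partial>lebesgue) + (\<integral>z. Qg z \<partial>lebesgue)"
    using f_phi_integrable by (simp add: weak_L1 weak_L2 left_diff_distrib)
  have "integrable lebesgue (\<lambda>x. (f (x + h) - f x) * phi x)"
    using f_phi_integrable by (simp add: left_diff_distrib)
  then have "ennreal \<bar>\<integral>x. (f (x + h) - f x) * phi x \<partial>lebesgue\<bar> \<le> (\<integral>\<^sup>+x. ennreal (\<bar>(f (x + h) - f x) * phi x\<bar>) \<partial>lebesgue)"
    using integral_norm_bound_ennreal[of lebesgue "\<lambda>x. (f (x + h) - f x) * phi x"] by simp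
  also have "\<dots> \<le> ennreal (e powr s * la * (cf + C) * En)"
    using f_bound by (simp add: phi_def)
  finally have 1: "(\<integral>x. (f (x + h) - f x) * phi x \<partial>lebesgue) \<le> e powr s * la * (cf + C) * En"
    using la_ka cf C En by (subst (asm) ennreal_le_iff) auto
  have "ennreal \<bar>\<integral>z. Qg z \<partial>lebesgue\<bar> \<le> (\<integral>\<^sup>+z. ennreal (\<bar>Qg z\<bar>) \<partial>lebesgue)"
    using integral_norm_bound_ennreal[OF Q] by simp
  also have "\<dots> \<le> ennreal (p * \<Lambda> * (2 * la * ka * cT * En))"
    by (rule nn_integral_le_mono[OF Qg_bound Tfin])
  finally have 2: "(\<integral>z. Qg z \<partial>lebesgue) \<le> p * \<Lambda> * (2 * la * ka * cT * En)"
    using la_ka cT En p \<Lambda> by (subst (asm) ennreal_le_iff) auto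
  have "e powr s * la * (cf + C) * En \<le> ka * la * (cf + C) * En"
    using e_s_le la_ka cf C En by (intro mult_right_mono) auto
  then have "(\<integral>z. Pg z \<partial>lebesgue) \<le> cP * (la * ka * En)"
    using 1 2 unfolding eq cP_def by (simp add: algebra_simps)
  then show ?thesis
    using nn_integral_eq_integral[OF P] Pg_nonneg by (simp add: ennreal_leI)
qed

text \<open>\<open>2 powr (p - 2)\<close> stems from the cutoff inequality,
  \<open>2 powr (p - 1)\<close> inverts the lower bound of \<open>Jq\<close>, \<Lambda> passes from
  \<open>1 / K\<close> to \<open>mu\<close>, and the last summand is the pure cutoff error.\<close>

definition cE :: real where "cE = 2 powr (p - 2) * 2 powr (p - 1) * \<Lambda> * cP + 2 powr p * (2 * cY * C)"

lemma cE: "0 \<le> cE" using cP cY C \<Lambda> by (simp add: cE_def)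

lemma cutoff_energy: "gagliardo s p B\<rho> (\<lambda>x. eta x * w x) \<le> ennreal (cE * (la * ka * En))"
proof -
  let ?v = "\<lambda>x. eta x * w x"
  let ?c = "2 powr (p - 2) * 2 powr (p - 1) * \<Lambda>"
  have YZ: "(\<integral>\<^sup>+z. ennreal (1 * (indicator B\<rho> (fst z) * Yp z) + 1 * (indicator B\<rho> (snd z) * Zp z)) \<partial>lebesgue)
     \<le> ennreal (1 * (cY * C * la powr p * En) + 1 * (cY * C * la powr p * En))"
    by (rule nn_integral_combine[OF _ _ _ _ _ _ _ _ _ Y_bound Y_bound_swap]) (use cY C En in auto)
  have "gagliardo s p B\<rho> ?v \<le> ennreal (?c * (cP * (la * ka * En)) + 2 powr p * (1 * (cY * C * la powr p * En) + 1 * (cY * C * la powr p * En)))"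
    unfolding gagliardo_def
  proof (rule nn_integral_combine[OF _ _ _ _ _ _ _ _ _ Pg_bound YZ])
    fix z :: "'a \<times> 'a"
    obtain x y where z: "z = (x, y)" by fastforce
    show "indicator B\<rho> (fst z) * indicator B\<rho> (snd z) * norm (?v (fst z) - ?v (snd z)) powr p /
        norm (fst z - snd z) powr (real DIM('a) + s * p) \<le>
      ?c * Pg z + 2 powr p * (1 * (indicator B\<rho> (fst z) * Yp z) + 1 * (indicator B\<rho> (snd z) * Zp z))"
    proof (cases "x \<in> B\<rho> \<and> y \<in> B\<rho>")
      case True
      let ?d = "(?v x - ?v y)\<^sup>2" and ?J = "Jq p (da z) (db z)"
      have "2 powr (1 - p) * \<bar>w x - w y\<bar> powr (p - 2) \<le> ?J"
        using Jq_bounds(1)[OF p, of "da z" "db z"] da_db[of z] by (simp add: z)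
      then have "2 powr (p - 1) * (2 powr (1 - p) * \<bar>w x - w y\<bar> powr (p - 2)) \<le> 2 powr (p - 1) * ?J"
        by (intro mult_left_mono) auto
      then have J: "\<bar>w x - w y\<bar> powr (p - 2) \<le> 2 powr (p - 1) * ?J"
        by (simp flip: mult.assoc powr_add)
      have "\<bar>?v x - ?v y\<bar> powr p * mu s p z \<le>
        (2 powr (p - 2) * (\<bar>w x - w y\<bar> powr (p - 2) * ?d) + \<bar>eta x - eta y\<bar> powr p * (\<bar>w x\<bar> + \<bar>w y\<bar>) powr p) * mu s p z"
        by (intro mult_right_mono cutoff_diff_powr_le p eta_bounds) auto
      also have "\<dots> = 2 powr (p - 2) * (\<bar>w x - w y\<bar> powr (p - 2) * ?d) * mu s p z + \<bar>eta x - eta y\<bar> powr p * (\<bar>w x\<bar> + \<bar>w y\<bar>) powr p * mu s p z"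
        by (simp add: algebra_simps)
      also have "2 powr (p - 2) * (\<bar>w x - w y\<bar> powr (p - 2) * ?d) * mu s p z
         \<le> 2 powr (p - 2) * ((2 powr (p - 1) * ?J) * ?d) * (\<Lambda> * (1 / K (fst z - snd z)))"
        using K_mu[of z] Jq_nonneg by (intro mult_mono mult_left_mono mult_right_mono J) auto
      also have "\<dots> = ?c * Pg z" by (simp add: Pg_def z)
      also have "\<bar>eta x - eta y\<bar> powr p * (\<bar>w x\<bar> + \<bar>w y\<bar>) powr p * mu s p z
         \<le> \<bar>eta x - eta y\<bar> powr p * (2 powr p * (\<bar>w x\<bar> powr p + \<bar>w y\<bar> powr p)) * mu s p z"
        using sp by (intro mult_right_mono mult_left_mono powr_sum_le) auto
      also have "\<dots> = 2 powr p * (1 * (indicator B\<rho> (fst z) * Yp z) + 1 * (indicator B\<rho> (snd z) * Zp z))"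
        using True by (simp add: Yp_def Zp_def z algebra_simps)
      finally show ?thesis using True by (simp add: z mu_def)
    next
      case False
      then have "0 \<le> ?c * Pg z + 2 powr p * (1 * (indicator B\<rho> (fst z) * Yp z) + 1 * (indicator B\<rho> (snd z) * Zp z))"
        using Pg_nonneg[of z] \<Lambda> by simp
      then show ?thesis using False by (auto simp: z)
    qed
  qed (use Pg_nonneg cP la_ka cY C En \<Lambda> in auto)
  also have "\<dots> \<le> ennreal (cE * (la * ka * En))"
  proof (rule ennreal_leI)
    \<comment> \<open>The cutoff error is of order \<open>la powr p\<close>. Since
      \<open>p \<ge> 2\<close> and \<open>la \<le> ka \<le> 1\<close>, it is absorbed by
      \<open>la * ka\<close>.\<close>
    have "la powr p \<le> la powr 2" using la_ka p by (intro powr_mono') auto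
    also have "la powr 2 = la * la" using la_ka by (simp add: power2_eq_square)
    also have "\<dots> \<le> la * ka" using la_ka by (intro mult_left_mono) auto
    finally have "2 powr p * (2 * (cY * C) * En) * la powr p \<le> 2 powr p * (2 * (cY * C) * En) * (la * ka)"
      using cY C En by (intro mult_left_mono) auto
    then show "?c * (cP * (la * ka * En)) + 2 powr p * (1 * (cY * C * la powr p * En) + 1 * (cY * C * la powr p * En)) \<le> cE * (la * ka * En)"
      by (simp add: cE_def algebra_simps)
  qed
  finally show ?thesis .
qed

text \<open>Where \<open>eta\<close> is 1 both at \<open>x\<close> and at \<open>x + k\<close>, the
  difference of \<open>eta * w\<close> is a second difference of \<open>u\<close>. Enlarging
  \<open>norm k\<close> to \<open>norm h\<close> in the result gives one bound for all increments
  not longer than \<open>h\<close>.\<close>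

lemma second_difference:
  assumes k: "0 < norm k" "norm k \<le> norm h"
  shows "(\<integral>\<^sup>+x. ennreal (indicator (ball x0 (\<rho>' * R)) x * \<bar>w (x + k) - w x\<bar> powr p) \<partial>lebesgue)
    \<le> ennreal (cb * cE * (norm h / R) powr (s * p + t + \<tau>) * A)"
proof -
  let ?v = "\<lambda>x. eta x * w x"
  have kd: "norm k \<le> d * R" using k h by linarith
  have r: "\<rho>' * R + 2 * norm k \<le> \<rho> * R"
    using radii kd dR by (simp add: algebra_simps)
  have "(\<integral>\<^sup>+x. ennreal (indicator (ball x0 (\<rho>' * R)) x * \<bar>?v (x + k) - ?v x\<bar> powr p) \<partial>lebesgue)
    \<le> ennreal (2 powr p * 2 * 2 powr (real DIM('a) + s * p) / unit_ball_vol (real DIM('a)) * norm k powr (s * p) * (cE * (la * ka * En)))"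
    by (rule nn_integral_translate_le_gagliardo[OF _ _ _ _ r cutoff_energy]) (use sp s k cE la_ka En in auto)
  also have "\<dots> \<le> ennreal (cb * cE * (norm h / R) powr (s * p + t + \<tau>) * A)"
  proof (rule ennreal_leI)
    have "cb * norm k powr (s * p) * (cE * (la * ka * En)) \<le> cb * norm h powr (s * p) * (cE * (la * ka * En))"
      using cb cE la_ka En k sp by (intro mult_right_mono mult_left_mono powr_mono2) auto
    also have "norm h powr (s * p) = e powr (s * p) * R powr (s * p)"
      using e R by (simp add: powr_mult)
    also have "cb * (e powr (s * p) * R powr (s * p)) * (cE * (la * ka * En)) = cb * cE * (e powr (s * p) * la * ka) * A"
      using R by (simp add: En_def powr_minus field_simps)
    also have "e powr (s * p) * la * ka = (norm h / R) powr (s * p + t + \<tau>)"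
      by (simp add: la_def ka_def e_def powr_add)
    finally show "2 powr p * 2 * 2 powr (real DIM('a) + s * p) / unit_ball_vol (real DIM('a)) * norm k powr (s * p) * (cE * (la * ka * En)) \<le> cb * cE * (norm h / R) powr (s * p + t + \<tau>) * A"
      by (simp add: cb_def)
  qed
  finally have *: "(\<integral>\<^sup>+x. ennreal (indicator (ball x0 (\<rho>' * R)) x * \<bar>?v (x + k) - ?v x\<bar> powr p) \<partial>lebesgue) \<le> ennreal (cb * cE * (norm h / R) powr (s * p + t + \<tau>) * A)" .
  show ?thesis
  proof (rule nn_integral_le_mono[OF _ *])
    fix x
    show "indicator (ball x0 (\<rho>' * R)) x * \<bar>w (x + k) - w x\<bar> powr p \<le> indicator (ball x0 (\<rho>' * R)) x * \<bar>?v (x + k) - ?v x\<bar> powr p"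
    proof (cases "x \<in> ball x0 (\<rho>' * R)")
      case True
      then have x: "norm (x - x0) < \<rho>' * R" by (simp add: dist_norm norm_minus_commute)
      have "norm (x + k - x0) \<le> norm (x - x0) + norm k"
        using norm_triangle_ineq[of "x - x0" k] by (simp add: algebra_simps)
      then have "norm (x - x0) \<le> (\<rho>' + 2 * d) * R" "norm (x + k - x0) \<le> (\<rho>' + 2 * d) * R"
        using x kd dR by (simp_all add: algebra_simps)
      then show ?thesis by (simp add: eta_one)
    qed simp
  qed
qed

end

section \<open>Improvement of the differentiability exponent\<close>

text \<open>A Nikolskii condition of order \<tau> in scale-invariant form, with radii and steps in
  units of \<open>R\<close>.\<close>

definition diff_bound :: "real \<Rightarrow> ('a::euclidean_space \<Rightarrow> real) \<Rightarrow> 'a \<Rightarrow> real \<Rightarrow> real \<Rightarrow> real \<Rightarrow> real \<Rightarrow> real \<Rightarrow> real \<Rightarrow> bool" where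
  "diff_bound p u x0 R A \<tau> \<rho> C c \<longleftrightarrow> (\<forall>h. 0 < norm h \<and> norm h \<le> c * R \<longrightarrow>
     (\<integral>\<^sup>+x. ennreal (indicator (ball x0 (\<rho> * R)) x * \<bar>u (x + h) - u x\<bar> powr p) \<partial>lebesgue)
       \<le> ennreal (C * (norm h / R) powr (\<tau> * p) * A))"

text \<open>Two increments are allowed: \<open>k = h\<close> serves to halve a step, and a shorter
  arbitrary \<open>k\<close> serves to translate a difference quotient.\<close>

definition diff2_bound :: "real \<Rightarrow> ('a::euclidean_space \<Rightarrow> real) \<Rightarrow> 'a \<Rightarrow> real \<Rightarrow> real \<Rightarrow> real \<Rightarrow> real \<Rightarrow> real \<Rightarrow> real \<Rightarrow> bool" where
  "diff2_bound p u x0 R A \<sigma> \<rho> C c \<longleftrightarrow> (\<forall>h k. 0 < norm h \<and> norm h \<le> c * R \<and> 0 < norm k \<and> norm k \<le> norm h \<longrightarrow>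
     (\<integral>\<^sup>+x. ennreal (indicator (ball x0 (\<rho> * R)) x * \<bar>(u (x + k + h) - u (x + k)) - (u (x + h) - u x)\<bar> powr p) \<partial>lebesgue)
       \<le> ennreal (C * (norm h / R) powr (\<sigma> * p) * A))"

text \<open>Hiding \<open>K\<close> and \<open>f\<close> makes it impossible for the constants below
  to depend on them.\<close>

definition admissible :: "real \<Rightarrow> real \<Rightarrow> real \<Rightarrow> real \<Rightarrow> real \<Rightarrow> real \<Rightarrow> ('a::euclidean_space \<Rightarrow> real) \<Rightarrow> 'a \<Rightarrow> real \<Rightarrow> real \<Rightarrow> bool" where
  "admissible p s t \<Lambda> kf kn u x0 R A \<longleftrightarrow> (\<exists>K f. controlled p s t \<Lambda> kf kn K f u x0 R A)"

text \<open>The constants precede \<open>u\<close> and the ball; in this form the dependence on the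
  parameters alone survives any number of iteration steps.\<close>

definition uniform_diff :: "(('a::euclidean_space \<Rightarrow> real) \<Rightarrow> 'a \<Rightarrow> real \<Rightarrow> real \<Rightarrow> bool) \<Rightarrow> real \<Rightarrow> real \<Rightarrow> real \<Rightarrow> bool" where
  "uniform_diff S p \<tau> \<rho> \<longleftrightarrow> (\<exists>C c. 0 < C \<and> 0 < c \<and> c \<le> 1 / 32 \<and> (\<forall>u x0 R A. S u x0 R A \<longrightarrow> diff_bound p u x0 R A \<tau> \<rho> C c))"

definition uniform_diff2 :: "(('a::euclidean_space \<Rightarrow> real) \<Rightarrow> 'a \<Rightarrow> real \<Rightarrow> real \<Rightarrow> bool) \<Rightarrow> real \<Rightarrow> real \<Rightarrow> real \<Rightarrow> bool" where
  "uniform_diff2 S p \<sigma> \<rho> \<longleftrightarrow> (\<exists>C c. 0 < C \<and> 0 < c \<and> c \<le> 1 / 32 \<and> (\<forall>u x0 R A. S u x0 R A \<longrightarrow> diff2_bound p u x0 R A \<sigma> \<rho> C c))"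

lemma uniform_diff_base:
  "uniform_diff (admissible p s t \<Lambda> kf kn :: ('a::euclidean_space \<Rightarrow> real) \<Rightarrow> _) p s (5/8)"
proof -
  let ?C = "2 powr p * 2 * 2 powr (real DIM('a) + s * p) / unit_ball_vol (real DIM('a))"
  have "diff_bound p u x0 R A s (5/8) ?C (1/32)" if adm: "admissible p s t \<Lambda> kf kn u x0 R A"
    for u and x0 :: 'a and R A
  proof -
    obtain K f where "controlled p s t \<Lambda> kf kn K f u x0 R A"
      using adm by (auto simp: admissible_def)
    then interpret controlled p s t \<Lambda> kf kn K f u x0 R A .
    show ?thesis
      unfolding diff_bound_def
    proof (intro allI impI)
      fix h :: 'a assume h: "0 < norm h \<and> norm h \<le> 1 / 32 * R"
      have b: "norm h \<le> R / 16" using h R by linarith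
      show "(\<integral>\<^sup>+x. ennreal (indicator (ball x0 (5/8 * R)) x * \<bar>u (x + h) - u x\<bar> powr p) \<partial>lebesgue)
        \<le> ennreal (?C * (norm h / R) powr (s * p) * A)"
        by (rule nn_integral_le_mono[OF _ translates_base[OF _ b]]) (use h R in \<open>auto simp: indicator_def\<close>)
    qed
  qed
  then show ?thesis
    unfolding uniform_diff_def by (intro exI[of _ ?C] exI[of _ "1/32"]) auto
qed

lemma uniform_diff2_of_uniform_diff:
  assumes H: "uniform_diff (admissible p s t \<Lambda> kf kn :: ('a::euclidean_space \<Rightarrow> real) \<Rightarrow> _) p \<tau> \<rho>"
    and \<tau>: "t \<le> \<tau>" and \<rho>: "0 \<le> \<rho>'" "\<rho>' < \<rho>" "\<rho> \<le> 5 / 8" and p: "0 < p"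
  shows "uniform_diff2 (admissible p s t \<Lambda> kf kn :: ('a \<Rightarrow> real) \<Rightarrow> _) p ((s * p + t + \<tau>) / p) \<rho>'"
proof -
  obtain C c where C: "0 < C" "0 < c" "c \<le> 1 / 32"
    and HC: "\<And>(u :: 'a \<Rightarrow> real) x0 R A. admissible p s t \<Lambda> kf kn u x0 R A \<Longrightarrow> diff_bound p u x0 R A \<tau> \<rho> C c"
    using H unfolding uniform_diff_def by auto
  define d where "d = min c ((\<rho> - \<rho>') / 4)"
  have d: "0 < d" "d \<le> 1 / 32" "\<rho>' + 4 * d \<le> \<rho>" "d \<le> c"
  proof -
    show "0 < d" "d \<le> c" using C \<rho> by (auto simp: d_def)
    then show "d \<le> 1 / 32" using C by linarith
    have "d \<le> (\<rho> - \<rho>') / 4" unfolding d_def by (rule min.cobounded2)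
    then show "\<rho>' + 4 * d \<le> \<rho>" by (simp add: field_simps)
  qed
  \<comment> \<open>The constants exported from the locale depend only on the arguments displayed,
    hence neither on \<open>h\<close> nor on \<open>u\<close> or the ball, and can be fixed here.
    Absolute value and summand 1 ensure positivity.\<close>
  define C2 where "C2 = \<bar>energy.cb TYPE('a) p s * energy.cE TYPE('a) p s \<Lambda> kf kn d C\<bar> + 1"
  have "diff2_bound p u x0 R A ((s * p + t + \<tau>) / p) \<rho>' C2 d"
    if S: "admissible p s t \<Lambda> kf kn u x0 R A" for u and x0 :: 'a and R A
  proof -
    obtain K f where "controlled p s t \<Lambda> kf kn K f u x0 R A"
      using S by (auto simp: admissible_def)
    then interpret controlled p s t \<Lambda> kf kn K f u x0 R A .
    show ?thesis
      unfolding diff2_bound_def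
    proof (intro allI impI)
      fix h k :: 'a assume hk: "0 < norm h \<and> norm h \<le> d * R \<and> 0 < norm k \<and> norm k \<le> norm h"
      have hc: "norm h \<le> c * R" using hk d(4) R mult_right_mono[of d c R] by linarith
      interpret energy p s t \<Lambda> kf kn K f u x0 R A h \<rho> \<rho>' d \<tau> C
        by unfold_locales (use d \<rho> hk \<tau> C HC[OF S] hc in \<open>auto simp: diff_bound_def\<close>)
      have "(\<integral>\<^sup>+x. ennreal (indicator (ball x0 (\<rho>' * R)) x * \<bar>w (x + k) - w x\<bar> powr p) \<partial>lebesgue)
        \<le> ennreal (energy.cb TYPE('a) p s * energy.cE TYPE('a) p s \<Lambda> kf kn d C * (norm h / R) powr (s * p + t + \<tau>) * A)"
        by (rule second_difference) (use hk in auto)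
      also have "\<dots> \<le> ennreal (C2 * (norm h / R) powr ((s * p + t + \<tau>) / p * p) * A)"
      proof -
        have "energy.cb TYPE('a) p s * energy.cE TYPE('a) p s \<Lambda> kf kn d C \<le> C2"
          unfolding C2_def by linarith
        moreover have "(s * p + t + \<tau>) / p * p = s * p + t + \<tau>" using sp by simp
        ultimately show ?thesis using A by (simp only:) (intro ennreal_leI mult_right_mono, auto)
      qed
      finally show "(\<integral>\<^sup>+x. ennreal (indicator (ball x0 (\<rho>' * R)) x * \<bar>(u (x + k + h) - u (x + k)) - (u (x + h) - u x)\<bar> powr p) \<partial>lebesgue)
        \<le> ennreal (C2 * (norm h / R) powr ((s * p + t + \<tau>) / p * p) * A)"
        by (simp add: w_def)
    qed
  qed
  moreover have "0 < C2" by (simp add: C2_def)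
  ultimately show ?thesis
    unfolding uniform_diff2_def using d by blast
qed

section \<open>From second differences back to first differences\<close>

context controlled
begin

lemma diff_trivial_bound:
  assumes h: "norm h \<le> R / 4" and \<rho>: "\<rho> \<le> 5 / 8"
  shows "(\<integral>\<^sup>+x. ennreal (indicator (ball x0 (\<rho> * R)) x * \<bar>u (x + h) - u x\<bar> powr p) \<partial>lebesgue) \<le> ennreal (2 powr (p + 1) * A)"
proof -
  let ?F = "\<lambda>x. indicator (ball x0 R) x * \<bar>u x\<bar> powr p"
  have F': "(\<integral>\<^sup>+x. ennreal (?F (x + h)) \<partial>lebesgue) \<le> ennreal A"
    using u_Lp by (subst nn_integral_lebesgue_shift[of "\<lambda>x. ennreal (?F x)"]) auto
  have "(\<integral>\<^sup>+x. ennreal (indicator (ball x0 (\<rho> * R)) x * \<bar>u (x + h) - u x\<bar> powr p) \<partial>lebesgue) \<le> ennreal (2 powr p * A + 2 powr p * A)"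
  proof (rule nn_integral_combine[OF _ _ _ _ _ _ _ _ _ F' u_Lp])
    fix x
    show "indicator (ball x0 (\<rho> * R)) x * \<bar>u (x + h) - u x\<bar> powr p \<le> 2 powr p * ?F (x + h) + 2 powr p * ?F x"
    proof (cases "x \<in> ball x0 (\<rho> * R)")
      case True
      have r: "\<rho> * R \<le> 5 / 8 * R" using \<rho> R by (intro mult_right_mono) auto
      have "dist x0 x < \<rho> * R" using True by simp
      moreover have "dist x0 (x + h) \<le> dist x0 x + norm h"
        using norm_triangle_ineq4[of "x0 - x" h] by (simp add: dist_norm algebra_simps)
      ultimately have "dist x0 x < R" "dist x0 (x + h) < R" using h R r by linarith+
      then show ?thesis using True powr_diff_le[of p "u (x + h)" "u x"] sp by (simp add: algebra_simps)
    qed simp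
  qed (use A in auto)
  then show ?thesis by (simp add: powr_add mult_ac)
qed

text \<open>The difference at step \<open>h\<close> is half the difference at \<open>2 * h\<close>
  minus half a second difference. This gives a recursion for the \<open>L^p\<close> norms in the
  variable \<open>e = norm h / R\<close>, and \<open>g\<close> is any majorant of it; its choice is
  left open because exponents below 1 and the exponent 1 need different ones. Steps comparable to
  \<open>c * R\<close> require only the trivial bound, whose constant appears in
  \<open>g_base\<close>.\<close>

lemma diff_bound_of_diff2:
  fixes g :: "real \<Rightarrow> real"
  assumes S: "diff2_bound p u x0 R A \<sigma> \<rho> C c" and C: "0 < C" and c: "0 < c" "c \<le> 1 / 32" and \<rho>: "\<rho> \<le> 5 / 8"
    and g_pos: "\<And>e. 0 < e \<Longrightarrow> e \<le> c \<Longrightarrow> 0 < g e"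
    and g_base: "\<And>e. c < 2 * e \<Longrightarrow> e \<le> c \<Longrightarrow> 2 powr ((p + 1) / p) \<le> g e"
    and g_step: "\<And>e. 0 < e \<Longrightarrow> 2 * e \<le> c \<Longrightarrow> g (2 * e) / 2 + C powr (1 / p) * e powr \<sigma> / 2 \<le> g e"
    and h: "0 < norm h" "norm h \<le> c * R"
  shows "(\<integral>\<^sup>+x. ennreal (indicator (ball x0 (\<rho> * R)) x * \<bar>u (x + h) - u x\<bar> powr p) \<partial>lebesgue)
     \<le> ennreal ((g (norm h / R) * A powr (1 / p)) powr p)"
proof -
  have Ap: "0 < A powr (1 / p)" "(A powr (1 / p)) powr p = A"
    using A sp by (auto simp: powr_powr)
  have base: "(\<integral>\<^sup>+x. ennreal (indicator (ball x0 (\<rho> * R)) x * \<bar>u (x + h) - u x\<bar> powr p) \<partial>lebesgue)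
     \<le> ennreal ((g (norm h / R) * A powr (1 / p)) powr p)"
    if "norm h \<le> c * R" "c * R < 2 * norm h" for h
  proof -
    have "norm h \<le> R / 4" using that c R mult_right_mono[of c "1/32" R] by linarith
    then have "(\<integral>\<^sup>+x. ennreal (indicator (ball x0 (\<rho> * R)) x * \<bar>u (x + h) - u x\<bar> powr p) \<partial>lebesgue) \<le> ennreal (2 powr (p + 1) * A)"
      by (rule diff_trivial_bound[OF _ \<rho>])
    also have "\<dots> \<le> ennreal ((g (norm h / R) * A powr (1 / p)) powr p)"
    proof (rule ennreal_leI)
      have "2 powr ((p + 1) / p) \<le> g (norm h / R)"
        using that R by (intro g_base) (auto simp: field_simps)
      then have "(2 powr ((p + 1) / p) * A powr (1 / p)) powr p \<le> (g (norm h / R) * A powr (1 / p)) powr p"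
        using sp by (intro powr_mono2 mult_right_mono) auto
      then show "2 powr (p + 1) * A \<le> (g (norm h / R) * A powr (1 / p)) powr p"
        using A sp by (simp add: powr_mult powr_powr)
    qed
    finally show ?thesis .
  qed
  \<comment> \<open>Induction on the number of doublings after which the step exceeds
    \<open>c * R\<close>.\<close>
  have main: "(\<integral>\<^sup>+x. ennreal (indicator (ball x0 (\<rho> * R)) x * \<bar>u (x + h) - u x\<bar> powr p) \<partial>lebesgue)
     \<le> ennreal ((g (norm h / R) * A powr (1 / p)) powr p)"
    if "0 < norm h" "norm h \<le> c * R" "c * R < 2 ^ Suc n * norm h" for n h
    using that
  proof (induction n arbitrary: h)
    case 0
    then show ?case by (intro base) auto
  next
    case (Suc n)
    show ?case
    proof (cases "c * R < 2 * norm h")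
      case True
      then show ?thesis using Suc.prems by (intro base) auto
    next
      case False
      define e where "e = norm h / R"
      have e: "0 < e" "2 * e \<le> c" using Suc.prems False R by (auto simp: e_def field_simps)
      have IH: "(\<integral>\<^sup>+x. ennreal (indicator (ball x0 (\<rho> * R)) x * \<bar>u (x + 2 *\<^sub>R h) - u x\<bar> powr p) \<partial>lebesgue)
         \<le> ennreal ((g (2 * e) * A powr (1 / p)) powr p)"
        using Suc.IH[of "2 *\<^sub>R h"] Suc.prems False by (simp add: e_def mult_ac)
      have D: "(\<integral>\<^sup>+x. ennreal (indicator (ball x0 (\<rho> * R)) x * \<bar>(u (x + h + h) - u (x + h)) - (u (x + h) - u x)\<bar> powr p) \<partial>lebesgue)
         \<le> ennreal (C * e powr (\<sigma> * p) * A)"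
        unfolding e_def by (rule S[unfolded diff2_bound_def, rule_format, of h h]) (use Suc.prems in auto)
      let ?I = "indicator (ball x0 (\<rho> * R)) :: 'a \<Rightarrow> real"
      have ip: "\<bar>?I x * r / 2\<bar> powr p = (1 / 2) powr p * (?I x * \<bar>r\<bar> powr p)" for x r
        by (simp add: indicator_def powr_divide)
      have ip': "\<bar>?I x * r\<bar> powr p = ?I x * \<bar>r\<bar> powr p" for x r
        by (simp add: indicator_def)
      have "(\<integral>\<^sup>+x. ennreal (\<bar>?I x * (u (x + h) - u x)\<bar> powr p) \<partial>lebesgue)
        \<le> ennreal ((g (2 * e) * A powr (1 / p) / 2 + C powr (1 / p) * e powr \<sigma> * A powr (1 / p) / 2) powr p)"
      proof (rule nn_integral_Minkowski[where F = "\<lambda>x. ?I x * (u (x + 2 *\<^sub>R h) - u x) / 2"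
            and G = "\<lambda>x. ?I x * ((u (x + h + h) - u (x + h)) - (u (x + h) - u x)) / 2"])
        have g2: "0 < g (2 * e)" using e by (intro g_pos) auto
        show "0 < g (2 * e) * A powr (1 / p) / 2" using g2 A by simp
        show "0 < C powr (1 / p) * e powr \<sigma> * A powr (1 / p) / 2" using C e A by simp
        show "(\<integral>\<^sup>+x. ennreal (\<bar>?I x * (u (x + 2 *\<^sub>R h) - u x) / 2\<bar> powr p) \<partial>lebesgue) \<le> ennreal ((g (2 * e) * A powr (1 / p) / 2) powr p)"
        proof -
          have "(\<integral>\<^sup>+x. ennreal (\<bar>?I x * (u (x + 2 *\<^sub>R h) - u x) / 2\<bar> powr p) \<partial>lebesgue) \<le> ennreal ((1 / 2) powr p * ((g (2 * e) * A powr (1 / p)) powr p))"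
            unfolding ip by (rule nn_integral_scale[OF _ _ _ IH]) auto
          then show ?thesis using g2 A by (simp add: powr_divide)
        qed
        show "(\<integral>\<^sup>+x. ennreal (\<bar>?I x * ((u (x + h + h) - u (x + h)) - (u (x + h) - u x)) / 2\<bar> powr p) \<partial>lebesgue)
          \<le> ennreal ((C powr (1 / p) * e powr \<sigma> * A powr (1 / p) / 2) powr p)"
        proof -
          have "(\<integral>\<^sup>+x. ennreal (\<bar>?I x * ((u (x + h + h) - u (x + h)) - (u (x + h) - u x)) / 2\<bar> powr p) \<partial>lebesgue) \<le> ennreal ((1 / 2) powr p * (C * e powr (\<sigma> * p) * A))"
            unfolding ip by (rule nn_integral_scale[OF _ _ _ D]) auto
          also have "(1 / 2) powr p * (C * e powr (\<sigma> * p) * A) = (C powr (1 / p) * e powr \<sigma> * A powr (1 / p) / 2) powr p"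
            using C e A sp by (simp add: powr_divide powr_mult powr_powr)
          finally show ?thesis .
        qed
        show "\<bar>?I x * (u (x + h) - u x)\<bar> \<le> \<bar>?I x * (u (x + 2 *\<^sub>R h) - u x) / 2\<bar> + \<bar>?I x * ((u (x + h + h) - u (x + h)) - (u (x + h) - u x)) / 2\<bar>" for x
        proof -
          have "u (x + h + h) = u (x + 2 *\<^sub>R h)" by (simp add: scaleR_2 add.assoc)
          moreover have "\<bar>b - a\<bar> \<le> \<bar>(d - a) / 2\<bar> + \<bar>((d - b) - (b - a)) / 2\<bar>" for a b d :: real
          proof -
            have "b - a = (d - a) / 2 - ((d - b) - (b - a)) / 2" by (simp add: field_simps)
            then show ?thesis by (simp only: abs_triangle_ineq4)
          qed
          ultimately show ?thesis by (simp add: indicator_def)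
        qed
      qed (use p in auto)
      also have "\<dots> \<le> ennreal ((g e * A powr (1 / p)) powr p)"
      proof (intro ennreal_leI powr_mono2)
        have "(g (2 * e) / 2 + C powr (1 / p) * e powr \<sigma> / 2) * A powr (1 / p) \<le> g e * A powr (1 / p)"
          by (intro mult_right_mono g_step e) auto
        then show "g (2 * e) * A powr (1 / p) / 2 + C powr (1 / p) * e powr \<sigma> * A powr (1 / p) / 2 \<le> g e * A powr (1 / p)"
          by (simp add: algebra_simps)
        show "0 \<le> g (2 * e) * A powr (1 / p) / 2 + C powr (1 / p) * e powr \<sigma> * A powr (1 / p) / 2"
          using g_pos[of "2 * e"] e C A by (intro add_nonneg_nonneg) auto
      qed (use sp in auto)
      finally show ?thesis unfolding ip' by (simp add: e_def)
    qed
  qed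
  obtain n where "c * R / norm h < 2 ^ n" using real_arch_pow[of 2] by auto
  then have "c * R < 2 ^ n * norm h" using h by (simp add: field_simps)
  also have "\<dots> \<le> 2 ^ Suc n * norm h" by (intro mult_right_mono) auto
  finally show ?thesis by (rule main[OF h])
qed

end

lemma uniform_diff_of_uniform_diff2:
  assumes S: "uniform_diff2 (admissible p s t \<Lambda> kf kn :: ('a::euclidean_space \<Rightarrow> real) \<Rightarrow> _) p \<sigma> \<rho>"
    and \<rho>: "\<rho> \<le> 5 / 8" and p: "0 < p" and \<tau>: "0 < \<tau>" "\<tau> < 1 \<and> \<tau> \<le> \<sigma> \<or> \<tau> = 1 \<and> 1 < \<sigma>"
  shows "uniform_diff (admissible p s t \<Lambda> kf kn :: ('a \<Rightarrow> real) \<Rightarrow> _) p \<tau> \<rho>"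
proof -
  obtain C c where C: "0 < C" "0 < c" "c \<le> 1 / 32"
    and SC: "\<And>(u :: 'a \<Rightarrow> real) x0 R A. admissible p s t \<Lambda> kf kn u x0 R A \<Longrightarrow> diff2_bound p u x0 R A \<sigma> \<rho> C c"
    using S unfolding uniform_diff2_def by auto
  let ?b = "2 powr ((p + 1) / p)" and ?k = "C powr (1 / p)"
  have k: "0 < ?k" using C by simp
  have "\<exists>g M. 0 < M \<and> (\<forall>e. 0 < e \<and> e \<le> c \<longrightarrow> 0 < g e \<and> g e \<le> M * e powr \<tau>) \<and> (\<forall>e. c < 2 * e \<and> e \<le> c \<longrightarrow> ?b \<le> g e)
    \<and> (\<forall>e. 0 < e \<and> 2 * e \<le> c \<longrightarrow> g (2 * e) / 2 + ?k * e powr \<sigma> / 2 \<le> g e)"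
    using \<tau>(2)
  proof
    assume \<tau>': "\<tau> < 1 \<and> \<tau> \<le> \<sigma>"
    have lt: "2 powr \<tau> < (2 :: real)" using \<tau>' powr_less_mono[of \<tau> 1 "2::real"] by simp
    \<comment> \<open>A pure power works for \<tau> below 1: one step of the recursion multiplies it
      by half of \<open>2 powr \<tau>\<close>, and the room \<open>2 - 2 powr \<tau>\<close> absorbs
      the second difference. The other summand covers steps near \<open>c\<close>.\<close>
    define M where "M = ?b / (c / 2) powr \<tau> + ?k / (2 - 2 powr \<tau>)"
    have M: "?b / (c / 2) powr \<tau> \<le> M" "?k / (2 - 2 powr \<tau>) \<le> M" "0 < M"
      using C k lt by (auto simp: M_def intro!: add_pos_pos)
    show ?thesis
    proof (intro exI[of _ "\<lambda>e. M * e powr \<tau>"] exI[of _ M] conjI allI impI M(3))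
      fix e :: real assume e: "c < 2 * e \<and> e \<le> c"
      have "?b = ?b / (c / 2) powr \<tau> * (c / 2) powr \<tau>" using C by simp
      also have "\<dots> \<le> M * e powr \<tau>"
        using M e C \<tau> by (intro mult_mono powr_mono2) auto
      finally show "?b \<le> M * e powr \<tau>" .
    next
      fix e :: real assume e: "0 < e \<and> 2 * e \<le> c"
      have e1: "e \<le> 1" using e C by linarith
      have "e powr \<sigma> \<le> e powr \<tau>" using e e1 \<tau>' by (intro powr_mono') auto
      then have "?k * e powr \<sigma> \<le> ?k * e powr \<tau>" using k by (intro mult_left_mono) auto
      moreover have "?k \<le> M * (2 - 2 powr \<tau>)" using M(2) lt by (simp add: field_simps)
      then have "?k * e powr \<tau> \<le> M * (2 - 2 powr \<tau>) * e powr \<tau>" by (rule mult_right_mono) simp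
      ultimately show "M * (2 * e) powr \<tau> / 2 + ?k * e powr \<sigma> / 2 \<le> M * e powr \<tau>"
        using e by (simp add: powr_mult algebra_simps)
    qed (use M in auto)
  next
    assume \<tau>': "\<tau> = 1 \<and> 1 < \<sigma>"
    have lt: "2 < (2 powr \<sigma> :: real)" using \<tau>' powr_less_mono[of 1 \<sigma> "2::real"] by simp
    \<comment> \<open>For \<tau> equal to 1 the linear function reproduces itself and leaves no
      room. The correction \<open>- L * e powr \<sigma>\<close>, with \<sigma> above 1, turns the
      recursion into an equality for this value of \<open>L\<close>.\<close>
    define L where "L = ?k / (2 powr \<sigma> - 2)"
    have L: "0 < L" using k lt by (simp add: L_def)
    define M where "M = L + 2 * ?b / c"
    have M: "L < M" "?b \<le> (M - L) * (c / 2)" using C by (auto simp: M_def)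
    have le: "e powr \<sigma> \<le> e" if "0 < e" "e \<le> c" for e
      using that C \<tau>' powr_mono'[of 1 \<sigma> e] by simp
    have low: "(M - L) * e \<le> M * e - L * e powr \<sigma>" if "0 < e" "e \<le> c" for e
      using mult_left_mono[OF le[OF that], of L] L by (simp add: algebra_simps)
    show ?thesis
    proof (intro exI[of _ "\<lambda>e. M * e - L * e powr \<sigma>"] exI[of _ M] conjI allI impI)
      show "0 < M" using L M by simp
    next
      fix e :: real assume e: "0 < e \<and> e \<le> c"
      then have "0 < (M - L) * e" using M by simp
      then show "0 < M * e - L * e powr \<sigma>" using low[of e] e by linarith
      show "M * e - L * e powr \<sigma> \<le> M * e powr \<tau>" using e L \<tau>' by simp
    next
      fix e :: real assume e: "c < 2 * e \<and> e \<le> c"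
      have "?b \<le> (M - L) * (c / 2)" by (fact M)
      also have "\<dots> \<le> (M - L) * e" using e M by (intro mult_left_mono) auto
      also have "\<dots> \<le> M * e - L * e powr \<sigma>" using e C by (intro low) auto
      finally show "?b \<le> M * e - L * e powr \<sigma>" .
    next
      fix e :: real assume e: "0 < e \<and> 2 * e \<le> c"
      have "?k = L * (2 powr \<sigma> - 2)" using lt by (simp add: L_def)
      then have "?k * e powr \<sigma> = L * (2 powr \<sigma> - 2) * e powr \<sigma>" by simp
      moreover have "(2 * e) powr \<sigma> = 2 powr \<sigma> * e powr \<sigma>" using e by (simp add: powr_mult)
      ultimately have "(M * (2 * e) - L * (2 * e) powr \<sigma>) / 2 + ?k * e powr \<sigma> / 2
          = (M * (2 * e) - L * (2 powr \<sigma> * e powr \<sigma>)) / 2 + L * (2 powr \<sigma> - 2) * e powr \<sigma> / 2"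
        by (simp only:)
      also have "\<dots> = M * e - L * e powr \<sigma>" by (simp add: field_simps)
      finally show "(M * (2 * e) - L * (2 * e) powr \<sigma>) / 2 + ?k * e powr \<sigma> / 2 \<le> M * e - L * e powr \<sigma>"
        by simp
    qed
  qed
  then obtain g M where M: "0 < M" and "\<forall>e. 0 < e \<and> e \<le> c \<longrightarrow> 0 < g e \<and> g e \<le> M * e powr \<tau>"
    "\<forall>e. c < 2 * e \<and> e \<le> c \<longrightarrow> ?b \<le> g e"
    "\<forall>e. 0 < e \<and> 2 * e \<le> c \<longrightarrow> g (2 * e) / 2 + ?k * e powr \<sigma> / 2 \<le> g e"
    by (elim exE conjE)
  then have g: "\<And>e. 0 < e \<Longrightarrow> e \<le> c \<Longrightarrow> 0 < g e" "\<And>e. 0 < e \<Longrightarrow> e \<le> c \<Longrightarrow> g e \<le> M * e powr \<tau>"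
    "\<And>e. c < 2 * e \<Longrightarrow> e \<le> c \<Longrightarrow> ?b \<le> g e"
    "\<And>e. 0 < e \<Longrightarrow> 2 * e \<le> c \<Longrightarrow> g (2 * e) / 2 + ?k * e powr \<sigma> / 2 \<le> g e"
    by simp_all
  have "diff_bound p u x0 R A \<tau> \<rho> (M powr p) c" if adm: "admissible p s t \<Lambda> kf kn u x0 R A" for u and x0 :: 'a and R A
  proof -
    obtain K f where "controlled p s t \<Lambda> kf kn K f u x0 R A"
      using adm by (auto simp: admissible_def)
    then interpret controlled p s t \<Lambda> kf kn K f u x0 R A .
    show ?thesis
      unfolding diff_bound_def
    proof (intro allI impI)
      fix h :: 'a assume h: "0 < norm h \<and> norm h \<le> c * R"
      have e: "0 < norm h / R" "norm h / R \<le> c" using h R by (auto simp: field_simps)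
      have "(\<integral>\<^sup>+x. ennreal (indicator (ball x0 (\<rho> * R)) x * \<bar>u (x + h) - u x\<bar> powr p) \<partial>lebesgue)
        \<le> ennreal ((g (norm h / R) * A powr (1 / p)) powr p)"
        by (rule diff_bound_of_diff2[OF SC[OF adm] C \<rho> g(1,3,4)]) (use h in auto)
      also have "\<dots> \<le> ennreal ((M * (norm h / R) powr \<tau> * A powr (1 / p)) powr p)"
        using g(1,2)[OF e] sp by (intro ennreal_leI powr_mono2 mult_right_mono mult_nonneg_nonneg) auto
      also have "(M * (norm h / R) powr \<tau> * A powr (1 / p)) powr p = M powr p * (norm h / R) powr (\<tau> * p) * A"
        using M e A sp by (simp add: powr_mult powr_powr)
      finally show "(\<integral>\<^sup>+x. ennreal (indicator (ball x0 (\<rho> * R)) x * \<bar>u (x + h) - u x\<bar> powr p) \<partial>lebesgue)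
        \<le> ennreal (M powr p * (norm h / R) powr (\<tau> * p) * A)" .
    qed
  qed
  moreover have "0 < M powr p" using M by simp
  ultimately show ?thesis unfolding uniform_diff_def using C by blast
qed

lemma uniform_diff_mono:
  assumes "uniform_diff S p \<tau> \<rho>" "\<rho>' \<le> \<rho>"
    and R: "\<And>u x0 R A. S u x0 R A \<Longrightarrow> 0 < R"
  shows "uniform_diff S p \<tau> \<rho>'"
proof -
  have "diff_bound p u x0 R A \<tau> \<rho>' C c" if "diff_bound p u x0 R A \<tau> \<rho> C c" "S u x0 R A" for u x0 R A C c
    unfolding diff_bound_def
  proof (intro allI impI)
    fix h :: 'a assume h: "0 < norm h \<and> norm h \<le> c * R"
    have r: "\<rho>' * R \<le> \<rho> * R" using assms(2) R[OF that(2)] by (intro mult_right_mono) auto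
    have "(\<integral>\<^sup>+x. ennreal (indicator (ball x0 (\<rho> * R)) x * \<bar>u (x + h) - u x\<bar> powr p) \<partial>lebesgue)
      \<le> ennreal (C * (norm h / R) powr (\<tau> * p) * A)"
      using that(1) h by (auto simp: diff_bound_def)
    then show "(\<integral>\<^sup>+x. ennreal (indicator (ball x0 (\<rho>' * R)) x * \<bar>u (x + h) - u x\<bar> powr p) \<partial>lebesgue)
      \<le> ennreal (C * (norm h / R) powr (\<tau> * p) * A)"
      by (rule nn_integral_le_mono[rotated]) (use r in \<open>auto simp: indicator_def\<close>)
  qed
  then show ?thesis using assms(1) unfolding uniform_diff_def by meson
qed

lemma admissible_R_pos: "admissible p s t \<Lambda> kf kn u x0 R A \<Longrightarrow> 0 < R"
  unfolding admissible_def by (auto simp: controlled_def)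

text \<open>One energy step turns the exponent \<open>\<tau>\<close> into \<open>(s p + t + \<tau>) / p\<close>, whose fixed point is
  \<open>(t + s p) / (p - 1)\<close>; below a given \<open>\<tau>\<close> the gain per step is at least \<open>\<gamma>\<close>.\<close>

lemma uniform_diff_iterate:
  assumes p: "2 \<le> p" and s: "0 < s" "s < 1" and t: "0 \<le> t" "t \<le> s"
    and \<tau>: "s \<le> \<tau>" "\<tau> < 1" "\<tau> < (t + s * p) / (p - 1)"
  shows "\<exists>\<rho>. 1/2 < \<rho> \<and> \<rho> \<le> 5/8 \<and> uniform_diff (admissible p s t \<Lambda> kf kn :: ('a::euclidean_space \<Rightarrow> real) \<Rightarrow> _) p \<tau> \<rho>"
proof -
  define \<gamma> where "\<gamma> = (s * p + t - (p - 1) * \<tau>) / p"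
  have \<gamma>: "0 < \<gamma>" using p \<tau>(3) by (simp add: \<gamma>_def field_simps)
  let ?U = "uniform_diff (admissible p s t \<Lambda> kf kn :: ('a \<Rightarrow> real) \<Rightarrow> _) p"
  \<comment> \<open>Every step costs some radius: the radii start at 5/8 and decrease towards 1/2,
    which they never reach.\<close>
  have it: "?U (min \<tau> (s + real n * \<gamma>)) (1/2 + 1 / 2 ^ (n + 3))" for n
  proof (induction n)
    case 0
    then show ?case using uniform_diff_base[of p s t \<Lambda> kf kn] \<tau> by (simp add: min_def)
  next
    case (Suc n)
    let ?\<tau> = "min \<tau> (s + real n * \<gamma>)"
    have st: "s \<le> ?\<tau>" using \<tau> \<gamma> by simp
    have le8: "1 / 2 ^ (m + 3) \<le> (1 / 8 :: real)" for m :: nat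
      by (simp add: power_add field_simps)
    have lt: "1 / 2 ^ (Suc n + 3) < (1 / 2 ^ (n + 3) :: real)" by (simp add: field_simps)
    have S: "uniform_diff2 (admissible p s t \<Lambda> kf kn :: ('a \<Rightarrow> real) \<Rightarrow> _) p ((s * p + t + ?\<tau>) / p) (1/2 + 1 / 2 ^ (Suc n + 3))"
      by (rule uniform_diff2_of_uniform_diff[OF Suc.IH]) (use st t p lt le8[of n] in \<open>auto intro: order_trans\<close>)
    have "m + \<gamma> \<le> (s * p + t + m) / p" if "m \<le> \<tau>" for m
    proof -
      have "(p - 1) * m \<le> (p - 1) * \<tau>" using p that by (intro mult_left_mono) auto
      then have "(m * p + (s * p + t - (p - 1) * \<tau>)) / p \<le> (s * p + t + m) / p"
        using p by (intro divide_right_mono) (auto simp: algebra_simps)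
      then show ?thesis using p by (simp add: \<gamma>_def add_divide_distrib)
    qed
    then have "?\<tau> + \<gamma> \<le> (s * p + t + ?\<tau>) / p" by simp
    then have "min \<tau> (s + real (Suc n) * \<gamma>) \<le> (s * p + t + ?\<tau>) / p"
      using \<gamma> by (auto simp: min_def algebra_simps split: if_splits)
    then show ?case
      by (intro uniform_diff_of_uniform_diff2[OF S]) (use le8[of "Suc n"] p \<tau> s \<gamma> in \<open>auto simp: min_less_iff_disj add_pos_nonneg intro: less_le_trans\<close>)
  qed
  obtain n :: nat where "\<tau> - s < real n * \<gamma>" using \<gamma> reals_Archimedean3 by blast
  then have "min \<tau> (s + real n * \<gamma>) = \<tau>" by simp
  moreover have "1 / 2 ^ (n + 3) \<le> (1 / 8 :: real)" by (simp add: power_add field_simps)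
  ultimately show ?thesis
    using it[of n] by (intro exI[of _ "1/2 + 1 / 2 ^ (n + 3)"]) auto
qed

lemma uniform_diff_limit_case:
  assumes p: "2 \<le> p" and s: "0 < s" "s < 1" and t: "0 \<le> t" "t \<le> s" and big: "p - 1 < t + s * p"
  defines "\<Gamma> \<equiv> (1 + t + s * p) / p"
  shows "uniform_diff (admissible p s t \<Lambda> kf kn :: ('a::euclidean_space \<Rightarrow> real) \<Rightarrow> _) p 1 (1/2)"
    and "uniform_diff2 (admissible p s t \<Lambda> kf kn :: ('a \<Rightarrow> real) \<Rightarrow> _) p \<Gamma> (1/2)"
proof -
  let ?U = "uniform_diff (admissible p s t \<Lambda> kf kn :: ('a \<Rightarrow> real) \<Rightarrow> _) p"
  let ?U2 = "uniform_diff2 (admissible p s t \<Lambda> kf kn :: ('a \<Rightarrow> real) \<Rightarrow> _) p"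
  \<comment> \<open>Any exponent between \<open>p - t - s * p\<close> and 1 is carried beyond 1 by
    one energy step. The midpoint is taken, or \<open>s\<close> if that is larger, since the
    iteration starts from \<open>s\<close>.\<close>
  define \<tau> where "\<tau> = max s ((1 + (p - t - s * p)) / 2)"
  have "p - t - s * p < 1" using big by simp
  moreover have "x < (1 + x) / 2" if "x < 1" for x :: real using that by simp
  ultimately have "p - t - s * p < (1 + (p - t - s * p)) / 2" by blast
  also have "\<dots> \<le> \<tau>" unfolding \<tau>_def by (rule max.cobounded2)
  finally have \<tau>: "s \<le> \<tau>" "\<tau> < 1" "p - t - s * p < \<tau>" using s big by (auto simp: \<tau>_def)
  have "\<tau> < (t + s * p) / (p - 1)"
  proof -
    have "1 < (t + s * p) / (p - 1)" using big p by (simp add: field_simps)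
    then show ?thesis using \<tau> by linarith
  qed
  then obtain \<rho> where \<rho>: "1/2 < \<rho>" "\<rho> \<le> 5/8" "?U \<tau> \<rho>"
    using uniform_diff_iterate[OF p s t \<tau>(1,2)] by blast
  define \<rho>' where "\<rho>' = (1/2 + \<rho>) / 2"
  have \<rho>': "1/2 < \<rho>'" "\<rho>' < \<rho>" using \<rho> by (auto simp: \<rho>'_def)
  have S: "?U2 ((s * p + t + \<tau>) / p) \<rho>'"
    by (rule uniform_diff2_of_uniform_diff[OF \<rho>(3)]) (use \<tau> t p \<rho> \<rho>' in auto)
  have "1 < (s * p + t + \<tau>) / p" using \<tau> p by (simp add: field_simps)
  then have H: "?U 1 \<rho>'"
    by (intro uniform_diff_of_uniform_diff2[OF S]) (use \<rho> \<rho>' p in auto)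
  show "?U 1 (1/2)"
    by (rule uniform_diff_mono[OF H]) (use \<rho>' admissible_R_pos in auto)
  have "?U2 ((s * p + t + 1) / p) (1/2)"
    by (rule uniform_diff2_of_uniform_diff[OF H]) (use t s p \<rho> \<rho>' in auto)
  then show "?U2 \<Gamma> (1/2)" by (simp add: \<Gamma>_def add_ac)
qed

section \<open>The gradient as a limit of dyadic difference quotients\<close>

lemma nn_integral_AE_limit_le:
  fixes g :: "nat \<Rightarrow> 'a \<Rightarrow> real"
  assumes [measurable]: "\<And>j. g j \<in> borel_measurable M"
    and lim: "AE x in M. (\<lambda>j. g j x) \<longlonglongrightarrow> G x"
    and le: "\<And>j. (\<integral>\<^sup>+x. ennreal (g j x) \<partial>M) \<le> a"
  shows "(\<integral>\<^sup>+x. ennreal (G x) \<partial>M) \<le> a"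
proof -
  have "(\<integral>\<^sup>+x. ennreal (G x) \<partial>M) = (\<integral>\<^sup>+x. liminf (\<lambda>j. ennreal (g j x)) \<partial>M)"
    using lim by (intro nn_integral_cong_AE) (auto elim!: eventually_mono intro!: lim_imp_Liminf[symmetric] tendsto_ennrealI)
  also have "\<dots> \<le> liminf (\<lambda>j. \<integral>\<^sup>+x. ennreal (g j x) \<partial>M)"
    by (rule nn_integral_liminf) measurable
  also have "\<dots> \<le> a"
    using le by (intro Liminf_le) auto
  finally show ?thesis .
qed

lemma le_add_powr:
  fixes v \<epsilon> p :: real
  assumes "1 \<le> p" "0 < \<epsilon>" "0 \<le> v"
  shows "v \<le> \<epsilon> + \<epsilon> / \<epsilon> powr p * v powr p"
proof (cases "v \<le> \<epsilon>")
  case False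
  then have "1 \<le> v / \<epsilon>" using assms by simp
  then have "v / \<epsilon> \<le> (v / \<epsilon>) powr p"
    using powr_mono[of 1 p "v / \<epsilon>"] assms by simp
  then have "\<epsilon> * (v / \<epsilon>) \<le> \<epsilon> * (v / \<epsilon>) powr p"
    using assms by (intro mult_left_mono) auto
  then have "v \<le> \<epsilon> / \<epsilon> powr p * v powr p"
    using assms by (simp add: powr_divide)
  then show ?thesis using assms by linarith
qed (use assms in \<open>auto intro: add_increasing2\<close>)

text \<open>A substitute for Hoelder's inequality on a ball. With \<epsilon> chosen as the rate of
  the \<open>L^p\<close> norm, the pointwise bound before gives an \<open>L^1\<close> norm of the
  same order \<epsilon>.\<close>

lemma nn_integral_ball_le_of_powr:
  fixes v :: "'a::euclidean_space \<Rightarrow> real"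
  assumes [measurable]: "v \<in> borel_measurable lebesgue" and p: "1 \<le> p" and \<epsilon>: "0 < \<epsilon>" and r: "0 \<le> r" and c: "0 \<le> c"
    and v: "(\<integral>\<^sup>+x. ennreal (indicator (ball x0 r) x * \<bar>v x\<bar> powr p) \<partial>lebesgue) \<le> ennreal ((c * \<epsilon>) powr p)"
  shows "(\<integral>\<^sup>+x. ennreal (indicator (ball x0 r) x * \<bar>v x\<bar>) \<partial>lebesgue)
    \<le> ennreal ((unit_ball_vol (real DIM('a)) * r ^ DIM('a) + c powr p) * \<epsilon>)"
proof -
  have B: "(\<integral>\<^sup>+x. ennreal (indicator (ball x0 r) x) \<partial>lebesgue) \<le> ennreal (unit_ball_vol (real DIM('a)) * r ^ DIM('a))"
    using nn_integral_ball_const[OF r zero_le_one, of x0] by simp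
  have "(\<integral>\<^sup>+x. ennreal (indicator (ball x0 r) x * \<bar>v x\<bar>) \<partial>lebesgue)
    \<le> ennreal (\<epsilon> * (unit_ball_vol (real DIM('a)) * r ^ DIM('a)) + \<epsilon> / \<epsilon> powr p * (c * \<epsilon>) powr p)"
  proof (rule nn_integral_combine[OF _ _ _ _ _ _ _ _ _ B v])
    fix x
    show "indicator (ball x0 r) x * \<bar>v x\<bar> \<le> \<epsilon> * indicator (ball x0 r) x + \<epsilon> / \<epsilon> powr p * (indicator (ball x0 r) x * \<bar>v x\<bar> powr p)"
      using le_add_powr[OF p \<epsilon>, of "\<bar>v x\<bar>"] by (simp add: indicator_def)
  qed (use \<epsilon> r in auto)
  also have "\<epsilon> * (unit_ball_vol (real DIM('a)) * r ^ DIM('a)) + \<epsilon> / \<epsilon> powr p * (c * \<epsilon>) powr p = (unit_ball_vol (real DIM('a)) * r ^ DIM('a) + c powr p) * \<epsilon>"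
    using \<epsilon> c by (simp add: powr_mult algebra_simps)
  finally show ?thesis .
qed

definition quot :: "('a::euclidean_space \<Rightarrow> real) \<Rightarrow> 'a \<Rightarrow> real \<Rightarrow> 'a \<Rightarrow> real" where
  "quot u b r x = (u (x + r *\<^sub>R b) - u x) / r"

text \<open>The sequence of steps is the same at every point and for every ball, so the limits found
  in different balls agree and form one function on the whole space. The value where the sequence
  diverges does not matter, as this happens only on a null set of each ball considered.\<close>

definition dyadic_deriv :: "('a::euclidean_space \<Rightarrow> real) \<Rightarrow> 'a \<Rightarrow> 'a \<Rightarrow> real" where
  "dyadic_deriv u b x = lim (\<lambda>j. quot u b (1 / 2 ^ j) x)"

lemma measurable_quot [measurable]:
  assumes [measurable]: "u \<in> borel_measurable lebesgue"
  shows "quot u b r \<in> borel_measurable lebesgue"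
  unfolding quot_def[abs_def] by measurable

lemma measurable_dyadic_deriv [measurable]:
  assumes [measurable]: "u \<in> borel_measurable lebesgue"
  shows "dyadic_deriv u b \<in> borel_measurable lebesgue"
  unfolding dyadic_deriv_def[abs_def] by measurable

text \<open>The steps whose successive halvings run, up to an index shift, through the sequence that
  defines \<open>dyadic_deriv\<close>; all of them therefore have the same limit.\<close>

definition dyadic :: "real \<Rightarrow> bool" where
  "dyadic r \<longleftrightarrow> (\<exists>n :: nat. r = 2 ^ n \<or> r = 1 / 2 ^ n)"

lemma dyadic_pos: "dyadic r \<Longrightarrow> 0 < r"
  by (auto simp: dyadic_def)

lemma quot_dyadic_tendsto:
  assumes "convergent (\<lambda>j. quot u b (1 / 2 ^ j) x)" "dyadic r"
  shows "(\<lambda>j. quot u b (r / 2 ^ j) x) \<longlonglongrightarrow> dyadic_deriv u b x"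
proof -
  have L: "(\<lambda>j. quot u b (1 / 2 ^ j) x) \<longlonglongrightarrow> dyadic_deriv u b x"
    using assms(1) by (simp add: dyadic_deriv_def convergent_LIMSEQ_iff)
  obtain n where "r = 2 ^ n \<or> r = 1 / 2 ^ n" using assms(2) by (auto simp: dyadic_def)
  then show ?thesis
  proof
    assume r: "r = 2 ^ n"
    have "(\<lambda>j. quot u b (r / 2 ^ (j + n)) x) \<longlonglongrightarrow> dyadic_deriv u b x"
      using L by (simp add: r power_add)
    then show ?thesis by (rule LIMSEQ_offset)
  next
    assume r: "r = 1 / 2 ^ n"
    show ?thesis
      using LIMSEQ_ignore_initial_segment[OF L, of n] by (simp add: r power_add mult.commute)
  qed
qed

lemma ex_dyadic_small:
  fixes a :: real
  assumes "0 < a"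
  obtains j :: nat where "1 / 2 ^ j < a"
  using real_arch_pow_inv[of a "1/2"] assms by (auto simp: power_divide)

lemma ex_dyadic_between:
  fixes a :: real
  assumes a: "0 < a"
  obtains r where "dyadic r" "a \<le> r" "r < 2 * a"
proof (cases "a \<le> 1")
  case True
  obtain j where j: "2 / 2 ^ Suc j \<le> a" "a < 2 / 2 ^ j"
    using dyadic_between[of a 2] a True by auto
  show ?thesis
  proof (cases "a = 1 / 2 ^ j")
    case True
    then show ?thesis using that[of "1 / 2 ^ j"] a by (auto simp: dyadic_def)
  next
    case False
    have "1 / 2 ^ j < a" using j(1) False by simp
    moreover have "dyadic (2 / 2 ^ j)"
    proof (cases j)
      case 0 then show ?thesis unfolding dyadic_def by (intro exI[of _ 1]) simp
    next
      case (Suc m) then show ?thesis unfolding dyadic_def by (intro exI[of _ m]) simp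
    qed
    ultimately show ?thesis using that[of "2 / 2 ^ j"] j by auto
  qed
next
  case False
  obtain j :: nat where j: "1 * 2 ^ j \<le> a" "a < 1 * 2 ^ Suc j"
    using dyadic_between_up[of 1 a] False by auto
  show ?thesis
  proof (cases "a = 2 ^ j")
    case True
    then show ?thesis using that[of "2 ^ j"] a by (auto simp: dyadic_def)
  next
    case False
    then have "2 ^ j < a" using j by simp
    moreover have "dyadic (2 ^ Suc j)" unfolding dyadic_def by blast
    ultimately show ?thesis using that[of "2 ^ Suc j"] j by simp
  qed
qed

lemma powr_dyadic_scale:
  fixes r R g :: real
  assumes "0 < r" "0 < R"
  shows "(r / 2 / R) powr g = (r / R) powr g * 2 powr (- g)"
    and "(r / 2 ^ j / R) powr g = (r / R) powr g * (2 powr (- g)) ^ j"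
  using assms by (simp_all add: powr_divide powr_mult powr_minus_divide two_power_powr power_divide)

text \<open>From here on the equation is forgotten: exponent 1 for first differences and an exponent
  above 1 for second differences carry the rest.\<close>

locale gradient =
  fixes p :: real and u :: "'a::euclidean_space \<Rightarrow> real" and x0 :: 'a and R A \<Gamma> C1 C2 c :: real
  assumes p: "1 < p" and measurable_u [measurable]: "u \<in> borel_measurable lebesgue"
    and R: "0 < R" and A: "0 < A" and \<Gamma>: "1 < \<Gamma>" "\<Gamma> < 2" and C: "0 < C1" "0 < C2" and c: "0 < c" "c \<le> 1 / 32"
    and H: "diff_bound p u x0 R A 1 (1/2) C1 c" and S: "diff2_bound p u x0 R A \<Gamma> (1/2) C2 c"
begin

abbreviation B :: "'a set" where "B \<equiv> ball x0 (1/2 * R)"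

definition Kst :: real where "Kst = C2 powr (1 / p) * A powr (1 / p) / R"
text \<open>The factor by which the error of a difference quotient decreases when its step is
  halved.\<close>

definition \<theta> :: real where "\<theta> = 2 powr (- (\<Gamma> - 1))"

lemma Kst: "0 < Kst" "Kst powr p = C2 * A / R powr p"
  using C A R p by (auto simp: Kst_def powr_divide powr_mult powr_powr)

lemma \<theta>: "0 < \<theta>" "\<theta> < 1"
  using \<Gamma> by (auto simp: \<theta>_def powr_less_one)

text \<open>The divisor is separate from the step for two uses: twice the step when a quotient is
  halved, and the step itself when a quotient is translated.\<close>

lemma scaled_diff2:
  assumes b: "b \<in> Basis" and r: "0 < r" "r \<le> c * R" and k: "0 < norm k" "norm k \<le> r" and a: "r \<le> a"
  shows "(\<integral>\<^sup>+x. ennreal (indicator B x * \<bar>((u (x + k + r *\<^sub>R b) - u (x + k)) - (u (x + r *\<^sub>R b) - u x)) / a\<bar> powr p) \<partial>lebesgue)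
    \<le> ennreal ((Kst * (a / R) powr (\<Gamma> - 1)) powr p)"
proof -
  have n: "norm (r *\<^sub>R b) = r" using b r by simp
  have a0: "0 < a" using r a by linarith
  have S': "(\<integral>\<^sup>+x. ennreal (indicator B x * \<bar>(u (x + k + r *\<^sub>R b) - u (x + k)) - (u (x + r *\<^sub>R b) - u x)\<bar> powr p) \<partial>lebesgue)
    \<le> ennreal (C2 * (norm (r *\<^sub>R b) / R) powr (\<Gamma> * p) * A)"
    by (rule S[unfolded diff2_bound_def, rule_format], unfold n, intro conjI) (fact r k)+
  have "(\<integral>\<^sup>+x. ennreal (indicator B x * \<bar>((u (x + k + r *\<^sub>R b) - u (x + k)) - (u (x + r *\<^sub>R b) - u x)) / a\<bar> powr p) \<partial>lebesgue)
     \<le> ennreal (1 / a powr p * (C2 * (norm (r *\<^sub>R b) / R) powr (\<Gamma> * p) * A))"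
    by (rule nn_integral_scale[OF _ _ _ S']) (use a0 in \<open>auto simp: powr_divide abs_divide\<close>)
  also have "\<dots> \<le> ennreal (1 / a powr p * (C2 * (a / R) powr (\<Gamma> * p) * A))"
    unfolding n using r R a C A \<Gamma> p
    by (intro ennreal_leI mult_left_mono mult_right_mono powr_mono2 divide_right_mono) auto
  also have "1 / a powr p * (C2 * (a / R) powr (\<Gamma> * p) * A) = (Kst * (a / R) powr (\<Gamma> - 1)) powr p"
  proof -
    have "(a / R) powr (\<Gamma> * p) = (a / R) powr ((\<Gamma> - 1) * p) * (a / R) powr p"
      by (simp add: algebra_simps flip: powr_add)
    also have "(a / R) powr p = a powr p / R powr p" using a0 R by (simp add: powr_divide)
    finally have *: "(a / R) powr (\<Gamma> * p) = (a / R) powr ((\<Gamma> - 1) * p) * (a powr p / R powr p)" .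
    show ?thesis
      using a0 Kst(1) unfolding * by (simp add: powr_mult powr_powr Kst(2))
  qed
  finally show ?thesis .
qed

text \<open>The quotients at \<open>r\<close> and \<open>r / 2\<close> differ by a second difference
  with both increments \<open>r / 2\<close>, divided by \<open>r\<close>.\<close>

lemma quot_step:
  assumes b: "b \<in> Basis" and r: "0 < r" "r \<le> c * R"
  shows "(\<integral>\<^sup>+x. ennreal (indicator B x * \<bar>quot u b r x - quot u b (r / 2) x\<bar> powr p) \<partial>lebesgue)
    \<le> ennreal ((Kst * (r / R) powr (\<Gamma> - 1)) powr p)"
proof -
  have "quot u b r x - quot u b (r / 2) x
    = ((u (x + (r/2) *\<^sub>R b + (r/2) *\<^sub>R b) - u (x + (r/2) *\<^sub>R b)) - (u (x + (r/2) *\<^sub>R b) - u x)) / r" for x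
  proof -
    have "x + (r/2) *\<^sub>R b + (r/2) *\<^sub>R b = x + r *\<^sub>R b"
      by (simp add: add.assoc flip: scaleR_add_left)
    then show ?thesis using r by (simp add: quot_def field_simps)
  qed
  then show ?thesis
    using scaled_diff2[OF b, of "r / 2" "(r/2) *\<^sub>R b" r] b r by simp
qed

lemma quot_telescope:
  assumes b: "b \<in> Basis" and r: "0 < r" "r \<le> c * R"
  shows "(\<integral>\<^sup>+x. ennreal (indicator B x * \<bar>quot u b r x - quot u b (r / 2 ^ n) x\<bar> powr p) \<partial>lebesgue)
    \<le> ennreal ((Kst * (r / R) powr (\<Gamma> - 1) / (1 - \<theta>)) powr p)"
  using r
proof (induction n arbitrary: r)
  case 0
  then show ?case by simp
next
  case (Suc n)
  have ip: "\<bar>indicator B x * v\<bar> powr p = indicator B x * \<bar>v\<bar> powr p" for x v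
    by (simp add: indicator_def)
  have "(\<integral>\<^sup>+x. ennreal (\<bar>indicator B x * (quot u b r x - quot u b (r / 2 ^ Suc n) x)\<bar> powr p) \<partial>lebesgue)
    \<le> ennreal ((Kst * (r / R) powr (\<Gamma> - 1) + Kst * (r / 2 / R) powr (\<Gamma> - 1) / (1 - \<theta>)) powr p)"
  proof (rule nn_integral_Minkowski[where F = "\<lambda>x. indicator B x * (quot u b r x - quot u b (r / 2) x)"
        and G = "\<lambda>x. indicator B x * (quot u b (r / 2) x - quot u b (r / 2 / 2 ^ n) x)"])
    show "(\<integral>\<^sup>+x. ennreal (\<bar>indicator B x * (quot u b r x - quot u b (r / 2) x)\<bar> powr p) \<partial>lebesgue) \<le> ennreal ((Kst * (r / R) powr (\<Gamma> - 1)) powr p)"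
      unfolding ip by (rule quot_step[OF b Suc.prems])
    show "(\<integral>\<^sup>+x. ennreal (\<bar>indicator B x * (quot u b (r / 2) x - quot u b (r / 2 / 2 ^ n) x)\<bar> powr p) \<partial>lebesgue)
       \<le> ennreal ((Kst * (r / 2 / R) powr (\<Gamma> - 1) / (1 - \<theta>)) powr p)"
      unfolding ip by (rule Suc.IH) (use Suc.prems in auto)
    show "\<bar>indicator B x * (quot u b r x - quot u b (r / 2 ^ Suc n) x)\<bar> \<le>
      \<bar>indicator B x * (quot u b r x - quot u b (r / 2) x)\<bar> + \<bar>indicator B x * (quot u b (r / 2) x - quot u b (r / 2 / 2 ^ n) x)\<bar>" for x
      by (auto simp: indicator_def)
  qed (use p Kst \<theta> Suc.prems R in auto)
  also have "Kst * (r / R) powr (\<Gamma> - 1) + Kst * (r / 2 / R) powr (\<Gamma> - 1) / (1 - \<theta>) = Kst * (r / R) powr (\<Gamma> - 1) / (1 - \<theta>)"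
  proof -
    have "(r / 2 / R) powr (\<Gamma> - 1) = (r / R) powr (\<Gamma> - 1) * \<theta>"
      unfolding \<theta>_def using Suc.prems R by (intro powr_dyadic_scale)
    then show ?thesis using \<theta> by (simp add: field_simps)
  qed
  finally show ?case unfolding ip .
qed

lemma geometric_rate: "0 < r \<Longrightarrow> (r / 2 ^ j / R) powr (\<Gamma> - 1) = (r / R) powr (\<Gamma> - 1) * \<theta> ^ j"
  unfolding \<theta>_def using R by (intro powr_dyadic_scale)

text \<open>The successive differences have \<open>L^1\<close> norms on the ball dominated by a
  geometric series, so they are absolutely summable almost everywhere. The index is shifted by
  \<open>j0\<close> because only steps up to \<open>c * R\<close> are controlled.\<close>

lemma quot_convergent:
  assumes b: "b \<in> Basis"
  shows "AE x in lebesgue. x \<in> B \<longrightarrow> convergent (\<lambda>j. quot u b (1 / 2 ^ j) x)"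
proof -
  obtain j0 :: nat where j0: "1 / 2 ^ j0 < c * R" using ex_dyadic_small[of "c * R"] c R by auto
  define r :: real where "r = 1 / 2 ^ j0"
  have r: "0 < r" "r \<le> c * R" using j0 by (auto simp: r_def)
  define v where "v j x = quot u b (r / 2 ^ j) x - quot u b (r / 2 ^ Suc j) x" for j x
  have [measurable]: "v j \<in> borel_measurable lebesgue" for j unfolding v_def[abs_def] by measurable
  let ?M = "unit_ball_vol (real DIM('a)) * (1/2 * R) ^ DIM('a) + Kst powr p" and ?e = "(r / R) powr (\<Gamma> - 1)"
  have e: "0 < ?e" using r R by simp
  have M: "0 \<le> ?M" using R by simp
  have v1: "(\<integral>\<^sup>+x. ennreal (indicator B x * \<bar>v j x\<bar>) \<partial>lebesgue) \<le> ennreal (?M * (?e * \<theta> ^ j))" for j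
  proof (rule nn_integral_ball_le_of_powr)
    have "r / 2 ^ j \<le> r" using r by (simp add: field_simps)
    then have "r / 2 ^ j \<le> c * R" using r by linarith
    then show "(\<integral>\<^sup>+x. ennreal (indicator B x * \<bar>v j x\<bar> powr p) \<partial>lebesgue) \<le> ennreal ((Kst * (?e * \<theta> ^ j)) powr p)"
      using quot_step[OF b, of "r / 2 ^ j"] r unfolding geometric_rate[OF r(1), symmetric] v_def by (simp add: mult.commute)
  qed (use p e \<theta> R Kst in auto)
  have "(\<integral>\<^sup>+x. (\<Sum>j. ennreal (indicator B x * \<bar>v j x\<bar>)) \<partial>lebesgue) = (\<Sum>j. \<integral>\<^sup>+x. ennreal (indicator B x * \<bar>v j x\<bar>) \<partial>lebesgue)"
    by (rule nn_integral_suminf) measurable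
  also have "\<dots> \<le> (\<Sum>j. ennreal (?M * (?e * \<theta> ^ j)))"
    by (intro suminf_le v1) auto
  also have "\<dots> = ennreal (\<Sum>j. ?M * (?e * \<theta> ^ j))"
    using M e \<theta> by (intro suminf_ennreal2 summable_mult summable_geometric) auto
  also have "\<dots> < \<infinity>" by simp
  finally have "AE x in lebesgue. (\<Sum>j. ennreal (indicator B x * \<bar>v j x\<bar>)) \<noteq> \<infinity>"
    by (intro nn_integral_PInf_AE) auto
  then show ?thesis
  proof (rule eventually_mono)
    fix x assume fin: "(\<Sum>j. ennreal (indicator B x * \<bar>v j x\<bar>)) \<noteq> \<infinity>"
    show "x \<in> B \<longrightarrow> convergent (\<lambda>j. quot u b (1 / 2 ^ j) x)"
    proof
      assume x: "x \<in> B"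
      have "summable (\<lambda>j. \<bar>v j x\<bar>)"
        using fin x by (intro summable_suminf_not_top) auto
      then have "summable (\<lambda>j. v j x)" by (rule summable_rabs_cancel)
      then have "convergent (\<lambda>n. \<Sum>j<n. v j x)" by (simp add: summable_iff_convergent)
      then have "convergent (\<lambda>n. quot u b r x - (\<Sum>j<n. v j x))"
        by (intro convergent_diff convergent_const)
      moreover have "quot u b r x - (\<Sum>j<n. v j x) = quot u b (1 / 2 ^ (n + j0)) x" for n
      proof -
        have "(\<Sum>j<n. v j x) = quot u b (r / 2 ^ 0) x - quot u b (r / 2 ^ n) x"
          unfolding v_def by (rule sum_lessThan_telescope')
        then show ?thesis by (simp add: r_def power_add mult.commute)
      qed
      ultimately have "convergent (\<lambda>n. quot u b (1 / 2 ^ (n + j0)) x)" by simp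
      then show "convergent (\<lambda>j. quot u b (1 / 2 ^ j) x)"
        using convergent_ignore_initial_segment[of "\<lambda>n. quot u b (1 / 2 ^ n) x" j0] by simp
    qed
  qed
qed

lemma quot_tendsto:
  assumes b: "b \<in> Basis" and r: "dyadic r"
  shows "AE x in lebesgue. x \<in> B \<longrightarrow> (\<lambda>j. quot u b (r / 2 ^ j) x) \<longlonglongrightarrow> dyadic_deriv u b x"
  using quot_convergent[OF b] by eventually_elim (use quot_dyadic_tendsto[OF _ r] in auto)

lemma quot_deriv_Lp:
  assumes b: "b \<in> Basis" and r: "dyadic r" "r \<le> c * R"
  shows "(\<integral>\<^sup>+x. ennreal (indicator B x * \<bar>quot u b r x - dyadic_deriv u b x\<bar> powr p) \<partial>lebesgue)
    \<le> ennreal ((Kst * (r / R) powr (\<Gamma> - 1) / (1 - \<theta>)) powr p)"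
proof (rule nn_integral_AE_limit_le)
  show "(\<integral>\<^sup>+x. ennreal (indicator B x * \<bar>quot u b r x - quot u b (r / 2 ^ n) x\<bar> powr p) \<partial>lebesgue)
    \<le> ennreal ((Kst * (r / R) powr (\<Gamma> - 1) / (1 - \<theta>)) powr p)" for n
    by (rule quot_telescope[OF b dyadic_pos[OF r(1)] r(2)])
  show "AE x in lebesgue. (\<lambda>n. indicator B x * \<bar>quot u b r x - quot u b (r / 2 ^ n) x\<bar> powr p)
      \<longlonglongrightarrow> indicator B x * \<bar>quot u b r x - dyadic_deriv u b x\<bar> powr p"
    using quot_tendsto[OF b r(1)]
  proof eventually_elim
    case (elim x)
    show ?case
    proof (cases "x \<in> B")
      case True
      then show ?thesis using elim p by (intro tendsto_intros) auto
    qed simp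
  qed
qed measurable

lemma deriv_Lp:
  assumes b: "b \<in> Basis"
  shows "(\<integral>\<^sup>+x. ennreal (indicator B x * \<bar>dyadic_deriv u b x\<bar> powr p) \<partial>lebesgue) \<le> ennreal (C1 / R powr p * A)"
proof -
  obtain j0 :: nat where j0: "1 / 2 ^ j0 < c * R" using ex_dyadic_small[of "c * R"] c R by auto
  define r :: real where "r = 1 / 2 ^ j0"
  have r: "0 < r" "r \<le> c * R" "dyadic r" using j0 by (auto simp: r_def dyadic_def)
  show ?thesis
  proof (rule nn_integral_AE_limit_le)
    show "(\<integral>\<^sup>+x. ennreal (indicator B x * \<bar>quot u b (r / 2 ^ n) x\<bar> powr p) \<partial>lebesgue) \<le> ennreal (C1 / R powr p * A)" for n
    proof -
      define a where "a = r / 2 ^ n"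
      have "r / 2 ^ n \<le> r" using r by (simp add: field_simps)
      then have a: "0 < a" "a \<le> c * R" using r by (auto simp: a_def)
      have nb: "norm (a *\<^sub>R b) = a" using a b by simp
      have "(\<integral>\<^sup>+x. ennreal (indicator B x * \<bar>u (x + a *\<^sub>R b) - u x\<bar> powr p) \<partial>lebesgue) \<le> ennreal (C1 * (norm (a *\<^sub>R b) / R) powr (1 * p) * A)"
        by (rule H[unfolded diff_bound_def, rule_format]) (use nb a in auto)
      then have "(\<integral>\<^sup>+x. ennreal (indicator B x * \<bar>quot u b a x\<bar> powr p) \<partial>lebesgue) \<le> ennreal (1 / a powr p * (C1 * (norm (a *\<^sub>R b) / R) powr (1 * p) * A))"
        by (rule nn_integral_scale[rotated 3]) (use a in \<open>auto simp: quot_def powr_divide abs_divide\<close>)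
      also have "1 / a powr p * (C1 * (norm (a *\<^sub>R b) / R) powr (1 * p) * A) = C1 / R powr p * A"
        unfolding nb using a R by (simp add: powr_divide)
      finally show ?thesis by (simp add: a_def)
    qed
    show "AE x in lebesgue. (\<lambda>n. indicator B x * \<bar>quot u b (r / 2 ^ n) x\<bar> powr p)
        \<longlonglongrightarrow> indicator B x * \<bar>dyadic_deriv u b x\<bar> powr p"
      using quot_tendsto[OF b r(3)]
    proof eventually_elim
      case (elim x)
      show ?case
      proof (cases "x \<in> B")
        case True
        then show ?thesis using elim p by (intro tendsto_intros) auto
      qed simp
    qed
  qed measurable
qed

text \<open>The mode of convergence that integration by parts needs: test functions are bounded, so
  \<open>L^1\<close> suffices.\<close>

lemma quot_tendsto_L1:
  assumes b: "b \<in> Basis"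
  shows "(\<lambda>j. \<integral>\<^sup>+x. ennreal (indicator B x * \<bar>quot u b (1 / 2 ^ j) x - dyadic_deriv u b x\<bar>) \<partial>lebesgue) \<longlonglongrightarrow> 0"
proof -
  obtain j0 :: nat where j0: "1 / 2 ^ j0 < c * R" using ex_dyadic_small[of "c * R"] c R by auto
  let ?M = "unit_ball_vol (real DIM('a)) * (1/2 * R) ^ DIM('a) + (Kst / (1 - \<theta>)) powr p" and ?e = "(1 / R) powr (\<Gamma> - 1)"
  have e: "0 < ?e" using R by simp
  have "(\<integral>\<^sup>+x. ennreal (indicator B x * \<bar>quot u b (1 / 2 ^ j) x - dyadic_deriv u b x\<bar>) \<partial>lebesgue) \<le> ennreal (?M * (?e * \<theta> ^ j))"
    if "j0 \<le> j" for j
  proof (rule nn_integral_ball_le_of_powr)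
    have "1 / 2 ^ j \<le> (1 / 2 ^ j0 :: real)" using that by (simp add: field_simps)
    then have *: "1 / 2 ^ j \<le> c * R" using j0 by linarith
    have "dyadic (1 / 2 ^ j)" by (auto simp: dyadic_def)
    from quot_deriv_Lp[OF b this *]
    show "(\<integral>\<^sup>+x. ennreal (indicator B x * \<bar>quot u b (1 / 2 ^ j) x - dyadic_deriv u b x\<bar> powr p) \<partial>lebesgue) \<le> ennreal ((Kst / (1 - \<theta>) * (?e * \<theta> ^ j)) powr p)"
      unfolding geometric_rate[of 1 j, OF zero_less_one] by (simp add: mult_ac)
  qed (use p e \<theta> R Kst in auto)
  then have ev: "\<forall>\<^sub>F j in sequentially. (\<integral>\<^sup>+x. ennreal (indicator B x * \<bar>quot u b (1 / 2 ^ j) x - dyadic_deriv u b x\<bar>) \<partial>lebesgue) \<le> ennreal (?M * (?e * \<theta> ^ j))"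
    by (auto simp: eventually_sequentially)
  have "(\<lambda>j. ?M * (?e * \<theta> ^ j)) \<longlonglongrightarrow> ?M * (?e * 0)"
    using \<theta> by (intro tendsto_intros LIMSEQ_power_zero) auto
  then have "(\<lambda>j. ennreal (?M * (?e * \<theta> ^ j))) \<longlonglongrightarrow> ennreal (?M * (?e * 0))"
    by (rule tendsto_ennrealI)
  then have lim: "(\<lambda>j. ennreal (?M * (?e * \<theta> ^ j))) \<longlonglongrightarrow> 0" by simp
  show ?thesis
    by (rule tendsto_sandwich[OF _ ev tendsto_const lim]) simp
qed

text \<open>Take a dyadic step \<open>r\<close> with \<open>norm k \<le> r < 2 * norm k\<close>. The
  difference of derivatives splits into two errors of the quotient at \<open>r\<close> and a
  translate of this quotient by \<open>k\<close>, which is a second difference; all three are of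
  order \<open>r powr (\<Gamma> - 1)\<close>. The step has to be dyadic, since the derivative is a
  limit along dyadic steps.\<close>

lemma deriv_translates:
  assumes b: "b \<in> Basis" and k: "0 < norm k" "norm k < c * R / 2"
  shows "(\<integral>\<^sup>+x. ennreal (indicator (ball x0 (R / 4)) x * \<bar>dyadic_deriv u b (x + k) - dyadic_deriv u b x\<bar> powr p) \<partial>lebesgue)
    \<le> ennreal ((3 / (1 - \<theta>) * Kst * (2 / R) powr (\<Gamma> - 1)) powr p * norm k powr ((\<Gamma> - 1) * p))"
proof -
  obtain r where r: "dyadic r" "norm k \<le> r" "r < 2 * norm k" using ex_dyadic_between[OF k(1)] by blast
  have rc: "0 < r" "r \<le> c * R" using r k by auto
  let ?b = "indicator (ball x0 (R / 4)) :: 'a \<Rightarrow> real" and ?D = "dyadic_deriv u b" and ?q = "quot u b r"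
  let ?e = "(r / R) powr (\<Gamma> - 1)"
  have ip: "\<bar>?b x * v\<bar> powr p = ?b x * \<bar>v\<bar> powr p" for x v
    by (simp add: indicator_def)
  have e: "0 < ?e" using rc R by simp
  have kR: "norm k < R / 4" using k c R mult_right_mono[of c "1/32" R] by linarith
  have sub: "x \<in> B" "x + k \<in> B" if "x \<in> ball x0 (R / 4)" for x
  proof -
    have "dist x0 (x + k) \<le> dist x0 x + norm k"
      using norm_triangle_ineq4[of "x0 - x" k] by (simp add: dist_norm algebra_simps)
    then show "x \<in> B" "x + k \<in> B" using that kR R by auto
  qed
  let ?L = "Kst * ?e / (1 - \<theta>)"
  have L: "0 < ?L" using Kst e \<theta> by simp
  have 3: "(\<integral>\<^sup>+x. ennreal (\<bar>?b x * (?q x - ?D x)\<bar> powr p) \<partial>lebesgue) \<le> ennreal (?L powr p)"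
    unfolding ip by (rule nn_integral_le_mono[OF _ quot_deriv_Lp[OF b r(1) rc(2)]]) (use sub in \<open>auto simp: indicator_def\<close>)
  have 1: "(\<integral>\<^sup>+x. ennreal (\<bar>?b x * (?D (x + k) - ?q (x + k))\<bar> powr p) \<partial>lebesgue) \<le> ennreal (?L powr p)"
  proof -
    define F where "F x = indicator B x * \<bar>?q x - ?D x\<bar> powr p" for x
    have [measurable]: "F \<in> borel_measurable lebesgue" unfolding F_def[abs_def] by measurable
    have "(\<integral>\<^sup>+x. ennreal (F (x + k)) \<partial>lebesgue) \<le> ennreal (?L powr p)"
      using quot_deriv_Lp[OF b r(1) rc(2)]
      by (subst nn_integral_lebesgue_shift[of "\<lambda>x. ennreal (F x)"]) (auto simp: F_def)
    then show ?thesis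
      unfolding ip by (rule nn_integral_le_mono[rotated]) (use sub in \<open>auto simp: indicator_def F_def abs_minus_commute\<close>)
  qed
  have 2: "(\<integral>\<^sup>+x. ennreal (\<bar>?b x * (?q (x + k) - ?q x)\<bar> powr p) \<partial>lebesgue) \<le> ennreal (?L powr p)"
  proof -
    have "(\<integral>\<^sup>+x. ennreal (\<bar>?b x * (?q (x + k) - ?q x)\<bar> powr p) \<partial>lebesgue) \<le> ennreal ((Kst * ?e) powr p)"
      unfolding ip by (rule nn_integral_le_mono[OF _ scaled_diff2[OF b rc k(1) r(2) order_refl]])
        (use sub in \<open>auto simp: indicator_def quot_def diff_divide_distrib\<close>)
    also have "\<dots> \<le> ennreal (?L powr p)"
    proof (intro ennreal_leI powr_mono2)
      have "Kst * ?e * (1 - \<theta>) \<le> Kst * ?e * 1" using \<theta> Kst e by (intro mult_left_mono) auto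
      then show "Kst * ?e \<le> ?L" using \<theta> by (simp add: field_simps)
    qed (use p Kst e in auto)
    finally show ?thesis .
  qed
  have 12: "(\<integral>\<^sup>+x. ennreal (\<bar>?b x * (?D (x + k) - ?q x)\<bar> powr p) \<partial>lebesgue) \<le> ennreal ((?L + ?L) powr p)"
    by (rule nn_integral_Minkowski[OF _ _ _ _ L L 1 2]) (use p in \<open>auto simp: indicator_def\<close>)
  have LL: "0 < ?L + ?L" using L by linarith
  have "(\<integral>\<^sup>+x. ennreal (\<bar>?b x * (?D (x + k) - ?D x)\<bar> powr p) \<partial>lebesgue) \<le> ennreal (((?L + ?L) + ?L) powr p)"
    by (rule nn_integral_Minkowski[OF _ _ _ _ LL L 12 3]) (use p in \<open>auto simp: indicator_def\<close>)
  also have "\<dots> \<le> ennreal ((3 / (1 - \<theta>) * Kst * (2 / R) powr (\<Gamma> - 1) * norm k powr (\<Gamma> - 1)) powr p)"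
  proof (intro ennreal_leI powr_mono2)
    have "?e \<le> (2 * norm k / R) powr (\<Gamma> - 1)"
      using r rc R \<Gamma> by (intro powr_mono2 divide_right_mono) auto
    also have "\<dots> = (2 / R) powr (\<Gamma> - 1) * norm k powr (\<Gamma> - 1)"
      using R by (simp add: powr_mult powr_divide)
    finally have "3 / (1 - \<theta>) * Kst * ?e \<le> 3 / (1 - \<theta>) * Kst * ((2 / R) powr (\<Gamma> - 1) * norm k powr (\<Gamma> - 1))"
      using \<theta> Kst by (intro mult_left_mono) auto
    then show "?L + ?L + ?L \<le> 3 / (1 - \<theta>) * Kst * (2 / R) powr (\<Gamma> - 1) * norm k powr (\<Gamma> - 1)"
      by (simp add: mult_ac)
  qed (use p LL L in auto)
  also have "(3 / (1 - \<theta>) * Kst * (2 / R) powr (\<Gamma> - 1) * norm k powr (\<Gamma> - 1)) powr p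
     = (3 / (1 - \<theta>) * Kst * (2 / R) powr (\<Gamma> - 1)) powr p * norm k powr ((\<Gamma> - 1) * p)"
    by (subst powr_mult) (use \<theta> Kst in \<open>simp_all add: powr_powr\<close>)
  finally show ?thesis unfolding ip .
qed

end

lemma measurable_shift_minus_lebesgue [measurable (raw)]:
  fixes f :: "'c \<Rightarrow> 'a::euclidean_space"
  shows "f \<in> M \<rightarrow>\<^sub>M lebesgue \<Longrightarrow> (\<lambda>x. f x - h) \<in> M \<rightarrow>\<^sub>M lebesgue"
  using measurable_shift_lebesgue[of f M "- h"] by simp

section \<open>Local spaces and weak gradients\<close>

lemma compact_ball_cover:
  fixes S :: "'a::metric_space set"
  assumes "compact S" "\<And>x. x \<in> S \<Longrightarrow> 0 < r x"
  obtains T where "T \<subseteq> S" "finite T" "S \<subseteq> (\<Union>x\<in>T. ball x (r x))"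
proof (rule compactE_image[OF assms(1), of S "\<lambda>x. ball x (r x)"])
  show "S \<subseteq> (\<Union>x\<in>S. ball x (r x))" using assms(2) by force
qed (use that in auto)

lemma choose_radii:
  assumes "\<forall>x\<in>S. \<exists>r>0::real. P x r"
  obtains r where "\<And>x. x \<in> S \<Longrightarrow> 0 < r x" "\<And>x. x \<in> S \<Longrightarrow> P x (r x)"
  using assms by metis

lemma nn_integral_compact_le_sum:
  fixes g :: "'a::euclidean_space \<Rightarrow> real"
  assumes [measurable]: "g \<in> borel_measurable lebesgue" and g: "\<And>x. 0 \<le> g x"
    and T: "finite T" "S \<subseteq> (\<Union>x\<in>T. ball x (r x))"
  shows "(\<integral>\<^sup>+x. ennreal (indicator S x * g x) \<partial>lebesgue) \<le> (\<Sum>y\<in>T. \<integral>\<^sup>+x. ennreal (indicator (ball y (r y)) x * g x) \<partial>lebesgue)"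
proof -
  have "(\<integral>\<^sup>+x. ennreal (indicator S x * g x) \<partial>lebesgue) \<le> (\<integral>\<^sup>+x. (\<Sum>y\<in>T. ennreal (indicator (ball y (r y)) x * g x)) \<partial>lebesgue)"
  proof (rule nn_integral_mono)
    fix x
    show "ennreal (indicator S x * g x) \<le> (\<Sum>y\<in>T. ennreal (indicator (ball y (r y)) x * g x))"
    proof (cases "x \<in> S")
      case True
      then obtain y where y: "y \<in> T" "x \<in> ball y (r y)" using T by blast
      then have "ennreal (indicator S x * g x) = ennreal (indicator (ball y (r y)) x * g x)"
        using True by simp
      also have "\<dots> \<le> (\<Sum>y\<in>T. ennreal (indicator (ball y (r y)) x * g x))"
        by (rule member_le_sum) (use y T in auto)
      finally show ?thesis .
    qed simp
  qed
  also have "\<dots> = (\<Sum>y\<in>T. \<integral>\<^sup>+x. ennreal (indicator (ball y (r y)) x * g x) \<partial>lebesgue)"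
    by (rule nn_integral_sum) measurable
  finally show ?thesis .
qed

lemma nn_integral_compact_finite:
  fixes g :: "'a::euclidean_space \<Rightarrow> real"
  assumes g: "g \<in> borel_measurable lebesgue" "\<And>x. 0 \<le> g x" and S: "compact S"
    and loc: "\<And>x. x \<in> S \<Longrightarrow> \<exists>r>0. (\<integral>\<^sup>+y. ennreal (indicator (ball x r) y * g y) \<partial>lebesgue) < \<infinity>"
  shows "(\<integral>\<^sup>+x. ennreal (indicator S x * g x) \<partial>lebesgue) < \<infinity>"
proof -
  have "\<forall>x\<in>S. \<exists>r>0. (\<integral>\<^sup>+y. ennreal (indicator (ball x r) y * g y) \<partial>lebesgue) < \<infinity>"
    by (intro ballI loc)
  then obtain r where r: "\<And>x. x \<in> S \<Longrightarrow> 0 < r x" "\<And>x. x \<in> S \<Longrightarrow> (\<integral>\<^sup>+y. ennreal (indicator (ball x (r x)) y * g y) \<partial>lebesgue) < \<infinity>"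
    by (rule choose_radii) (rule that)
  obtain T where T: "T \<subseteq> S" "finite T" "S \<subseteq> (\<Union>x\<in>T. ball x (r x))"
    by (rule compact_ball_cover[of S r, OF S]) (erule r(1), rule that)
  have "(\<integral>\<^sup>+x. ennreal (indicator S x * g x) \<partial>lebesgue) \<le> (\<Sum>y\<in>T. \<integral>\<^sup>+x. ennreal (indicator (ball y (r y)) x * g x) \<partial>lebesgue)"
    by (rule nn_integral_compact_le_sum[OF g T(2,3)])
  also have "\<dots> < \<infinity>" using T r by auto
  finally show ?thesis .
qed

lemma nn_integral_compact_tendsto_0:
  fixes g :: "nat \<Rightarrow> 'a::euclidean_space \<Rightarrow> real"
  assumes g: "\<And>j. g j \<in> borel_measurable lebesgue" "\<And>j x. 0 \<le> g j x" and S: "compact S"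
    and loc: "\<And>x. x \<in> S \<Longrightarrow> \<exists>r>0. (\<lambda>j. \<integral>\<^sup>+y. ennreal (indicator (ball x r) y * g j y) \<partial>lebesgue) \<longlonglongrightarrow> 0"
  shows "(\<lambda>j. \<integral>\<^sup>+x. ennreal (indicator S x * g j x) \<partial>lebesgue) \<longlonglongrightarrow> 0"
proof -
  have "\<forall>x\<in>S. \<exists>r>0. (\<lambda>j. \<integral>\<^sup>+y. ennreal (indicator (ball x r) y * g j y) \<partial>lebesgue) \<longlonglongrightarrow> 0"
    by (intro ballI loc)
  then obtain r where r: "\<And>x. x \<in> S \<Longrightarrow> 0 < r x" "\<And>x. x \<in> S \<Longrightarrow> (\<lambda>j. \<integral>\<^sup>+y. ennreal (indicator (ball x (r x)) y * g j y) \<partial>lebesgue) \<longlonglongrightarrow> 0"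
    by (rule choose_radii) (rule that)
  obtain T where T: "T \<subseteq> S" "finite T" "S \<subseteq> (\<Union>x\<in>T. ball x (r x))"
    by (rule compact_ball_cover[of S r, OF S]) (erule r(1), rule that)
  have lim: "(\<lambda>j. \<Sum>y\<in>T. \<integral>\<^sup>+x. ennreal (indicator (ball y (r y)) x * g j x) \<partial>lebesgue) \<longlonglongrightarrow> (\<Sum>y\<in>T. 0)"
    using r(2) T(1) by (intro tendsto_sum) auto
  show ?thesis
    by (rule tendsto_sandwich[OF _ _ tendsto_const lim[simplified]])
      (use nn_integral_compact_le_sum[OF g T(2,3)] in auto)
qed

text \<open>Seminorms on the balls of a cover do not by themselves bound the seminorm on the union.
  The Lebesgue number \<open>e\<close> of a finite cover helps: pairs closer than \<open>e\<close>
  share a ball, and the remaining pairs are controlled by the \<open>L^q\<close> norm.\<close>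

lemma Wspace_loc_I:
  fixes \<psi> :: "'a::euclidean_space \<Rightarrow> 'b::euclidean_space"
  assumes \<psi> [measurable]: "\<psi> \<in> borel_measurable lebesgue" and q: "0 < q" and \<tau>: "0 \<le> \<tau>"
    and loc: "\<And>x. x \<in> \<Omega> \<Longrightarrow> \<exists>r>0. (\<integral>\<^sup>+y. ennreal (indicator (ball x r) y * norm (\<psi> y) powr q) \<partial>lebesgue) < \<infinity> \<and> gagliardo \<tau> q (ball x r) \<psi> < \<infinity>"
  shows "\<psi> \<in> Wspace_loc \<tau> q \<Omega>"
  unfolding Wspace_loc_def
proof (intro CollectI allI impI)
  fix E assume E: "compactly_inside E \<Omega>"
  define S where "S = closure E"
  have S: "compact S" "S \<subseteq> \<Omega>" "E \<subseteq> S" "open E"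
    using E by (auto simp: compactly_inside_def S_def closure_subset)
  have EM [measurable]: "E \<in> sets lebesgue" using S(4) by auto
  have Lp: "(\<integral>\<^sup>+x. ennreal (indicator S x * norm (\<psi> x) powr q) \<partial>lebesgue) < \<infinity>"
  proof (rule nn_integral_compact_finite[OF _ _ S(1)])
    show "\<exists>r>0. (\<integral>\<^sup>+y. ennreal (indicator (ball x r) y * norm (\<psi> y) powr q) \<partial>lebesgue) < \<infinity>" if "x \<in> S" for x
      using loc[OF subsetD[OF S(2) that]] by (elim exE conjE) (intro exI conjI)
  qed auto
  have LpE: "(\<integral>\<^sup>+x. ennreal (indicator E x * norm (\<psi> x) powr q) \<partial>lebesgue) < \<infinity>"
    using Lp by (rule le_less_trans[rotated]) (intro nn_integral_mono ennreal_leI, use S(3) in \<open>auto simp: indicator_def\<close>)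
  have "\<exists>r>0. gagliardo \<tau> q (ball x r) \<psi> < \<infinity>" if "x \<in> S" for x
    using loc[OF subsetD[OF S(2) that]] by (elim exE conjE) (intro exI conjI)
  then have "\<forall>x\<in>S. \<exists>r>0. gagliardo \<tau> q (ball x r) \<psi> < \<infinity>" by (rule ballI)
  then obtain r where r: "\<And>x. x \<in> S \<Longrightarrow> 0 < r x" "\<And>x. x \<in> S \<Longrightarrow> gagliardo \<tau> q (ball x (r x)) \<psi> < \<infinity>"
    by (rule choose_radii) (rule that)
  obtain T where T: "T \<subseteq> S" "finite T" "S \<subseteq> (\<Union>x\<in>T. ball x (r x))"
    by (rule compact_ball_cover[of S r, OF S(1)]) (erule r(1), rule that)
  obtain e where e: "0 < e" "\<And>x. x \<in> S \<Longrightarrow> \<exists>G\<in>(\<lambda>x. ball x (r x)) ` T. ball x e \<subseteq> G"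
    using Heine_Borel_lemma[OF S(1), of "(\<lambda>x. ball x (r x)) ` T"] T(3) by auto
  let ?\<Phi> = "\<lambda>z. norm (\<psi> (fst z) - \<psi> (snd z)) powr q / norm (fst z - snd z) powr (real DIM('a) + \<tau> * q)"
  have far: "(\<integral>\<^sup>+z. ennreal (indicator E (fst z) * indicator E (snd z) * indicator (- ball 0 e) (fst z - snd z) *
       norm (\<psi> (fst z) - \<psi> (snd z)) powr q / norm (fst z - snd z) powr (real DIM('a) + \<tau> * q)) \<partial>lebesgue) < \<infinity>"
  proof -
    have "emeasure lebesgue E \<le> emeasure lborel S"
      using emeasure_mono[OF S(3), of lebesgue] S(1) by (simp add: borel_compact)
    also have "\<dots> < \<infinity>" using emeasure_compact_finite[OF S(1)] by simp
    finally have W: "emeasure lebesgue E \<le> ennreal (enn2real (emeasure lebesgue E))" by simp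
    have P: "(\<integral>\<^sup>+x. ennreal (indicator E x * norm (\<psi> x) powr q) \<partial>lebesgue) \<le> ennreal (enn2real (\<integral>\<^sup>+x. ennreal (indicator E x * norm (\<psi> x) powr q) \<partial>lebesgue))"
      using LpE by simp
    show ?thesis
      by (rule le_less_trans[OF nn_integral_gagliardo_far[OF _ EM q \<tau> e(1) W _ P]]) auto
  qed
  have "gagliardo \<tau> q E \<psi> \<le> (\<integral>\<^sup>+z. (\<Sum>x\<in>T. ennreal (indicator (ball x (r x)) (fst z) * indicator (ball x (r x)) (snd z) * norm (\<psi> (fst z) - \<psi> (snd z)) powr q / norm (fst z - snd z) powr (real DIM('a) + \<tau> * q)))
      + ennreal (indicator E (fst z) * indicator E (snd z) * indicator (- ball 0 e) (fst z - snd z) *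
       norm (\<psi> (fst z) - \<psi> (snd z)) powr q / norm (fst z - snd z) powr (real DIM('a) + \<tau> * q)) \<partial>lebesgue)"
    unfolding gagliardo_def
  proof (rule nn_integral_mono)
    fix z :: "'a \<times> 'a"
    obtain x y where z: "z = (x, y)" by fastforce
    show "ennreal (indicator E (fst z) * indicator E (snd z) * norm (\<psi> (fst z) - \<psi> (snd z)) powr q / norm (fst z - snd z) powr (real DIM('a) + \<tau> * q))
      \<le> (\<Sum>x\<in>T. ennreal (indicator (ball x (r x)) (fst z) * indicator (ball x (r x)) (snd z) * norm (\<psi> (fst z) - \<psi> (snd z)) powr q / norm (fst z - snd z) powr (real DIM('a) + \<tau> * q)))
      + ennreal (indicator E (fst z) * indicator E (snd z) * indicator (- ball 0 e) (fst z - snd z) *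
       norm (\<psi> (fst z) - \<psi> (snd z)) powr q / norm (fst z - snd z) powr (real DIM('a) + \<tau> * q))"
    proof (cases "x \<in> E \<and> y \<in> E \<and> norm (x - y) < e")
      case True
      then obtain v where v: "v \<in> T" "ball x e \<subseteq> ball v (r v)" using e(2)[of x] S(3) by auto
      then have xy: "x \<in> ball v (r v)" "y \<in> ball v (r v)" using True e(1) by (auto simp: dist_norm subset_eq)
      have "ennreal (indicator E (fst z) * indicator E (snd z) * norm (\<psi> (fst z) - \<psi> (snd z)) powr q / norm (fst z - snd z) powr (real DIM('a) + \<tau> * q))
        = ennreal (indicator (ball v (r v)) (fst z) * indicator (ball v (r v)) (snd z) * norm (\<psi> (fst z) - \<psi> (snd z)) powr q / norm (fst z - snd z) powr (real DIM('a) + \<tau> * q))"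
        using True xy by (simp add: z)
      also have "\<dots> \<le> (\<Sum>x\<in>T. ennreal (indicator (ball x (r x)) (fst z) * indicator (ball x (r x)) (snd z) * norm (\<psi> (fst z) - \<psi> (snd z)) powr q / norm (fst z - snd z) powr (real DIM('a) + \<tau> * q)))"
        by (rule member_le_sum[OF v(1)]) (use T in auto)
      finally show ?thesis by (rule order_trans) simp
    next
      case False
      then show ?thesis by (intro add_increasing) (auto simp: z indicator_def intro: sum_nonneg)
    qed
  qed
  also have "\<dots> = (\<Sum>x\<in>T. gagliardo \<tau> q (ball x (r x)) \<psi>) + (\<integral>\<^sup>+z. ennreal (indicator E (fst z) * indicator E (snd z) * indicator (- ball 0 e) (fst z - snd z) *
       norm (\<psi> (fst z) - \<psi> (snd z)) powr q / norm (fst z - snd z) powr (real DIM('a) + \<tau> * q)) \<partial>lebesgue)"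
    unfolding gagliardo_def by (subst nn_integral_add, measurable, subst nn_integral_sum, measurable)
  also have "\<dots> < \<infinity>"
    using far r(2) T by auto
  finally show "\<psi> \<in> Wspace \<tau> q E"
    unfolding Wspace_iff[OF q] using LpE \<psi> by (auto intro: measurable_restrict_space1)
qed

section \<open>Test functions and integration by parts through difference quotients\<close>

lemma directional_derivative:
  fixes \<phi> :: "'a::euclidean_space \<Rightarrow> real"
  assumes "\<phi> differentiable_on UNIV"
  shows "((\<lambda>t. \<phi> (x + t *\<^sub>R d)) has_real_derivative frechet_derivative \<phi> (at (x + t *\<^sub>R d)) d) (at t)"
proof -
  let ?D = "frechet_derivative \<phi> (at (x + t *\<^sub>R d))"
  have D: "(\<phi> has_derivative ?D) (at (x + t *\<^sub>R d))"
    using assms by (simp add: differentiable_on_def frechet_derivative_works)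
  have L: "((\<lambda>t. x + t *\<^sub>R d) has_derivative (\<lambda>t. t *\<^sub>R d)) (at t)"
    by (auto intro!: derivative_eq_intros)
  have "((\<lambda>t. \<phi> (x + t *\<^sub>R d)) has_derivative (\<lambda>r. ?D (r *\<^sub>R d))) (at t)"
    using has_derivative_compose[OF L D] .
  moreover have "(\<lambda>r. ?D (r *\<^sub>R d)) = (*) (?D d)"
    using has_derivative_linear[OF D] by (auto simp: linear_scale fun_eq_iff)
  ultimately show ?thesis by (simp add: has_field_derivative_def)
qed

locale test_direction =
  fixes E :: "'a::euclidean_space set" and \<phi> :: "'a \<Rightarrow> real" and b :: 'a
  assumes \<phi>: "test_function E \<phi>" and b: "b \<in> Basis"
begin

definition S :: "'a set" where "S = closure {x. \<phi> x \<noteq> 0}"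
definition d\<phi> :: "'a \<Rightarrow> real" where "d\<phi> x = frechet_derivative \<phi> (at x) b"

lemma S: "compact S" "S \<subseteq> E"
  using \<phi> by (auto simp: test_function_def S_def)

lemma diff: "\<phi> differentiable_on UNIV" and d\<phi>_cont: "continuous_on UNIV d\<phi>"
proof -
  have "Ck 1 \<phi>" "Ck 0 \<phi>" using \<phi> unfolding test_function_def by blast+
  then show "\<phi> differentiable_on UNIV" "continuous_on UNIV d\<phi>"
    using b by (auto simp: d\<phi>_def[abs_def])
qed

lemma \<phi>_cont: "continuous_on UNIV \<phi>"
  using diff by (rule differentiable_imp_continuous_on)

lemma \<phi>_zero: "x \<notin> S \<Longrightarrow> \<phi> x = 0"
  using closure_subset[of "{x. \<phi> x \<noteq> 0}"] by (auto simp: S_def)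

lemma d\<phi>_zero: "x \<notin> S \<Longrightarrow> d\<phi> x = 0"
proof -
  assume x: "x \<notin> S"
  have o: "open (- S)" by (simp add: S_def open_Compl)
  have "((\<lambda>_. 0) has_derivative (\<lambda>_. 0 :: real)) (at x)" by simp
  then have "(\<phi> has_derivative (\<lambda>_. 0)) (at x)"
    by (rule has_derivative_transform_within_open[OF _ o]) (use x in \<open>simp_all add: \<phi>_zero\<close>)
  then have "frechet_derivative \<phi> (at x) = (\<lambda>_. 0)" by (rule frechet_derivative_at[symmetric])
  then show "d\<phi> x = 0" by (simp add: d\<phi>_def)
qed

lemma bounded_of_support:
  fixes g :: "'a \<Rightarrow> real"
  assumes "continuous_on UNIV g" "\<And>x. x \<notin> S \<Longrightarrow> g x = 0"
  shows "\<exists>M\<ge>0. \<forall>x. \<bar>g x\<bar> \<le> M"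
proof -
  have "bounded (g ` S)"
    using S(1) assms(1) by (intro compact_imp_bounded compact_continuous_image) (auto intro: continuous_on_subset)
  then obtain M where M: "\<forall>x\<in>S. \<bar>g x\<bar> \<le> M" by (auto simp: bounded_iff)
  have "\<bar>g x\<bar> \<le> max M 0" for x
  proof (cases "x \<in> S")
    case True
    then show ?thesis using M by (auto simp: max.coboundedI1)
  next
    case False
    then show ?thesis using assms(2) by simp
  qed
  then show ?thesis by (intro exI[of _ "max M 0"]) auto
qed

lemma measurable_\<phi> [measurable]: "\<phi> \<in> borel_measurable lebesgue" "d\<phi> \<in> borel_measurable lebesgue"
  using \<phi>_cont d\<phi>_cont by (auto intro!: measurable_completion borel_measurable_continuous_onI simp: measurable_lborel2)

text \<open>Provides the majorant for dominated convergence. The direction is \<open>- b\<close>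
  because moving a translation from \<open>u\<close> to \<phi> reverses it.\<close>

lemma quot_bound:
  assumes M: "\<And>x. \<bar>d\<phi> x\<bar> \<le> M" and r: "0 < r"
  shows "\<bar>quot \<phi> (- b) r x\<bar> \<le> M"
proof -
  have "\<exists>z. 0 < z \<and> z < r \<and> \<phi> (x + r *\<^sub>R (- b)) - \<phi> (x + 0 *\<^sub>R (- b)) = (r - 0) * frechet_derivative \<phi> (at (x + z *\<^sub>R (- b))) (- b)"
    by (rule MVT2[OF r]) (rule directional_derivative[OF diff])
  then obtain z where z: "\<phi> (x + r *\<^sub>R (- b)) - \<phi> x = r * frechet_derivative \<phi> (at (x + z *\<^sub>R (- b))) (- b)" by auto
  have "linear (frechet_derivative \<phi> (at y))" for y
    using diff by (auto simp: differentiable_on_def intro: linear_frechet_derivative)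
  then have "frechet_derivative \<phi> (at y) (- b) = - d\<phi> y" for y
    by (simp add: linear_neg d\<phi>_def)
  then show ?thesis using z r M by (simp add: quot_def abs_mult)
qed

lemma quot_tendsto_deriv: "(\<lambda>j. quot \<phi> (- b) (1 / 2 ^ j) x) \<longlonglongrightarrow> - d\<phi> x"
proof -
  have "((\<lambda>t. \<phi> (x + t *\<^sub>R (- b))) has_real_derivative frechet_derivative \<phi> (at (x + 0 *\<^sub>R (- b))) (- b)) (at 0)"
    by (rule directional_derivative[OF diff])
  then have "(\<lambda>h. (\<phi> (x + (0 + h) *\<^sub>R (- b)) - \<phi> (x + 0 *\<^sub>R (- b))) / h) \<midarrow>0\<rightarrow> frechet_derivative \<phi> (at (x + 0 *\<^sub>R (- b))) (- b)"
    by (rule DERIV_D)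
  moreover have "linear (frechet_derivative \<phi> (at x))"
    using diff by (auto simp: differentiable_on_def intro: linear_frechet_derivative)
  ultimately have L: "(\<lambda>h. quot \<phi> (- b) h x) \<midarrow>0\<rightarrow> - d\<phi> x"
    by (simp add: quot_def d\<phi>_def linear_neg)
  have "(\<lambda>j. 1 / 2 ^ j :: real) \<longlonglongrightarrow> 0"
    using LIMSEQ_power_zero[of "1/2 :: real"] by (simp add: power_divide)
  then have "filterlim (\<lambda>j. 1 / 2 ^ j :: real) (at 0) sequentially"
    by (auto simp: filterlim_at)
  then show ?thesis by (rule filterlim_compose[OF L])
qed

text \<open>For a fixed step the identity is a change of variables. As the step tends to 0, the side
  with quotients of \<phi> converges by domination, and the side with quotients of \<open>u\<close>
  by local \<open>L^1\<close> convergence, which compactness extends to the whole support.\<close>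

lemma integration_by_parts:
  fixes u g :: "'a \<Rightarrow> real"
  assumes [measurable]: "u \<in> borel_measurable lebesgue" "g \<in> borel_measurable lebesgue"
    and u: "\<And>n :: nat. (\<integral>\<^sup>+x. ennreal (indicator (ball 0 (real n)) x * \<bar>u x\<bar>) \<partial>lebesgue) < \<infinity>"
    and g: "\<And>x. x \<in> E \<Longrightarrow> \<exists>r>0. (\<integral>\<^sup>+y. ennreal (indicator (ball x r) y * \<bar>g y\<bar>) \<partial>lebesgue) < \<infinity>"
    and lim: "\<And>x. x \<in> E \<Longrightarrow> \<exists>r>0. (\<lambda>j. \<integral>\<^sup>+y. ennreal (indicator (ball x r) y * \<bar>quot u b (1 / 2 ^ j) y - g y\<bar>) \<partial>lebesgue) \<longlonglongrightarrow> 0"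
  shows "(\<integral>x. u x * d\<phi> x \<partial>lebesgue) = - (\<integral>x. g x * \<phi> x \<partial>lebesgue)"
proof -
  obtain M where M: "0 \<le> M" "\<And>x. \<bar>d\<phi> x\<bar> \<le> M" using bounded_of_support[OF d\<phi>_cont d\<phi>_zero] by blast
  obtain M0 where M0: "0 \<le> M0" "\<And>x. \<bar>\<phi> x\<bar> \<le> M0" using bounded_of_support[OF \<phi>_cont \<phi>_zero] by blast
  obtain n0 where n0: "\<And>x. x \<in> S \<Longrightarrow> norm x \<le> n0" using compact_imp_bounded[OF S(1)] by (auto simp: bounded_iff)
  \<comment> \<open>The ball of radius \<open>n\<close> contains the support of \<phi> and all its
    translates by vectors of length at most 1, so one integrable majorant serves all steps.\<close>
  obtain n :: nat where n: "n0 + 2 < real n" using reals_Archimedean2 by blast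
  let ?I = "indicator (ball 0 (real n)) :: 'a \<Rightarrow> real"
  have Iu: "integrable lebesgue (\<lambda>x. ?I x * u x)"
    by (rule integrable_of_abs_le[OF _ _ u[of n]]) (auto simp: abs_mult)
  have near: "norm x < real n" if "x \<in> S \<or> x + v \<in> S" "norm v \<le> 1" for x v
  proof -
    have "norm x \<le> n0 + 1"
      using that n0[of x] n0[of "x + v"] norm_triangle_ineq4[of "x + v" v] by auto
    then show ?thesis using n by simp
  qed
  have Int_u: "integrable lebesgue (\<lambda>x. u x * v x)"
    if [measurable]: "v \<in> borel_measurable lebesgue" and "\<And>x. v x \<noteq> 0 \<Longrightarrow> norm x < real n" "\<And>x. \<bar>v x\<bar> \<le> m" for v m
  proof -
    have "integrable lebesgue (\<lambda>x. m * \<bar>?I x * u x\<bar>)" using Iu by auto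
    then show ?thesis
    proof (rule Bochner_Integration.integrable_bound)
      show "AE x in lebesgue. norm (u x * v x) \<le> norm (m * \<bar>?I x * u x\<bar>)"
      proof (rule AE_I2)
        fix x
        have "\<bar>u x\<bar> * \<bar>v x\<bar> \<le> \<bar>m * \<bar>?I x * u x\<bar>\<bar>"
        proof (cases "v x = 0")
          case False
          then have "norm x < real n" using that(2) by blast
          moreover have "\<bar>u x\<bar> * \<bar>v x\<bar> \<le> \<bar>u x\<bar> * m" using that(3) by (intro mult_left_mono) auto
          moreover have "0 \<le> m" using that(3)[of x] by linarith
          ultimately show ?thesis by (simp add: abs_mult mult.commute)
        qed simp
        then show "norm (u x * v x) \<le> norm (m * \<bar>?I x * u x\<bar>)" by (simp add: abs_mult)
      qed
    qed measurable
  qed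
  have I\<phi>: "integrable lebesgue (\<lambda>x. u x * \<phi> x)"
  proof (rule Int_u[OF _ _ M0(2)])
    show "norm x < real n" if "\<phi> x \<noteq> 0" for x
      using near[of x 0] \<phi>_zero[of x] that by auto
  qed measurable
  have parts: "(\<integral>x. quot u b r x * \<phi> x \<partial>lebesgue) = (\<integral>x. u x * quot \<phi> (- b) r x \<partial>lebesgue)" "integrable lebesgue (\<lambda>x. quot u b r x * \<phi> x)"
    if r: "0 < r" "r \<le> 1" for r
  proof -
    have nb: "norm (- (r *\<^sub>R b)) \<le> 1" using b r by simp
    have s: "integrable lebesgue (\<lambda>x. u x * \<phi> (x + - (r *\<^sub>R b)))"
    proof (rule Int_u[OF _ _ M0(2)])
      show "norm x < real n" if "\<phi> (x + - (r *\<^sub>R b)) \<noteq> 0" for x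
        using near[OF _ nb, of x] \<phi>_zero[of "x + - (r *\<^sub>R b)"] that by auto
    qed measurable
    have "integrable lebesgue (\<lambda>x. (u (x + r *\<^sub>R b) * \<phi> (x + r *\<^sub>R b + - (r *\<^sub>R b))))"
    proof -
      have "integrable (distr lebesgue lebesgue (\<lambda>x. x + r *\<^sub>R b)) (\<lambda>x. u x * \<phi> (x + - (r *\<^sub>R b)))"
        using s by (simp add: distr_lebesgue_plus)
      then show ?thesis
        by (subst (asm) integrable_distr_eq) (auto intro: measurable_lebesgue_plus)
    qed
    then have s': "integrable lebesgue (\<lambda>x. u (x + r *\<^sub>R b) * \<phi> x)" by simp
    have e1: "quot u b r x * \<phi> x = (u (x + r *\<^sub>R b) * \<phi> x - u x * \<phi> x) / r" for x
      by (simp add: quot_def field_simps)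
    have e2: "u x * quot \<phi> (- b) r x = (u x * \<phi> (x + - (r *\<^sub>R b)) - u x * \<phi> x) / r" for x
      by (simp add: quot_def field_simps)
    have "(\<integral>x. u (x + r *\<^sub>R b) * \<phi> (x + r *\<^sub>R b + - (r *\<^sub>R b)) \<partial>lebesgue) = (\<integral>x. u x * \<phi> (x + - (r *\<^sub>R b)) \<partial>lebesgue)"
      by (rule integral_lebesgue_shift[of "\<lambda>x. u x * \<phi> (x + - (r *\<^sub>R b))"]) measurable
    then have "(\<integral>x. u (x + r *\<^sub>R b) * \<phi> x \<partial>lebesgue) = (\<integral>x. u x * \<phi> (x + - (r *\<^sub>R b)) \<partial>lebesgue)" by simp
    then show "(\<integral>x. quot u b r x * \<phi> x \<partial>lebesgue) = (\<integral>x. u x * quot \<phi> (- b) r x \<partial>lebesgue)"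
      unfolding e1 e2 using s s' I\<phi> by simp
    show "integrable lebesgue (\<lambda>x. quot u b r x * \<phi> x)"
      unfolding e1 using s' I\<phi> by simp
  qed
  have lim1: "(\<lambda>j. \<integral>x. u x * quot \<phi> (- b) (1 / 2 ^ j) x \<partial>lebesgue) \<longlonglongrightarrow> (\<integral>x. u x * (- d\<phi> x) \<partial>lebesgue)"
  proof (rule integral_dominated_convergence)
    show "integrable lebesgue (\<lambda>x. M * \<bar>?I x * u x\<bar>)" using Iu by auto
    show "AE x in lebesgue. (\<lambda>j. u x * quot \<phi> (- b) (1 / 2 ^ j) x) \<longlonglongrightarrow> u x * (- d\<phi> x)"
      by (intro AE_I2 tendsto_intros quot_tendsto_deriv)
    show "AE x in lebesgue. norm (u x * quot \<phi> (- b) (1 / 2 ^ j) x) \<le> M * \<bar>?I x * u x\<bar>" for j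
    proof (rule AE_I2)
      fix x
      have nb: "norm ((1 / 2 ^ j) *\<^sub>R (- b)) \<le> 1" using b by (simp add: field_simps)
      show "norm (u x * quot \<phi> (- b) (1 / 2 ^ j) x) \<le> M * \<bar>?I x * u x\<bar>"
      proof (cases "quot \<phi> (- b) (1 / 2 ^ j) x = 0")
        case False
        have "x \<in> S \<or> x + (1 / 2 ^ j) *\<^sub>R (- b) \<in> S"
        proof (rule ccontr)
          assume "\<not> ?thesis"
          then have "\<phi> x = 0" "\<phi> (x + (1 / 2 ^ j) *\<^sub>R (- b)) = 0" using \<phi>_zero by blast+
          then have "quot \<phi> (- b) (1 / 2 ^ j) x = 0" unfolding quot_def by (simp only: diff_self div_0)
          then show False using False by simp
        qed
        then have "norm x < real n" using near nb by blast
        moreover have "\<bar>quot \<phi> (- b) (1 / 2 ^ j) x\<bar> \<le> M" by (rule quot_bound[OF M(2)]) simp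
        then have "\<bar>u x\<bar> * \<bar>quot \<phi> (- b) (1 / 2 ^ j) x\<bar> \<le> \<bar>u x\<bar> * M" by (intro mult_left_mono) auto
        ultimately show ?thesis by (simp add: abs_mult mult.commute)
      qed (use M in auto)
    qed
  qed measurable
  have Sg: "(\<integral>\<^sup>+x. ennreal (indicator S x * \<bar>g x\<bar>) \<partial>lebesgue) < \<infinity>"
    by (rule nn_integral_compact_finite[OF _ _ S(1) g[OF subsetD[OF S(2)]]]) auto
  have SM [measurable]: "S \<in> sets lebesgue"
    using borel_compact[OF S(1)] by (simp add: sets_completionI_sets)
  have Ig: "integrable lebesgue (\<lambda>x. g x * \<phi> x)"
  proof (rule integrable_of_abs_le)
    show "\<bar>g x * \<phi> x\<bar> \<le> M0 * (indicator S x * \<bar>g x\<bar>)" for x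
    proof (cases "x \<in> S")
      case True
      then show ?thesis using mult_right_mono[OF M0(2)[of x], of "\<bar>g x\<bar>"] by (simp add: abs_mult mult.commute)
    qed (simp add: \<phi>_zero)
    have "(\<integral>\<^sup>+x. ennreal (M0 * (indicator S x * \<bar>g x\<bar>)) \<partial>lebesgue) = ennreal M0 * (\<integral>\<^sup>+x. ennreal (indicator S x * \<bar>g x\<bar>) \<partial>lebesgue)"
      using M0 by (simp add: nn_integral_cmult ennreal_mult')
    also have "\<dots> < \<infinity>" using Sg by (simp add: ennreal_mult_less_top)
    finally show "(\<integral>\<^sup>+x. ennreal (M0 * (indicator S x * \<bar>g x\<bar>)) \<partial>lebesgue) < \<infinity>" .
  qed measurable
  have lim0: "(\<lambda>j. \<integral>\<^sup>+x. ennreal (indicator S x * \<bar>quot u b (1 / 2 ^ j) x - g x\<bar>) \<partial>lebesgue) \<longlonglongrightarrow> 0"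
    by (rule nn_integral_compact_tendsto_0[OF _ _ S(1) lim[OF subsetD[OF S(2)]]]) auto
  then have "(\<lambda>j. ennreal M0 * (\<integral>\<^sup>+x. ennreal (indicator S x * \<bar>quot u b (1 / 2 ^ j) x - g x\<bar>) \<partial>lebesgue)) \<longlonglongrightarrow> ennreal M0 * 0"
    by (intro ennreal_tendsto_cmult) auto
  then have lim0': "(\<lambda>j. ennreal M0 * (\<integral>\<^sup>+x. ennreal (indicator S x * \<bar>quot u b (1 / 2 ^ j) x - g x\<bar>) \<partial>lebesgue)) \<longlonglongrightarrow> 0" by simp
  have diff_le: "ennreal \<bar>(\<integral>x. quot u b (1 / 2 ^ j) x * \<phi> x \<partial>lebesgue) - (\<integral>x. g x * \<phi> x \<partial>lebesgue)\<bar>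
     \<le> ennreal M0 * (\<integral>\<^sup>+x. ennreal (indicator S x * \<bar>quot u b (1 / 2 ^ j) x - g x\<bar>) \<partial>lebesgue)" for j
  proof -
    have r: "0 < (1 / 2 ^ j :: real)" "1 / 2 ^ j \<le> (1 :: real)" by (auto simp: field_simps)
    have I: "integrable lebesgue (\<lambda>x. (quot u b (1 / 2 ^ j) x - g x) * \<phi> x)"
      using parts(2)[OF r] Ig by (simp add: left_diff_distrib)
    have "(\<integral>x. quot u b (1 / 2 ^ j) x * \<phi> x \<partial>lebesgue) - (\<integral>x. g x * \<phi> x \<partial>lebesgue) = (\<integral>x. (quot u b (1 / 2 ^ j) x - g x) * \<phi> x \<partial>lebesgue)"
      using parts(2)[OF r] Ig by (simp add: left_diff_distrib)
    then have "ennreal \<bar>(\<integral>x. quot u b (1 / 2 ^ j) x * \<phi> x \<partial>lebesgue) - (\<integral>x. g x * \<phi> x \<partial>lebesgue)\<bar> \<le> (\<integral>\<^sup>+x. ennreal (\<bar>(quot u b (1 / 2 ^ j) x - g x) * \<phi> x\<bar>) \<partial>lebesgue)"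
      using integral_norm_bound_ennreal[OF I] by simp
    also have "\<dots> \<le> (\<integral>\<^sup>+x. ennreal M0 * ennreal (indicator S x * \<bar>quot u b (1 / 2 ^ j) x - g x\<bar>) \<partial>lebesgue)"
    proof (rule nn_integral_mono)
      fix x
      have "\<bar>(quot u b (1 / 2 ^ j) x - g x) * \<phi> x\<bar> \<le> M0 * (indicator S x * \<bar>quot u b (1 / 2 ^ j) x - g x\<bar>)"
      proof (cases "x \<in> S")
        case True
        then show ?thesis
          using mult_right_mono[OF M0(2)[of x], of "\<bar>quot u b (1 / 2 ^ j) x - g x\<bar>"] by (simp add: abs_mult mult.commute)
      qed (simp add: \<phi>_zero)
      then show "ennreal \<bar>(quot u b (1 / 2 ^ j) x - g x) * \<phi> x\<bar> \<le> ennreal M0 * ennreal (indicator S x * \<bar>quot u b (1 / 2 ^ j) x - g x\<bar>)"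
        using M0 by (simp add: ennreal_leI flip: ennreal_mult')
    qed
    also have "\<dots> = ennreal M0 * (\<integral>\<^sup>+x. ennreal (indicator S x * \<bar>quot u b (1 / 2 ^ j) x - g x\<bar>) \<partial>lebesgue)"
      by (rule nn_integral_cmult) measurable
    finally show ?thesis .
  qed
  have "(\<lambda>j. ennreal \<bar>(\<integral>x. quot u b (1 / 2 ^ j) x * \<phi> x \<partial>lebesgue) - (\<integral>x. g x * \<phi> x \<partial>lebesgue)\<bar>) \<longlonglongrightarrow> 0"
    by (rule tendsto_sandwich[OF _ _ tendsto_const lim0']) (use diff_le in auto)
  then have "(\<lambda>j. \<bar>(\<integral>x. quot u b (1 / 2 ^ j) x * \<phi> x \<partial>lebesgue) - (\<integral>x. g x * \<phi> x \<partial>lebesgue)\<bar>) \<longlonglongrightarrow> 0"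
    by (subst (asm) ennreal_0[symmetric], subst (asm) tendsto_ennreal_iff) auto
  then have "(\<lambda>j. (\<integral>x. quot u b (1 / 2 ^ j) x * \<phi> x \<partial>lebesgue) - (\<integral>x. g x * \<phi> x \<partial>lebesgue)) \<longlonglongrightarrow> 0"
    by (rule tendsto_rabs_zero_cancel)
  then have lim2: "(\<lambda>j. \<integral>x. quot u b (1 / 2 ^ j) x * \<phi> x \<partial>lebesgue) \<longlonglongrightarrow> (\<integral>x. g x * \<phi> x \<partial>lebesgue)"
    by (simp add: LIM_zero_iff)
  have "(\<lambda>j. \<integral>x. quot u b (1 / 2 ^ j) x * \<phi> x \<partial>lebesgue) = (\<lambda>j. \<integral>x. u x * quot \<phi> (- b) (1 / 2 ^ j) x \<partial>lebesgue)"
    by (intro ext parts) (auto simp: field_simps)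
  then have "(\<integral>x. g x * \<phi> x \<partial>lebesgue) = (\<integral>x. u x * (- d\<phi> x) \<partial>lebesgue)"
    using LIMSEQ_unique[OF lim2] lim1 by simp
  then show ?thesis by simp
qed

end

lemma Lspace_loc_I:
  fixes \<psi> :: "'a::euclidean_space \<Rightarrow> 'b::euclidean_space"
  assumes \<psi> [measurable]: "\<psi> \<in> borel_measurable lebesgue" and q: "0 < q"
    and loc: "\<And>x. x \<in> \<Omega> \<Longrightarrow> \<exists>r>0. (\<integral>\<^sup>+y. ennreal (indicator (ball x r) y * norm (\<psi> y) powr q) \<partial>lebesgue) < \<infinity>"
  shows "\<psi> \<in> Lspace_loc q \<Omega>"
  unfolding Lspace_loc_def
proof (intro CollectI allI impI)
  fix E assume E: "compactly_inside E \<Omega>"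
  define S where "S = closure E"
  have S: "compact S" "S \<subseteq> \<Omega>" "E \<subseteq> S" "open E"
    using E by (auto simp: compactly_inside_def S_def closure_subset)
  have Lp: "(\<integral>\<^sup>+x. ennreal (indicator S x * norm (\<psi> x) powr q) \<partial>lebesgue) < \<infinity>"
    by (rule nn_integral_compact_finite[OF _ _ S(1) loc[OF subsetD[OF S(2)]]]) auto
  have "(\<integral>\<^sup>+x. ennreal (indicator E x * norm (\<psi> x) powr q) \<partial>lebesgue) < \<infinity>"
    using Lp by (rule le_less_trans[rotated]) (intro nn_integral_mono ennreal_leI, use S(3) in \<open>auto simp: indicator_def\<close>)
  then have "Lnorm q E \<psi> < \<infinity>"
    using Lnorm_powr[OF q, of E \<psi>] epowr_less_top_iff[of "Lnorm q E \<psi>" q] by simp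
  then show "\<psi> \<in> Lspace q E"
    unfolding Lspace_def using \<psi> by (auto intro: measurable_restrict_space1)
qed

lemma epowr_mono: "0 < a \<Longrightarrow> x \<le> y \<Longrightarrow> epowr x a \<le> epowr y a"
  by (auto simp: epowr_def top_unique intro!: ennreal_leI powr_mono2 enn2real_mono simp: less_top)

section \<open>The estimates on balls\<close>

lemma ex_kernel_constants:
  assumes "0 < s" "s < 1" "(2 :: real) \<le> p"
  shows "\<exists>kf kn. 0 \<le> kf \<and> 0 \<le> kn \<and>
    (\<forall>(x :: 'a::euclidean_space) a. 0 < a \<longrightarrow>
      (\<integral>\<^sup>+y. ennreal (indicator (- ball x a) y / norm (x - y) powr (real DIM('a) + s * p)) \<partial>lebesgue) \<le> ennreal (kf * a powr (- (s * p)))) \<and>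
    (\<forall>(x :: 'a) a. 0 < a \<longrightarrow>
      (\<integral>\<^sup>+y. ennreal (indicator (ball x a) y * norm (x - y) powr (p - s * p - real DIM('a))) \<partial>lebesgue) \<le> ennreal (kn * a powr (p - s * p)))"
proof -
  let ?V = "unit_ball_vol (real DIM('a)) * 2 ^ DIM('a)"
  have sp: "0 < s * p" "0 < p - s * p" using assms by auto
  have pos: "0 \<le> ?V / (1 - 2 powr (- \<beta>))" if "0 < \<beta>" for \<beta> :: real
    using powr_less_one[of 2 "- \<beta>"] that by (intro divide_nonneg_nonneg mult_nonneg_nonneg) auto
  show ?thesis
  proof (intro exI conjI allI impI)
    show "0 \<le> ?V / (1 - 2 powr (- (s * p)))" "0 \<le> ?V / (1 - 2 powr (- (p - s * p)))"
      by (rule pos[OF sp(1)] pos[OF sp(2)])+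
    fix x :: 'a and a :: real assume a: "0 < a"
    show "(\<integral>\<^sup>+y. ennreal (indicator (- ball x a) y / norm (x - y) powr (real DIM('a) + s * p)) \<partial>lebesgue)
      \<le> ennreal (?V / (1 - 2 powr (- (s * p))) * a powr (- (s * p)))"
      by (rule nn_integral_kernel_far[OF sp(1) a])
    show "(\<integral>\<^sup>+y. ennreal (indicator (ball x a) y * norm (x - y) powr (p - s * p - real DIM('a))) \<partial>lebesgue)
      \<le> ennreal (?V / (1 - 2 powr (- (p - s * p))) * a powr (p - s * p))"
      using nn_integral_kernel_near[OF sp(2) a, of x] by simp
  qed
qed

section \<open>From snails and \<open>A_term\<close> to the hypotheses of the energy
  estimate\<close>

lemma measurable_of_balls:
  fixes u :: "'a::euclidean_space \<Rightarrow> real"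
  assumes "\<And>n :: nat. u \<in> borel_measurable (lebesgue_on (ball 0 (real n)))"
  shows "u \<in> borel_measurable lebesgue"
proof (rule borel_measurable_LIMSEQ_real)
  show "(\<lambda>x. if x \<in> ball 0 (real n) then u x else 0) \<in> borel_measurable lebesgue" for n
    using assms[of n] by (subst borel_measurable_if) auto
  show "(\<lambda>n. if x \<in> ball 0 (real n) then u x else 0) \<longlonglongrightarrow> u x" for x
  proof (rule tendsto_eventually)
    obtain m :: nat where "norm x < real m" using reals_Archimedean2 by blast
    then have "\<forall>n\<ge>m. x \<in> ball 0 (real n)" by auto
    then show "\<forall>\<^sub>F n in sequentially. (if x \<in> ball 0 (real n) then u x else 0) = u x"
      by (auto simp: eventually_sequentially)
  qed
qed

lemma compactly_inside_ball:
  fixes \<Omega> :: "'a::euclidean_space set"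
  assumes "compactly_inside (ball x0 R) \<Omega>" "r \<le> R"
  shows "compactly_inside (ball x0 r) \<Omega>"
proof -
  have "closure (ball x0 r) \<subseteq> closure (ball x0 R)" using assms(2) by (intro closure_mono) auto
  moreover have "bounded (closure (ball x0 r))" using bounded_closure[OF bounded_ball, of x0 r] .
  ultimately show ?thesis
    using assms(1) by (auto simp: compactly_inside_def compact_eq_bounded_closed)
qed

lemma compactly_inside_UNIV_ball: "compactly_inside (ball (x0 :: 'a::euclidean_space) r) UNIV"
  using bounded_closure[OF bounded_ball, of x0 r] by (auto simp: compactly_inside_def compact_eq_bounded_closed)

lemma Xspace_measurable: "u \<in> Xspace s p \<Longrightarrow> u \<in> borel_measurable lebesgue"
  using compactly_inside_UNIV_ball
  by (intro measurable_of_balls) (auto simp: Xspace_def Lspace_loc_def Lspace_def)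

text \<open>Turns the norm of a snail into the double integral in which tails enter the energy
  estimate. The volume factor does not depend on \<open>x\<close> and comes out; for a ball it is a
  multiple of the radius to the power \<open>s * p\<close>.\<close>

lemma snail_integral:
  fixes \<psi> :: "'a::euclidean_space \<Rightarrow> real"
  assumes [measurable]: "\<psi> \<in> borel_measurable lebesgue" "E \<in> sets borel" "F \<in> sets borel" and p: "0 < p"
  shows "(\<integral>\<^sup>+x\<in>F. epowr (Snail s p \<psi> x E) p \<partial>lebesgue)
    = ennreal (measure lebesgue E powr (s * p / real DIM('a))) *
      (\<integral>\<^sup>+z. ennreal (indicator F (fst z) * indicator (- E) (snd z) * \<bar>\<psi> (snd z)\<bar> powr p * mu s p z) \<partial>lebesgue)"
proof -
  let ?m = "ennreal (measure lebesgue E powr (s * p / real DIM('a)))"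
  let ?g = "\<lambda>z. indicator F (fst z) * indicator (- E) (snd z) * \<bar>\<psi> (snd z)\<bar> powr p * mu s p z"
  have [measurable]: "- E \<in> sets borel" using assms(2) by auto
  have [measurable]: "?g \<in> borel_measurable lebesgue" by measurable
  have "?m * (\<integral>\<^sup>+z. ennreal (?g z) \<partial>lebesgue) = (\<integral>\<^sup>+z. ?m * ennreal (?g z) \<partial>lebesgue)"
    by (rule nn_integral_cmult[symmetric]) measurable
  also have "\<dots> = (\<integral>\<^sup>+x. \<integral>\<^sup>+y. ?m * ennreal (?g (x, y)) \<partial>lebesgue \<partial>lebesgue)"
    by (rule nn_integral_lebesgue_fst) measurable
  also have "\<dots> = (\<integral>\<^sup>+x\<in>F. epowr (Snail s p \<psi> x E) p \<partial>lebesgue)"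
  proof (rule nn_integral_cong)
    fix x
    have "(\<integral>\<^sup>+y. ?m * ennreal (?g (x, y)) \<partial>lebesgue) = ?m * (\<integral>\<^sup>+y. ennreal (?g (x, y)) \<partial>lebesgue)"
      by (rule nn_integral_cmult) (simp add: mu_def, measurable)
    also have "(\<integral>\<^sup>+y. ennreal (?g (x, y)) \<partial>lebesgue) = (\<integral>\<^sup>+y. indicator F x * (ennreal (\<bar>\<psi> y\<bar> powr p / norm (x - y) powr (real DIM('a) + s * p)) * indicator (UNIV - E) y) \<partial>lebesgue)"
      by (intro nn_integral_cong) (auto simp: mu_def indicator_def)
    also have "\<dots> = indicator F x * (\<integral>\<^sup>+y\<in>UNIV - E. ennreal (\<bar>\<psi> y\<bar> powr p / norm (x - y) powr (real DIM('a) + s * p)) \<partial>lebesgue)"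
      by (auto simp: indicator_def)
    finally show "(\<integral>\<^sup>+y. ?m * ennreal (?g (x, y)) \<partial>lebesgue) = epowr (Snail s p \<psi> x E) p * indicator F x"
      using p by (simp add: Snail_def epowr_epowr mult_ac)
  qed
  finally show ?thesis by simp
qed

lemma measure_lebesgue_ball_powr:
  assumes "0 < r" "0 < s" "0 < p"
  shows "measure lebesgue (ball (x0 :: 'a::euclidean_space) r) powr (s * p / real DIM('a))
    = unit_ball_vol (real DIM('a)) powr (s * p / real DIM('a)) * r powr (s * p)"
proof -
  have "measure lebesgue (ball x0 r) = unit_ball_vol (real DIM('a)) * r powr real DIM('a)"
    using assms by (simp add: content_ball powr_realpow)
  then show ?thesis using assms by (simp add: powr_mult powr_powr)
qed

text \<open>Bounds the losses when summands of \<open>A_term\<close> become hypotheses of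
  \<open>controlled\<close>: the volume normalization of snails, the radius \<open>7/8 * R\<close>
  in one of them, and the factor \<open>1 - s\<close> in front of \<open>f\<close>. A sum stands in
  for the maximum.\<close>

definition control_const :: "nat \<Rightarrow> real \<Rightarrow> real \<Rightarrow> real" where
  "control_const n s p = 1 + unit_ball_vol (real n) powr (- (s * p / real n)) * (1 + (8 / 7) powr (s * p))
     + (1 - s) powr (- conj_exp p)"

lemma control_const_pos: "0 < control_const n s p"
  unfolding control_const_def by (intro add_pos_nonneg mult_nonneg_nonneg) auto

text \<open>The lower bound makes every increment shorter than \<open>R / 16\<close> admissible in
  \<open>Ynorm\<close>. The upper bound keeps all its increments below \<open>R / 2\<close>, which
  serves to show that \<open>A_term\<close> is finite.\<close>

lemma setdist_balls:
  assumes "0 < R"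
  shows "R / 8 \<le> setdist (ball (x0 :: 'a::euclidean_space) (3/4 * R)) (UNIV - ball x0 (7/8 * R))"
    and "setdist (ball x0 (3/4 * R)) (UNIV - ball x0 (7/8 * R)) \<le> 7/8 * R"
proof -
  let ?F = "ball x0 (3/4 * R)" and ?E = "UNIV - ball x0 (7/8 * R)"
  obtain b :: 'a where b: "b \<in> Basis" using nonempty_Basis by blast
  have n: "norm ((7/8 * R) *\<^sub>R b) = 7/8 * R" using b assms by simp
  have y: "x0 + (7/8 * R) *\<^sub>R b \<in> ?E" unfolding DiffE mem_ball using n by (simp add: dist_norm)
  have x: "x0 \<in> ?F" using assms by simp
  show "R / 8 \<le> setdist ?F ?E"
  proof (rule le_setdistI)
    fix v w assume "v \<in> ?F" "w \<in> ?E"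
    then have "dist x0 v < 3/4 * R" "7/8 * R \<le> dist x0 w" by auto
    then show "R / 8 \<le> dist v w" using dist_triangle[of x0 w v] by linarith
  qed (use x y in blast)+
  have "setdist ?F ?E \<le> dist x0 (x0 + (7/8 * R) *\<^sub>R b)"
    by (rule setdist_le_dist[OF x y])
  then show "setdist ?F ?E \<le> 7/8 * R" using n by (simp add: dist_norm)
qed

lemma ennreal_mult_leD:
  assumes "ennreal k * X \<le> ennreal a" "0 < k" "a / k \<le> b"
  shows "X \<le> ennreal b"
  using ennreal_mult_le_imp[OF assms(1,2)] ennreal_leI[OF assms(3)] by (rule order_trans)

lemma A_term_bounds:
  fixes u f :: "'a::euclidean_space \<Rightarrow> real"
  assumes p: "2 \<le> p" and s: "0 < s" "s < 1" and R: "0 < R" and a: "A_term t s p u f x0 R \<le> ennreal a" "0 < a"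
    and u_m [measurable]: "u \<in> borel_measurable lebesgue"
  shows "gagliardo s p (ball x0 R) u \<le> ennreal (R powr (- (s * p)) * a)"
    and "(\<integral>\<^sup>+x. ennreal (indicator (ball x0 R) x * \<bar>u x\<bar> powr p) \<partial>lebesgue) \<le> ennreal a"
    and "(\<integral>\<^sup>+z. ennreal (indicator (ball x0 (3/4 * R)) (fst z) * indicator (- ball x0 R) (snd z) *
        \<bar>u (snd z)\<bar> powr p * mu s p z) \<partial>lebesgue)
      \<le> ennreal (R powr (- (s * p)) * (unit_ball_vol (real DIM('a)) powr (- (s * p / real DIM('a))) * a))"
    and "\<And>h. 0 < norm h \<Longrightarrow> norm h < R / 16 \<Longrightarrow>
        (\<integral>\<^sup>+z. ennreal (indicator (ball x0 (3/4 * R)) (fst z) * indicator (- ball x0 (7/8 * R)) (snd z) *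
        \<bar>u (snd z + h) - u (snd z)\<bar> powr p * mu s p z) \<partial>lebesgue)
      \<le> ennreal (R powr (- (s * p)) * (norm h / R) powr (t * p) *
          (unit_ball_vol (real DIM('a)) powr (- (s * p / real DIM('a))) * (8 / 7) powr (s * p) * a))"
    and "gagliardo s (conj_exp p) (ball x0 R) (\<lambda>x. (1 - s) * f x)
        \<le> ennreal (R powr (- (s * p * conj_exp p)) * R powr (- (s * conj_exp p)) * a)"
proof -
  let ?q = "conj_exp p" and ?N = "real DIM('a)"
  have q: "0 < ?q" and p0: "0 < p" using p by (auto simp: conj_exp_def)
  have ss: "0 < s * (1 - s)" "s * (1 - s) \<le> 1" using s mult_le_one[of s "1 - s"] by auto
  have bb: "ball x r \<in> sets borel" for x :: 'a and r by simp
  define V where "V = unit_ball_vol ?N powr (s * p / ?N)"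
  have V: "0 < V" "unit_ball_vol ?N powr (- (s * p / ?N)) = 1 / V"
    using less_imp_neq[OF unit_ball_vol_DIM_pos, of "DIM('a)", symmetric] by (auto simp: V_def powr_minus_divide)
  let ?X1 = "ennreal (R powr (s * p)) * gagliardo s p (ball x0 R) u"
  let ?X2 = "ennreal (1 / (s * (1 - s))) * (\<integral>\<^sup>+x. ennreal (indicator (ball x0 R) x * \<bar>u x\<bar> powr p) \<partial>lebesgue)"
  let ?X3 = "ennreal (1 / s) * epowr (Xnorm s p u (ball x0 (3/4 * R)) (ball x0 R)) p"
  let ?Y = "Ynorm t s p u (ball x0 (3/4 * R)) (ball x0 (7/8 * R))"
  let ?X4 = "ennreal (R powr (t * p)) * epowr ?Y p"
  let ?X5 = "ennreal (R powr (s * p * ?q)) * (ennreal (R powr (s * ?q)) * gagliardo s ?q (ball x0 R) (\<lambda>x. (1 - s) * f x))"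
  have A: "A_term t s p u f x0 R = (?X1 + ?X2) + ?X3 + ?X4 + (?X5 + ennreal (R powr (s * p * ?q)) * (ennreal (1 / (s * (1 - s))) * epowr (Lnorm ?q (ball x0 R) (\<lambda>x. (1 - s) * f x)) ?q))"
    unfolding A_term_def Let_def using Wseminorm_powr[OF p0, of s "ball x0 R" u] Lnorm_powr[OF p0, of "ball x0 R" u]
      Wseminorm_powr[OF q, of s "ball x0 R" "\<lambda>x. (1 - s) * f x"]
    by (simp add: distrib_left)
  have X: "?X1 \<le> ennreal a" "?X2 \<le> ennreal a" "?X3 \<le> ennreal a" "?X4 \<le> ennreal a" "?X5 \<le> ennreal a"
    using a(1) unfolding A by (auto intro: order_trans[rotated] simp: add_increasing add_increasing2)
  show "gagliardo s p (ball x0 R) u \<le> ennreal (R powr (- (s * p)) * a)"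
    by (rule ennreal_mult_leD[OF X(1)]) (use R in \<open>auto simp: powr_minus_divide\<close>)
  show "(\<integral>\<^sup>+x. ennreal (indicator (ball x0 R) x * \<bar>u x\<bar> powr p) \<partial>lebesgue) \<le> ennreal a"
  proof (rule ennreal_mult_leD[OF X(2)])
    show "a / (1 / (s * (1 - s))) \<le> a" using ss a mult_left_mono[of "s * (1 - s)" 1 a] by simp
  qed (use ss in auto)
  show "(\<integral>\<^sup>+z. ennreal (indicator (ball x0 (3/4 * R)) (fst z) * indicator (- ball x0 R) (snd z) *
        \<bar>u (snd z)\<bar> powr p * mu s p z) \<partial>lebesgue)
      \<le> ennreal (R powr (- (s * p)) * (unit_ball_vol ?N powr (- (s * p / ?N)) * a))" (is "?I \<le> _")
  proof -
    have "epowr (Xnorm s p u (ball x0 (3/4 * R)) (ball x0 R)) p \<le> ennreal a"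
    proof (rule ennreal_mult_leD[OF X(3)])
      show "a / (1 / s) \<le> a" using s a mult_left_mono[of s 1 a] by simp
    qed (use s in auto)
    then have "(\<integral>\<^sup>+x\<in>ball x0 (3/4 * R). epowr (Snail s p u x (ball x0 R)) p \<partial>lebesgue) \<le> ennreal a"
      unfolding Xnorm_def epowr_epowr[OF p0] by (rule order_trans[rotated]) simp
    then have "ennreal (V * R powr (s * p)) * ?I \<le> ennreal a"
      unfolding snail_integral[OF u_m bb bb p0] measure_lebesgue_ball_powr[OF R s(1) p0] V_def .
    then show ?thesis
      unfolding V(2) by (rule ennreal_mult_leD) (use V(1) R a in \<open>auto simp: powr_minus_divide mult.commute\<close>)
  qed
  show "(\<integral>\<^sup>+z. ennreal (indicator (ball x0 (3/4 * R)) (fst z) * indicator (- ball x0 (7/8 * R)) (snd z) *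
        \<bar>u (snd z + h) - u (snd z)\<bar> powr p * mu s p z) \<partial>lebesgue)
      \<le> ennreal (R powr (- (s * p)) * (norm h / R) powr (t * p) * (unit_ball_vol ?N powr (- (s * p / ?N)) * (8 / 7) powr (s * p) * a))"
    (is "?I \<le> _") if h: "0 < norm h" "norm h < R / 16" for h
  proof -
    let ?S = "\<integral>\<^sup>+x\<in>ball x0 (3/4 * R). epowr (Snail s p (diff_quot t h u) x (ball x0 (7/8 * R))) p \<partial>lebesgue"
    have dq_m [measurable]: "diff_quot t h u \<in> borel_measurable lebesgue" unfolding diff_quot_def[abs_def] by measurable
    have R78: "0 < 7/8 * R" using R by simp
    have "epowr ?S (1 / p) \<le> ?Y"
      unfolding Ynorm_def by (rule SUP_upper) (use h setdist_balls(1)[OF R, of x0] in auto)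
    then have "epowr (epowr ?S (1 / p)) p \<le> epowr ?Y p" by (rule epowr_mono[OF p0])
    then have "?S \<le> epowr ?Y p" by (simp only: epowr_epowr[OF p0])
    also have "epowr ?Y p \<le> ennreal (R powr (- (t * p)) * a)"
      by (rule ennreal_mult_leD[OF X(4)]) (use R in \<open>auto simp: powr_minus_divide\<close>)
    finally have S: "?S \<le> ennreal (R powr (- (t * p)) * a)" .
    let ?J = "\<integral>\<^sup>+z. ennreal (indicator (ball x0 (3/4 * R)) (fst z) * indicator (- ball x0 (7/8 * R)) (snd z) *
        \<bar>diff_quot t h u (snd z)\<bar> powr p * mu s p z) \<partial>lebesgue"
    have "ennreal (V * (7/8 * R) powr (s * p)) * ?J \<le> ennreal (R powr (- (t * p)) * a)"
      using S unfolding snail_integral[OF dq_m bb bb p0] measure_lebesgue_ball_powr[OF R78 s(1) p0] V_def .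
    then have J: "?J \<le> ennreal (R powr (- (t * p)) * a / (V * (7/8 * R) powr (s * p)))"
      by (rule ennreal_mult_le_imp) (use V R in auto)
    have "?I \<le> ennreal (norm h powr (t * p) * (R powr (- (t * p)) * a / (V * (7/8 * R) powr (s * p))))"
    proof (rule nn_integral_scale[OF _ _ _ J])
      fix z :: "'a \<times> 'a"
      have "\<bar>u (snd z + h) - u (snd z)\<bar> powr p = norm h powr (t * p) * \<bar>diff_quot t h u (snd z)\<bar> powr p"
        using h by (simp add: diff_quot_def powr_divide powr_powr abs_divide)
      then show "indicator (ball x0 (3/4 * R)) (fst z) * indicator (- ball x0 (7/8 * R)) (snd z) *
        \<bar>u (snd z + h) - u (snd z)\<bar> powr p * mu s p z \<le> norm h powr (t * p) * (indicator (ball x0 (3/4 * R)) (fst z) * indicator (- ball x0 (7/8 * R)) (snd z) *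
        \<bar>diff_quot t h u (snd z)\<bar> powr p * mu s p z)"
        by (simp add: mult_ac)
    qed auto
    also have "norm h powr (t * p) * (R powr (- (t * p)) * a / (V * (7/8 * R) powr (s * p)))
      = R powr (- (s * p)) * (norm h / R) powr (t * p) * (1 / V * (8 / 7) powr (s * p) * a)"
      using R V by (simp add: powr_mult powr_divide powr_minus_divide field_simps)
    finally show ?thesis unfolding V(2) .
  qed
  have "ennreal (R powr (s * ?q)) * gagliardo s ?q (ball x0 R) (\<lambda>x. (1 - s) * f x) \<le> ennreal (R powr (- (s * p * ?q)) * a)"
    by (rule ennreal_mult_leD[OF X(5)]) (use R in \<open>auto simp: powr_minus_divide\<close>)
  then show "gagliardo s ?q (ball x0 R) (\<lambda>x. (1 - s) * f x) \<le> ennreal (R powr (- (s * p * ?q)) * R powr (- (s * ?q)) * a)"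
    by (rule ennreal_mult_leD) (use R in \<open>auto simp: powr_minus_divide\<close>)
qed

lemma admissible_of_weak_solution:
  fixes u f K :: "'a::euclidean_space \<Rightarrow> real"
  assumes p: "2 \<le> p" and s: "0 < s" "s < 1" and t: "0 \<le> t" "t \<le> s" and \<Lambda>: "1 \<le> \<Lambda>"
    and kf: "0 \<le> kf" "\<And>(x :: 'a) a. 0 < a \<Longrightarrow>
      (\<integral>\<^sup>+y. ennreal (indicator (- ball x a) y / norm (x - y) powr (real DIM('a) + s * p)) \<partial>lebesgue) \<le> ennreal (kf * a powr (- (s * p)))"
    and kn: "0 \<le> kn" "\<And>(x :: 'a) a. 0 < a \<Longrightarrow>
      (\<integral>\<^sup>+y. ennreal (indicator (ball x a) y * norm (x - y) powr (p - s * p - real DIM('a))) \<partial>lebesgue) \<le> ennreal (kn * a powr (p - s * p))"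
    and K_m: "K \<in> borel_measurable lebesgue"
    and K: "\<And>z. 1 / \<Lambda> * norm z powr (real DIM('a) + s * p) \<le> K z" "\<And>z. K z \<le> \<Lambda> * norm z powr (real DIM('a) + s * p)"
    and f: "f \<in> Wspace_loc s (conj_exp p) \<Omega>" and u: "u \<in> Xspace s p" and sol: "local_weak_solution s p K \<Omega> f u"
    and R: "0 < R" and B: "compactly_inside (ball x0 R) \<Omega>"
    and a: "A_term t s p u f x0 R \<le> ennreal a" "0 < a"
  shows "admissible p s t \<Lambda> kf kn u x0 R (control_const DIM('a) s p * a)"
proof -
  let ?q = "conj_exp p" and ?N = "real DIM('a)" and ?B = "ball x0 R"
  have q: "0 < ?q" and p0: "0 < p" using p by (auto simp: conj_exp_def)
  have u_m [measurable]: "u \<in> borel_measurable lebesgue" by (rule Xspace_measurable[OF u])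
  \<comment> \<open>\<open>f\<close> is known to be measurable only locally in \<Omega>. Setting it
    to 0 outside the ball gives a function measurable on the whole space and changes nothing for
    test functions supported in the ball.\<close>
  define f0 where "f0 x = (if x \<in> ?B then f x else 0)" for x
  have fB: "f \<in> Wspace s ?q ?B" using f B by (auto simp: Wspace_loc_def)
  have f0_m [measurable]: "f0 \<in> borel_measurable lebesgue"
    unfolding f0_def[abs_def] by (subst borel_measurable_if) (use fB Wspace_iff[OF q] in auto)
  note b = A_term_bounds[OF p s R a u_m]
  define c where "c = control_const DIM('a) s p"
  let ?v = "unit_ball_vol ?N powr (- (s * p / ?N))"
  have c: "1 \<le> c" "?v \<le> c" "?v * (8 / 7) powr (s * p) \<le> c" "(1 - s) powr (- ?q) \<le> c"
  proof -
    have "0 \<le> ?v" "0 \<le> ?v * (8 / 7) powr (s * p)" "0 \<le> (1 - s) powr (- ?q)" by auto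
    moreover have "c = 1 + ?v + ?v * (8 / 7) powr (s * p) + (1 - s) powr (- ?q)"
      by (simp add: c_def control_const_def distrib_left)
    ultimately show "1 \<le> c" "?v \<le> c" "?v * (8 / 7) powr (s * p) \<le> c" "(1 - s) powr (- ?q) \<le> c" by linarith+
  qed
  have le: "k * (l * a) \<le> k * (c * a)" "k * a \<le> k * (c * a)" if "0 \<le> k" "l \<le> c" for k l
    using that c(1) a(2) by (auto intro!: mult_left_mono mult_right_mono)
  have "controlled p s t \<Lambda> kf kn K f0 u x0 R (c * a)"
  proof
    show "0 < c * a" using c a by simp
    show "gagliardo s p ?B u \<le> ennreal (R powr (- (s * p)) * (c * a))"
      using b(1) by (rule order_trans) (intro ennreal_leI le(2)[OF _ c(1)], simp)
    show "(\<integral>\<^sup>+x. ennreal (indicator ?B x * \<bar>u x\<bar> powr p) \<partial>lebesgue) \<le> ennreal (c * a)"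
      using b(2) by (rule order_trans) (use le(2)[of 1, OF _ c(1)] in \<open>simp add: ennreal_leI\<close>)
    show "(\<integral>\<^sup>+z. ennreal (indicator (ball x0 (3/4 * R)) (fst z) * indicator (- ball x0 R) (snd z) *
        \<bar>u (snd z)\<bar> powr p * mu s p z) \<partial>lebesgue) \<le> ennreal (R powr (- (s * p)) * (c * a))"
      using b(3) by (rule order_trans) (intro ennreal_leI le(1) c, simp)
    show "(\<integral>\<^sup>+z. ennreal (indicator (ball x0 (3/4 * R)) (fst z) * indicator (- ball x0 (7/8 * R)) (snd z) *
        \<bar>u (snd z + h) - u (snd z)\<bar> powr p * mu s p z) \<partial>lebesgue) \<le> ennreal (R powr (- (s * p)) * (norm h / R) powr (t * p) * (c * a))"
      if "0 < norm h" "norm h < R / 16" for h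
      using b(4)[OF that] by (rule order_trans) (intro ennreal_leI le(1) c, simp)
    show "gagliardo s ?q ?B f0 \<le> ennreal (R powr (- (s * p * ?q)) * R powr (- (s * ?q)) * (c * a))"
    proof -
      have s1: "0 < (1 - s) powr ?q" using s by simp
      have "ennreal ((1 - s) powr ?q) * gagliardo s ?q ?B f0 = gagliardo s ?q ?B (\<lambda>x. (1 - s) * f x)"
      proof -
        have "ennreal ((1 - s) powr ?q) * gagliardo s ?q ?B f0 = (\<integral>\<^sup>+z. ennreal ((1 - s) powr ?q) * ennreal (indicator ?B (fst z) * indicator ?B (snd z) *
     norm (f0 (fst z) - f0 (snd z)) powr ?q / norm (fst z - snd z) powr (?N + s * ?q)) \<partial>lebesgue)"
          unfolding gagliardo_def by (rule nn_integral_cmult[symmetric]) measurable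
        also have "\<dots> = gagliardo s ?q ?B (\<lambda>x. (1 - s) * f x)"
          unfolding gagliardo_def
        proof (rule nn_integral_cong)
          fix z :: "'a \<times> 'a"
          have "\<bar>(1 - s) * f x - (1 - s) * f y\<bar> powr ?q = (1 - s) powr ?q * \<bar>f x - f y\<bar> powr ?q" for x y
            using s by (simp add: abs_mult powr_mult flip: right_diff_distrib)
          then show "ennreal ((1 - s) powr ?q) * ennreal (indicator ?B (fst z) * indicator ?B (snd z) *
     norm (f0 (fst z) - f0 (snd z)) powr ?q / norm (fst z - snd z) powr (?N + s * ?q)) = ennreal (indicator ?B (fst z) * indicator ?B (snd z) *
     norm ((1 - s) * f (fst z) - (1 - s) * f (snd z)) powr ?q / norm (fst z - snd z) powr (?N + s * ?q))"
            by (auto simp: f0_def indicator_def ennreal_mult'[symmetric])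
        qed
        finally show ?thesis .
      qed
      then have "ennreal ((1 - s) powr ?q) * gagliardo s ?q ?B f0 \<le> ennreal (R powr (- (s * p * ?q)) * R powr (- (s * ?q)) * a)"
        using b(5) by simp
      then show ?thesis
      proof (rule ennreal_mult_leD[OF _ s1])
        have "R powr (- (s * p * ?q)) * R powr (- (s * ?q)) * a / (1 - s) powr ?q = R powr (- (s * p * ?q)) * R powr (- (s * ?q)) * ((1 - s) powr (- ?q) * a)"
          using s by (simp add: powr_minus_divide)
        also have "\<dots> \<le> R powr (- (s * p * ?q)) * R powr (- (s * ?q)) * (c * a)" by (intro le(1) c) simp
        finally show "R powr (- (s * p * ?q)) * R powr (- (s * ?q)) * a / (1 - s) powr ?q \<le> R powr (- (s * p * ?q)) * R powr (- (s * ?q)) * (c * a)" .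
      qed
    qed
    show "(\<integral>\<^sup>+x. ennreal (indicator ?B x * \<bar>f0 x\<bar> powr ?q) \<partial>lebesgue) < \<infinity>"
    proof -
      have "(\<integral>\<^sup>+x. ennreal (indicator ?B x * \<bar>f0 x\<bar> powr ?q) \<partial>lebesgue) = (\<integral>\<^sup>+x. ennreal (indicator ?B x * norm (f x) powr ?q) \<partial>lebesgue)"
        by (intro nn_integral_cong) (auto simp: f0_def indicator_def)
      then show ?thesis using fB Wspace_iff[OF q, of f s ?B] by simp
    qed
    fix \<phi> :: "'a \<Rightarrow> real"
    assume \<phi>_m: "\<phi> \<in> borel_measurable lebesgue" and \<phi>0: "\<And>x. x \<notin> ball x0 (3/4 * R) \<Longrightarrow> \<phi> x = 0"
      and \<phi>_Lp: "(\<integral>\<^sup>+x. ennreal (\<bar>\<phi> x\<bar> powr p) \<partial>lebesgue) < \<infinity>"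
      and \<phi>_en: "(\<integral>\<^sup>+z. ennreal (\<bar>\<phi> (fst z) - \<phi> (snd z)\<bar> powr p * mu s p z) \<partial>lebesgue) < \<infinity>"
    let ?\<Omega>' = "ball x0 (3/4 * R)"
    have sub: "?\<Omega>' \<subseteq> ?B" using R by auto
    have B\<Omega>: "?B \<subseteq> \<Omega>" using B closure_subset[of ?B] by (auto simp: compactly_inside_def)
    have \<Omega>': "compactly_inside ?\<Omega>' \<Omega>" by (rule compactly_inside_ball[OF B]) (use R in auto)
    have "\<phi> \<in> Wspace s p \<Omega>"
      unfolding Wspace_iff[OF p0]
    proof (intro conjI)
      show "\<phi> \<in> borel_measurable (lebesgue_on \<Omega>)" using \<phi>_m by (rule measurable_restrict_space1)
      show "(\<integral>\<^sup>+x. ennreal (indicator \<Omega> x * norm (\<phi> x) powr p) \<partial>lebesgue) < \<infinity>"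
        using \<phi>_Lp by (rule le_less_trans[rotated]) (intro nn_integral_mono ennreal_leI, auto simp: indicator_def)
      show "gagliardo s p \<Omega> \<phi> < \<infinity>"
        using \<phi>_en unfolding gagliardo_def by (rule le_less_trans[rotated]) (intro nn_integral_mono ennreal_leI, auto simp: indicator_def mu_def)
    qed
    moreover have "\<forall>x\<in>\<Omega> - ?\<Omega>'. \<phi> x = 0" using \<phi>0 by auto
    moreover have \<phi>_eq: "(\<lambda>x. if x \<in> \<Omega> then \<phi> x else 0) = \<phi>" 
    proof
      fix x
      have "\<phi> x = 0" if "x \<notin> \<Omega>" by (rule \<phi>0) (use that sub B\<Omega> in blast)
      then show "(if x \<in> \<Omega> then \<phi> x else 0) = \<phi> x" by simp
    qed
    ultimately have "compactly_inside ?\<Omega>' \<Omega> \<and> \<phi> \<in> Wspace s p \<Omega> \<and> (\<forall>x\<in>\<Omega> - ?\<Omega>'. \<phi> x = 0)"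
      using \<Omega>' by blast
    then have "let \<phi>0 = (\<lambda>x. if x \<in> \<Omega> then \<phi> x else 0) in
          (LINT z|lebesgue. (case z of (x, y) \<Rightarrow> \<bar>u x - u y\<bar> powr (p - 2) * (u x - u y) / K (x - y) * (\<phi>0 x - \<phi>0 y)))
          = (LINT x:?\<Omega>'|lebesgue. f x * \<phi> x)"
      by (rule sol[unfolded local_weak_solution_def, THEN conjunct2, THEN conjunct2, THEN spec, THEN spec, THEN mp])
    then have "(LINT z|lebesgue. (case z of (x, y) \<Rightarrow> \<bar>u x - u y\<bar> powr (p - 2) * (u x - u y) / K (x - y) * (\<phi> x - \<phi> y)))
          = (LINT x:?\<Omega>'|lebesgue. f x * \<phi> x)"
      unfolding \<phi>_eq unfolding Let_def .
    moreover have "(LINT z|lebesgue. (case z of (x, y) \<Rightarrow> \<bar>u x - u y\<bar> powr (p - 2) * (u x - u y) / K (x - y) * (\<phi> x - \<phi> y)))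
       = (\<integral>z. Jp p (u (fst z) - u (snd z)) / K (fst z - snd z) * (\<phi> (fst z) - \<phi> (snd z)) \<partial>lebesgue)"
      by (simp add: Jp_def case_prod_unfold)
    moreover have "(LINT x:?\<Omega>'|lebesgue. f x * \<phi> x) = (\<integral>x. f0 x * \<phi> x \<partial>lebesgue)"
      unfolding set_lebesgue_integral_def
      by (intro Bochner_Integration.integral_cong) (use \<phi>0 sub in \<open>auto simp: f0_def indicator_def\<close>)
    ultimately show "(\<integral>z. Jp p (u (fst z) - u (snd z)) / K (fst z - snd z) * (\<phi> (fst z) - \<phi> (snd z)) \<partial>lebesgue) = (\<integral>x. f0 x * \<phi> x \<partial>lebesgue)"
      by simp
  qed (use p s t \<Lambda> kf kn K_m K R in auto)
  then show ?thesis unfolding admissible_def c_def by blast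
qed

text \<open>Let \<open>d\<close> be the distance of \<open>y\<close> from the centre. Then
  \<open>x\<close> is within \<open>3/4 * R\<close>, hence within \<open>6/7 * d\<close>, of the
  centre, so \<open>norm (x - y)\<close> is at least \<open>d / 7\<close>; and
  \<open>1 + norm y\<close> is at most a multiple of \<open>d\<close>, because \<open>d\<close> is
  at least \<open>7/8 * R\<close>.\<close>

lemma tail_weight:
  fixes x0 x y :: "'a::euclidean_space"
  assumes R: "0 < R" and x: "x \<in> ball x0 (3/4 * R)" and y: "y \<notin> ball x0 (7/8 * R)"
  shows "1 + norm y \<le> 7 * ((1 + norm x0) / (7/8 * R) + 1) * norm (x - y)"
proof -
  let ?d = "norm (y - x0)"
  have d: "7/8 * R \<le> ?d" "norm (x - x0) < 3/4 * R" using x y by (auto simp: dist_norm norm_minus_commute)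
  have "?d \<le> norm (x - x0) + norm (x - y)"
    using norm_triangle_ineq4[of "x - x0" "x - y"] by simp
  then have 1: "?d / 7 \<le> norm (x - y)" using d by linarith
  have "norm y \<le> norm x0 + ?d" using norm_triangle_ineq[of x0 "y - x0"] by simp
  moreover have "1 + norm x0 \<le> (1 + norm x0) / (7/8 * R) * ?d"
  proof -
    have "(1 + norm x0) / (7/8 * R) * (7/8 * R) \<le> (1 + norm x0) / (7/8 * R) * ?d"
      using d(1) R by (intro mult_left_mono) auto
    then show ?thesis using R by simp
  qed
  ultimately have "1 + norm y \<le> ((1 + norm x0) / (7/8 * R) + 1) * ?d" by (simp add: algebra_simps)
  also have "\<dots> \<le> ((1 + norm x0) / (7/8 * R) + 1) * (7 * norm (x - y))"
    using 1 R by (intro mult_left_mono) (auto intro!: add_nonneg_nonneg)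
  finally show ?thesis by (simp only: mult_ac)
qed

text \<open>Compares the tail with the global weight of \<open>Xspace\<close> and
  \<open>Yspace\<close>. It serves only to prove finiteness, so the dependence of the constant on
  the centre and on \<open>R\<close> is harmless.\<close>

lemma tail_integral_le:
  fixes \<psi> :: "'a::euclidean_space \<Rightarrow> real"
  assumes [measurable]: "\<psi> \<in> borel_measurable lebesgue" and R: "0 < R" and sp: "0 \<le> s * p"
    and E: "ball x0 (7/8 * R) \<subseteq> E"
  shows "(\<integral>\<^sup>+z. ennreal (indicator (ball x0 (3/4 * R)) (fst z) * indicator (- E) (snd z) * \<bar>\<psi> (snd z)\<bar> powr p * mu s p z) \<partial>lebesgue)
    \<le> ennreal ((7 * ((1 + norm x0) / (7/8 * R) + 1)) powr (real DIM('a) + s * p) * (unit_ball_vol (real DIM('a)) * (3/4 * R) ^ DIM('a))) *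
      (\<integral>\<^sup>+x. ennreal (\<bar>\<psi> x\<bar> powr p / (1 + norm x) powr (real DIM('a) + s * p)) \<partial>lebesgue)"
proof -
  let ?e = "real DIM('a) + s * p" and ?k = "7 * ((1 + norm x0) / (7/8 * R) + 1)" and ?F = "ball x0 (3/4 * R)"
  have k: "0 < ?k" using R by (intro mult_pos_pos add_nonneg_pos) auto
  let ?g = "\<lambda>x. \<bar>\<psi> x\<bar> powr p / (1 + norm x) powr ?e"
  have "(\<integral>\<^sup>+z. ennreal (indicator ?F (fst z) * indicator (- E) (snd z) * \<bar>\<psi> (snd z)\<bar> powr p * mu s p z) \<partial>lebesgue)
    \<le> (\<integral>\<^sup>+z. ennreal ((?k powr ?e * indicator ?F (fst z)) * ?g (snd z)) \<partial>lebesgue)"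
  proof (intro nn_integral_mono ennreal_leI)
    fix z :: "'a \<times> 'a"
    obtain x y where z: "z = (x, y)" by fastforce
    show "indicator ?F (fst z) * indicator (- E) (snd z) * \<bar>\<psi> (snd z)\<bar> powr p * mu s p z
      \<le> (?k powr ?e * indicator ?F (fst z)) * ?g (snd z)"
    proof (cases "x \<in> ?F \<and> y \<notin> E")
      case True
      then have le: "1 + norm y \<le> ?k * norm (x - y)" using E by (intro tail_weight R) auto
      have ny: "0 < 1 + norm y" by (rule add_pos_nonneg) auto
      then have xy: "0 < norm (x - y)" using le k by (metis less_le_trans zero_less_mult_pos)
      have "(1 + norm y) powr ?e \<le> (?k * norm (x - y)) powr ?e"
        using le ny sp by (intro powr_mono2) auto
      also have "\<dots> = ?k powr ?e * norm (x - y) powr ?e"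
        by (rule powr_mult)
      finally have "1 / norm (x - y) powr ?e \<le> ?k powr ?e / (1 + norm y) powr ?e"
        using xy ny by (simp add: field_simps)
      then have "\<bar>\<psi> y\<bar> powr p * (1 / norm (x - y) powr ?e) \<le> \<bar>\<psi> y\<bar> powr p * (?k powr ?e / (1 + norm y) powr ?e)"
        by (rule mult_left_mono) simp
      then show ?thesis using True by (simp add: z mu_def mult_ac)
    qed (auto simp: z indicator_def)
  qed
  also have "\<dots> = (\<integral>\<^sup>+x. ennreal (?k powr ?e * indicator ?F x) \<partial>lebesgue) * (\<integral>\<^sup>+x. ennreal (?g x) \<partial>lebesgue)"
    by (rule nn_integral_fst_times_snd) auto
  also have "(\<integral>\<^sup>+x. ennreal (?k powr ?e * indicator ?F x) \<partial>lebesgue) = ennreal (?k powr ?e * (unit_ball_vol (real DIM('a)) * (3/4 * R) ^ DIM('a)))"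
    by (rule nn_integral_ball_const) (use R in auto)
  finally show ?thesis .
qed

text \<open>The radius is at most \<open>h0\<close>, so that all increments occurring in
  \<open>Ynorm\<close> are covered by the supremum that \<open>Yspace\<close> makes finite.\<close>

lemma A_term_finite:
  fixes u f :: "'a::euclidean_space \<Rightarrow> real"
  assumes p: "2 \<le> p" and s: "0 < s" "s < 1" and u: "u \<in> Yspace t s p"
    and uB: "u \<in> Wspace s p (ball x0 R)" and fB: "f \<in> Wspace s (conj_exp p) (ball x0 R)" and R: "0 < R" "R \<le> h0"
    and h0: "(SUP h\<in>{h. 0 < norm h \<and> norm h < h0}.
        \<integral>\<^sup>+x. ennreal (\<bar>diff_quot t h u x\<bar> powr p / (1 + norm x) powr (real DIM('a) + s * p)) \<partial>lebesgue) < \<infinity>"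
  shows "A_term t s p u f x0 R < \<infinity>"
proof -
  let ?q = "conj_exp p" and ?N = "real DIM('a)" and ?B = "ball x0 R"
  have q: "0 < ?q" and p0: "0 < p" using p by (auto simp: conj_exp_def)
  have uX: "u \<in> Xspace s p" using u by (simp add: Yspace_def)
  have u_m [measurable]: "u \<in> borel_measurable lebesgue" by (rule Xspace_measurable[OF uX])
  have sp: "0 \<le> s * p" using s p by simp
  let ?w = "\<lambda>\<psi>. \<integral>\<^sup>+x. ennreal (\<bar>\<psi> x\<bar> powr p / (1 + norm x) powr (?N + s * p)) \<partial>lebesgue"
  let ?F = "ball x0 (3/4 * R)"
  have tail: "(\<integral>\<^sup>+x\<in>?F. epowr (Snail s p \<psi> x (ball x0 (\<rho> * R))) p \<partial>lebesgue)
     \<le> ennreal (measure lebesgue (ball x0 (\<rho> * R)) powr (s * p / ?N)) *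
        (ennreal ((7 * ((1 + norm x0) / (7/8 * R) + 1)) powr (?N + s * p) * (unit_ball_vol ?N * (3/4 * R) ^ DIM('a))) * ?w \<psi>)"
    if "\<psi> \<in> borel_measurable lebesgue" "7/8 \<le> \<rho>" for \<psi> \<rho>
  proof (subst snail_integral)
    have "7/8 * R \<le> \<rho> * R" using that R by (intro mult_right_mono) auto
    then have "ball x0 (7/8 * R) \<subseteq> ball x0 (\<rho> * R)" by auto
    then show "ennreal (measure lebesgue (ball x0 (\<rho> * R)) powr (s * p / ?N)) *
      (\<integral>\<^sup>+z. ennreal (indicator ?F (fst z) * indicator (- ball x0 (\<rho> * R)) (snd z) * \<bar>\<psi> (snd z)\<bar> powr p * mu s p z) \<partial>lebesgue)
      \<le> ennreal (measure lebesgue (ball x0 (\<rho> * R)) powr (s * p / ?N)) *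
        (ennreal ((7 * ((1 + norm x0) / (7/8 * R) + 1)) powr (?N + s * p) * (unit_ball_vol ?N * (3/4 * R) ^ DIM('a))) * ?w \<psi>)"
      by (intro mult_left_mono tail_integral_le that R sp) auto
  qed (use that p0 in auto)
  have fin: "ennreal a * (ennreal b * X) < \<infinity>" if "X < \<infinity>" for a b X
    using that by (simp add: ennreal_mult_less_top)
  have wu: "?w u < \<infinity>" using uX by (simp add: Xspace_def)
  have X: "epowr (Xnorm s p u ?F ?B) p < \<infinity>"
  proof -
    have "(\<integral>\<^sup>+x\<in>?B. ennreal (\<bar>u x\<bar> powr p) \<partial>lebesgue) = (\<integral>\<^sup>+x. ennreal (indicator ?B x * norm (u x) powr p) \<partial>lebesgue)"
      by (intro nn_integral_cong) (auto simp: indicator_def)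
    then have "(\<integral>\<^sup>+x\<in>?B. ennreal (\<bar>u x\<bar> powr p) \<partial>lebesgue) < \<infinity>"
      using uB Wspace_iff[OF p0, of u s ?B] by simp
    moreover have "(\<integral>\<^sup>+x\<in>?F. epowr (Snail s p u x ?B) p \<partial>lebesgue) < \<infinity>"
      using le_less_trans[OF tail[of u 1] fin[OF wu]] by simp
    ultimately show ?thesis unfolding Xnorm_def epowr_epowr[OF p0] by simp
  qed
  have Y: "epowr (Ynorm t s p u ?F (ball x0 (7/8 * R))) p < \<infinity>"
  proof -
    let ?S = "SUP h\<in>{h. 0 < norm h \<and> norm h < h0}. ?w (diff_quot t h u)"
    let ?Z = "ennreal (measure lebesgue (ball x0 (7/8 * R)) powr (s * p / ?N)) *
        (ennreal ((7 * ((1 + norm x0) / (7/8 * R) + 1)) powr (?N + s * p) * (unit_ball_vol ?N * (3/4 * R) ^ DIM('a))) * ?S)"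
    have le: "Ynorm t s p u ?F (ball x0 (7/8 * R)) \<le> epowr ?Z (1 / p)"
      unfolding Ynorm_def
    proof (rule SUP_least)
      fix h :: 'a assume h: "h \<in> {h. 0 < norm h \<and> norm h < setdist ?F (UNIV - ball x0 (7/8 * R)) / 2}"
      then have h': "h \<in> {h. 0 < norm h \<and> norm h < h0}"
        using setdist_balls(2)[OF R(1), of x0] R by auto
      have [measurable]: "diff_quot t h u \<in> borel_measurable lebesgue" unfolding diff_quot_def[abs_def] by measurable
      have "(\<integral>\<^sup>+x\<in>?F. epowr (Snail s p (diff_quot t h u) x (ball x0 (7/8 * R))) p \<partial>lebesgue)
        \<le> ennreal (measure lebesgue (ball x0 (7/8 * R)) powr (s * p / ?N)) *
        (ennreal ((7 * ((1 + norm x0) / (7/8 * R) + 1)) powr (?N + s * p) * (unit_ball_vol ?N * (3/4 * R) ^ DIM('a))) * ?w (diff_quot t h u))"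
        by (rule tail) auto
      also have "\<dots> \<le> ?Z" by (intro mult_left_mono SUP_upper h') auto
      finally show "epowr (\<integral>\<^sup>+x\<in>?F. epowr (Snail s p (diff_quot t h u) x (ball x0 (7/8 * R))) p \<partial>lebesgue) (1 / p) \<le> epowr ?Z (1 / p)"
        using p0 by (intro epowr_mono) auto
    qed
    have "?Z < \<infinity>" by (rule fin[OF h0])
    then have "epowr ?Z (1 / p) < \<infinity>" by (simp only: epowr_less_top_iff)
    with le have "Ynorm t s p u ?F (ball x0 (7/8 * R)) < \<infinity>" by (rule le_less_trans)
    then show ?thesis by (simp only: epowr_less_top_iff)
  qed
  have f1: "epowr (Wseminorm s ?q ?B (\<lambda>x. (1 - s) * f x)) ?q < \<infinity>" "epowr (Lnorm ?q ?B (\<lambda>x. (1 - s) * f x)) ?q < \<infinity>"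
  proof -
    have s1: "(1 - s) powr ?q \<le> 1" using s q by (intro powr_le1) auto
    have "\<bar>(1 - s) * f x - (1 - s) * f y\<bar> powr ?q = (1 - s) powr ?q * \<bar>f x - f y\<bar> powr ?q" for x y
      using s by (simp add: abs_mult powr_mult flip: right_diff_distrib)
    then have d: "\<bar>(1 - s) * f x - (1 - s) * f y\<bar> powr ?q \<le> \<bar>f x - f y\<bar> powr ?q" for x y
      using mult_right_mono[OF s1, of "\<bar>f x - f y\<bar> powr ?q"] by simp
    have "gagliardo s ?q ?B (\<lambda>x. (1 - s) * f x) \<le> gagliardo s ?q ?B f"
      unfolding gagliardo_def using d by (intro nn_integral_mono ennreal_leI) (auto simp: indicator_def intro: divide_right_mono)
    then show "epowr (Wseminorm s ?q ?B (\<lambda>x. (1 - s) * f x)) ?q < \<infinity>"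
      using fB Wspace_iff[OF q, of f s ?B] by (simp only: Wseminorm_powr[OF q] le_less_trans)
    have "(\<integral>\<^sup>+x. ennreal (indicator ?B x * norm ((1 - s) * f x) powr ?q) \<partial>lebesgue) \<le> (\<integral>\<^sup>+x. ennreal (indicator ?B x * norm (f x) powr ?q) \<partial>lebesgue)"
      using s q by (intro nn_integral_mono ennreal_leI mult_left_mono powr_mono2) (auto simp: abs_mult intro: mult_left_le_one_le)
    then show "epowr (Lnorm ?q ?B (\<lambda>x. (1 - s) * f x)) ?q < \<infinity>"
      using fB Wspace_iff[OF q, of f s ?B] by (simp only: Lnorm_powr[OF q] le_less_trans)
  qed
  have u1: "epowr (Wseminorm s p ?B u) p < \<infinity>" "epowr (Lnorm p ?B u) p < \<infinity>"
    using uB Wspace_iff[OF p0, of u s ?B] by (simp_all only: Wseminorm_powr[OF p0] Lnorm_powr[OF p0])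
  show ?thesis
    unfolding A_term_def Let_def using X Y f1 u1 by (simp add: ennreal_mult_less_top)
qed

section \<open>Seminorm estimates on smaller concentric balls\<close>

lemma powr_rescale:
  fixes R c \<sigma> \<tau> p :: real
  assumes "0 < R" "0 < c"
  shows "R powr (- (\<sigma> * p)) * (c * R) powr ((\<sigma> - \<tau>) * p) = c powr ((\<sigma> - \<tau>) * p) / R powr (\<tau> * p)"
    and "R ^ n / (c * R) powr (real n + \<tau> * p) = 1 / (c powr (real n + \<tau> * p) * R powr (\<tau> * p))"
proof -
  have "R powr (- (\<sigma> * p)) * R powr ((\<sigma> - \<tau>) * p) = R powr (- (\<tau> * p))"
    by (simp add: algebra_simps flip: powr_add)
  then show "R powr (- (\<sigma> * p)) * (c * R) powr ((\<sigma> - \<tau>) * p) = c powr ((\<sigma> - \<tau>) * p) / R powr (\<tau> * p)"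
  proof -
    assume eq: "R powr (- (\<sigma> * p)) * R powr ((\<sigma> - \<tau>) * p) = R powr (- (\<tau> * p))"
    have "R powr (- (\<sigma> * p)) * (c * R) powr ((\<sigma> - \<tau>) * p)
        = c powr ((\<sigma> - \<tau>) * p) * (R powr (- (\<sigma> * p)) * R powr ((\<sigma> - \<tau>) * p))"
      by (simp only: powr_mult mult.left_commute)
    then show ?thesis unfolding eq by (simp add: powr_minus_divide)
  qed
  show "R ^ n / (c * R) powr (real n + \<tau> * p) = 1 / (c powr (real n + \<tau> * p) * R powr (\<tau> * p))"
    using assms by (simp add: powr_mult powr_add powr_realpow field_simps)
qed

lemma first_order_bound:
  assumes p: "2 \<le> p" and s: "0 < s" "s < 1" and t: "0 \<le> t" "t \<le> s"
    and \<tau>: "s \<le> \<tau>" "\<tau> < (t + s * p) / (p - 1)" and small: "t + s * p \<le> p - 1"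
  shows "\<exists>C>0. \<forall>(u :: 'a::euclidean_space \<Rightarrow> real) x0 R A. admissible p s t \<Lambda> kf kn u x0 R A \<longrightarrow>
    gagliardo \<tau> p (ball x0 (R / 2)) u \<le> ennreal (C / R powr (\<tau> * p) * A)"
proof -
  let ?r = "(t + s * p) / (p - 1)" and ?N = "DIM('a)"
  have r: "?r \<le> 1" using small p by simp
  \<comment> \<open>Passing from translates to the seminorm needs some room, so the iteration is run
    up to the midpoint between \<tau> and its limit; this stays below 1 because the limit is at most
    1.\<close>
  define \<sigma> where "\<sigma> = (\<tau> + ?r) / 2"
  have \<sigma>: "\<tau> < \<sigma>" "\<sigma> < ?r" "\<sigma> < 1" "s \<le> \<sigma>" 
  proof -
    have "\<tau> < (\<tau> + v) / 2 \<and> (\<tau> + v) / 2 < v" if "\<tau> < v" for v using that by simp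
    from this[OF \<tau>(2)] show "\<tau> < \<sigma>" "\<sigma> < ?r" by (simp_all only: \<sigma>_def)
    then show "\<sigma> < 1" "s \<le> \<sigma>" using r \<tau>(1) by linarith+
  qed
  obtain \<rho> where \<rho>: "1/2 < \<rho>" "uniform_diff (admissible p s t \<Lambda> kf kn :: ('a \<Rightarrow> real) \<Rightarrow> _) p \<sigma> \<rho>"
    using uniform_diff_iterate[OF p s t \<sigma>(4,3,2)] by blast
  have "uniform_diff (admissible p s t \<Lambda> kf kn :: ('a \<Rightarrow> real) \<Rightarrow> _) p \<sigma> (1/2)"
    by (rule uniform_diff_mono[OF \<rho>(2)]) (use \<rho>(1) admissible_R_pos in auto)
  then obtain C c where C: "0 < C" "0 < c" "c \<le> 1 / 32"
    and HC: "\<And>(u :: 'a \<Rightarrow> real) x0 R A. admissible p s t \<Lambda> kf kn u x0 R A \<Longrightarrow> diff_bound p u x0 R A \<sigma> (1/2) C c"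
    unfolding uniform_diff_def by auto
  let ?V = "unit_ball_vol (real ?N)"
  define Z where "Z = ?V * 2 ^ ?N / (1 - 2 powr (- ((\<sigma> - \<tau>) * p)))"
  define C' where "C' = C * Z * c powr ((\<sigma> - \<tau>) * p) + 2 * 2 powr p * ?V / 2 ^ ?N / c powr (real ?N + \<tau> * p)"
  have "0 < (\<sigma> - \<tau>) * p" using \<sigma> p by simp
  then have Z: "0 \<le> Z" unfolding Z_def using powr_less_one[of 2 "- ((\<sigma> - \<tau>) * p)"]
    by (intro divide_nonneg_nonneg mult_nonneg_nonneg) auto
  have C': "0 < C'" unfolding C'_def using C Z by (intro add_nonneg_pos) auto
  have "gagliardo \<tau> p (ball x0 (R / 2)) u \<le> ennreal (C' / R powr (\<tau> * p) * A)"
    if adm: "admissible p s t \<Lambda> kf kn u x0 R A" for u and x0 :: 'a and R A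
  proof -
    obtain K f where "controlled p s t \<Lambda> kf kn K f u x0 R A"
      using adm by (auto simp: admissible_def)
    then interpret controlled p s t \<Lambda> kf kn K f u x0 R A .
    have "gagliardo \<tau> p (ball x0 (R / 2)) u \<le> ennreal
      ((C * R powr (- (\<sigma> * p)) * A) * (?V * 2 ^ ?N * (c * R) powr ((\<sigma> - \<tau>) * p) / (1 - 2 powr (- ((\<sigma> - \<tau>) * p))))
     + 2 * 2 powr p / (c * R) powr (real ?N + \<tau> * p) * (?V * (R / 2) ^ ?N) * A)"
    proof (rule gagliardo_le_of_translates)
      fix k :: 'a assume k: "0 < norm k" "norm k < c * R"
      have "(\<integral>\<^sup>+x. ennreal (indicator (ball x0 (1/2 * R)) x * \<bar>u (x + k) - u x\<bar> powr p) \<partial>lebesgue)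
        \<le> ennreal (C * (norm k / R) powr (\<sigma> * p) * A)"
        by (rule HC[OF adm, unfolded diff_bound_def, rule_format]) (use k in auto)
      also have "C * (norm k / R) powr (\<sigma> * p) * A = C * R powr (- (\<sigma> * p)) * A * norm k powr (\<sigma> * p)"
        using R by (simp add: powr_divide powr_minus_divide)
      finally show "(\<integral>\<^sup>+x. ennreal (indicator (ball x0 (R / 2)) x * \<bar>u (x + k) - u x\<bar> powr p) \<partial>lebesgue)
        \<le> ennreal (C * R powr (- (\<sigma> * p)) * A * norm k powr (\<sigma> * p))" by simp
    next
      show "(\<integral>\<^sup>+x. ennreal (indicator (ball x0 (R / 2)) x * norm (u x) powr p) \<partial>lebesgue) \<le> ennreal A"
        by (rule nn_integral_le_mono[OF _ u_Lp]) (use R in \<open>auto simp: indicator_def\<close>)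
    qed (use p s \<tau> \<sigma> C R A in auto)
    also have "(C * R powr (- (\<sigma> * p)) * A) * (?V * 2 ^ ?N * (c * R) powr ((\<sigma> - \<tau>) * p) / (1 - 2 powr (- ((\<sigma> - \<tau>) * p))))
     + 2 * 2 powr p / (c * R) powr (real ?N + \<tau> * p) * (?V * (R / 2) ^ ?N) * A
      = C * Z * A * (R powr (- (\<sigma> * p)) * (c * R) powr ((\<sigma> - \<tau>) * p))
        + 2 * 2 powr p * ?V / 2 ^ ?N * A * (R ^ ?N / (c * R) powr (real ?N + \<tau> * p))"
      by (simp add: Z_def power_divide mult_ac)
    also have "\<dots> = C' / R powr (\<tau> * p) * A"
      unfolding powr_rescale[OF R C(2)] by (simp add: C'_def add_divide_distrib distrib_left distrib_right mult_ac)
    finally show ?thesis .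
  qed
  then show ?thesis using C' by blast
qed

text \<open>The source of the factor \<open>1 / (\<Gamma> - 1 - \<tau>)\<close>: the geometric
  series of the kernel near the diagonal blows up like \<open>1 / x\<close>, with a constant uniform
  for \<open>x \<le> p\<close>.\<close>

lemma inverse_one_minus_powr_le:
  fixes x p :: real
  assumes "0 < x" "x \<le> p"
  shows "1 / (1 - 2 powr (- x)) \<le> (1 + p * ln 2) / ln 2 / x"
proof -
  have l: "0 < ln (2 :: real)" by simp
  have "1 + x * ln 2 \<le> exp (x * ln 2)" by (rule exp_ge_add_one_self)
  then have e: "1 + x * ln 2 \<le> 2 powr x" by (simp add: powr_def)
  have xl: "0 < x * ln 2" using assms by simp
  then have xl1: "0 < 1 + x * ln 2" by linarith
  have "1 / 2 powr x \<le> 1 / (1 + x * ln 2)" using e xl by (intro divide_left_mono) auto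
  then have "x * ln 2 / (1 + x * ln 2) \<le> 1 - 2 powr (- x)"
    using xl by (simp add: powr_minus_divide field_simps)
  then have "1 / (1 - 2 powr (- x)) \<le> 1 / (x * ln 2 / (1 + x * ln 2))"
    using xl1 assms powr_less_one[of 2 "- x"] by (intro divide_left_mono mult_pos_pos divide_pos_pos) auto
  also have "\<dots> = (1 + x * ln 2) / ln 2 / x" by (simp add: field_simps)
  also have "\<dots> \<le> (1 + p * ln 2) / ln 2 / x"
    using assms l by (intro divide_right_mono add_left_mono mult_right_mono) auto
  finally show ?thesis .
qed

text \<open>The constant is written out because \<tau> may enter it only through the displayed
  denominator and the power of \<open>R\<close>. The part near the diagonal really produces
  \<open>1 / (\<Gamma> - 1 - \<tau>)\<close>; missing factors are inserted for free, as
  \<open>\<tau> < \<Gamma> - 1 < 1\<close>.\<close>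

lemma (in gradient) deriv_gagliardo:
  assumes b: "b \<in> Basis" and \<tau>: "0 < \<tau>" "\<tau> < \<Gamma> - 1"
  defines "V \<equiv> unit_ball_vol (real DIM('a))"
  shows "gagliardo \<tau> p (ball x0 (R / 4)) (dyadic_deriv u b) \<le> ennreal
    (((3 / (1 - \<theta>)) powr p * 2 powr ((\<Gamma> - 1) * p) * C2 * (V * 2 ^ DIM('a)) * ((1 + p * ln 2) / ln 2)
      + 2 * 2 powr p * V * C1 / (c / 2) powr (real DIM('a) + p)) / ((\<Gamma> - 1 - \<tau>) * \<tau>) / R powr (p * (1 + \<tau>)) * A)"
proof -
  let ?N = "DIM('a)" and ?x = "(\<Gamma> - 1 - \<tau>) * p"
  have V: "0 < V" by (simp add: V_def)
  have x: "0 < ?x" "?x \<le> p"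
    using \<tau> \<Gamma> p mult_right_mono[of "\<Gamma> - 1 - \<tau>" 1 p] by auto
  define m where "m = (3 / (1 - \<theta>)) powr p * 2 powr ((\<Gamma> - 1) * p) * C2"
  have m: "0 \<le> m" using C by (simp add: m_def)
  have Mp: "(3 / (1 - \<theta>) * Kst * (2 / R) powr (\<Gamma> - 1)) powr p = m * A / R powr p * R powr (- ((\<Gamma> - 1) * p))"
  proof -
    have "((2 / R) powr (\<Gamma> - 1)) powr p = 2 powr ((\<Gamma> - 1) * p) * R powr (- ((\<Gamma> - 1) * p))"
      using R by (simp add: powr_powr powr_divide powr_minus_divide)
    then show ?thesis unfolding m_def powr_mult Kst(2) by simp
  qed
  have c2: "0 < c / 2" "c / 2 \<le> 1" "c * R / 2 = c / 2 * R" using c by auto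
  have "gagliardo \<tau> p (ball x0 (R / 4)) (dyadic_deriv u b) \<le> ennreal
      ((3 / (1 - \<theta>) * Kst * (2 / R) powr (\<Gamma> - 1)) powr p * (V * 2 ^ ?N * (c * R / 2) powr ?x / (1 - 2 powr (- ?x)))
     + 2 * 2 powr p / (c * R / 2) powr (real ?N + \<tau> * p) * (V * (R / 4) ^ ?N) * (C1 / R powr p * A))"
    unfolding V_def
  proof (rule gagliardo_le_of_translates[OF _ _ _ _ _ _ _ deriv_translates[OF b]])
    show "(\<integral>\<^sup>+x. ennreal (indicator (ball x0 (R / 4)) x * norm (dyadic_deriv u b x) powr p) \<partial>lebesgue) \<le> ennreal (C1 / R powr p * A)"
      by (rule nn_integral_le_mono[OF _ deriv_Lp[OF b]]) (use R in \<open>auto simp: indicator_def\<close>)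
  qed (use p \<tau> c R C A in auto)
  also have "\<dots> \<le> ennreal ((m * (V * 2 ^ ?N) * ((1 + p * ln 2) / ln 2) + 2 * 2 powr p * V * C1 / (c / 2) powr (real ?N + p))
      / ((\<Gamma> - 1 - \<tau>) * \<tau>) / R powr (p * (1 + \<tau>)) * A)"
  proof (rule ennreal_leI)
    let ?R = "1 / R powr p / R powr (\<tau> * p) * A" and ?g = "1 / ((\<Gamma> - 1 - \<tau>) * \<tau>)"
    have R0: "0 \<le> ?R" using A by simp
    have Req: "1 / R powr (p * (1 + \<tau>)) * A = ?R" by (simp add: algebra_simps powr_add)
    have g0: "0 < (\<Gamma> - 1 - \<tau>) * \<tau>" using \<tau> by simp
    have g1: "(\<Gamma> - 1 - \<tau>) * \<tau> \<le> (\<Gamma> - 1 - \<tau>)" "(\<Gamma> - 1 - \<tau>) * \<tau> \<le> 1"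
      using \<tau> \<Gamma> mult_left_mono[of \<tau> 1 "\<Gamma> - 1 - \<tau>"] mult_le_one[of "\<Gamma> - 1 - \<tau>" \<tau>] by auto
    have "(3 / (1 - \<theta>) * Kst * (2 / R) powr (\<Gamma> - 1)) powr p * (V * 2 ^ ?N * (c * R / 2) powr ?x / (1 - 2 powr (- ?x)))
      = m * (V * 2 ^ ?N) * (1 / (1 - 2 powr (- ?x))) * (A / R powr p) * (R powr (- ((\<Gamma> - 1) * p)) * (c / 2 * R) powr ?x)"
      unfolding Mp c2(3) by (simp add: mult_ac)
    also have "\<dots> = m * (V * 2 ^ ?N) * (1 / (1 - 2 powr (- ?x)) * (c / 2) powr ?x) * ?R"
      unfolding powr_rescale(1)[OF R c2(1)] by (simp add: mult_ac)
    also have "\<dots> \<le> m * (V * 2 ^ ?N) * ((1 + p * ln 2) / ln 2 * ?g) * ?R"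
    proof (intro mult_right_mono mult_left_mono)
      have "1 / (1 - 2 powr (- ?x)) * (c / 2) powr ?x \<le> 1 / (1 - 2 powr (- ?x)) * 1"
        using c2 x powr_less_one[of 2 "- ?x"] by (intro mult_left_mono powr_le1) auto
      also have "\<dots> \<le> (1 + p * ln 2) / ln 2 / ?x"
        using inverse_one_minus_powr_le[OF x] by simp
      also have "\<dots> \<le> (1 + p * ln 2) / ln 2 / ((\<Gamma> - 1 - \<tau>) * \<tau>)"
      proof (rule divide_left_mono)
        have "\<Gamma> - 1 - \<tau> \<le> ?x" using \<tau> p mult_left_mono[of 1 p "\<Gamma> - 1 - \<tau>"] by simp
        with g1(1) show "(\<Gamma> - 1 - \<tau>) * \<tau> \<le> ?x" by (rule order_trans)
      qed (use g0 x p in auto)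
      finally show "1 / (1 - 2 powr (- ?x)) * (c / 2) powr ?x \<le> (1 + p * ln 2) / ln 2 * ?g" by simp
    qed (use m V R0 in auto)
    finally have 1: "(3 / (1 - \<theta>) * Kst * (2 / R) powr (\<Gamma> - 1)) powr p * (V * 2 ^ ?N * (c * R / 2) powr ?x / (1 - 2 powr (- ?x)))
      \<le> m * (V * 2 ^ ?N) * ((1 + p * ln 2) / ln 2 * ?g) * ?R" .
    have "2 * 2 powr p / (c * R / 2) powr (real ?N + \<tau> * p) * (V * (R / 4) ^ ?N) * (C1 / R powr p * A)
      = 2 * 2 powr p * V * C1 / 4 ^ ?N * (A / R powr p) * (R ^ ?N / (c / 2 * R) powr (real ?N + \<tau> * p))"
      unfolding c2(3) by (simp add: power_divide mult_ac)
    also have "\<dots> = 2 * 2 powr p * V * C1 * (1 / 4 ^ ?N * (1 / (c / 2) powr (real ?N + \<tau> * p))) * ?R"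
      unfolding powr_rescale(2)[OF R c2(1)] by (simp add: mult_ac)
    also have "\<dots> \<le> 2 * 2 powr p * V * C1 * (1 / (c / 2) powr (real ?N + p) * ?g) * ?R"
    proof (intro mult_right_mono mult_left_mono)
      have "1 / 4 ^ ?N * (1 / (c / 2) powr (real ?N + \<tau> * p)) \<le> 1 * (1 / (c / 2) powr (real ?N + \<tau> * p))"
        by (intro mult_right_mono) auto
      \<comment> \<open>Since \<open>c / 2 \<le> 1\<close> and \<tau> is below 1, enlarging the
        exponent to \<open>p\<close> removes \<tau> from the constant.\<close>
      also have "\<dots> \<le> 1 / (c / 2) powr (real ?N + p) * 1"
        using c2 \<tau> \<Gamma> p by (auto intro!: divide_left_mono powr_mono')
      also have "\<dots> \<le> 1 / (c / 2) powr (real ?N + p) * ?g"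
        using g0 g1(2) by (intro mult_left_mono) auto
      finally show "1 / 4 ^ ?N * (1 / (c / 2) powr (real ?N + \<tau> * p)) \<le> 1 / (c / 2) powr (real ?N + p) * ?g" .
    qed (use V C R0 in auto)
    finally have 2: "2 * 2 powr p / (c * R / 2) powr (real ?N + \<tau> * p) * (V * (R / 4) ^ ?N) * (C1 / R powr p * A)
      \<le> 2 * 2 powr p * V * C1 * (1 / (c / 2) powr (real ?N + p) * ?g) * ?R" .
    have "m * (V * 2 ^ ?N) * ((1 + p * ln 2) / ln 2 * ?g) * ?R + 2 * 2 powr p * V * C1 * (1 / (c / 2) powr (real ?N + p) * ?g) * ?R
      = (m * (V * 2 ^ ?N) * ((1 + p * ln 2) / ln 2) + 2 * 2 powr p * V * C1 / (c / 2) powr (real ?N + p)) * ?g * ?R"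
    proof -
      have "X * (K * g) * r + W * (1 / q * g) * r = (X * K + W / q) * g * r" for X K g r W q :: real
        by (simp add: algebra_simps)
      then show ?thesis .
    qed
    also have "\<dots> = (m * (V * 2 ^ ?N) * ((1 + p * ln 2) / ln 2) + 2 * 2 powr p * V * C1 / (c / 2) powr (real ?N + p))
      / ((\<Gamma> - 1 - \<tau>) * \<tau>) / R powr (p * (1 + \<tau>)) * A"
      unfolding Req[symmetric] by simp
    finally show "(3 / (1 - \<theta>) * Kst * (2 / R) powr (\<Gamma> - 1)) powr p * (V * 2 ^ ?N * (c * R / 2) powr ?x / (1 - 2 powr (- ?x)))
     + 2 * 2 powr p / (c * R / 2) powr (real ?N + \<tau> * p) * (V * (R / 4) ^ ?N) * (C1 / R powr p * A) \<le>
     (m * (V * 2 ^ ?N) * ((1 + p * ln 2) / ln 2) + 2 * 2 powr p * V * C1 / (c / 2) powr (real ?N + p))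
      / ((\<Gamma> - 1 - \<tau>) * \<tau>) / R powr (p * (1 + \<tau>)) * A"
      using add_mono[OF 1 2] by linarith
  qed
  finally show ?thesis by (simp add: m_def)
qed

text \<open>The constants precede \<tau>, as the second case of the theorem demands, and a common
  \<open>c\<close> is taken for first and second differences.\<close>

lemma second_order_bound:
  assumes p: "2 \<le> p" and s: "0 < s" "s < 1" and t: "0 \<le> t" "t \<le> s" and big: "p - 1 < t + s * p"
  defines "\<Gamma> \<equiv> (1 + t + s * p) / p"
  shows "\<exists>C2>0. \<exists>C3>0. \<forall>(u :: 'a::euclidean_space \<Rightarrow> real) x0 R A b. admissible p s t \<Lambda> kf kn u x0 R A \<longrightarrow> b \<in> Basis \<longrightarrow>
    (\<integral>\<^sup>+x. ennreal (indicator (ball x0 (R / 2)) x * \<bar>dyadic_deriv u b x\<bar> powr p) \<partial>lebesgue) \<le> ennreal (C2 / R powr p * A) \<and>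
    (\<lambda>j. \<integral>\<^sup>+x. ennreal (indicator (ball x0 (R / 2)) x * \<bar>quot u b (1 / 2 ^ j) x - dyadic_deriv u b x\<bar>) \<partial>lebesgue) \<longlonglongrightarrow> 0 \<and>
    (\<forall>\<tau>. 0 < \<tau> \<and> \<tau> < \<Gamma> - 1 \<longrightarrow> gagliardo \<tau> p (ball x0 (R / 4)) (dyadic_deriv u b)
      \<le> ennreal (C3 / ((\<Gamma> - 1 - \<tau>) * \<tau>) / R powr (p * (1 + \<tau>)) * A))"
proof -
  have sp: "s * p < p" using s p by simp
  have "1 + t + s * p < 2 * p" "1 * p < 1 + t + s * p" using big sp p s t by linarith+
  then have \<Gamma>: "1 < \<Gamma>" "\<Gamma> < 2" using p by (simp_all add: \<Gamma>_def pos_less_divide_eq pos_divide_less_eq)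
  obtain C1 c1 where C1: "0 < C1" "0 < c1" "c1 \<le> 1 / 32"
    and H: "\<And>(u :: 'a \<Rightarrow> real) x0 R A. admissible p s t \<Lambda> kf kn u x0 R A \<Longrightarrow> diff_bound p u x0 R A 1 (1/2) C1 c1"
    using uniform_diff_limit_case(1)[OF p s t big, where ?'a = 'a] unfolding uniform_diff_def by blast
  obtain C2 c2 where C2: "0 < C2" "0 < c2" "c2 \<le> 1 / 32"
    and S: "\<And>(u :: 'a \<Rightarrow> real) x0 R A. admissible p s t \<Lambda> kf kn u x0 R A \<Longrightarrow> diff2_bound p u x0 R A \<Gamma> (1/2) C2 c2"
    using uniform_diff_limit_case(2)[OF p s t big, where ?'a = 'a] unfolding uniform_diff2_def \<Gamma>_def by blast
  define c where "c = min c1 c2"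
  have c: "0 < c" "c \<le> c1" "c \<le> c2" "c \<le> 1 / 32" using C1 C2 by (auto simp: c_def)
  let ?V = "unit_ball_vol (real DIM('a))"
  define C3 where "C3 = (3 / (1 - 2 powr (- (\<Gamma> - 1)))) powr p * 2 powr ((\<Gamma> - 1) * p) * C2 * (?V * 2 ^ DIM('a)) * ((1 + p * ln 2) / ln 2)
      + 2 * 2 powr p * ?V * C1 / (c / 2) powr (real DIM('a) + p)"
  have C3: "0 < C3"
    unfolding C3_def using C1 C2 c p by (intro add_nonneg_pos mult_nonneg_nonneg divide_nonneg_nonneg) auto
  have grad: "gradient p u x0 R A \<Gamma> C1 C2 c" if adm: "admissible p s t \<Lambda> kf kn u x0 R A" for u and x0 :: 'a and R A
  proof -
    obtain K f where "controlled p s t \<Lambda> kf kn K f u x0 R A"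
      using adm by (auto simp: admissible_def)
    then interpret controlled p s t \<Lambda> kf kn K f u x0 R A .
    have cR: "c * R \<le> c1 * R" "c * R \<le> c2 * R" using c R by (auto intro!: mult_right_mono)
    show ?thesis
    proof
      show "diff_bound p u x0 R A 1 (1/2) C1 c"
        using H[OF adm] cR(1) unfolding diff_bound_def by (meson order_trans)
      show "diff2_bound p u x0 R A \<Gamma> (1/2) C2 c"
        using S[OF adm] cR(2) unfolding diff2_bound_def by (meson order_trans)
    qed (use p R A \<Gamma> C1 C2 c in auto)
  qed
  show ?thesis
  proof (rule exI[of _ C1], intro conjI C1(1), rule exI[of _ C3], intro conjI C3 allI impI)
    fix u :: "'a \<Rightarrow> real" and x0 b :: 'a and R A \<tau> :: real
    assume adm: "admissible p s t \<Lambda> kf kn u x0 R A" and b: "b \<in> Basis"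
    interpret gradient p u x0 R A \<Gamma> C1 C2 c by (rule grad[OF adm])
    show "(\<integral>\<^sup>+x. ennreal (indicator (ball x0 (R / 2)) x * \<bar>dyadic_deriv u b x\<bar> powr p) \<partial>lebesgue) \<le> ennreal (C1 / R powr p * A)"
      using deriv_Lp[OF b] by simp
    show "(\<lambda>j. \<integral>\<^sup>+x. ennreal (indicator (ball x0 (R / 2)) x * \<bar>quot u b (1 / 2 ^ j) x - dyadic_deriv u b x\<bar>) \<partial>lebesgue) \<longlonglongrightarrow> 0"
      using quot_tendsto_L1[OF b] by simp
    assume \<tau>: "0 < \<tau> \<and> \<tau> < \<Gamma> - 1"
    then show "gagliardo \<tau> p (ball x0 (R / 4)) (dyadic_deriv u b) \<le> ennreal (C3 / ((\<Gamma> - 1 - \<tau>) * \<tau>) / R powr (p * (1 + \<tau>)) * A)"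
      using deriv_gagliardo[OF b, of \<tau>] unfolding C3_def \<theta>_def by simp
  qed
qed

section \<open>From partial derivatives to the gradient\<close>

lemma norm_powr_le_sum_Basis:
  fixes v :: "'a::euclidean_space"
  assumes "0 \<le> p"
  shows "norm v powr p \<le> real DIM('a) powr p * (\<Sum>b\<in>Basis. \<bar>v \<bullet> b\<bar> powr p)"
proof -
  define m where "m = Max ((\<lambda>b. \<bar>v \<bullet> b\<bar>) ` Basis)"
  have "m \<in> (\<lambda>b. \<bar>v \<bullet> b\<bar>) ` Basis" unfolding m_def by (rule Max_in) auto
  then obtain b0 where b0: "b0 \<in> Basis" "m = \<bar>v \<bullet> b0\<bar>" by auto
  have le: "\<bar>v \<bullet> b\<bar> \<le> m" if "b \<in> Basis" for b unfolding m_def by (rule Max_ge) (use that in auto)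
  have "norm v \<le> (\<Sum>b\<in>Basis. \<bar>v \<bullet> b\<bar>)" by (rule norm_le_l1)
  also have "\<dots> \<le> real DIM('a) * m" using sum_bounded_above[of Basis "\<lambda>b. \<bar>v \<bullet> b\<bar>" m] le by simp
  finally have "norm v powr p \<le> (real DIM('a) * m) powr p" using assms by (intro powr_mono2) auto
  also have "\<dots> = real DIM('a) powr p * \<bar>v \<bullet> b0\<bar> powr p" using b0 by (simp add: powr_mult)
  also have "\<dots> \<le> real DIM('a) powr p * (\<Sum>b\<in>Basis. \<bar>v \<bullet> b\<bar> powr p)"
    using b0 by (intro mult_left_mono member_le_sum[of b0 Basis "\<lambda>b. \<bar>v \<bullet> b\<bar> powr p"]) auto
  finally show ?thesis .
qed

lemma nn_integral_sum_Basis_le: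
  fixes F :: "'a::euclidean_space \<Rightarrow> 'b \<Rightarrow> real"
  assumes [measurable]: "\<And>b. b \<in> Basis \<Longrightarrow> F b \<in> borel_measurable M" and F: "\<And>b x. 0 \<le> F b x" and k: "0 \<le> k" and B: "0 \<le> B"
    and le: "\<And>x. G x \<le> k * (\<Sum>b\<in>Basis. F b x)"
    and FB: "\<And>b. b \<in> Basis \<Longrightarrow> (\<integral>\<^sup>+x. ennreal (F b x) \<partial>M) \<le> ennreal B"
  shows "(\<integral>\<^sup>+x. ennreal (G x) \<partial>M) \<le> ennreal (k * real DIM('a) * B)"
proof -
  have "(\<integral>\<^sup>+x. ennreal (\<Sum>b\<in>Basis. F b x) \<partial>M) = (\<integral>\<^sup>+x. (\<Sum>b\<in>Basis. ennreal (F b x)) \<partial>M)"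
    by (simp add: sum_ennreal F)
  also have "\<dots> = (\<Sum>b\<in>Basis. \<integral>\<^sup>+x. ennreal (F b x) \<partial>M)"
    by (rule nn_integral_sum) measurable
  also have "\<dots> \<le> (\<Sum>b\<in>(Basis :: 'a set). ennreal B)" by (intro sum_mono FB)
  also have "\<dots> = ennreal (real DIM('a) * B)" using B by (simp add: ennreal_mult' ennreal_of_nat_eq_real_of_nat)
  finally have "(\<integral>\<^sup>+x. ennreal (G x) \<partial>M) \<le> ennreal (k * (real DIM('a) * B))"
    by (intro nn_integral_scale[OF _ le k]) auto
  then show ?thesis by (simp add: mult.assoc)
qed

definition dyadic_grad :: "('a::euclidean_space \<Rightarrow> real) \<Rightarrow> 'a \<Rightarrow> 'a" where
  "dyadic_grad u x = (\<Sum>b\<in>Basis. dyadic_deriv u b x *\<^sub>R b)"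

lemma measurable_dyadic_grad [measurable]:
  assumes [measurable]: "u \<in> borel_measurable lebesgue"
  shows "dyadic_grad u \<in> borel_measurable lebesgue"
  unfolding dyadic_grad_def[abs_def] by measurable

lemma dyadic_grad_inner: "b \<in> Basis \<Longrightarrow> dyadic_grad u x \<bullet> b = dyadic_deriv u b x"
  by (simp add: dyadic_grad_def inner_sum_left_Basis)

lemma dyadic_grad_Lp:
  fixes u :: "'a::euclidean_space \<Rightarrow> real"
  assumes [measurable]: "u \<in> borel_measurable lebesgue" "E \<in> sets borel" and p: "0 \<le> p" and B: "0 \<le> B"
    and le: "\<And>b. b \<in> Basis \<Longrightarrow> (\<integral>\<^sup>+x. ennreal (indicator E x * \<bar>dyadic_deriv u b x\<bar> powr p) \<partial>lebesgue) \<le> ennreal B"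
  shows "(\<integral>\<^sup>+x. ennreal (indicator E x * norm (dyadic_grad u x) powr p) \<partial>lebesgue) \<le> ennreal (real DIM('a) powr p * real DIM('a) * B)"
proof (rule nn_integral_sum_Basis_le[OF _ _ _ B _ le])
  fix x
  have "indicator E x * norm (dyadic_grad u x) powr p \<le> indicator E x * (real DIM('a) powr p * (\<Sum>b\<in>Basis. \<bar>dyadic_grad u x \<bullet> b\<bar> powr p))"
    by (intro mult_left_mono norm_powr_le_sum_Basis p) auto
  then show "indicator E x * norm (dyadic_grad u x) powr p \<le> real DIM('a) powr p * (\<Sum>b\<in>Basis. indicator E x * \<bar>dyadic_deriv u b x\<bar> powr p)"
    by (simp add: dyadic_grad_inner sum_distrib_left mult_ac)
qed auto

lemma dyadic_grad_gagliardo: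
  fixes u :: "'a::euclidean_space \<Rightarrow> real"
  assumes [measurable]: "u \<in> borel_measurable lebesgue" "E \<in> sets borel" and p: "0 \<le> p" and B: "0 \<le> B"
    and le: "\<And>b. b \<in> Basis \<Longrightarrow> gagliardo \<tau> p E (dyadic_deriv u b) \<le> ennreal B"
  shows "gagliardo \<tau> p E (dyadic_grad u) \<le> ennreal (real DIM('a) powr p * real DIM('a) * B)"
  unfolding gagliardo_def
proof (rule nn_integral_sum_Basis_le[OF _ _ _ B _ le[unfolded gagliardo_def]])
  fix z :: "'a \<times> 'a"
  let ?i = "indicator E (fst z) * indicator E (snd z)" and ?n = "norm (fst z - snd z) powr (real DIM('a) + \<tau> * p)"
  have "?i / ?n * norm (dyadic_grad u (fst z) - dyadic_grad u (snd z)) powr p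
    \<le> ?i / ?n * (real DIM('a) powr p * (\<Sum>b\<in>Basis. \<bar>(dyadic_grad u (fst z) - dyadic_grad u (snd z)) \<bullet> b\<bar> powr p))"
    by (intro mult_left_mono norm_powr_le_sum_Basis p) auto
  then show "?i * norm (dyadic_grad u (fst z) - dyadic_grad u (snd z)) powr p / ?n
    \<le> real DIM('a) powr p * (\<Sum>b\<in>Basis. ?i * norm (dyadic_deriv u b (fst z) - dyadic_deriv u b (snd z)) powr p / ?n)"
    by (cases "fst z \<in> E"; cases "snd z \<in> E")
      (simp_all add: dyadic_grad_inner inner_diff_left sum_distrib_left sum_divide_distrib mult_ac)
qed auto

lemma nn_integral_ball_L1_finite:
  fixes g :: "'a::euclidean_space \<Rightarrow> 'b::euclidean_space"
  assumes [measurable]: "g \<in> borel_measurable lebesgue" and p: "1 \<le> p" and r: "0 \<le> r"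
    and g: "(\<integral>\<^sup>+x. ennreal (indicator (ball x0 r) x * norm (g x) powr p) \<partial>lebesgue) < \<infinity>"
  shows "(\<integral>\<^sup>+x. ennreal (indicator (ball x0 r) x * norm (g x)) \<partial>lebesgue) < \<infinity>"
proof -
  have "(\<integral>\<^sup>+x. ennreal (indicator (ball x0 r) x * norm (g x)) \<partial>lebesgue) \<le>
    (\<integral>\<^sup>+x. ennreal (1 * indicator (ball x0 r) x) + ennreal (indicator (ball x0 r) x * norm (g x) powr p) \<partial>lebesgue)"
  proof (rule nn_integral_mono)
    fix x
    show "ennreal (indicator (ball x0 r) x * norm (g x)) \<le> ennreal (1 * indicator (ball x0 r) x) + ennreal (indicator (ball x0 r) x * norm (g x) powr p)"
    proof (cases "x \<in> ball x0 r")
      case True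
      have "ennreal (norm (g x)) \<le> ennreal (1 + norm (g x) powr p)"
        using le_add_powr[OF p zero_less_one, of "norm (g x)"] by (intro ennreal_leI) simp
      then show ?thesis using True by simp
    qed simp
  qed
  also have "\<dots> = (\<integral>\<^sup>+x. ennreal (1 * indicator (ball x0 r) x) \<partial>lebesgue) + (\<integral>\<^sup>+x. ennreal (indicator (ball x0 r) x * norm (g x) powr p) \<partial>lebesgue)"
    by (rule nn_integral_add) measurable
  also have "\<dots> < \<infinity>"
    using g nn_integral_ball_const[OF r zero_le_one, of x0] by simp
  finally show ?thesis .
qed

text \<open>All hypotheses on the gradient are local around points of \<open>E\<close>; test
  functions have compact support in \<open>E\<close>, so finitely many balls suffice for
  each.\<close>

lemma weak_gradient_dyadic_grad:
  fixes u :: "'a::euclidean_space \<Rightarrow> real"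
  assumes [measurable]: "u \<in> borel_measurable lebesgue"
    and u: "\<And>n :: nat. (\<integral>\<^sup>+x. ennreal (indicator (ball 0 (real n)) x * norm (u x)) \<partial>lebesgue) < \<infinity>"
    and D: "\<And>x. x \<in> E \<Longrightarrow> \<exists>r>0. (\<integral>\<^sup>+y. ennreal (indicator (ball x r) y * norm (dyadic_grad u y)) \<partial>lebesgue) < \<infinity>"
    and lim: "\<And>x b. x \<in> E \<Longrightarrow> b \<in> Basis \<Longrightarrow>
      \<exists>r>0. (\<lambda>j. \<integral>\<^sup>+y. ennreal (indicator (ball x r) y * \<bar>quot u b (1 / 2 ^ j) y - dyadic_deriv u b y\<bar>) \<partial>lebesgue) \<longlonglongrightarrow> 0"
  shows "weak_gradient E u (dyadic_grad u)"
  unfolding weak_gradient_def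
proof (intro conjI allI impI ballI)
  show "u \<in> Lspace_loc 1 E"
  proof (rule Lspace_loc_I)
    fix x :: 'a
    obtain n :: nat where n: "norm x + 1 < real n" using reals_Archimedean2 by blast
    have sub: "y \<in> ball 0 (real n)" if "y \<in> ball x 1" for y
      using that n norm_triangle_ineq4[of x "x - y"] by (auto simp: dist_norm)
    have "(\<integral>\<^sup>+y. ennreal (indicator (ball x 1) y * norm (u y) powr 1) \<partial>lebesgue) \<le> (\<integral>\<^sup>+y. ennreal (indicator (ball 0 (real n)) y * norm (u y)) \<partial>lebesgue)"
      using sub by (intro nn_integral_mono ennreal_leI) (auto simp: indicator_def)
    then show "\<exists>r>0. (\<integral>\<^sup>+y. ennreal (indicator (ball x r) y * norm (u y) powr 1) \<partial>lebesgue) < \<infinity>"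
      using le_less_trans[OF _ u[of n]] by (intro exI[of _ 1]) simp
  qed auto
  show "dyadic_grad u \<in> Lspace_loc 1 E"
    by (rule Lspace_loc_I) (use D in auto)
  fix \<phi> :: "'a \<Rightarrow> real" and b :: 'a assume \<phi>: "test_function E \<phi>" and b: "b \<in> Basis"
  interpret test_direction E \<phi> b by unfold_locales (fact \<phi> b)+
  have D': "\<exists>r>0. (\<integral>\<^sup>+y. ennreal (indicator (ball x r) y * \<bar>dyadic_deriv u b y\<bar>) \<partial>lebesgue) < \<infinity>" if x: "x \<in> E" for x
  proof -
    obtain r where r: "0 < r" "(\<integral>\<^sup>+y. ennreal (indicator (ball x r) y * norm (dyadic_grad u y)) \<partial>lebesgue) < \<infinity>"
      using D[OF x] by (elim exE conjE)
    have "(\<integral>\<^sup>+y. ennreal (indicator (ball x r) y * \<bar>dyadic_deriv u b y\<bar>) \<partial>lebesgue) \<le> (\<integral>\<^sup>+y. ennreal (indicator (ball x r) y * norm (dyadic_grad u y)) \<partial>lebesgue)"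
      using Basis_le_norm[OF b] by (intro nn_integral_mono ennreal_leI mult_left_mono) (auto simp: dyadic_grad_inner[OF b, symmetric])
    then show ?thesis using r(1) le_less_trans[OF _ r(2)] by (intro exI[of _ r]) simp
  qed
  have ibp: "(\<integral>x. u x * d\<phi> x \<partial>lebesgue) = - (\<integral>x. dyadic_deriv u b x * \<phi> x \<partial>lebesgue)"
    by (rule integration_by_parts) (use u D' lim b in auto)
  have "(LINT x:E|lebesgue. u x * frechet_derivative \<phi> (at x) b) = (\<integral>x. u x * d\<phi> x \<partial>lebesgue)"
    unfolding set_lebesgue_integral_def
    by (intro Bochner_Integration.integral_cong) (use d\<phi>_zero S(2) in \<open>auto simp: d\<phi>_def indicator_def\<close>)
  moreover have "(LINT x:E|lebesgue. (dyadic_grad u x \<bullet> b) * \<phi> x) = (\<integral>x. dyadic_deriv u b x * \<phi> x \<partial>lebesgue)"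
    unfolding set_lebesgue_integral_def
    by (intro Bochner_Integration.integral_cong) (use \<phi>_zero S(2) in \<open>auto simp: dyadic_grad_inner[OF b] indicator_def\<close>)
  ultimately show "(LINT x:E|lebesgue. u x * frechet_derivative \<phi> (at x) b) = - (LINT x:E|lebesgue. (dyadic_grad u x \<bullet> b) * \<phi> x)"
    using ibp by simp
qed

text \<open>\<open>A_term\<close> may be 0 or infinite, whereas the energy estimate works with a
  positive real \<open>A\<close>. Estimates are therefore proved for every positive real upper bound
  of it, and letting this bound decrease gives the claim; the infinite case is trivial.\<close>

lemma ennreal_le_scaled:
  assumes "\<And>a. 0 < a \<Longrightarrow> X \<le> ennreal a \<Longrightarrow> Y \<le> ennreal (k * a)" and k: "0 < k"
  shows "Y \<le> ennreal k * X"
proof (cases X)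
  case (real x)
  show ?thesis
  proof (rule ennreal_le_epsilon)
    fix \<epsilon> :: real assume \<epsilon>: "0 < \<epsilon>"
    have "Y \<le> ennreal (k * (x + \<epsilon> / k))"
      using real \<epsilon> k by (intro assms(1)) (auto intro!: ennreal_leI add_nonneg_pos)
    also have "k * (x + \<epsilon> / k) = k * x + \<epsilon>" using k by (simp add: distrib_left)
    also have "ennreal (k * x + \<epsilon>) = ennreal k * X + ennreal \<epsilon>"
      using real k \<epsilon> by (simp add: ennreal_plus ennreal_mult)
    finally show "Y \<le> ennreal k * X + ennreal \<epsilon>" .
  qed
next
  case top
  then show ?thesis using k by (simp add: ennreal_mult_top)
qed

lemma Xspace_ball_L1:
  assumes u: "u \<in> Xspace s p" and p: "1 \<le> p"
  shows "(\<integral>\<^sup>+x. ennreal (indicator (ball 0 (real n)) x * norm (u x)) \<partial>lebesgue) < \<infinity>"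
proof (rule nn_integral_ball_L1_finite[OF Xspace_measurable[OF u] p])
  have "Lnorm p (ball 0 (real n)) u < \<infinity>"
    using u compactly_inside_UNIV_ball[of 0 "real n"] by (auto simp: Xspace_def Lspace_loc_def Lspace_def)
  then show "(\<integral>\<^sup>+x. ennreal (indicator (ball 0 (real n)) x * norm (u x) powr p) \<partial>lebesgue) < \<infinity>"
    using p by (simp only: epowr_less_top_iff flip: Lnorm_powr)
qed simp

text \<open>Small balls with finite \<open>A_term\<close> exist around every point. Membership in
  local spaces follows from these by covering, without any claim on the finiteness of
  \<open>A_term\<close> for larger balls.\<close>

lemma ex_good_ball:
  fixes u f :: "'a::euclidean_space \<Rightarrow> real"
  assumes p: "2 \<le> p" and s: "0 < s" "s < 1" and \<Omega>: "open \<Omega>" and x: "x \<in> \<Omega>"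
    and f: "f \<in> Wspace_loc s (conj_exp p) \<Omega>" and u: "u \<in> Wspace_loc s p \<Omega>" "u \<in> Yspace t s p"
  obtains R a where "0 < R" "compactly_inside (ball x R) \<Omega>" "0 < a" "A_term t s p u f x R \<le> ennreal a"
proof -
  obtain h0 where h0: "0 < h0" "(SUP h\<in>{h. 0 < norm h \<and> norm h < h0}.
        \<integral>\<^sup>+x. ennreal (\<bar>diff_quot t h u x\<bar> powr p / (1 + norm x) powr (real DIM('a) + s * p)) \<partial>lebesgue) < \<infinity>"
    using u(2) unfolding Yspace_def mem_Collect_eq by (elim conjE exE)
  obtain e where e: "0 < e" "cball x e \<subseteq> \<Omega>" using \<Omega> x open_contains_cball by blast
  define R where "R = min e h0"
  have R: "0 < R" "R \<le> h0" "R \<le> e" using e h0 by (auto simp: R_def)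
  have B: "compactly_inside (ball x R) \<Omega>"
    unfolding compactly_inside_def using \<Omega> R e(2) by (auto simp: subset_eq)
  have "A_term t s p u f x R < \<infinity>"
    by (rule A_term_finite[OF p s u(2) _ _ R(1,2) h0(2)]) (use u(1) f B in \<open>auto simp: Wspace_loc_def\<close>)
  then have "A_term t s p u f x R \<le> ennreal (enn2real (A_term t s p u f x R) + 1)"
    by (cases "A_term t s p u f x R") (auto intro!: ennreal_leI)
  moreover have "0 < enn2real (A_term t s p u f x R) + 1" by (rule add_nonneg_pos) auto
  ultimately show ?thesis using that[OF R(1) B] by blast
qed

lemma Wspace_loc_Lspace_loc:
  assumes "u \<in> Wspace_loc s p \<Omega>" "compactly_inside E \<Omega>"
  shows "u \<in> Lspace p E"
  using assms by (auto simp: Wspace_loc_def Wspace_def)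

lemma gradient_of_good_balls:
  fixes u :: "'a::euclidean_space \<Rightarrow> real"
  assumes p: "2 \<le> p" and u: "u \<in> Xspace s p" and E: "E \<subseteq> \<Omega>"
    and loc: "\<And>x. x \<in> \<Omega> \<Longrightarrow> \<exists>r>0. (\<integral>\<^sup>+y. ennreal (indicator (ball x r) y * norm (dyadic_grad u y) powr p) \<partial>lebesgue) < \<infinity> \<and>
      (\<forall>b\<in>Basis. (\<lambda>j. \<integral>\<^sup>+y. ennreal (indicator (ball x r) y * \<bar>quot u b (1 / 2 ^ j) y - dyadic_deriv u b y\<bar>) \<partial>lebesgue) \<longlonglongrightarrow> 0)"
  shows "weak_gradient E u (dyadic_grad u)"
proof (rule weak_gradient_dyadic_grad)
  show u_m [measurable]: "u \<in> borel_measurable lebesgue" by (rule Xspace_measurable[OF u])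
  show "(\<integral>\<^sup>+x. ennreal (indicator (ball 0 (real n)) x * norm (u x)) \<partial>lebesgue) < \<infinity>" for n
    using p by (intro Xspace_ball_L1[OF u]) auto
  fix x assume xE: "x \<in> E"
  obtain r where r: "0 < r" "(\<integral>\<^sup>+y. ennreal (indicator (ball x r) y * norm (dyadic_grad u y) powr p) \<partial>lebesgue) < \<infinity>"
    "\<forall>b\<in>Basis. (\<lambda>j. \<integral>\<^sup>+y. ennreal (indicator (ball x r) y * \<bar>quot u b (1 / 2 ^ j) y - dyadic_deriv u b y\<bar>) \<partial>lebesgue) \<longlonglongrightarrow> 0"
    using loc[OF subsetD[OF E xE]] by (elim exE conjE)
  show "\<exists>r>0. (\<integral>\<^sup>+y. ennreal (indicator (ball x r) y * norm (dyadic_grad u y)) \<partial>lebesgue) < \<infinity>"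
    using nn_integral_ball_L1_finite[OF _ _ _ r(2)] p r(1) by (intro exI[of _ r] conjI) auto
  show "\<exists>r>0. (\<lambda>j. \<integral>\<^sup>+y. ennreal (indicator (ball x r) y * \<bar>quot u b (1 / 2 ^ j) y - dyadic_deriv u b y\<bar>) \<partial>lebesgue) \<longlonglongrightarrow> 0"
    if "b \<in> Basis" for b
    using r(1) bspec[OF r(3) that] by (intro exI[of _ r] conjI)
qed

theorem theorem1p5:
  fixes p s t \<Lambda> :: real
  assumes "p \<ge> 2" and "0 < s" and "s < 1" and "0 \<le> t" and "t \<le> s" and "\<Lambda> \<ge> 1"
  shows
    "(t + s * p \<le> p - 1 \<longrightarrow>
       (\<forall>\<tau>. s \<le> \<tau> \<and> \<tau> < (t + s * p) / (p - 1) \<longrightarrow>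
         (\<exists>C1>0. \<forall>(\<Omega> :: 'a::euclidean_space set) (K :: 'a \<Rightarrow> real) (f :: 'a \<Rightarrow> real) (u :: 'a \<Rightarrow> real).
            open \<Omega> \<and>
            K \<in> borel_measurable lebesgue \<and>
            (\<forall>z. 0 \<le> K z \<and> 1 / \<Lambda> * norm z powr (real DIM('a) + s * p) \<le> K z
                 \<and> K z \<le> \<Lambda> * norm z powr (real DIM('a) + s * p)) \<and>
            f \<in> Wspace_loc s (conj_exp p) \<Omega> \<and>
            u \<in> Wspace_loc s p \<Omega> \<inter> Yspace t s p \<and>
            local_weak_solution s p K \<Omega> f u \<longrightarrow>
              u \<in> Wspace_loc \<tau> p \<Omega> \<and>
              (\<forall>x0 R. 0 < R \<and> compactly_inside (ball x0 R) \<Omega> \<longrightarrow>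
                 epowr (Wseminorm \<tau> p (ball x0 (R / 2)) u) p
                   \<le> ennreal (C1 / R powr (\<tau> * p)) * A_term t s p u f x0 R))))
     \<and>
     (t + s * p > p - 1 \<longrightarrow>
       (let \<Gamma> = (1 + t + s * p) / p in
         (\<exists>C2>0. \<exists>C3>0. \<forall>(\<Omega> :: 'a set) (K :: 'a \<Rightarrow> real) (f :: 'a \<Rightarrow> real) (u :: 'a \<Rightarrow> real).
            open \<Omega> \<and>
            K \<in> borel_measurable lebesgue \<and>
            (\<forall>z. 0 \<le> K z \<and> 1 / \<Lambda> * norm z powr (real DIM('a) + s * p) \<le> K z
                 \<and> K z \<le> \<Lambda> * norm z powr (real DIM('a) + s * p)) \<and>
            f \<in> Wspace_loc s (conj_exp p) \<Omega> \<and>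
            u \<in> Wspace_loc s p \<Omega> \<inter> Yspace t s p \<and>
            local_weak_solution s p K \<Omega> f u \<longrightarrow>
              u \<in> W1space_loc p \<Omega> \<and>
              (\<exists>Du. weak_gradient \<Omega> u Du \<and>
                 (\<forall>\<tau>. 0 < \<tau> \<and> \<tau> < \<Gamma> - 1 \<longrightarrow> Du \<in> Wspace_loc \<tau> p \<Omega>) \<and>
                 (\<forall>x0 R. 0 < R \<and> compactly_inside (ball x0 R) \<Omega> \<longrightarrow>
                    epowr (Lnorm p (ball x0 (R / 2)) Du) p
                      \<le> ennreal (C2 / R powr p) * A_term t s p u f x0 R \<and>
                    (\<forall>\<tau>. 0 < \<tau> \<and> \<tau> < \<Gamma> - 1 \<longrightarrow>
                       epowr (Wseminorm \<tau> p (ball x0 (R / 4)) Du) p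
                         \<le> ennreal ((2 - \<Gamma>) powr (-p) * (\<Gamma> - 1) powr (-p) / ((\<Gamma> - 1 - \<tau>) * \<tau>)
                                    * (C3 / R powr (p * (1 + \<tau>))))
                           * A_term t s p u f x0 R))))))"
  (is "(_ \<longrightarrow> (\<forall>\<tau>. _ \<longrightarrow> (\<exists>C1>0. \<forall>\<Omega> K f u. ?hyp \<Omega> K f u \<longrightarrow> ?est1 \<tau> C1 \<Omega> f u))) \<and> (_ \<longrightarrow> ?part2)")
proof -
  note p = assms(1) and s = assms(2,3) and t = assms(4,5) and \<Lambda> = assms(6)
  have p0: "0 < p" using p by simp
  \<comment> \<open>Fixed before \<Omega>, \<open>K\<close>, \<open>f\<close> and \<open>u\<close>,
    and depending only on the dimension, \<open>s\<close> and \<open>p\<close>, so that the final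
    constants inherit no further dependence.\<close>
  obtain kf kn where kf: "0 \<le> kf" and kn: "0 \<le> kn"
    and kf': "\<forall>(x :: 'a) a. 0 < a \<longrightarrow>
      (\<integral>\<^sup>+y. ennreal (indicator (- ball x a) y / norm (x - y) powr (real DIM('a) + s * p)) \<partial>lebesgue) \<le> ennreal (kf * a powr (- (s * p)))"
    and kn': "\<forall>(x :: 'a) a. 0 < a \<longrightarrow>
      (\<integral>\<^sup>+y. ennreal (indicator (ball x a) y * norm (x - y) powr (p - s * p - real DIM('a))) \<partial>lebesgue) \<le> ennreal (kn * a powr (p - s * p))"
    using ex_kernel_constants[OF s p, where ?'a = 'a] by (elim exE conjE)
  define cc where "cc = control_const DIM('a) s p"
  have cc: "0 < cc" unfolding cc_def by (rule control_const_pos)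
  have adm: "admissible p s t \<Lambda> kf kn u x0 R (cc * a)"
    if hyp: "?hyp \<Omega> K f u" and "0 < R" "compactly_inside (ball x0 R) \<Omega>" "A_term t s p u f x0 R \<le> ennreal a" "0 < a"
    for \<Omega> and K f u :: "'a \<Rightarrow> real" and x0 R a
    unfolding cc_def
    by (rule admissible_of_weak_solution[OF p s t \<Lambda> kf kf'[rule_format] kn kn'[rule_format], of K f \<Omega>]) (use that in \<open>auto simp: Yspace_def\<close>)
  have good: "\<exists>R a. 0 < R \<and> 0 < a \<and> admissible p s t \<Lambda> kf kn u x R a"
    if hyp: "?hyp \<Omega> K f u" and x: "x \<in> \<Omega>" for \<Omega> and K f u :: "'a \<Rightarrow> real" and x
  proof -
    obtain R a where "0 < R" "compactly_inside (ball x R) \<Omega>" "0 < a" "A_term t s p u f x R \<le> ennreal a"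
      by (rule ex_good_ball[OF p s, of \<Omega> x f u t]) (use hyp x in auto)
    then show ?thesis using adm[OF hyp] cc by (intro exI[of _ R] exI[of _ "cc * a"]) auto
  qed
  show ?thesis
  proof (intro conjI impI allI)
    fix \<tau> assume small: "t + s * p \<le> p - 1" and \<tau>: "s \<le> \<tau> \<and> \<tau> < (t + s * p) / (p - 1)"
    obtain C where C: "0 < C" and CB: "\<And>(u :: 'a \<Rightarrow> real) x0 R A. admissible p s t \<Lambda> kf kn u x0 R A \<Longrightarrow>
        gagliardo \<tau> p (ball x0 (R / 2)) u \<le> ennreal (C / R powr (\<tau> * p) * A)"
      using first_order_bound[OF p s t conjunct1[OF \<tau>] conjunct2[OF \<tau>] small, where ?'a = 'a and \<Lambda> = \<Lambda> and kf = kf and kn = kn]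
      by blast
    show "\<exists>C1>0. \<forall>\<Omega> K f u. ?hyp \<Omega> K f u \<longrightarrow> ?est1 \<tau> C1 \<Omega> f u"
    proof (rule exI[of _ "C * cc"], rule conjI, use C cc in simp, intro allI impI)
      fix \<Omega> and K f u :: "'a \<Rightarrow> real" assume hyp: "?hyp \<Omega> K f u"
      have uX: "u \<in> Xspace s p" using hyp by (auto simp: Yspace_def)
      have u_m [measurable]: "u \<in> borel_measurable lebesgue" by (rule Xspace_measurable[OF uX])
      show "?est1 \<tau> (C * cc) \<Omega> f u"
      proof (intro conjI allI impI)
        show "u \<in> Wspace_loc \<tau> p \<Omega>"
        proof (rule Wspace_loc_I[OF u_m p0])
          fix x assume "x \<in> \<Omega>"
          then obtain R a where Ra: "0 < R" "0 < a" "admissible p s t \<Lambda> kf kn u x R a" using good[OF hyp] by blast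
          then obtain K' f' where "controlled p s t \<Lambda> kf kn K' f' u x R a" by (auto simp: admissible_def)
          then interpret c: controlled p s t \<Lambda> kf kn K' f' u x R a .
          have "(\<integral>\<^sup>+y. ennreal (indicator (ball x (R / 2)) y * norm (u y) powr p) \<partial>lebesgue) \<le> ennreal a"
            by (rule nn_integral_le_mono[OF _ c.u_Lp]) (use Ra in \<open>auto simp: indicator_def\<close>)
          then have "(\<integral>\<^sup>+y. ennreal (indicator (ball x (R / 2)) y * norm (u y) powr p) \<partial>lebesgue) < \<infinity>"
            by (rule le_less_trans) simp
          moreover have "gagliardo \<tau> p (ball x (R / 2)) u < \<infinity>"
            by (rule le_less_trans[OF CB[OF Ra(3)]]) simp
          ultimately show "\<exists>r>0. (\<integral>\<^sup>+y. ennreal (indicator (ball x r) y * norm (u y) powr p) \<partial>lebesgue) < \<infinity> \<and> gagliardo \<tau> p (ball x r) u < \<infinity>"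
            using Ra(1) by (intro exI[of _ "R / 2"] conjI) auto
        qed (use s \<tau> in auto)
        fix x0 :: 'a and R assume B: "0 < R \<and> compactly_inside (ball x0 R) \<Omega>"
        show "epowr (Wseminorm \<tau> p (ball x0 (R / 2)) u) p \<le> ennreal (C * cc / R powr (\<tau> * p)) * A_term t s p u f x0 R"
          unfolding Wseminorm_powr[OF p0]
        proof (rule ennreal_le_scaled)
          fix a :: real assume a: "0 < a" "A_term t s p u f x0 R \<le> ennreal a"
          have "gagliardo \<tau> p (ball x0 (R / 2)) u \<le> ennreal (C / R powr (\<tau> * p) * (cc * a))"
            by (rule CB[OF adm[OF hyp]]) (use B a in auto)
          then show "gagliardo \<tau> p (ball x0 (R / 2)) u \<le> ennreal (C * cc / R powr (\<tau> * p) * a)"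
            by (simp add: mult_ac)
        qed (use C cc B in auto)
      qed
    qed
  next
    assume big: "p - 1 < t + s * p"
    define \<Gamma> where "\<Gamma> = (1 + t + s * p) / p"
    have "s * p < p" using s p by simp
    then have "1 + t + s * p < 2 * p" "1 * p < 1 + t + s * p" using big p s t by linarith+
    then have \<Gamma>: "1 < \<Gamma>" "\<Gamma> < 2" using p by (simp_all add: \<Gamma>_def pos_less_divide_eq pos_divide_less_eq)
    obtain C2 C3 where C2: "0 < C2" and C3: "0 < C3"
      and CB: "\<forall>(u :: 'a \<Rightarrow> real) x0 R A b. admissible p s t \<Lambda> kf kn u x0 R A \<longrightarrow> b \<in> Basis \<longrightarrow>
        (\<integral>\<^sup>+x. ennreal (indicator (ball x0 (R / 2)) x * \<bar>dyadic_deriv u b x\<bar> powr p) \<partial>lebesgue) \<le> ennreal (C2 / R powr p * A) \<and>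
        (\<lambda>j. \<integral>\<^sup>+x. ennreal (indicator (ball x0 (R / 2)) x * \<bar>quot u b (1 / 2 ^ j) x - dyadic_deriv u b x\<bar>) \<partial>lebesgue) \<longlonglongrightarrow> 0 \<and>
        (\<forall>\<tau>. 0 < \<tau> \<and> \<tau> < \<Gamma> - 1 \<longrightarrow> gagliardo \<tau> p (ball x0 (R / 4)) (dyadic_deriv u b)
          \<le> ennreal (C3 / ((\<Gamma> - 1 - \<tau>) * \<tau>) / R powr (p * (1 + \<tau>)) * A))"
      using second_order_bound[OF p s t big, where ?'a = 'a and \<Lambda> = \<Lambda> and kf = kf and kn = kn]
      unfolding \<Gamma>_def by (elim exE conjE)
    define n where "n = real DIM('a) powr p * real DIM('a)"
    have n: "0 < n" by (simp add: n_def)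
    have Lp: "(\<integral>\<^sup>+x. ennreal (indicator (ball x0 (R / 2)) x * norm (dyadic_grad u x) powr p) \<partial>lebesgue) \<le> ennreal (n * (C2 / R powr p * A))"
      if "admissible p s t \<Lambda> kf kn u x0 R A" "u \<in> borel_measurable lebesgue" "0 < A" for u and x0 :: 'a and R A
      unfolding n_def by (rule dyadic_grad_Lp) (use CB that C2 p in auto)
    have W: "gagliardo \<tau> p (ball x0 (R / 4)) (dyadic_grad u) \<le> ennreal (n * (C3 / ((\<Gamma> - 1 - \<tau>) * \<tau>) / R powr (p * (1 + \<tau>)) * A))"
      if "admissible p s t \<Lambda> kf kn u x0 R A" "u \<in> borel_measurable lebesgue" "0 < A" "0 < \<tau>" "\<tau> < \<Gamma> - 1" for u and x0 :: 'a and R A \<tau>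
      unfolding n_def by (rule dyadic_grad_gagliardo) (use CB that C3 p in auto)
    \<comment> \<open>The singular factor with \<Gamma> equals \<open>1 / g\<close> and depends only
      on \<open>p\<close>, \<open>s\<close> and \<open>t\<close>, as the last constant may;
      including \<open>g\<close> in that constant cancels it.\<close>
    define g where "g = (2 - \<Gamma>) powr p * (\<Gamma> - 1) powr p"
    have g: "0 < g" "(2 - \<Gamma>) powr (- p) * (\<Gamma> - 1) powr (- p) = 1 / g"
      using \<Gamma> by (auto simp: g_def powr_minus_divide)
    show ?part2
      unfolding Let_def \<Gamma>_def[symmetric] g(2)
    proof (rule exI[of _ "n * C2 * cc"], rule conjI, use n C2 cc in simp, rule exI[of _ "g * (n * C3 * cc)"], rule conjI,
        use g(1) n C3 cc in simp, intro allI impI)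
      fix \<Omega> and K f u :: "'a \<Rightarrow> real" assume hyp: "?hyp \<Omega> K f u"
      have uX: "u \<in> Xspace s p" using hyp by (auto simp: Yspace_def)
      have u_m [measurable]: "u \<in> borel_measurable lebesgue" by (rule Xspace_measurable[OF uX])
      \<comment> \<open>A single function is the weak gradient on \<Omega> and, at the same time, on
        each set compactly inside \<Omega>, so no gluing is required.\<close>
      let ?D = "dyadic_grad u"
      have loc: "\<exists>r>0. (\<integral>\<^sup>+y. ennreal (indicator (ball x r) y * norm (?D y) powr p) \<partial>lebesgue) < \<infinity> \<and>
        (\<forall>b\<in>Basis. (\<lambda>j. \<integral>\<^sup>+y. ennreal (indicator (ball x r) y * \<bar>quot u b (1 / 2 ^ j) y - dyadic_deriv u b y\<bar>) \<partial>lebesgue) \<longlonglongrightarrow> 0)"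
        if "x \<in> \<Omega>" for x
      proof -
        obtain R a where Ra: "0 < R" "0 < a" "admissible p s t \<Lambda> kf kn u x R a" using good[OF hyp \<open>x \<in> \<Omega>\<close>] by blast
        have "(\<integral>\<^sup>+y. ennreal (indicator (ball x (R / 2)) y * norm (?D y) powr p) \<partial>lebesgue) < \<infinity>"
          by (rule le_less_trans[OF Lp[OF Ra(3) u_m Ra(2)]]) simp
        moreover have "\<forall>b\<in>Basis. (\<lambda>j. \<integral>\<^sup>+y. ennreal (indicator (ball x (R / 2)) y * \<bar>quot u b (1 / 2 ^ j) y - dyadic_deriv u b y\<bar>) \<partial>lebesgue) \<longlonglongrightarrow> 0"
          using CB[rule_format, OF Ra(3)] by simp
        ultimately show ?thesis using Ra(1) by (intro exI[of _ "R / 2"] conjI) auto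
      qed
      have D_m: "?D \<in> borel_measurable lebesgue" by measurable
      have DL: "?D \<in> Lspace_loc p \<Omega>"
      proof (rule Lspace_loc_I[OF D_m p0])
        fix x assume "x \<in> \<Omega>"
        from loc[OF this] show "\<exists>r>0. (\<integral>\<^sup>+y. ennreal (indicator (ball x r) y * norm (?D y) powr p) \<partial>lebesgue) < \<infinity>"
          by (elim exE conjE) (intro exI conjI)
      qed
      have D_W: "?D \<in> Wspace_loc \<tau> p \<Omega>" if \<tau>: "0 < \<tau> \<and> \<tau> < \<Gamma> - 1" for \<tau>
      proof (rule Wspace_loc_I[OF D_m p0])
        fix x assume "x \<in> \<Omega>"
        then obtain R a where Ra: "0 < R" "0 < a" "admissible p s t \<Lambda> kf kn u x R a" using good[OF hyp] by blast
        have "(\<integral>\<^sup>+y. ennreal (indicator (ball x (R / 4)) y * norm (?D y) powr p) \<partial>lebesgue) \<le> ennreal (n * (C2 / R powr p * a))"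
          by (rule nn_integral_le_mono[OF _ Lp[OF Ra(3) u_m Ra(2)]]) (use Ra in \<open>auto simp: indicator_def\<close>)
        then have "(\<integral>\<^sup>+y. ennreal (indicator (ball x (R / 4)) y * norm (?D y) powr p) \<partial>lebesgue) < \<infinity>"
          by (rule le_less_trans) simp
        moreover have "gagliardo \<tau> p (ball x (R / 4)) ?D < \<infinity>"
          by (rule le_less_trans[OF W[OF Ra(3) u_m Ra(2)]]) (use \<tau> in auto)
        ultimately show "\<exists>r>0. (\<integral>\<^sup>+y. ennreal (indicator (ball x r) y * norm (?D y) powr p) \<partial>lebesgue) < \<infinity> \<and> gagliardo \<tau> p (ball x r) ?D < \<infinity>"
          using Ra(1) by (intro exI[of _ "R / 4"] conjI) auto
      qed (use \<tau> in auto)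
      have W1: "u \<in> W1space_loc p \<Omega>"
        unfolding W1space_loc_def
      proof (intro CollectI allI impI)
        fix E assume E: "compactly_inside E \<Omega>"
        then have "E \<subseteq> \<Omega>" using closure_subset[of E] by (auto simp: compactly_inside_def)
        then have "weak_gradient E u ?D" by (rule gradient_of_good_balls[OF p uX _ loc])
        moreover have "?D \<in> Lspace p E" using DL E by (auto simp: Lspace_loc_def)
        moreover have "u \<in> Lspace p E" using Wspace_loc_Lspace_loc[OF _ E] hyp by blast
        ultimately show "u \<in> W1space p E" unfolding W1space_def by blast
      qed
      show "u \<in> W1space_loc p \<Omega> \<and>
        (\<exists>Du. weak_gradient \<Omega> u Du \<and>
           (\<forall>\<tau>. 0 < \<tau> \<and> \<tau> < \<Gamma> - 1 \<longrightarrow> Du \<in> Wspace_loc \<tau> p \<Omega>) \<and>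
           (\<forall>x0 R. 0 < R \<and> compactly_inside (ball x0 R) \<Omega> \<longrightarrow>
              epowr (Lnorm p (ball x0 (R / 2)) Du) p \<le> ennreal (n * C2 * cc / R powr p) * A_term t s p u f x0 R \<and>
              (\<forall>\<tau>. 0 < \<tau> \<and> \<tau> < \<Gamma> - 1 \<longrightarrow>
                 epowr (Wseminorm \<tau> p (ball x0 (R / 4)) Du) p
                   \<le> ennreal (1 / g / ((\<Gamma> - 1 - \<tau>) * \<tau>) * (g * (n * C3 * cc) / R powr (p * (1 + \<tau>)))) * A_term t s p u f x0 R)))"
      proof (intro conjI W1 exI[of _ ?D] allI impI)
        show "weak_gradient \<Omega> u ?D" by (rule gradient_of_good_balls[OF p uX subset_refl loc])
        show "?D \<in> Wspace_loc \<tau> p \<Omega>" if "0 < \<tau> \<and> \<tau> < \<Gamma> - 1" for \<tau> by (rule D_W[OF that])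
      next
        fix x0 :: 'a and R assume B: "0 < R \<and> compactly_inside (ball x0 R) \<Omega>"
        show "epowr (Lnorm p (ball x0 (R / 2)) ?D) p \<le> ennreal (n * C2 * cc / R powr p) * A_term t s p u f x0 R"
          unfolding Lnorm_powr[OF p0]
        proof (rule ennreal_le_scaled)
          fix a :: real assume a: "0 < a" "A_term t s p u f x0 R \<le> ennreal a"
          have "(\<integral>\<^sup>+x. ennreal (indicator (ball x0 (R / 2)) x * norm (?D x) powr p) \<partial>lebesgue) \<le> ennreal (n * (C2 / R powr p * (cc * a)))"
            by (rule Lp[OF adm[OF hyp] u_m]) (use B a cc in auto)
          then show "(\<integral>\<^sup>+x. ennreal (indicator (ball x0 (R / 2)) x * norm (?D x) powr p) \<partial>lebesgue) \<le> ennreal (n * C2 * cc / R powr p * a)"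
            by (simp add: mult_ac)
        qed (use n C2 cc B in auto)
        fix \<tau> assume \<tau>: "0 < \<tau> \<and> \<tau> < \<Gamma> - 1"
        have g0: "0 < (\<Gamma> - 1 - \<tau>) * \<tau>" using \<tau> by simp
        show "epowr (Wseminorm \<tau> p (ball x0 (R / 4)) ?D) p
          \<le> ennreal (1 / g / ((\<Gamma> - 1 - \<tau>) * \<tau>) * (g * (n * C3 * cc) / R powr (p * (1 + \<tau>)))) * A_term t s p u f x0 R"
          unfolding Wseminorm_powr[OF p0]
        proof (rule ennreal_le_scaled)
          fix a :: real assume a: "0 < a" "A_term t s p u f x0 R \<le> ennreal a"
          have "gagliardo \<tau> p (ball x0 (R / 4)) ?D \<le> ennreal (n * (C3 / ((\<Gamma> - 1 - \<tau>) * \<tau>) / R powr (p * (1 + \<tau>)) * (cc * a)))"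
            by (rule W[OF adm[OF hyp] u_m]) (use B a cc \<tau> in auto)
          also have "n * (C3 / ((\<Gamma> - 1 - \<tau>) * \<tau>) / R powr (p * (1 + \<tau>)) * (cc * a))
            = 1 / g / ((\<Gamma> - 1 - \<tau>) * \<tau>) * (g * (n * C3 * cc) / R powr (p * (1 + \<tau>))) * a"
            using g(1) by simp
          finally show "gagliardo \<tau> p (ball x0 (R / 4)) ?D \<le> ennreal (1 / g / ((\<Gamma> - 1 - \<tau>) * \<tau>) * (g * (n * C3 * cc) / R powr (p * (1 + \<tau>))) * a)" .
        next
          have "0 < R powr (p * (1 + \<tau>))" using B by simp
          then show "0 < 1 / g / ((\<Gamma> - 1 - \<tau>) * \<tau>) * (g * (n * C3 * cc) / R powr (p * (1 + \<tau>)))"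
            using g(1) \<tau> n C3 cc by (intro mult_pos_pos divide_pos_pos) auto
        qed
      qed
    qed
  qed
qed

end
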